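(* Fix $\alpha\in(0,1)$. Assume that (A1) $n,p\to\infty$ with $p/n\to c\in(0,1)$; (A2) $0<\lim_{p\to\infty}a_i<\infty$ for $i=1,\dots,6$; (A3) $0<\lim n^{1/2}\Delta^2<\infty$, $0<\lim n^{1/2}\Delta_I^2<\infty$ and $0<\lim n^{1/2}\Delta_\Sigma^2<\infty$ (limits as $n,p\to\infty$). Let $\beta_H,\beta_D,\beta_P$ denote the local asymptotic powers (limits of the rejection probabilities) of, respectively, Hotelling's test, Dempster's test and the proposed test, where the proposed test is either the one rejecting $H_0$ when $T(\hat\rho^\ast)/\sigma(\hat\rho^\ast,\hat c,\hat a_1,\hat a_2)\ge z(\alpha)$ or the one rejecting $H_0$ when $T(\hat\rho^\ast)/\sigma(\hat\rho^\ast,\hat c,\hat a_1,\hat a_2)\ge\hat x(\alpha)$. Consider the condition $$\text{(C1)}\qquad \frac{\Delta^2}{\Delta_I^2}\in\left[\frac{\sqrt2\left(1+a_1\sqrt{(1-c)/a_2}\right)^{1/2}-1}{\sqrt{a_2(1-c)}},\ \frac{\left\{\sqrt2\left(1+a_1\sqrt{(1-c)/a_2}\right)^{1/2}-1\right\}^{-1}}{\sqrt{a_2(1-c)}}\right],$$ where $\Delta^2/\Delta_I^2$, $a_1$ and $a_2$ are understood as their limiting values. If (C1) holds, the proposed test has the highest local asymptotic power among the three tests: $\beta_P\ge\max\{\beta_H,\beta_D\}$. If (C1) does not hold, the local asymptotic power of the proposed test is the second highest among the three tests: $\min\{\beta_H,\beta_D\}<\beta_P<\max\{\beta_H,\bet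a_D\}$.
   Context: For each $(N,p)$, $x_1,\dots,x_N$ are independent $p$-dimensional random vectors with distribution $\mathcal N_p(\mu,\Sigma)$, $\Sigma$ positive definite; $\mu_0\in\mathbb R^p$ is a given vector and one tests $H_0:\mu=\mu_0$ against $H_1:\mu\ne\mu_0$. Put $n=N-1$, $\hat c=p/n$, $\bar x=\frac1N\sum_{i=1}^N x_i$, $S=\frac1n\sum_{i=1}^N(x_i-\bar x)(x_i-\bar x)'$. The quantities $\mu,\mu_0,\Sigma$ may depend on $(n,p)$. Hotelling's statistic: $T^2=N(\bar x-\mu_0)'S^{-1}(\bar x-\mu_0)$. Dempster's statistic: $D_n=\dfrac{N(\bar x-\mu_0)'(\bar x-\mu_0)}{\operatorname{tr}S}$. For a weight $\rho\in[0,1]$ (possibly random): $T(\rho)=\rho\sqrt n\left(\frac{T^2}{n}-\frac{p}{N-p}\right)+(1-\rho)\sqrt n(D_n-1)$. $a_i=\operatorname{tr}\Sigma^i/p$; their estimators are $\hat a_1=\operatorname{tr}S/p$, $\hat a_2=\frac{n^2}{p(n+2)(n-1)}\left\{\operatorname{tr}S^2-\frac{(\operatorname{tr}S)^2}{n}\right\}$, $\hat a_3=\frac{n^2}{(n+4)(n+2)(n-1)(n-2)p}\{n^2\operatorname{tr}S^3-3n\operatorname{tr}S^2\operatorname{tr}S+2(\operatorname{tr}S)^3\}$. $\Delta^2=(\mu-\mu_0)'\Sigma^{-1}(\mu-\mu_0)$, $\Delta_I^2=(\mu-\mu_0)'(\mu-\mu_0)$, $\Delta_\Sigma^2=(\mu-\mu_0)'\Sigma(\mu-\mu_0)$.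 $\sigma(\rho,c,a_1,a_2)>0$ is given by $\sigma^2(\rho,c,a_1,a_2)=\rho^2\frac{2c}{(1-c)^3}+(1-\rho)^2\frac{2a_2}{ca_1^2}+2\rho(1-\rho)\frac{2}{1-c}$, $\rho^\ast(c,a_1,a_2)=\left(\frac{a_1c\sqrt{a_2(1-c)}}{a_2(1-c)^2}+1\right)^{-1}$, and $\hat\rho^\ast=\rho^\ast(\hat c,\hat a_1,\hat a_2)$. $\Phi$ is the standard normal distribution function, $z(\alpha)$ is the upper $100\alpha$ percentile of $\mathcal N(0,1)$, and $F_{p,N-p}(\alpha)$ is the upper $100\alpha$ percentile of the $F$-distribution with $p$ and $N-p$ degrees of freedom. Hotelling's test rejects $H_0$ if $\frac{N-p}{np}T^2\ge F_{p,N-p}(\alpha)$. Dempster's test rejects $H_0$ if $\sqrt n\,\frac{D_n-1}{\sqrt{2\hat a_2/(\hat c\hat a_1^2)}}\ge z(\alpha)$. The adjusted critical value is $$\hat x(\alpha)=z(\alpha)+\frac1{\sqrt n}\left\{\frac{\hat b_1}{\hat\sigma}+\frac{\hat b_3}{\hat\sigma^3}(z(\alpha)^2-1)\right\},\qquad \hat\sigma=\sigma(\hat\rho^\ast,\hat c,\hat a_1,\hat a_2),$$ where $\hat b_1,\hat b_3$ are obtained by substituting $\hat\rho^\ast,\hat c,\hat a_1,\hat a_2,\hat a_3$ for $\rho,c,a_1,a_2,a_3$ in $b_1=\nu_1$, $b_3=\frac{\nu_3}{6}-\frac{\nu_1\sigma^2(\rho,c,a_1,a_2)}{2}$, with $$\nu_1=\frac{2\rho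 c}{(1-c)^2},\quad \nu_3=\frac{4\rho^3c(5c+2)}{(1-c)^5}+\frac{24\rho^2(1-\rho)(c+1)}{(1-c)^3}+\frac{12\rho(1-\rho)^2a_2(2-c)}{a_1^2(1-c)^2c}+\frac{8(1-\rho)^3a_3}{a_1^3c^2}.$$ *)

theory Defs
  imports
    "HOL-Probability.Probability"
    "Jordan_Normal_Form.Gauss_Jordan_Elimination"
    "Jordan_Normal_Form.Determinant"
begin

text \<open>
  The dimension \<open>p\<close> varies along the asymptotics, so vectors and matrices are those of
  Jordan-Normal-Form, whose dimension is a value.  A random vector takes its values in the
  functions \<open>nat \<Rightarrow> real\<close> on the index set \<open>{..<p}\<close> (a product measure space), and
  \<open>Matrix.vec p\<close> turns such a function into a vector.  A sample is a function
  \<open>x :: nat \<Rightarrow> nat \<Rightarrow> real\<close>, with \<open>x i j\<close> the \<open>j\<close>-th coordinate of observation \<open>i\<close>, for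
  \<open>i < N\<close> and \<open>j < p\<close>.
\<close>

definition trace_mat :: "real Matrix.mat \<Rightarrow> real" where
  "trace_mat A = (\<Sum>i<dim_row A. A $$ (i, i))"

text \<open>A singular matrix gets the zero matrix as its inverse.\<close>

definition inv_mat :: "real Matrix.mat \<Rightarrow> real Matrix.mat" where
  "inv_mat A = (case mat_inverse A of Some B \<Rightarrow> B | None \<Rightarrow> 0\<^sub>m (dim_row A) (dim_col A))"

definition quad_form :: "real Matrix.mat \<Rightarrow> real Matrix.vec \<Rightarrow> real" where
  "quad_form A v = scalar_prod v (A *\<^sub>v v)"

definition pos_def_mat :: "nat \<Rightarrow> real Matrix.mat \<Rightarrow> bool" where
  "pos_def_mat p A \<longleftrightarrow> A \<in> carrier_mat p p \<and> transpose_mat A = A \<and>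
     (\<forall>v \<in> carrier_vec p. v \<noteq> 0\<^sub>v p \<longrightarrow> 0 < quad_form A v)"

abbreviation lborel_n :: "nat \<Rightarrow> (nat \<Rightarrow> real) measure" where
  "lborel_n p \<equiv> Pi\<^sub>M {..<p} (\<lambda>_. lborel)"

definition mvn_density ::
    "nat \<Rightarrow> real Matrix.vec \<Rightarrow> real Matrix.mat \<Rightarrow> (nat \<Rightarrow> real) \<Rightarrow> real" where
  "mvn_density p \<mu> \<Sigma> y =
     exp (- quad_form (inv_mat \<Sigma>) (Matrix.vec p y - \<mu>) / 2) /
     sqrt ((2 * pi) ^ p * Determinant.det \<Sigma>)"

definition normal_sample ::
    "'a measure \<Rightarrow> nat \<Rightarrow> nat \<Rightarrow> real Matrix.vec \<Rightarrow> real Matrix.mat \<Rightarrow>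
     (nat \<Rightarrow> 'a \<Rightarrow> nat \<Rightarrow> real) \<Rightarrow> bool" where
  "normal_sample M N p \<mu> \<Sigma> X \<longleftrightarrow>
     prob_space M \<and>
     prob_space.indep_vars M (\<lambda>_. lborel_n p) X {..<N} \<and>
     (\<forall>i<N. distributed M (lborel_n p) (X i) (\<lambda>y. ennreal (mvn_density p \<mu> \<Sigma> y)))"

definition chi_square_distr :: "nat \<Rightarrow> real measure" where
  "chi_square_distr d =
     distr (Pi\<^sub>M {..<d} (\<lambda>_. std_normal_distribution)) borel (\<lambda>z. \<Sum>i<d. (z i)\<^sup>2)"

definition F_distr :: "nat \<Rightarrow> nat \<Rightarrow> real measure" where
  "F_distr d e =
     distr (chi_square_distr d \<Otimes>\<^sub>M chi_square_distr e) borel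
       (\<lambda>(u, v). (u / real d) / (v / real e))"

text \<open>
  The upper \<open>100\<alpha>\<close> percentile is the \<open>1 - \<alpha>\<close> quantile: for a continuous distribution function,
  a point that is exceeded with probability \<open>\<alpha>\<close>.
\<close>

definition upper_percentile :: "real measure \<Rightarrow> real \<Rightarrow> real" where
  "upper_percentile D \<alpha> = Inf {t. 1 - \<alpha> \<le> cdf D t}"

definition z_perc :: "real \<Rightarrow> real" where
  "z_perc \<alpha> = upper_percentile std_normal_distribution \<alpha>"

definition F_perc :: "nat \<Rightarrow> nat \<Rightarrow> real \<Rightarrow> real" where
  "F_perc d e \<alpha> = upper_percentile (F_distr d e) \<alpha>"

text \<open>The sample size is \<open>N\<close>; the divisor \<open>n = N - 1\<close> is written as the real number \<open>real N - 1\<close>.\<close>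

definition sample_mean :: "nat \<Rightarrow> nat \<Rightarrow> (nat \<Rightarrow> nat \<Rightarrow> real) \<Rightarrow> real Matrix.vec" where
  "sample_mean N p x = Matrix.vec p (\<lambda>j. (\<Sum>i<N. x i j) / real N)"

definition sample_cov :: "nat \<Rightarrow> nat \<Rightarrow> (nat \<Rightarrow> nat \<Rightarrow> real) \<Rightarrow> real Matrix.mat" where
  "sample_cov N p x = Matrix.mat p p (\<lambda>(j, l).
     (\<Sum>i<N. (x i j - vec_index (sample_mean N p x) j) * (x i l - vec_index (sample_mean N p x) l))
     / (real N - 1))"

definition hotelling_T2 ::
    "nat \<Rightarrow> nat \<Rightarrow> real Matrix.vec \<Rightarrow> (nat \<Rightarrow> nat \<Rightarrow> real) \<Rightarrow> real" where
  "hotelling_T2 N p \<mu>0 x =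
     real N * quad_form (inv_mat (sample_cov N p x)) (sample_mean N p x - \<mu>0)"

definition dempster_D ::
    "nat \<Rightarrow> nat \<Rightarrow> real Matrix.vec \<Rightarrow> (nat \<Rightarrow> nat \<Rightarrow> real) \<Rightarrow> real" where
  "dempster_D N p \<mu>0 x =
     real N * scalar_prod (sample_mean N p x - \<mu>0) (sample_mean N p x - \<mu>0)
     / trace_mat (sample_cov N p x)"

definition T_weighted ::
    "nat \<Rightarrow> nat \<Rightarrow> real Matrix.vec \<Rightarrow> real \<Rightarrow> (nat \<Rightarrow> nat \<Rightarrow> real) \<Rightarrow> real" where
  "T_weighted N p \<mu>0 \<rho> x = (let n = real N - 1 in
     \<rho> * sqrt n * (hotelling_T2 N p \<mu>0 x / n - real p / (real N - real p))
     + (1 - \<rho>) * sqrt n * (dempster_D N p \<mu>0 x - 1))"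

definition c_hat :: "nat \<Rightarrow> nat \<Rightarrow> real" where
  "c_hat N p = real p / (real N - 1)"

definition a1_hat :: "nat \<Rightarrow> nat \<Rightarrow> (nat \<Rightarrow> nat \<Rightarrow> real) \<Rightarrow> real" where
  "a1_hat N p x = trace_mat (sample_cov N p x) / real p"

definition a2_hat :: "nat \<Rightarrow> nat \<Rightarrow> (nat \<Rightarrow> nat \<Rightarrow> real) \<Rightarrow> real" where
  "a2_hat N p x = (let n = real N - 1; S = sample_cov N p x in
     n^2 / (real p * (n + 2) * (n - 1)) * (trace_mat (S ^\<^sub>m 2) - (trace_mat S)^2 / n))"

definition a3_hat :: "nat \<Rightarrow> nat \<Rightarrow> (nat \<Rightarrow> nat \<Rightarrow> real) \<Rightarrow> real" where
  "a3_hat N p x = (let n = real N - 1; S = sample_cov N p x in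
     n^2 / ((n + 4) * (n + 2) * (n - 1) * (n - 2) * real p) *
     (n^2 * trace_mat (S ^\<^sub>m 3) - 3 * n * trace_mat (S ^\<^sub>m 2) * trace_mat S
      + 2 * (trace_mat S)^3))"

definition sigma2 :: "real \<Rightarrow> real \<Rightarrow> real \<Rightarrow> real \<Rightarrow> real" where
  "sigma2 \<rho> c a1 a2 =
     \<rho>^2 * (2 * c / (1 - c)^3) + (1 - \<rho>)^2 * (2 * a2 / (c * a1^2))
     + 2 * \<rho> * (1 - \<rho>) * (2 / (1 - c))"

definition sigma :: "real \<Rightarrow> real \<Rightarrow> real \<Rightarrow> real \<Rightarrow> real" where
  "sigma \<rho> c a1 a2 = sqrt (sigma2 \<rho> c a1 a2)"

definition rho_star :: "real \<Rightarrow> real \<Rightarrow> real \<Rightarrow> real" where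
  "rho_star c a1 a2 = inverse (a1 * c * sqrt (a2 * (1 - c)) / (a2 * (1 - c)^2) + 1)"

definition nu1 :: "real \<Rightarrow> real \<Rightarrow> real" where
  "nu1 \<rho> c = 2 * \<rho> * c / (1 - c)^2"

definition nu3 :: "real \<Rightarrow> real \<Rightarrow> real \<Rightarrow> real \<Rightarrow> real \<Rightarrow> real" where
  "nu3 \<rho> c a1 a2 a3 =
     4 * \<rho>^3 * c * (5 * c + 2) / (1 - c)^5
     + 24 * \<rho>^2 * (1 - \<rho>) * (c + 1) / (1 - c)^3
     + 12 * \<rho> * (1 - \<rho>)^2 * a2 * (2 - c) / (a1^2 * (1 - c)^2 * c)
     + 8 * (1 - \<rho>)^3 * a3 / (a1^3 * c^2)"

definition b1 :: "real \<Rightarrow> real \<Rightarrow> real" where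
  "b1 \<rho> c = nu1 \<rho> c"

definition b3 :: "real \<Rightarrow> real \<Rightarrow> real \<Rightarrow> real \<Rightarrow> real \<Rightarrow> real" where
  "b3 \<rho> c a1 a2 a3 = nu3 \<rho> c a1 a2 a3 / 6 - nu1 \<rho> c * sigma2 \<rho> c a1 a2 / 2"

definition rho_hat :: "nat \<Rightarrow> nat \<Rightarrow> (nat \<Rightarrow> nat \<Rightarrow> real) \<Rightarrow> real" where
  "rho_hat N p x = rho_star (c_hat N p) (a1_hat N p x) (a2_hat N p x)"

definition sigma_hat :: "nat \<Rightarrow> nat \<Rightarrow> (nat \<Rightarrow> nat \<Rightarrow> real) \<Rightarrow> real" where
  "sigma_hat N p x = sigma (rho_hat N p x) (c_hat N p) (a1_hat N p x) (a2_hat N p x)"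

definition x_hat :: "nat \<Rightarrow> nat \<Rightarrow> real \<Rightarrow> (nat \<Rightarrow> nat \<Rightarrow> real) \<Rightarrow> real" where
  "x_hat N p \<alpha> x = (let
       \<rho> = rho_hat N p x; c = c_hat N p; s = sigma_hat N p x;
       \<beta>1 = b1 \<rho> c; \<beta>3 = b3 \<rho> c (a1_hat N p x) (a2_hat N p x) (a3_hat N p x)
     in z_perc \<alpha> + 1 / sqrt (real N - 1) * (\<beta>1 / s + \<beta>3 / s^3 * ((z_perc \<alpha>)^2 - 1)))"

definition hotelling_rejects ::
    "nat \<Rightarrow> nat \<Rightarrow> real Matrix.vec \<Rightarrow> real \<Rightarrow> (nat \<Rightarrow> nat \<Rightarrow> real) \<Rightarrow> bool" where
  "hotelling_rejects N p \<mu>0 \<alpha> x \<longleftrightarrow>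
     (real N - real p) / ((real N - 1) * real p) * hotelling_T2 N p \<mu>0 x \<ge> F_perc p (N - p) \<alpha>"

definition dempster_rejects ::
    "nat \<Rightarrow> nat \<Rightarrow> real Matrix.vec \<Rightarrow> real \<Rightarrow> (nat \<Rightarrow> nat \<Rightarrow> real) \<Rightarrow> bool" where
  "dempster_rejects N p \<mu>0 \<alpha> x \<longleftrightarrow>
     sqrt (real N - 1) * ((dempster_D N p \<mu>0 x - 1)
       / sqrt (2 * a2_hat N p x / (c_hat N p * (a1_hat N p x)^2))) \<ge> z_perc \<alpha>"

definition proposed_rejects ::
    "nat \<Rightarrow> nat \<Rightarrow> real Matrix.vec \<Rightarrow> real \<Rightarrow> (nat \<Rightarrow> nat \<Rightarrow> real) \<Rightarrow> bool" where
  "proposed_rejects N p \<mu>0 \<alpha> x \<longleftrightarrow>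
     T_weighted N p \<mu>0 (rho_hat N p x) x / sigma_hat N p x \<ge> z_perc \<alpha>"

definition proposed_adj_rejects ::
    "nat \<Rightarrow> nat \<Rightarrow> real Matrix.vec \<Rightarrow> real \<Rightarrow> (nat \<Rightarrow> nat \<Rightarrow> real) \<Rightarrow> bool" where
  "proposed_adj_rejects N p \<mu>0 \<alpha> x \<longleftrightarrow>
     T_weighted N p \<mu>0 (rho_hat N p x) x / sigma_hat N p x \<ge> x_hat N p \<alpha> x"

definition rejection_prob ::
    "'a measure \<Rightarrow> (nat \<Rightarrow> 'a \<Rightarrow> nat \<Rightarrow> real) \<Rightarrow> ((nat \<Rightarrow> nat \<Rightarrow> real) \<Rightarrow> bool) \<Rightarrow> real" where
  "rejection_prob M X rejects = Sigma_Algebra.measure M {\<omega> \<in> space M. rejects (\<lambda>i. X i \<omega>)}"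

definition a_pop :: "nat \<Rightarrow> real Matrix.mat \<Rightarrow> nat \<Rightarrow> real" where
  "a_pop p \<Sigma> i = trace_mat (\<Sigma> ^\<^sub>m i) / real p"

definition Delta2 :: "real Matrix.vec \<Rightarrow> real Matrix.vec \<Rightarrow> real Matrix.mat \<Rightarrow> real" where
  "Delta2 \<mu> \<mu>0 \<Sigma> = quad_form (inv_mat \<Sigma>) (\<mu> - \<mu>0)"

definition DeltaI2 :: "real Matrix.vec \<Rightarrow> real Matrix.vec \<Rightarrow> real" where
  "DeltaI2 \<mu> \<mu>0 = scalar_prod (\<mu> - \<mu>0) (\<mu> - \<mu>0)"

definition DeltaS2 :: "real Matrix.vec \<Rightarrow> real Matrix.vec \<Rightarrow> real Matrix.mat \<Rightarrow> real" where
  "DeltaS2 \<mu> \<mu>0 \<Sigma> = quad_form \<Sigma> (\<mu> - \<mu>0)"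

definition cond_C1 :: "real \<Rightarrow> real \<Rightarrow> real \<Rightarrow> real \<Rightarrow> bool" where
  "cond_C1 r c a1 a2 \<longleftrightarrow>
     r \<in> {(sqrt 2 * sqrt (1 + a1 * sqrt ((1 - c) / a2)) - 1) / sqrt (a2 * (1 - c)) ..
          inverse (sqrt 2 * sqrt (1 + a1 * sqrt ((1 - c) / a2)) - 1) / sqrt (a2 * (1 - c))}"

end

theory Submission
  imports Defs
begin

text \<open>
  Diagonalise \<open>\<Sigma>\<close>, write its eigenvalues as \<open>lam j\<close>, and rotate the sample index by an orthogonal
  matrix whose first row is constant. The sample becomes an array \<open>z\<close> of independent standard normal
  variables: row \<open>0\<close> carries the sample mean and rows \<open>1, \<dots>, n\<close> carry \<open>S\<close>. In these coordinates
  \<open>T\<^sup>2/n = |w|\<^sup>2 / V\<close>, where \<open>w\<close> is row \<open>0\<close> shifted by \<open>\<surd>N \<Sigma>\<^sup>-\<^sup>1\<^sup>/\<^sup>2 (\<mu> - \<mu>0)\<close>, and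
  \<open>D\<^sub>n = (\<Sum>j. lam j w\<^sub>j\<^sup>2) / tr S\<close>.

  The decisive exact fact is that \<open>V\<close> is independent of row \<open>0\<close> and has the \<open>\<chi>\<^sup>2\<close> law with \<open>N - p\<close> degrees of
  freedom (\<open>law_inv_form\<close>, \<open>distr_hot_ratio\<close>): an inverse Wishart quadratic form along \<open>w\<close> is, after a
  rotation of the columns that moves \<open>w\<close> onto an axis, the inverse squared length of the part of one
  Gaussian column that is orthogonal to the other columns. So \<open>T\<^sup>2\<close> and the numerator of \<open>D\<^sub>n\<close> are jointly
  functions of independent squares of Gaussian variables. Any linear combination of the two centred
  quadratic forms is a weighted sum of centred squares, and a central limit theorem for such sums
  (\<open>gauss_clt\<close>) gives a joint normal limit with the covariance \<open>var\<close> (\<open>AB0_clt\<close>).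

  What remains is a Slutsky argument. A shift of size \<open>n\<^sup>-\<^sup>1\<^sup>/\<^sup>2\<close> moves the two forms by the constants \<open>d\<close>
  and \<open>dI\<close> (\<open>tends_A\<close>, \<open>tends_B\<close>); moment bounds for the traces of \<open>S\<close>, \<open>S\<^sup>2\<close> and \<open>S\<^sup>3\<close> show that the
  trace in Dempster's denominator fluctuates negligibly (\<open>tends_trace\<close>), that \<open>a1_hat\<close> and \<open>a2_hat\<close> are
  consistent (\<open>tends_h1\<close>, \<open>tends_h2\<close>), and that \<open>a3_hat\<close> is \<open>o(\<surd>n)\<close> in probability (\<open>tends_h3\<close>). The last
  bound suffices for the adjusted critical value, which contains \<open>a3_hat / \<surd>n\<close>, to converge to \<open>z_perc \<alpha>\<close>.
  The percentile of the F distribution is handled by the same limit theorem with zero shift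
  (\<open>F_perc_tends\<close>).

  Every test then has a limiting power \<open>1 - \<Phi> (z_perc \<alpha> - gain)\<close>. If \<open>x\<close> and \<open>y\<close> are the gains of Hotelling's
  and Dempster's test, the weight \<open>rho_star\<close> is the one that gives both standardised statistics the same
  coefficient, so the gain of either proposed test is \<open>(x + y) / K\<close> with
  \<open>K = \<surd>(2 (1 + a1 \<surd>((1 - c) / a2)))\<close>, where \<open>K\<^sup>2 / 2 - 1\<close> is the limiting correlation of the two
  statistics. Since \<open>a1\<^sup>2 \<le> a2\<close>, this correlation lies strictly between \<open>0\<close> and \<open>1\<close>, hence \<open>1 < K < 2\<close>.
  Because \<open>K < 2\<close>, the number \<open>(x + y) / K\<close> exceeds \<open>min x y\<close>; it is at least \<open>max x y\<close> exactly when
  \<open>x / y\<close> lies in \<open>[K - 1, 1 / (K - 1)]\<close>, and this is condition (C1) because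
  \<open>x / y = (d / dI) \<surd>(a2 (1 - c))\<close> (\<open>power_comparison\<close>, \<open>cond_C1_iff\<close>).
\<close>

section \<open>Orthonormal systems over a finite index set\<close>

definition ip :: "'i set \<Rightarrow> ('i \<Rightarrow> real) \<Rightarrow> ('i \<Rightarrow> real) \<Rightarrow> real" where
  "ip I x y = (\<Sum>i\<in>I. x i * y i)"

definition orthonormal_on :: "'i set \<Rightarrow> 'k set \<Rightarrow> ('k \<Rightarrow> 'i \<Rightarrow> real) \<Rightarrow> bool" where
  "orthonormal_on I K q \<longleftrightarrow> (\<forall>a\<in>K. \<forall>b\<in>K. ip I (q a) (q b) = (if a = b then 1 else 0))"

lemma ip_commute: "ip I x y = ip I y x"
  by (simp add: ip_def mult.commute)

lemma ip_cong: "(\<And>i. i \<in> I \<Longrightarrow> x i = x' i) \<Longrightarrow> (\<And>i. i \<in> I \<Longrightarrow> y i = y' i) \<Longrightarrow> ip I x y = ip I x' y'"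
  by (simp add: ip_def)

lemma ip_add_left: "ip I (\<lambda>i. x i + y i) z = ip I x z + ip I y z"
  by (simp add: ip_def sum.distrib algebra_simps)

lemma ip_diff_left: "ip I (\<lambda>i. x i - y i) z = ip I x z - ip I y z"
  by (simp add: ip_def sum_subtractf algebra_simps)

lemma ip_scale_left: "ip I (\<lambda>i. c * x i) z = c * ip I x z"
  by (simp add: ip_def sum_distrib_left algebra_simps)

lemma ip_sum_left: "ip I (\<lambda>i. \<Sum>a\<in>K. c a * q a i) z = (\<Sum>a\<in>K. c a * ip I (q a) z)"
  unfolding ip_def sum_distrib_right sum_distrib_left
  by (subst sum.swap) (simp add: algebra_simps)

lemmas ip_linear_left = ip_add_left ip_diff_left ip_scale_left ip_sum_left

lemma ip_linear_right:
  "ip I z (\<lambda>i. x i + y i) = ip I z x + ip I z y"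
  "ip I z (\<lambda>i. x i - y i) = ip I z x - ip I z y"
  "ip I z (\<lambda>i. c * x i) = c * ip I z x"
  "ip I z (\<lambda>i. \<Sum>a\<in>K. d a * q a i) = (\<Sum>a\<in>K. d a * ip I z (q a))"
  by (simp_all add: ip_commute[of I z] ip_linear_left)

lemma ip_self_nonneg: "0 \<le> ip I x x"
  by (simp add: ip_def sum_nonneg)

lemma ip_self_eq_0_iff: "finite I \<Longrightarrow> ip I x x = 0 \<longleftrightarrow> (\<forall>i\<in>I. x i = 0)"
  by (simp add: ip_def sum_nonneg_eq_0_iff)

lemma ip_orthonormal_sum:
  assumes "orthonormal_on I K q" "finite K" "a \<in> K"
  shows "ip I (\<lambda>i. \<Sum>b\<in>K. c b * q b i) (q a) = c a"
proof -
  have "ip I (\<lambda>i. \<Sum>b\<in>K. c b * q b i) (q a) = (\<Sum>b\<in>K. c b * (if b = a then 1 else 0))"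
    unfolding ip_sum_left using assms by (intro sum.cong) (auto simp: orthonormal_on_def)
  then show ?thesis using assms by (simp add: if_distrib cong: if_cong)
qed

text \<open>
  Elimination of one equation and one unknown at a time.  It replaces dimension theory: all vectors
  here are functions restricted to a finite index set.
\<close>

lemma homogeneous_system_nontrivial:
  fixes v :: "'e \<Rightarrow> 'i \<Rightarrow> real"
  assumes "finite E" "finite I" "card E < card I"
  shows "\<exists>x. (\<exists>i\<in>I. x i \<noteq> 0) \<and> (\<forall>e\<in>E. ip I (v e) x = 0)"
  using assms
proof (induction E arbitrary: I v rule: finite_induct)
  case empty
  then show ?case by (intro exI[of _ "\<lambda>_. 1"]) (auto simp: card_gt_0_iff)
next
  case (insert e E)
  show ?case
  proof (cases "\<forall>i\<in>I. v e i = 0")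
    case True
    obtain x where "\<exists>i\<in>I. x i \<noteq> 0" "\<forall>e\<in>E. ip I (v e) x = 0"
      using insert.IH[of I v] insert.prems insert.hyps by (metis card_insert_disjoint Suc_lessD)
    then show ?thesis using True by (intro exI[of _ x]) (auto simp: ip_def)
  next
    case False
    then obtain k where k: "k \<in> I" "v e k \<noteq> 0" by auto
    let ?J = "I - {k}"
    define w where "w e' i = v e' i - v e' k / v e k * v e i" for e' i
    have cJ: "card E < card ?J" using insert k by auto
    obtain x where x: "\<exists>i\<in>?J. x i \<noteq> 0" "\<forall>e'\<in>E. ip ?J (w e') x = 0"
      using insert.IH[OF _ cJ, of w] insert.prems by auto
    define y where "y = x(k := - ip ?J (v e) x / v e k)"
    have split: "ip I u y = ip ?J u x - u k * ip ?J (v e) x / v e k" for u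
      unfolding ip_def using k insert.prems(1)
      by (subst sum.remove[of I k]) (auto simp: y_def ip_def intro!: sum.cong)
    have "ip I (v e) y = 0" using k by (simp add: split)
    moreover have "ip I (v e') y = 0" if "e' \<in> E" for e'
    proof -
      have "ip ?J (w e') x = ip ?J (v e') x - v e' k / v e k * ip ?J (v e) x"
        unfolding w_def ip_diff_left using ip_scale_left[of ?J "v e' k / v e k" "v e" x] by simp
      then show ?thesis using x that by (simp add: split)
    qed
    moreover have "\<exists>i\<in>I. y i \<noteq> 0" using x(1) by (auto simp: y_def)
    ultimately show ?thesis by blast
  qed
qed

lemma unit_vector_orthogonal:
  fixes v :: "'e \<Rightarrow> 'i \<Rightarrow> real"
  assumes "finite E" "finite I" "card E < card I"
  obtains x where "ip I x x = 1" "\<And>e. e \<in> E \<Longrightarrow> ip I (v e) x = 0"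
proof -
  obtain x where x: "\<exists>i\<in>I. x i \<noteq> 0" "\<forall>e\<in>E. ip I (v e) x = 0"
    using homogeneous_system_nontrivial[OF assms] by blast
  have pos: "ip I x x > 0"
    using x(1) ip_self_nonneg[of I x] ip_self_eq_0_iff[OF assms(2), of x] by force
  define y where "y i = (1 / sqrt (ip I x x)) * x i" for i
  have "ip I y y = 1" unfolding y_def ip_linear_left ip_linear_right using pos
    by (simp add: field_simps flip: power2_eq_square)
  moreover have "ip I (v e) y = 0" if "e \<in> E" for e
    unfolding y_def ip_linear_right using x that by simp
  ultimately show ?thesis using that by blast
qed

text \<open>
  As long as the vectors to be avoided and the vectors already chosen are fewer than the coordinates,
  some unit vector is orthogonal to all of them.  With \<open>C\<close> empty this completes an orthonormal system;
  with \<open>C\<close> a family of columns it supplies an orthonormal basis adapted to their span.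
\<close>

lemma extend_orthonormal:
  fixes v :: "'e \<Rightarrow> 'i \<Rightarrow> real" and q :: "'k \<Rightarrow> 'i \<Rightarrow> real"
  assumes "finite I" "finite C" "finite L" "K \<subseteq> L" "card C + card L \<le> card I"
    and "orthonormal_on I K q"
    and "\<And>a c. a \<in> K \<Longrightarrow> c \<in> C \<Longrightarrow> ip I (v c) (q a) = 0"
  shows "\<exists>q'. orthonormal_on I L q' \<and> (\<forall>a\<in>K. q' a = q a) \<and>
           (\<forall>a\<in>L. \<forall>c\<in>C. ip I (v c) (q' a) = 0)"
proof -
  have "\<exists>q'. orthonormal_on I (K \<union> D) q' \<and> (\<forall>a\<in>K. q' a = q a) \<and>
           (\<forall>a\<in>K \<union> D. \<forall>c\<in>C. ip I (v c) (q' a) = 0)"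
    if "finite D" "D \<subseteq> L - K" for D using that
  proof (induction D rule: finite_induct)
    case empty then show ?case using assms by auto
  next
    case (insert d D)
    then obtain q' where q': "orthonormal_on I (K \<union> D) q'" "\<forall>a\<in>K. q' a = q a"
      "\<forall>a\<in>K \<union> D. \<forall>c\<in>C. ip I (v c) (q' a) = 0" by auto
    define u where "u = case_sum v q'"
    have fin: "finite K" using assms finite_subset by blast
    have "card (K \<union> D) < card L"
      using insert assms by (intro psubset_card_mono) auto
    moreover have "card (C <+> (K \<union> D)) = card C + card (K \<union> D)"
      using assms fin insert by (intro card_Plus) auto
    ultimately have "card (C <+> (K \<union> D)) < card I" using assms by linarith
    then obtain x where x: "ip I x x = 1" "\<And>e. e \<in> C <+> (K \<union> D) \<Longrightarrow> ip I (u e) x = 0"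
      using unit_vector_orthogonal[of "C <+> (K \<union> D)" I u] assms fin insert by auto
    have x1: "ip I (v c) x = 0" if "c \<in> C" for c using x(2)[of "Inl c"] that by (auto simp: u_def)
    have x2: "ip I (q' c) x = 0" if "c \<in> K \<union> D" for c using x(2)[of "Inr c"] that by (auto simp: u_def)
    have x3: "ip I x (q' c) = 0" if "c \<in> K \<union> D" for c using x2[OF that] by (simp add: ip_commute)
    have dn: "d \<notin> K \<union> D" using insert by auto
    show ?case
    proof (intro exI[of _ "q'(d := x)"] conjI)
      show "orthonormal_on I (K \<union> insert d D) (q'(d := x))"
        using q'(1) x(1) x2 x3 dn unfolding orthonormal_on_def by auto
    qed (use q' x1 dn insert in auto)
  qed
  from this[of "L - K"] have "\<exists>q'. orthonormal_on I (K \<union> (L - K)) q' \<and> (\<forall>a\<in>K. q' a = q a) \<and>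
           (\<forall>a\<in>K \<union> (L - K). \<forall>c\<in>C. ip I (v c) (q' a) = 0)" using assms by auto
  moreover have "K \<union> (L - K) = L" using assms by auto
  ultimately show ?thesis by simp
qed

text \<open>
  The residual \<open>s\<close> of the expansion and the vectors \<open>q a\<close> are \<open>card I + 1\<close> vectors with \<open>card I\<close> coordinates, hence
  linearly dependent; taking inner products with the \<open>q a\<close> leaves a relation with \<open>s\<close> alone.
\<close>

lemma orthonormal_complete:
  assumes "finite I" "orthonormal_on I I q" "j \<in> I"
  shows "(\<Sum>a\<in>I. ip I x (q a) * q a j) = x j"
proof -
  define s where "s i = x i - (\<Sum>a\<in>I. ip I x (q a) * q a i)" for i
  have orth: "ip I s (q a) = 0" if "a \<in> I" for a
    using ip_orthonormal_sum[OF assms(2,1) that, of "\<lambda>a. ip I x (q a)"]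
    unfolding s_def ip_diff_left by simp
  have orth': "ip I (q a) s = 0" if "a \<in> I" for a using orth[OF that] by (simp add: ip_commute)
  define f where "f = case_option s q"
  let ?E = "insert None (Some ` I)"
  have "card ?E = Suc (card I)" using assms(1) by (subst card_insert_disjoint) (auto simp: card_image)
  then obtain c where c: "\<exists>e\<in>?E. c e \<noteq> 0" "\<forall>i\<in>I. ip ?E (\<lambda>e. f e i) c = 0"
    using homogeneous_system_nontrivial[of I ?E "\<lambda>i e. f e i"] assms(1) by auto
  have split: "ip ?E (\<lambda>e. f e i) c = c None * s i + (\<Sum>a\<in>I. c (Some a) * q a i)" for i
    unfolding ip_def using assms(1)
    by (subst sum.insert) (auto simp: f_def sum.reindex mult.commute intro!: sum.cong)
  define r where "r i = c None * s i + (\<Sum>a\<in>I. c (Some a) * q a i)" for i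
  have r0: "r i = 0" if "i \<in> I" for i using c(2) that by (simp add: split r_def)
  have ipr: "ip I r y = 0" for y using r0 by (simp add: ip_def)
  have "c (Some a) = 0" if "a \<in> I" for a
    using ipr[of "q a"] that assms(1) ip_orthonormal_sum[OF assms(2,1) that, of "\<lambda>a. c (Some a)"] orth[OF that]
    unfolding r_def ip_add_left ip_scale_left by simp
  then have cN: "c None \<noteq> 0" and "r = (\<lambda>i. c None * s i)" using c(1) by (auto simp: r_def)
  then have "s j = 0" using r0[OF assms(3)] by simp
  then show ?thesis by (simp add: s_def)
qed

lemma orthonormal_parseval:
  assumes "finite I" "orthonormal_on I I q"
  shows "(\<Sum>a\<in>I. ip I x (q a) * ip I y (q a)) = ip I x y"
proof -
  have "ip I x y = ip I (\<lambda>j. \<Sum>a\<in>I. ip I x (q a) * q a j) y"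
    by (rule ip_cong) (use orthonormal_complete[OF assms] in simp_all)
  also have "\<dots> = (\<Sum>a\<in>I. ip I x (q a) * ip I y (q a))"
    unfolding ip_sum_left by (simp add: ip_commute)
  finally show ?thesis by simp
qed

text \<open>
  The rows of a square matrix being orthonormal, so are its columns: expand the unit vectors.
\<close>

lemma orthonormal_columns:
  assumes "finite I" "orthonormal_on I I q" "i \<in> I" "j \<in> I"
  shows "(\<Sum>a\<in>I. q a i * q a j) = (if i = j then 1 else 0)"
proof -
  define e where "e k = (if k = i then 1 else 0 :: real)" for k
  have "ip I e (q a) = q a i" for a using assms unfolding ip_def e_def
    by (simp add: if_distrib[of "\<lambda>x. x * _"] sum.delta cong: if_cong)
  then show ?thesis using orthonormal_complete[OF assms(1,2,4), of e] by (auto simp: e_def)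
qed

section \<open>Standard Gaussian vectors and orthogonal maps\<close>

abbreviation leb :: "'i set \<Rightarrow> ('i \<Rightarrow> real) measure" where
  "leb I \<equiv> Pi\<^sub>M I (\<lambda>_. lborel)"

abbreviation gauss :: "'i set \<Rightarrow> ('i \<Rightarrow> real) measure" where
  "gauss I \<equiv> Pi\<^sub>M I (\<lambda>_. std_normal_distribution)"

definition lin_map :: "'i set \<Rightarrow> ('i \<Rightarrow> 'i \<Rightarrow> real) \<Rightarrow> ('i \<Rightarrow> real) \<Rightarrow> 'i \<Rightarrow> real" where
  "lin_map I A z = (\<lambda>i\<in>I. ip I (A i) z)"

interpretation leb: product_sigma_finite "\<lambda>_::'i. lborel :: real measure" ..

lemma prob_space_std_normal: "prob_space std_normal_distribution"
  by (rule prob_space_normal_density) simp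

interpretation gs: product_sigma_finite "\<lambda>_::'i. std_normal_distribution"
  by (simp add: product_sigma_finite_def prob_space_std_normal prob_space_imp_sigma_finite)

lemma prob_space_gauss: "prob_space (gauss I)"
  by (rule prob_space_PiM) (rule prob_space_std_normal)

lemma sets_gauss_leb: "sets (gauss I) = sets (leb I)"
  by (rule sets_PiM_cong) simp_all

lemma sets_gauss [measurable_cong]: "sets (gauss I) = sets (Pi\<^sub>M I (\<lambda>_. borel))"
  by (rule sets_PiM_cong) simp_all

lemma sets_leb [measurable_cong]: "sets (leb I) = sets (Pi\<^sub>M I (\<lambda>_. borel))"
  by (rule sets_PiM_cong) simp_all

lemma measurable_ip [measurable]: "ip I v \<in> borel_measurable (Pi\<^sub>M I (\<lambda>_. borel))"
  unfolding ip_def by measurable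

lemma measurable_lin_map [measurable]:
  "lin_map I A \<in> Pi\<^sub>M I (\<lambda>_. borel) \<rightarrow>\<^sub>M Pi\<^sub>M I (\<lambda>_. borel)"
  unfolding lin_map_def by measurable

lemma measurable_replace:
  assumes "i \<in> I"
  shows "(\<lambda>z. z(i := ip I c z)) \<in> leb I \<rightarrow>\<^sub>M leb I"
proof -
  have "(\<lambda>z. z(i := ip I c z)) \<in> leb I \<rightarrow>\<^sub>M leb I \<longleftrightarrow>
      (\<lambda>z. \<lambda>l\<in>I. if l = i then ip I c z else z l) \<in> leb I \<rightarrow>\<^sub>M leb I"
    using assms by (intro measurable_cong) (auto simp: space_PiM PiE_def extensional_def fun_eq_iff)
  also have "\<dots>" by (intro measurable_restrict) auto
  finally show ?thesis .
qed

text \<open>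
  The elementary substitution behind every linear change of variables: one coordinate is replaced by
  a linear form in which it occurs with coefficient \<open>c i \<noteq> 0\<close>, and Fubini reduces the claim to the real line.
\<close>

lemma nn_integral_replace_coordinate:
  assumes "finite I" "i \<in> I" "c i \<noteq> 0" and f[measurable]: "f \<in> borel_measurable (leb I)"
  shows "(\<integral>\<^sup>+z. f (z(i := ip I c z)) \<partial>leb I) = ennreal (1 / \<bar>c i\<bar>) * (\<integral>\<^sup>+z. f z \<partial>leb I)"
proof -
  let ?J = "I - {i}"
  have I: "insert i ?J = I" "finite ?J" "i \<notin> ?J" using assms by auto
  have m[measurable]: "(\<lambda>z. z(i := ip I c z)) \<in> leb I \<rightarrow>\<^sub>M leb I"
    using assms(2) by (rule measurable_replace)
  have c: "ip I c (z(i := y)) = c i * y + ip ?J c z" for z y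
    unfolding ip_def using assms by (subst sum.remove[of I i]) (auto intro!: sum.cong)
  have eq: "ennreal (1 / \<bar>c i\<bar>) * (\<integral>\<^sup>+y. f (z(i := y)) \<partial>lborel)
      = (\<integral>\<^sup>+y. f (z(i := c i * y + ip ?J c z)) \<partial>lborel)" if z: "z \<in> space (leb ?J)" for z
  proof -
    have "(\<lambda>y. z(i := y)) \<in> lborel \<rightarrow>\<^sub>M leb (insert i ?J)"
      using z by (intro measurable_fun_upd[where J="?J"]) auto
    then have "(\<lambda>y. f (z(i := y))) \<in> borel_measurable lborel"
      unfolding I(1) by (rule measurable_compose[OF _ f])
    then have fm: "(\<lambda>y. f (z(i := y))) \<in> borel_measurable borel"
      by simp
    have "(\<integral>\<^sup>+y. f (z(i := y)) \<partial>lborel)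
        = ennreal \<bar>c i\<bar> * (\<integral>\<^sup>+y. f (z(i := c i * y + ip ?J c z)) \<partial>lborel)" (is "_ = _ * ?r")
      using nn_integral_real_affine[OF fm assms(3), of "ip ?J c z"] by (simp only: add.commute)
    moreover have "ennreal (1 / \<bar>c i\<bar>) * (ennreal \<bar>c i\<bar> * ?r) = ?r"
      using assms(3) by (subst mult.assoc[symmetric], subst ennreal_mult[symmetric]) auto
    ultimately show ?thesis by simp
  qed
  have "(\<integral>\<^sup>+z. f (z(i := ip I c z)) \<partial>leb I)
      = (\<integral>\<^sup>+z. \<integral>\<^sup>+y. f (z(i := c i * y + ip ?J c z)) \<partial>lborel \<partial>leb ?J)"
    using leb.product_nn_integral_insert[OF I(2,3), of "\<lambda>z. f (z(i := ip I c z))"] I(1)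
    by (simp add: c)
  also have "\<dots> = (\<integral>\<^sup>+z. ennreal (1 / \<bar>c i\<bar>) * (\<integral>\<^sup>+y. f (z(i := y)) \<partial>lborel) \<partial>leb ?J)"
    by (intro nn_integral_cong) (simp add: eq)
  also have "\<dots> = ennreal (1 / \<bar>c i\<bar>) * (\<integral>\<^sup>+z. \<integral>\<^sup>+y. f (z(i := y)) \<partial>lborel \<partial>leb ?J)"
  proof (rule nn_integral_cmult)
    interpret J: sigma_finite_measure "leb ?J" using leb.sigma_finite I by auto
    have "(\<lambda>(z, y). z(i := y)) \<in> leb ?J \<Otimes>\<^sub>M lborel \<rightarrow>\<^sub>M leb (insert i ?J)" by measurable
    then have [measurable]: "(\<lambda>(z, y). f (z(i := y))) \<in> borel_measurable (leb ?J \<Otimes>\<^sub>M lborel)"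
      unfolding I(1) by (simp add: split_beta') measurable
    show "(\<lambda>z. \<integral>\<^sup>+y. f (z(i := y)) \<partial>lborel) \<in> borel_measurable (leb ?J)" by measurable
  qed
  also have "(\<integral>\<^sup>+z. \<integral>\<^sup>+y. f (z(i := y)) \<partial>lborel \<partial>leb ?J) = (\<integral>\<^sup>+z. f z \<partial>leb I)"
    using leb.product_nn_integral_insert[OF I(2,3), of f] I(1) by simp
  finally show ?thesis .
qed

text \<open>
  The constant \<open>K\<close> is the reciprocal of the absolute determinant.  It is pinned down each time by comparing
  total masses, so no determinant has to be computed.
\<close>

definition scales_leb :: "'i set \<Rightarrow> (('i \<Rightarrow> real) \<Rightarrow> 'i \<Rightarrow> real) \<Rightarrow> bool" where
  "scales_leb I T \<longleftrightarrow> (\<exists>K>0. \<forall>f\<in>borel_measurable (leb I).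
     (\<integral>\<^sup>+z. f (T z) \<partial>leb I) = ennreal K * (\<integral>\<^sup>+z. f z \<partial>leb I))"

definition surjective_on :: "'i set \<Rightarrow> ('i \<Rightarrow> 'i \<Rightarrow> real) \<Rightarrow> bool" where
  "surjective_on I A \<longleftrightarrow> (\<forall>y. \<exists>z. \<forall>i\<in>I. ip I (A i) z = y i)"

lemma ip_replace:
  assumes "finite I" "i \<in> I"
  shows "ip I b (z(i := ip I c z)) = ip I (\<lambda>j. b j + b i * (c j - (if j = i then 1 else 0))) z"
proof -
  have "ip I b (z(i := ip I c z)) = ip (I - {i}) b z + b i * ip I c z"
    unfolding ip_def using assms by (subst sum.remove[of I i]) (auto intro!: sum.cong)
  also have "ip (I - {i}) b z = ip I (\<lambda>j. b j - b i * (if j = i then 1 else 0)) z"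
    unfolding ip_def using assms by (subst sum.remove[of I i "\<lambda>j. (b j - b i * (if j = i then 1 else 0)) * z j"]) (auto intro!: sum.cong)
  also have "\<dots> + b i * ip I c z = ip I (\<lambda>j. b j + b i * (c j - (if j = i then 1 else 0))) z"
    unfolding ip_linear_left(3)[symmetric] ip_add_left[symmetric]
    by (intro ip_cong) (simp_all add: algebra_simps)
  finally show ?thesis .
qed

text \<open>
  Gaussian elimination, by induction on the set \<open>S\<close> of rows that differ from the identity matrix.  A row
  with a nonzero diagonal entry is split off as a replacement of one coordinate.  A zero diagonal entry
  is first repaired by the shear that adds coordinate \<open>i\<close> to coordinate \<open>j\<close>, which preserves Lebesgue measure.
\<close>

lemma lin_map_scales_leb_aux:
  assumes "finite I" "S \<subseteq> I" "surjective_on I A"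
    and "\<And>l j. l \<in> I - S \<Longrightarrow> j \<in> I \<Longrightarrow> A l j = (if j = l then 1 else 0)"
  shows "scales_leb I (lin_map I A)"
proof -
  have "finite S" using assms finite_subset by blast
  then show ?thesis using assms(2-)
  proof (induction S arbitrary: A rule: finite_induct)
    case empty
    have *: "lin_map I A z = z" if "z \<in> space (leb I)" for z
    proof
      fix l show "lin_map I A z l = z l"
      proof (cases "l \<in> I")
        case True
        then have "ip I (A l) z = (\<Sum>j\<in>I. (if j = l then z j else 0))"
          unfolding ip_def using empty by (intro sum.cong) auto
        then show ?thesis using True assms(1) by (simp add: lin_map_def)
      next
        case False then show ?thesis using that by (auto simp: lin_map_def space_PiM PiE_def extensional_def)
      qed
    qed
    show ?case unfolding scales_leb_def
      by (intro exI[of _ 1]) (auto intro!: nn_integral_cong simp: *)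
  next
    case (insert i S)
    \<comment> \<open>a row with a nonzero diagonal entry\<close>
    have diag: "scales_leb I (lin_map I B)"
      if B: "surjective_on I B" "\<And>l j. l \<in> I - insert i S \<Longrightarrow> j \<in> I \<Longrightarrow> B l j = (if j = l then 1 else 0)"
        and nz: "B i i \<noteq> 0" for B
    proof -
      have iI: "i \<in> I" using insert by auto
      \<comment> \<open>\<open>B'\<close> is chosen so that \<open>B\<close> is \<open>B'\<close> after the replacement; its row \<open>i\<close> is that of the identity\<close>
      define B' where "B' l j = B l j + B l i * ((if j = i then 1 else - B i j) / B i i - (if j = i then 1 else 0))" for l j
      have comp: "ip I (B' l) (z(i := ip I (B i) z)) = ip I (B l) z" for l z
        unfolding ip_replace[OF assms(1) iI] B'_def using nz
        by (intro ip_cong) (auto simp: field_simps)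
      have "surjective_on I B'" unfolding surjective_on_def
      proof
        fix y
        obtain z where "\<forall>l\<in>I. ip I (B l) z = y l" using B(1) by (auto simp: surjective_on_def)
        then show "\<exists>z. \<forall>l\<in>I. ip I (B' l) z = y l" using comp by (intro exI[of _ "z(i := ip I (B i) z)"]) simp
      qed
      moreover have "B' l j = (if j = l then 1 else 0)" if "l \<in> I - S" "j \<in> I" for l j
      proof (cases "l = i")
        case True then show ?thesis using nz by (auto simp: B'_def field_simps)
      next
        case False then show ?thesis using B(2)[of l j] B(2)[of l i] that iI by (auto simp: B'_def)
      qed
      ultimately have "scales_leb I (lin_map I B')" using insert by auto
      then obtain K where K: "K > 0" "\<And>f. f\<in>borel_measurable (leb I) \<Longrightarrow>
          (\<integral>\<^sup>+z. f (lin_map I B' z) \<partial>leb I) = ennreal K * (\<integral>\<^sup>+z. f z \<partial>leb I)"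
        by (auto simp: scales_leb_def)
      have lm: "lin_map I B z = lin_map I B' (z(i := ip I (B i) z))" for z
        unfolding lin_map_def using comp by auto
      show ?thesis unfolding scales_leb_def
      proof (intro exI[of _ "1 / \<bar>B i i\<bar> * K"] conjI ballI)
        fix f :: "_ \<Rightarrow> ennreal" assume f[measurable]: "f \<in> borel_measurable (leb I)"
        show "(\<integral>\<^sup>+z. f (lin_map I B z) \<partial>leb I) = ennreal (1 / \<bar>B i i\<bar> * K) * (\<integral>\<^sup>+z. f z \<partial>leb I)"
          unfolding lm using K
          by (subst nn_integral_replace_coordinate[OF assms(1) iI, where c="B i" and f="\<lambda>z. f (lin_map I B' z)"])
             (use K(1) nz in \<open>simp_all add: mult.assoc[symmetric] flip: ennreal_mult\<close>)
      qed (use K nz in auto)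
    qed
    have iI: "i \<in> I" using insert by auto
    show ?case
    proof (cases "A i i = 0")
      case False then show ?thesis using diag[of A] insert by auto
    next
      case True
      obtain z where z: "\<And>l. l \<in> I \<Longrightarrow> ip I (A l) z = (if l = i then 1 else 0)"
        using insert.prems(2)[unfolded surjective_on_def, rule_format, of "\<lambda>l. if l = i then 1 else 0"] by auto
      have z0: "z l = 0" if "l \<in> I - insert i S" for l
      proof -
        have "ip I (A l) z = (\<Sum>j\<in>I. (if j = l then z j else 0))"
          unfolding ip_def using insert that by (intro sum.cong) auto
        then show ?thesis using z[of l] that assms(1) by auto
      qed
      have "ip I (A i) z \<noteq> 0" using z[of i] iI by simp
      then obtain j where j: "j \<in> I" "A i j * z j \<noteq> 0" unfolding ip_def by (meson sum.not_neutral_contains_not_neutral)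
      then have jS: "j \<in> S" "j \<noteq> i" using z0[of j] True by (cases "j = i"; auto)+
      \<comment> \<open>the shear \<open>z\<^sub>j := z\<^sub>j + z\<^sub>i\<close>; it turns the diagonal entry into \<open>A i j \<noteq> 0\<close>\<close>
      define e where "e k = (if k = j \<or> k = i then 1 else 0 :: real)" for k
      define B where "B l k = A l k + A l j * (e k - (if k = j then 1 else 0))" for l k
      have comp: "ip I (B l) z = ip I (A l) (z(j := ip I e z))" for l z
        unfolding ip_replace[OF assms(1) j(1)] B_def ..
      have sur: "surjective_on I B" unfolding surjective_on_def
      proof
        fix y
        obtain x where x: "\<forall>l\<in>I. ip I (A l) x = y l" using insert.prems(2) by (auto simp: surjective_on_def)
        define w where "w = x(j := x j - x i)"
        have "ip I e w = (\<Sum>k\<in>I. (if k = j then w j else 0) + (if k = i then w i else 0))"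
          unfolding ip_def e_def using jS by (intro sum.cong) auto
        also have "\<dots> = x j" using assms(1) j iI jS by (simp add: sum.distrib w_def)
        finally have "w(j := ip I e w) = x" by (auto simp: w_def)
        then show "\<exists>z. \<forall>l\<in>I. ip I (B l) z = y l" using x by (intro exI[of _ w]) (simp add: comp)
      qed
      have "scales_leb I (lin_map I B)"
      proof (rule diag[OF sur])
        show "B l k = (if k = l then 1 else 0)" if "l \<in> I - insert i S" "k \<in> I" for l k
          using insert.prems(3)[OF that] insert.prems(3)[OF that(1) j(1)] jS that by (auto simp: B_def)
        show "B i i \<noteq> 0" using True jS j by (auto simp: B_def e_def)
      qed
      then obtain K where K: "K > 0" "\<And>f. f\<in>borel_measurable (leb I) \<Longrightarrow>
          (\<integral>\<^sup>+z. f (lin_map I B z) \<partial>leb I) = ennreal K * (\<integral>\<^sup>+z. f z \<partial>leb I)"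
        by (auto simp: scales_leb_def)
      have lm: "lin_map I B z = lin_map I A (z(j := ip I e z))" for z
        unfolding lin_map_def using comp by auto
      show ?thesis unfolding scales_leb_def
      proof (intro exI[of _ K] conjI ballI)
        fix f :: "_ \<Rightarrow> ennreal" assume f[measurable]: "f \<in> borel_measurable (leb I)"
        have "(\<integral>\<^sup>+z. f (lin_map I A z) \<partial>leb I) = (\<integral>\<^sup>+z. f (lin_map I A (z(j := ip I e z))) \<partial>leb I)"
          by (subst nn_integral_replace_coordinate[OF assms(1) j(1), of e "\<lambda>z. f (lin_map I A z)"])
             (simp_all add: e_def)
        then show "(\<integral>\<^sup>+z. f (lin_map I A z) \<partial>leb I) = ennreal K * (\<integral>\<^sup>+z. f z \<partial>leb I)"
          using K(2)[OF f] by (simp add: lm)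
      qed (use K in auto)
    qed
  qed
qed

lemma lin_map_scales_leb:
  assumes "finite I" "surjective_on I A"
  shows "scales_leb I (lin_map I A)"
  using lin_map_scales_leb_aux[of I I A] assms by auto

lemma gauss_eq_density:
  assumes "finite I"
  shows "gauss I = density (leb I) (\<lambda>z. ennreal (\<Prod>i\<in>I. std_normal_density (z i)))"
proof -
  have "density (leb I) (\<lambda>z. ennreal (\<Prod>i\<in>I. std_normal_density (z i))) = gauss I"
  proof (rule gs.PiM_eqI[OF assms])
    fix A :: "'a \<Rightarrow> real set" assume "\<And>i. i \<in> I \<Longrightarrow> A i \<in> sets std_normal_distribution"
    then have A[measurable]: "i \<in> I \<Longrightarrow> A i \<in> sets borel" for i by simp
    have PE: "Pi\<^sub>E I A \<in> sets (leb I)" using A by (intro sets_PiM_I_finite assms) auto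
    have "emeasure (density (leb I) (\<lambda>z. ennreal (\<Prod>i\<in>I. std_normal_density (z i)))) (Pi\<^sub>E I A)
      = (\<integral>\<^sup>+z. ennreal (\<Prod>i\<in>I. std_normal_density (z i)) * indicator (Pi\<^sub>E I A) z \<partial>leb I)"
      using PE by (subst emeasure_density) auto
    also have "\<dots> = (\<integral>\<^sup>+z. (\<Prod>i\<in>I. ennreal (std_normal_density (z i)) * indicator (A i) (z i)) \<partial>leb I)"
      using assms by (intro nn_integral_cong)
       (auto simp: prod.distrib prod_ennreal indicator_def space_PiM PiE_def Pi_def intro!: prod_zero)
    also have "\<dots> = (\<Prod>i\<in>I. \<integral>\<^sup>+x. ennreal (std_normal_density x) * indicator (A i) x \<partial>lborel)"
      using assms A by (intro leb.product_nn_integral_prod) auto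
    also have "\<dots> = (\<Prod>i\<in>I. emeasure std_normal_distribution (A i))"
      using A by (intro prod.cong refl) (simp add: emeasure_density)
    finally show "emeasure (density (leb I) (\<lambda>z. ennreal (\<Prod>i\<in>I. std_normal_density (z i)))) (Pi\<^sub>E I A)
      = (\<Prod>i\<in>I. emeasure std_normal_distribution (A i))" .
  qed (simp add: sets_gauss_leb)
  then show ?thesis by simp
qed

lemma prod_std_normal_density:
  assumes "finite I"
  shows "(\<Prod>i\<in>I. std_normal_density (z i)) = (1 / sqrt (2 * pi)) ^ card I * exp (- ip I z z / 2)"
proof -
  have "- ip I z z / 2 = (\<Sum>i\<in>I. - (z i)\<^sup>2 / 2)"
    by (simp add: ip_def power2_eq_square sum_negf sum_divide_distrib)
  then have "exp (- ip I z z / 2) = (\<Prod>i\<in>I. exp (- (z i)\<^sup>2 / 2))"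
    using assms by (simp only: exp_sum)
  then show ?thesis unfolding std_normal_density_def prod.distrib prod_constant by (simp only:)
qed

text \<open>
  The density depends on \<open>ip I z z\<close> only, which an orthogonal map preserves, and the map scales Lebesgue
  measure by some constant; that constant is \<open>1\<close> because both sides are probability measures.
\<close>

lemma gauss_orthogonal:
  assumes "finite I" and q: "orthonormal_on I I q"
  shows "distr (gauss I) (gauss I) (lin_map I q) = gauss I"
proof -
  have sur: "surjective_on I q" unfolding surjective_on_def
  proof
    fix y
    have "ip I (q i) (\<lambda>i. \<Sum>b\<in>I. y b * q b i) = y i" if "i \<in> I" for i
      by (subst ip_commute) (rule ip_orthonormal_sum[OF q assms(1) that])
    then show "\<exists>z. \<forall>i\<in>I. ip I (q i) z = y i" by blast
  qed
  obtain K where K: "K > 0" "\<And>f. f\<in>borel_measurable (leb I) \<Longrightarrow>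
          (\<integral>\<^sup>+z. f (lin_map I q z) \<partial>leb I) = ennreal K * (\<integral>\<^sup>+z. f z \<partial>leb I)"
    using lin_map_scales_leb[OF assms(1) sur] unfolding scales_leb_def by metis
  define g where "g z = ennreal (\<Prod>i\<in>I. std_normal_density (z i))" for z :: "'a \<Rightarrow> real"
  have g[measurable]: "g \<in> borel_measurable (Pi\<^sub>M I (\<lambda>_. borel))" unfolding g_def by measurable
  have ginv: "g (lin_map I q z) = g z" for z
  proof -
    have "ip I (lin_map I q z) (lin_map I q z) = (\<Sum>a\<in>I. ip I z (q a) * ip I z (q a))"
      unfolding ip_def[of I "lin_map I q z"] by (simp add: lin_map_def ip_commute[of I z])
    also have "\<dots> = ip I z z" by (rule orthonormal_parseval[OF assms])
    finally show ?thesis by (simp add: g_def prod_std_normal_density assms(1))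
  qed
  have dens: "gauss I = density (leb I) g" using gauss_eq_density[OF assms(1)] unfolding g_def .
  have T: "lin_map I q \<in> leb I \<rightarrow>\<^sub>M leb I"
    using measurable_lin_map measurable_cong_sets[OF sets_leb sets_leb] by blast
  have g': "g \<in> borel_measurable (leb I)"
    using g measurable_cong_sets[OF sets_leb refl] by blast
  have inv: "(\<integral>\<^sup>+z. f (lin_map I q z) \<partial>gauss I) = ennreal K * (\<integral>\<^sup>+z. f z \<partial>gauss I)"
    if f: "f \<in> borel_measurable (leb I)" for f :: "_ \<Rightarrow> ennreal"
  proof -
    have 1: "(\<integral>\<^sup>+z. h z \<partial>gauss I) = (\<integral>\<^sup>+z. g z * h z \<partial>leb I)" if "h \<in> borel_measurable (leb I)" for h
      unfolding dens using nn_integral_density[OF g' that] .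
    have "(\<lambda>z. g z * f z) \<in> borel_measurable (leb I)" using f g' by (rule borel_measurable_times_ennreal[rotated])
    from K(2)[OF this] show ?thesis
      using 1[OF f] 1[OF measurable_compose[OF T f]] by (simp only: ginv)
  qed
  interpret P: prob_space "gauss I" by (rule prob_space_gauss)
  have "(\<integral>\<^sup>+z. 1 \<partial>gauss I) = ennreal K * (\<integral>\<^sup>+z. 1 \<partial>gauss I)" by (rule inv) simp
  moreover have "(\<integral>\<^sup>+z. 1 \<partial>gauss I) = 1" using P.emeasure_space_1 by (simp only: nn_integral_const mult_1)
  ultimately have K1: "ennreal K = 1" by (simp only: mult_1_right)
  have T': "lin_map I q \<in> gauss I \<rightarrow>\<^sub>M gauss I"
    using measurable_lin_map measurable_cong_sets[OF sets_gauss sets_gauss] by blast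
  show ?thesis
  proof (rule measure_eqI)
    fix A assume "A \<in> sets (distr (gauss I) (gauss I) (lin_map I q))"
    then have A: "A \<in> sets (Pi\<^sub>M I (\<lambda>_. borel))" by (simp only: sets_gauss sets_distr)
    have A': "A \<in> sets (gauss I)" "A \<in> sets (leb I)"
      using A by (simp_all only: sets_gauss sets_leb)
    have "(\<integral>\<^sup>+z. indicator A z \<partial>distr (gauss I) (gauss I) (lin_map I q))
        = (\<integral>\<^sup>+z. indicator A (lin_map I q z) \<partial>gauss I)"
      using A' by (intro nn_integral_distr borel_measurable_indicator T') (simp only: sets_distr)
    moreover have "(\<integral>\<^sup>+z. indicator A (lin_map I q z) \<partial>gauss I) = ennreal K * (\<integral>\<^sup>+z. indicator A z \<partial>gauss I)"
      by (rule inv) (use A'(2) in \<open>rule borel_measurable_indicator\<close>)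
    ultimately show "emeasure (distr (gauss I) (gauss I) (lin_map I q)) A = emeasure (gauss I) A"
      using A' by (simp only: K1 mult_1 nn_integral_indicator sets_distr)
  qed simp
qed

section \<open>Quadratic forms in the inverse of a Gram matrix\<close>

text \<open>
  Cramer's rule makes the inverse an explicit rational function of the entries, which is what
  measurability needs.  The singular case agrees with the convention of \<open>inv_mat\<close>.
\<close>

lemma inv_mat_eq_adj:
  assumes "A \<in> carrier_mat n n"
  shows "inv_mat A = (if Determinant.det A = 0 then 0\<^sub>m n n else (1 / Determinant.det A) \<cdot>\<^sub>m adj_mat A)"
proof (cases "mat_inverse A")
  case None
  then have "Determinant.det A = 0"
    using det_non_zero_imp_unit[OF assms, where b="()"] mat_inverse(1)[OF assms, where b="()"] by blast
  then show ?thesis using None assms by (auto simp: inv_mat_def)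
next
  case (Some B)
  then have B: "A * B = 1\<^sub>m n" "B * A = 1\<^sub>m n" "B \<in> carrier_mat n n"
    using mat_inverse(2)[OF assms] by auto
  have d: "Determinant.det A \<noteq> 0" using det_mult[OF assms B(3)] B(1) by auto
  note adj = adj_mat[OF assms]
  have "adj_mat A = adj_mat A * (A * B)" using adj B by simp
  also have "\<dots> = (adj_mat A * A) * B" by (rule assoc_mult_mat[symmetric, OF adj(1) assms B(3)])
  also have "\<dots> = Determinant.det A \<cdot>\<^sub>m B" using adj B by (simp add: mult_smult_assoc_mat[of _ n n _ n])
  finally have "(1 / Determinant.det A) \<cdot>\<^sub>m adj_mat A = (1 / Determinant.det A) \<cdot>\<^sub>m (Determinant.det A \<cdot>\<^sub>m B)" by simp
  also have "\<dots> = B" using d B by (intro eq_matI) auto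
  finally show ?thesis using d Some by (simp add: inv_mat_def)
qed

lemma inv_mat_inverse:
  assumes "A \<in> carrier_mat n n" "Determinant.det A \<noteq> 0"
  shows "inv_mat A \<in> carrier_mat n n" "A * inv_mat A = 1\<^sub>m n" "inv_mat A * A = 1\<^sub>m n"
proof -
  note adj = adj_mat[OF assms(1)]
  show 1: "inv_mat A \<in> carrier_mat n n" using inv_mat_eq_adj[OF assms(1)] assms adj by simp
  show "A * inv_mat A = 1\<^sub>m n" using inv_mat_eq_adj[OF assms(1)] assms adj
    by (auto simp: mult_smult_distrib[of _ n n _ n] intro!: eq_matI)
  then show "inv_mat A * A = 1\<^sub>m n" by (rule mat_mult_left_right_inverse[OF assms(1) 1])
qed

lemma measurable_det [measurable (raw)]:
  assumes "\<And>i j. i < n \<Longrightarrow> j < n \<Longrightarrow> (\<lambda>z. f z i j) \<in> borel_measurable M"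
  shows "(\<lambda>z. Determinant.det (Matrix.mat n n (\<lambda>(i, j). f z i j)) :: real) \<in> borel_measurable M"
proof -
  have "(\<lambda>z. Determinant.det (Matrix.mat n n (\<lambda>(i, j). f z i j)))
      = (\<lambda>z. \<Sum>\<pi> | \<pi> permutes {0..<n}. signof \<pi> * (\<Prod>i = 0..<n. f z i (\<pi> i)))"
    by (auto simp: Determinant.det_def permutes_in_image intro!: sum.cong prod.cong ext)
  also have "\<dots> \<in> borel_measurable M"
    by (intro borel_measurable_sum borel_measurable_times borel_measurable_prod
        borel_measurable_const assms) (auto simp: permutes_in_image)
  finally show ?thesis .
qed

lemma measurable_quad_form_inv:
  assumes f: "\<And>i j. i < n \<Longrightarrow> j < n \<Longrightarrow> (\<lambda>z. f z i j) \<in> borel_measurable M"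
    and v: "\<And>i. i < n \<Longrightarrow> (\<lambda>z. v z i) \<in> borel_measurable M"
  shows "(\<lambda>z. quad_form (inv_mat (Matrix.mat n n (\<lambda>(i, j). f z i j))) (Matrix.vec n (v z))) \<in> borel_measurable M"
proof -
  define A where "A z = Matrix.mat n n (\<lambda>(i, j). f z i j)" for z
  have A: "A z \<in> carrier_mat n n" for z by (simp add: A_def)
  have d: "(\<lambda>z. Determinant.det (A z)) \<in> borel_measurable M" unfolding A_def by (rule measurable_det[OF f])
  have cof: "(\<lambda>z. cofactor (A z) j i) \<in> borel_measurable M" if "i < n" "j < n" for i j
  proof -
    have "mat_delete (A z) j i = Matrix.mat (n - 1) (n - 1) (\<lambda>(k, l). f z (insert_index j k) (insert_index i l))" for z
      unfolding A_def mat_delete_def using that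
      by (intro eq_matI) (auto simp: insert_index_def)
    moreover have "(\<lambda>z. Determinant.det (Matrix.mat (n - 1) (n - 1)
        (\<lambda>(k, l). f z (insert_index j k) (insert_index i l)))) \<in> borel_measurable M"
      by (rule measurable_det, rule f) (auto simp: insert_index_def)
    ultimately show ?thesis unfolding cofactor_def by simp
  qed
  have "quad_form (inv_mat (A z)) (Matrix.vec n (v z)) = (if Determinant.det (A z) = 0 then 0 else
     (\<Sum>i<n. v z i * (\<Sum>j<n. 1 / Determinant.det (A z) * cofactor (A z) j i * v z j)))" for z
    using A[of z] unfolding inv_mat_eq_adj[OF A]
    by (auto simp: quad_form_def scalar_prod_def adj_mat_def mult_mat_vec_def atLeast0LessThan intro!: sum.cong)
  moreover have "(\<lambda>z. if Determinant.det (A z) = 0 then 0 else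
     (\<Sum>i<n. v z i * (\<Sum>j<n. 1 / Determinant.det (A z) * cofactor (A z) j i * v z j))) \<in> borel_measurable M"
    by (intro measurable_If borel_measurable_sum borel_measurable_times borel_measurable_divide
        measurable_const d cof v) (use d in auto)
  ultimately show ?thesis unfolding A_def by simp
qed

definition gram :: "'r set \<Rightarrow> nat \<Rightarrow> ('r \<times> nat \<Rightarrow> real) \<Rightarrow> real Matrix.mat" where
  "gram R p z = Matrix.mat p p (\<lambda>(j, l). \<Sum>i\<in>R. z (i, j) * z (i, l))"

text \<open>
  Linear independence of the \<open>p\<close> columns of the array, restricted to the rows in \<open>R\<close>.
\<close>

definition col_indep :: "'r set \<Rightarrow> nat \<Rightarrow> ('r \<times> nat \<Rightarrow> real) \<Rightarrow> bool" where
  "col_indep R p z \<longleftrightarrow> (\<forall>c. (\<forall>i\<in>R. (\<Sum>j<p. c j * z (i, j)) = 0) \<longrightarrow> (\<forall>j<p. c j = 0))"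

lemma gram_carrier [simp]: "gram R p z \<in> carrier_mat p p"
  by (simp add: gram_def)

lemma gram_mult_vec:
  assumes "j < p"
  shows "(gram R p z *\<^sub>v Matrix.vec p u) $ j = (\<Sum>i\<in>R. z (i, j) * (\<Sum>l<p. u l * z (i, l)))"
proof -
  have "(gram R p z *\<^sub>v Matrix.vec p u) $ j = (\<Sum>l<p. (\<Sum>i\<in>R. z (i, j) * z (i, l)) * u l)"
    using assms by (simp add: gram_def scalar_prod_def atLeast0LessThan)
  also have "\<dots> = (\<Sum>i\<in>R. z (i, j) * (\<Sum>l<p. u l * z (i, l)))"
    unfolding sum_distrib_right sum_distrib_left
    by (subst sum.swap) (simp add: mult_ac)
  finally show ?thesis .
qed

lemma gram_quadratic:
  fixes z :: "'r \<times> nat \<Rightarrow> real"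
  shows "(\<Sum>j<p. u j * (\<Sum>i\<in>R. z (i, j) * s i)) = (\<Sum>i\<in>R. (\<Sum>j<p. u j * z (i, j)) * s i)"
proof -
  have "(\<Sum>j<p. u j * (\<Sum>i\<in>R. z (i, j) * s i)) = (\<Sum>j<p. \<Sum>i\<in>R. u j * z (i, j) * s i)"
    by (simp add: sum_distrib_left mult.assoc)
  also have "\<dots> = (\<Sum>i\<in>R. \<Sum>j<p. u j * z (i, j) * s i)" by (rule sum.swap)
  finally show ?thesis by (simp add: sum_distrib_right)
qed

lemma det_gram_iff:
  assumes "finite R"
  shows "Determinant.det (gram R p z) \<noteq> 0 \<longleftrightarrow> col_indep R p z"
proof
  assume d: "Determinant.det (gram R p z) \<noteq> 0"
  show "col_indep R p z" unfolding col_indep_def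
  proof (intro allI impI)
    fix c j assume c: "\<forall>i\<in>R. (\<Sum>j<p. c j * z (i, j)) = 0" and j: "j < p"
    have "gram R p z *\<^sub>v Matrix.vec p c = 0\<^sub>v p"
    proof
      fix k assume "k < dim_vec (0\<^sub>v p :: real Matrix.vec)"
      then have k: "k < p" by simp
      show "(gram R p z *\<^sub>v Matrix.vec p c) $ k = 0\<^sub>v p $ k"
        unfolding gram_mult_vec[OF k] using c k by simp
    qed (simp add: gram_def)
    then have "Matrix.vec p c = 0\<^sub>v p"
      using d det_0_iff_vec_prod_zero[OF gram_carrier, of R p z] vec_carrier[of p c] by blast
    then have "Matrix.vec p c $ j = 0\<^sub>v p $ j" by simp
    then show "c j = 0" using j by simp
  qed
next
  assume ci: "col_indep R p z"
  show "Determinant.det (gram R p z) \<noteq> 0"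
  proof
    assume "Determinant.det (gram R p z) = 0"
    then obtain v where v: "v \<in> carrier_vec p" "v \<noteq> 0\<^sub>v p" "gram R p z *\<^sub>v v = 0\<^sub>v p"
      using det_0_iff_vec_prod_zero[OF gram_carrier, of R p z] by blast
    define c where "c j = v $ j" for j
    have vc: "v = Matrix.vec p c" using v(1) by (auto simp: c_def)
    have "(\<Sum>i\<in>R. z (i, j) * (\<Sum>l<p. c l * z (i, l))) = 0" if "j < p" for j
      using gram_mult_vec[OF that, of R z c] v(3) that by (simp add: vc)
    then have "0 = (\<Sum>j<p. c j * (\<Sum>i\<in>R. z (i, j) * (\<Sum>l<p. c l * z (i, l))))" by simp
    also have "\<dots> = (\<Sum>i\<in>R. (\<Sum>j<p. c j * z (i, j)) * (\<Sum>l<p. c l * z (i, l)))"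
      by (rule gram_quadratic)
    finally have "\<forall>i\<in>R. (\<Sum>j<p. c j * z (i, j)) = 0"
      using assms by (simp add: sum_nonneg_eq_0_iff)
    then have "\<forall>j<p. c j = 0" using ci unfolding col_indep_def by blast
    then have "v = 0\<^sub>v p" unfolding vc by (intro eq_vecI) auto
    then show False using v by simp
  qed
qed

definition inv_form :: "'r set \<Rightarrow> nat \<Rightarrow> (nat \<Rightarrow> real) \<Rightarrow> ('r \<times> nat \<Rightarrow> real) \<Rightarrow> real" where
  "inv_form R p w z = quad_form (inv_mat (gram R p z)) (Matrix.vec p w)"

lemma measurable_inv_form [measurable (raw)]:
  assumes "\<And>i j. i \<in> R \<Longrightarrow> j < p \<Longrightarrow> (\<lambda>x. Z x (i, j)) \<in> borel_measurable M"
    "\<And>j. j < p \<Longrightarrow> (\<lambda>x. w x j) \<in> borel_measurable M"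
  shows "(\<lambda>x. inv_form R p (w x) (Z x)) \<in> borel_measurable M"
  unfolding inv_form_def gram_def
  by (rule measurable_quad_form_inv) (auto intro!: borel_measurable_sum borel_measurable_times assms)

text \<open>
  \<open>u\<close> solves the normal equations \<open>(Z' Z) u = w\<close>, so the form \<open>w' (Z' Z)\<^sup>-\<^sup>1 w\<close> can be read off without
  touching the inverse.
\<close>

lemma inv_form_eq:
  assumes "finite R" "col_indep R p z"
    and u: "\<And>j. j < p \<Longrightarrow> (\<Sum>i\<in>R. z (i, j) * (\<Sum>l<p. u l * z (i, l))) = w j"
  shows "inv_form R p w z = (\<Sum>j<p. w j * u j)"
proof -
  note d = det_gram_iff[OF assms(1), THEN iffD2, OF assms(2)]
  note inv = inv_mat_inverse[OF gram_carrier d]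
  have "gram R p z *\<^sub>v Matrix.vec p u = Matrix.vec p w"
    by (intro eq_vecI) (auto simp: gram_mult_vec u simp del: index_mult_mat_vec, simp add: gram_def)
  then have "inv_mat (gram R p z) *\<^sub>v Matrix.vec p w = inv_mat (gram R p z) *\<^sub>v (gram R p z *\<^sub>v Matrix.vec p u)"
    by simp
  also have "\<dots> = (inv_mat (gram R p z) * gram R p z) *\<^sub>v Matrix.vec p u"
    by (rule assoc_mult_mat_vec[symmetric, OF inv(1) gram_carrier]) simp
  also have "\<dots> = Matrix.vec p u" using inv by simp
  finally show ?thesis
    unfolding inv_form_def quad_form_def by (simp add: scalar_prod_def atLeast0LessThan)
qed

lemma inv_form_solution:
  assumes "finite R" "col_indep R p z"
  obtains u where "\<And>j. j < p \<Longrightarrow> (\<Sum>i\<in>R. z (i, j) * (\<Sum>l<p. u l * z (i, l))) = w j"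
proof -
  note d = det_gram_iff[OF assms(1), THEN iffD2, OF assms(2)]
  note inv = inv_mat_inverse[OF gram_carrier d]
  define x where "x = inv_mat (gram R p z) *\<^sub>v Matrix.vec p w"
  have x: "x \<in> carrier_vec p" unfolding x_def using inv by auto
  have "gram R p z *\<^sub>v x = (gram R p z * inv_mat (gram R p z)) *\<^sub>v Matrix.vec p w"
    unfolding x_def by (rule assoc_mult_mat_vec[symmetric, OF gram_carrier inv(1)]) simp
  then have gx: "gram R p z *\<^sub>v x = Matrix.vec p w" using inv by simp
  have xv: "x = Matrix.vec p (\<lambda>j. x $ j)" using x by auto
  have "(\<Sum>i\<in>R. z (i, j) * (\<Sum>l<p. x $ l * z (i, l))) = w j" if "j < p" for j
    using gram_mult_vec[OF that, of R z "\<lambda>j. x $ j"] that unfolding xv[symmetric] gx by simp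
  then show ?thesis using that by blast
qed

text \<open>
  For \<open>w\<close> on the last axis, \<open>t\<^sup>2 / (w' (Z' Z)\<^sup>-\<^sup>1 w)\<close> is a Schur complement: the squared distance of the last
  column from the span of the other \<open>p\<close> columns.  In an orthonormal basis \<open>q\<close> whose members with index in
  \<open>J\<close> are orthogonal to that span, and whose remaining \<open>p\<close> members therefore fill it, the squared distance
  is the sum over \<open>J\<close>.
\<close>

lemma inv_form_last_column:
  fixes z :: "'r \<times> nat \<Rightarrow> real"
  assumes R: "finite R" and J: "J \<subseteq> R" "card J + p = card R"
    and others: "col_indep R p z"
    and q: "orthonormal_on R R q" "\<And>a j. a \<in> J \<Longrightarrow> j < p \<Longrightarrow> ip R (\<lambda>i. z (i, j)) (q a) = 0"
    and pos: "(\<Sum>a\<in>J. (ip R (\<lambda>i. z (i, p)) (q a))\<^sup>2) \<noteq> 0"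
  shows "col_indep R (Suc p) z"
    and "t \<noteq> 0 \<Longrightarrow> t * t / inv_form R (Suc p) (\<lambda>j. if j = p then t else 0) z
       = (\<Sum>a\<in>J. (ip R (\<lambda>i. z (i, p)) (q a))\<^sup>2)"
proof -
  have fJ: "finite J" using J R finite_subset by blast
  define b where "b a = ip R (\<lambda>i. z (i, p)) (q a)" for a
  have comb: "ip R (\<lambda>i. \<Sum>j<Suc p. c j * z (i, j)) (q a) = c p * b a" if "a \<in> J" for c a
    using q(2)[OF that] unfolding ip_sum_left b_def by (simp add: sum.lessThan_Suc)
  show ci: "col_indep R (Suc p) z" unfolding col_indep_def
  proof (intro allI impI)
    fix c j assume c: "\<forall>i\<in>R. (\<Sum>j<Suc p. c j * z (i, j)) = 0" and j: "j < Suc p"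
    have "\<exists>a\<in>J. b a \<noteq> 0"
    proof (rule ccontr)
      assume "\<not> (\<exists>a\<in>J. b a \<noteq> 0)"
      then have "(\<Sum>a\<in>J. (b a)\<^sup>2) = 0" by simp
      then show False using pos by (simp add: b_def)
    qed
    then obtain a where a: "a \<in> J" "b a \<noteq> 0" by blast
    have "ip R (\<lambda>i. \<Sum>j<Suc p. c j * z (i, j)) (q a) = 0" unfolding ip_def using c by simp
    then have cp: "c p = 0" using comb[OF a(1), of c] a by simp
    then have "\<forall>i\<in>R. (\<Sum>j<p. c j * z (i, j)) = 0" using c by simp
    then have "\<forall>j<p. c j = 0" using others unfolding col_indep_def by blast
    then show "c j = 0" using cp j by (cases "j = p") auto
  qed
  show "t * t / inv_form R (Suc p) (\<lambda>j. if j = p then t else 0) z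
       = (\<Sum>a\<in>J. (ip R (\<lambda>i. z (i, p)) (q a))\<^sup>2)" if t: "t \<noteq> 0"
  proof -
    obtain u where u: "\<And>j. j < Suc p \<Longrightarrow> (\<Sum>i\<in>R. z (i, j) * (\<Sum>l<Suc p. u l * z (i, l)))
        = (if j = p then t else 0)"
      using inv_form_solution[OF R ci, of "\<lambda>j. if j = p then t else 0"] by blast
    define r where "r i = (\<Sum>l<Suc p. u l * z (i, l))" for i
    have rz: "ip R (\<lambda>i. z (i, j)) r = (if j = p then t else 0)" if "j < Suc p" for j
      using u[OF that] by (simp add: ip_def r_def)
    have rr: "ip R r r = t * u p"
    proof -
      have "ip R r r = ip R (\<lambda>i. \<Sum>l<Suc p. u l * z (i, l)) r"
        by (rule ip_cong) (simp_all add: r_def)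
      also have "\<dots> = (\<Sum>l<Suc p. u l * (if l = p then t else 0))"
        unfolding ip_sum_left using rz by (intro sum.cong) auto
      finally show ?thesis by (simp add: mult.commute)
    qed
    have rq: "ip R r (q a) = u p * b a" if "a \<in> J" for a
      using comb[OF that, of u] by (simp add: r_def[abs_def])
    define s where "s i = r i - (\<Sum>a\<in>J. ip R r (q a) * q a i)" for i
    have qJ: "orthonormal_on R J q" using q(1) J(1) unfolding orthonormal_on_def by blast
    have sq: "ip R s (q a) = 0" if "a \<in> J" for a
      unfolding s_def ip_diff_left using ip_orthonormal_sum[OF qJ fJ that, of "\<lambda>a. ip R r (q a)"] by simp
    have sz: "ip R (\<lambda>i. z (i, j)) s = 0" if "j < p" for j
      unfolding s_def ip_linear_right using rz[of j] q(2)[OF _ that] that by simp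
    \<comment> \<open>\<open>s\<close> is orthogonal to a basis\<close>
    have s0: "s i = 0" if "i \<in> R" for i
    proof (rule ccontr)
      assume nz: "s i \<noteq> 0"
      define v where "v = case_sum (case_option s (\<lambda>j i. z (i, j))) q"
      let ?E = "insert None (Some ` {..<p}) <+> J"
      have cE: "card ?E = Suc (card R)"
        using J fJ by (simp add: card_Plus card_image)
      then obtain c where c: "\<exists>e\<in>?E. c e \<noteq> 0" "\<forall>i\<in>R. ip ?E (\<lambda>e. v e i) c = 0"
        using homogeneous_system_nontrivial[of R ?E "\<lambda>i e. v e i"] R fJ by auto
      have split: "ip ?E (\<lambda>e. v e i) c = c (Inl None) * s i + (\<Sum>j<p. c (Inl (Some j)) * z (i, j))
          + (\<Sum>a\<in>J. c (Inr a) * q a i)" for i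
        unfolding ip_def using fJ
        by (subst sum.Plus) (auto simp: v_def sum.reindex mult.commute intro!: sum.cong)
      define x where "x i = c (Inl None) * s i + (\<Sum>j<p. c (Inl (Some j)) * z (i, j))
          + (\<Sum>a\<in>J. c (Inr a) * q a i)" for i
      have xz: "x i = 0" if "i \<in> R" for i using c(2) that by (simp only: split x_def)
      have x0: "ip R x y = 0" for y using xz by (simp add: ip_def[of R])
      have xe: "ip R x y = c (Inl None) * ip R s y + (\<Sum>j<p. c (Inl (Some j)) * ip R (\<lambda>i. z (i, j)) y)
          + (\<Sum>a\<in>J. c (Inr a) * ip R (q a) y)" for y
        unfolding x_def ip_linear_left ..
      have sq': "ip R (q a) s = 0" if "a \<in> J" for a using sq[OF that] by (simp add: ip_commute[of R "q a"])
      have "c (Inl None) * ip R s s = 0"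
        using x0[of s] sz sq' unfolding xe by simp
      moreover have "ip R s s \<noteq> 0" using nz that ip_self_eq_0_iff[OF R, of s] by auto
      ultimately have c1: "c (Inl None) = 0" by simp
      have c2: "c (Inr a) = 0" if "a \<in> J" for a
        using x0[of "q a"] unfolding xe
        using c1 q(2)[OF that] ip_orthonormal_sum[OF qJ fJ that, of "\<lambda>a. c (Inr a)"]
        unfolding ip_sum_left by simp
      have "x = (\<lambda>i. \<Sum>j<p. c (Inl (Some j)) * z (i, j))"
        unfolding x_def using c1 c2 by auto
      then have "\<forall>i\<in>R. (\<Sum>j<p. c (Inl (Some j)) * z (i, j)) = 0" using xz by simp
      then have "\<forall>j<p. c (Inl (Some j)) = 0"
        using others[unfolded col_indep_def, rule_format, of "\<lambda>j. c (Inl (Some j))"] by blast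
      then show False using c(1) c1 c2 by auto
    qed
    have "ip R r r = ip R (\<lambda>i. \<Sum>a\<in>J. ip R r (q a) * q a i) r"
      using s0 by (intro ip_cong) (simp_all add: s_def)
    also have "\<dots> = (u p)\<^sup>2 * (\<Sum>a\<in>J. (b a)\<^sup>2)"
      unfolding ip_sum_left sum_distrib_left ip_commute[of R "q _" r]
      by (intro sum.cong refl) (simp only: rq power2_eq_square mult_ac)
    finally have e: "t * u p = (u p)\<^sup>2 * (\<Sum>a\<in>J. (b a)\<^sup>2)" using rr by simp
    have up: "u p \<noteq> 0"
    proof
      assume "u p = 0"
      then have "ip R r r = 0" using rr by simp
      then have "\<forall>i\<in>R. r i = 0" using ip_self_eq_0_iff[OF R] by blast
      then have "ip R (\<lambda>i. z (i, p)) r = 0" by (simp add: ip_def)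
      then show False using rz[of p] t by simp
    qed
    have "inv_form R (Suc p) (\<lambda>j. if j = p then t else 0) z = t * u p"
      using inv_form_eq[OF R ci, of u "\<lambda>j. if j = p then t else 0"] u by (simp add: sum.lessThan_Suc)
    then show ?thesis using e up t unfolding b_def[symmetric] by (simp add: power2_eq_square field_simps)
  qed
qed

section \<open>The law of an inverse Wishart quadratic form\<close>

lemma measurable_gauss_iff: "f \<in> gauss I \<rightarrow>\<^sub>M N \<longleftrightarrow> f \<in> Pi\<^sub>M I (\<lambda>_. borel) \<rightarrow>\<^sub>M N"
  using measurable_cong_sets[OF sets_gauss refl, of I N] by blast

lemma lin_map_measurable_gauss: "lin_map I A \<in> gauss I \<rightarrow>\<^sub>M gauss I"
  using measurable_lin_map measurable_cong_sets[OF sets_gauss sets_gauss] by blast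

lemma AE_gauss_merge:
  assumes "finite A" "finite B" "A \<inter> B = {}"
    and P: "Measurable.pred (Pi\<^sub>M (A \<union> B) (\<lambda>_. borel)) P"
    and ae: "AE x in gauss A. AE y in gauss B. P (merge A B (x, y))"
  shows "AE z in gauss (A \<union> B). P z"
proof -
  interpret A: prob_space "gauss A" by (rule prob_space_gauss)
  interpret B: prob_space "gauss B" by (rule prob_space_gauss)
  interpret AB: pair_sigma_finite "gauss A" "gauss B" ..
  have P': "{z \<in> space (gauss (A \<union> B)). P z} \<in> sets (gauss (A \<union> B))"
    using P measurable_gauss_iff[of P "A \<union> B" "count_space UNIV"] by (simp add: pred_def)
  have m: "merge A B \<in> gauss A \<Otimes>\<^sub>M gauss B \<rightarrow>\<^sub>M gauss (A \<union> B)" by (rule measurable_merge)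
  have "{xy \<in> space (gauss A \<Otimes>\<^sub>M gauss B). P (merge A B xy)}
      = merge A B -` {z \<in> space (gauss (A \<union> B)). P z} \<inter> space (gauss A \<Otimes>\<^sub>M gauss B)"
    using measurable_space[OF m] by blast
  with measurable_sets[OF m P']
  have "{xy \<in> space (gauss A \<Otimes>\<^sub>M gauss B). P (merge A B xy)} \<in> sets (gauss A \<Otimes>\<^sub>M gauss B)"
    by (simp only:)
  then have "AE xy in gauss A \<Otimes>\<^sub>M gauss B. P (merge A B xy)"
    using ae by (rule AB.AE_pair_measure)
  then have "AE z in distr (gauss A \<Otimes>\<^sub>M gauss B) (gauss (A \<union> B)) (merge A B). P z"
    by (subst AE_distr_iff[OF m P'])
  then show ?thesis unfolding gs.distr_merge[OF assms(3,1,2)] .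
qed

lemma AE_gauss_neq: "i \<in> I \<Longrightarrow> AE z in gauss I. z i \<noteq> c"
proof (rule AE_PiM_component[where P="\<lambda>x. x \<noteq> c"])
  show "AE x in std_normal_distribution. x \<noteq> c"
    using AE_lborel_singleton[of c] by (subst AE_density) (auto elim: eventually_mono)
qed (auto intro: prob_space_std_normal)

lemma AE_gauss_sum_squares:
  assumes "a \<in> J" "finite J" "g a \<in> I"
  shows "AE z in gauss I. (\<Sum>j\<in>J. (z (g j))\<^sup>2) \<noteq> 0"
  using AE_gauss_neq[OF assms(3), of 0]
  by eventually_elim (use assms in \<open>auto simp: sum_nonneg_eq_0_iff\<close>)

lemma nn_integral_gauss_orthogonal:
  assumes "finite I" "orthonormal_on I I q" "F \<in> borel_measurable (Pi\<^sub>M I (\<lambda>_. borel))"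
  shows "(\<integral>\<^sup>+z. F (lin_map I q z) \<partial>gauss I) = (\<integral>\<^sup>+z. F z \<partial>gauss I)"
proof -
  have "F \<in> borel_measurable (distr (gauss I) (gauss I) (lin_map I q))"
    unfolding measurable_distr_eq1 measurable_gauss_iff by (rule assms(3))
  from nn_integral_distr[OF lin_map_measurable_gauss this]
  show ?thesis unfolding gauss_orthogonal[OF assms(1,2)] by (rule sym)
qed

lemma AE_gauss_orthogonal:
  assumes "finite I" "orthonormal_on I I q" "Measurable.pred (Pi\<^sub>M I (\<lambda>_. borel)) P"
    "AE z in gauss I. P z"
  shows "AE z in gauss I. P (lin_map I q z)"
proof -
  have "{z \<in> space (gauss I). P z} \<in> sets (gauss I)"
    using assms(3) measurable_gauss_iff[of P I "count_space UNIV"] by (simp add: pred_def)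
  moreover have "AE z in distr (gauss I) (gauss I) (lin_map I q). P z"
    unfolding gauss_orthogonal[OF assms(1,2)] by (rule assms(4))
  ultimately show ?thesis by (subst (asm) AE_distr_iff[OF lin_map_measurable_gauss])
qed

lemma col_indep_cong:
  assumes "\<And>i j. i \<in> R \<Longrightarrow> j < p \<Longrightarrow> z (i, j) = z' (i, j)"
  shows "col_indep R p z = col_indep R p z'"
  using assms by (simp add: col_indep_def)

lemma pred_col_indep [measurable]:
  assumes "finite R" "R \<times> {..<p} \<subseteq> I"
  shows "Measurable.pred (Pi\<^sub>M I (\<lambda>_. borel)) (col_indep R p)"
proof -
  have "(\<lambda>z. Determinant.det (gram R p z)) \<in> borel_measurable (Pi\<^sub>M I (\<lambda>_. borel))"
    unfolding gram_def using assms(2)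
    by (intro measurable_det borel_measurable_sum borel_measurable_times measurable_component_singleton) auto
  then have "Measurable.pred (Pi\<^sub>M I (\<lambda>_. borel)) (\<lambda>z. Determinant.det (gram R p z) \<noteq> 0)" by measurable
  then show ?thesis unfolding det_gram_iff[OF assms(1)] .
qed

text \<open>
  The first \<open>p\<close> columns are held fixed, with an orthonormal basis adapted to their span.  By rotation
  invariance the last column has independent standard normal coordinates in that basis, whatever the
  first columns are, so the Schur complement is a sum of \<open>card J\<close> squares of such variables.
\<close>

lemma last_column_conditional:
  fixes R :: "'r set" and x :: "'r \<times> nat \<Rightarrow> real"
  assumes R: "finite R" and J: "J \<subseteq> R" "card J + p = card R" "J \<noteq> {}"
    and x: "col_indep R p x"
  shows "AE y in gauss (R \<times> {p}). col_indep R (Suc p) (merge (R \<times> {..<p}) (R \<times> {p}) (x, y))"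
    and "t \<noteq> 0 \<Longrightarrow> F \<in> borel_measurable borel \<Longrightarrow>
      (\<integral>\<^sup>+y. F (t * t / inv_form R (Suc p) (\<lambda>j. if j = p then t else 0)
         (merge (R \<times> {..<p}) (R \<times> {p}) (x, y))) \<partial>gauss (R \<times> {p}))
      = (\<integral>\<^sup>+y. F (\<Sum>a\<in>J. (merge (R \<times> {..<p}) (R \<times> {p}) (x, y) (a, p))\<^sup>2) \<partial>gauss (R \<times> {p}))"
proof -
  let ?B = "R \<times> {p}" and ?M = "\<lambda>y. merge (R \<times> {..<p}) (R \<times> {p}) (x, y)"
  have fJ: "finite J" using J R finite_subset by blast
  obtain q1 where q1: "orthonormal_on R J q1" "\<forall>a\<in>J. \<forall>j\<in>{..<p}. ip R (\<lambda>i. x (i, j)) (q1 a) = 0"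
    using extend_orthonormal[OF R, of "{..<p}" J "{}" undefined "\<lambda>j i. x (i, j)"] J fJ
    by (auto simp: orthonormal_on_def)
  obtain q where q: "orthonormal_on R R q" "\<forall>a\<in>J. q a = q1 a"
    using extend_orthonormal[OF R, of "{}" R J q1 "\<lambda>j i. 0"] J q1 R by auto
  define Q where "Q e e' = q (fst e) (fst e')" for e e' :: "'r \<times> nat"
  have Bim: "?B = (\<lambda>i. (i, p)) ` R" by auto
  have ipB: "ip ?B f g = ip R (\<lambda>i. f (i, p)) (\<lambda>i. g (i, p))" for f g
    unfolding ip_def Bim by (subst sum.reindex) (auto simp: inj_on_def)
  have Q: "orthonormal_on ?B ?B Q"
    using q(1) unfolding orthonormal_on_def ipB Q_def by auto
  have fB: "finite ?B" using R by auto
  have M1: "?M y (i, j) = x (i, j)" if "i \<in> R" "j < p" for y i j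
    using that by (auto simp: merge_def)
  have M2: "?M y (i, p) = y (i, p)" if "i \<in> R" for y i
    using that by (auto simp: merge_def)
  have others: "col_indep R p (?M y)" for y
    using x col_indep_cong[of R p "?M y" x] M1 by simp
  have orth: "ip R (\<lambda>i. ?M y (i, j)) (q a) = 0" if "a \<in> J" "j < p" for y a j
    using q1(2) q(2) that M1 by (simp add: ip_def)
  have lin: "ip R (\<lambda>i. ?M y (i, p)) (q a) = lin_map ?B Q y (a, p)" if "a \<in> J" for y a
  proof -
    have "lin_map ?B Q y (a, p) = ip R (q a) (\<lambda>i. y (i, p))"
      using that J(1) by (auto simp: lin_map_def ipB Q_def)
    also have "\<dots> = ip R (\<lambda>i. y (i, p)) (q a)" by (rule ip_commute)
    finally show ?thesis using M2 by (simp add: ip_def)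
  qed
  obtain a where a: "a \<in> J" using J by auto
  have ae: "AE y in gauss ?B. (\<Sum>a\<in>J. (lin_map ?B Q y (a, p))\<^sup>2) \<noteq> 0"
  proof (rule AE_gauss_orthogonal[OF fB Q])
    show "AE y in gauss ?B. (\<Sum>a\<in>J. (y (a, p))\<^sup>2) \<noteq> 0"
      by (rule AE_gauss_sum_squares[OF a fJ]) (use a J in auto)
    have [measurable]: "(\<lambda>y. y (a, p)) \<in> borel_measurable (Pi\<^sub>M ?B (\<lambda>_. borel))" if "a \<in> J" for a
      using that J by (intro measurable_component_singleton) auto
    show "Measurable.pred (Pi\<^sub>M ?B (\<lambda>_. borel)) (\<lambda>y. (\<Sum>a\<in>J. (y (a, p))\<^sup>2) \<noteq> (0::real))" by measurable
  qed
  have sums: "(\<Sum>a\<in>J. (ip R (\<lambda>i. ?M y (i, p)) (q a))\<^sup>2) = (\<Sum>a\<in>J. (lin_map ?B Q y (a, p))\<^sup>2)" for y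
    by (intro sum.cong refl) (simp only: lin)
  show "AE y in gauss ?B. col_indep R (Suc p) (?M y)"
    using ae by eventually_elim (rule inv_form_last_column(1)[OF R J(1,2) others q(1) orth], simp_all only: sums, simp)
  assume t: "t \<noteq> 0" and F: "F \<in> borel_measurable borel"
  have "(\<integral>\<^sup>+y. F (t * t / inv_form R (Suc p) (\<lambda>j. if j = p then t else 0) (?M y)) \<partial>gauss ?B)
      = (\<integral>\<^sup>+y. F (\<Sum>a\<in>J. (lin_map ?B Q y (a, p))\<^sup>2) \<partial>gauss ?B)"
  proof (rule nn_integral_cong_AE)
    show "AE y in gauss ?B. F (t * t / inv_form R (Suc p) (\<lambda>j. if j = p then t else 0) (?M y))
        = F (\<Sum>a\<in>J. (lin_map ?B Q y (a, p))\<^sup>2)"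
      using ae
    proof eventually_elim
      case (elim y)
      then show ?case using inv_form_last_column(2)[OF R J(1,2) others q(1) orth _ t, of y] sums by simp
    qed
  qed
  also have "\<dots> = (\<integral>\<^sup>+y. F (\<Sum>a\<in>J. (y (a, p))\<^sup>2) \<partial>gauss ?B)"
  proof (rule nn_integral_gauss_orthogonal[OF fB Q])
    have [measurable]: "(\<lambda>y. y (a, p)) \<in> borel_measurable (Pi\<^sub>M ?B (\<lambda>_. borel))" if "a \<in> J" for a
      using that J by (intro measurable_component_singleton) auto
    note F[measurable]
    show "(\<lambda>y. F (\<Sum>a\<in>J. (y (a, p))\<^sup>2)) \<in> borel_measurable (Pi\<^sub>M ?B (\<lambda>_. borel))" by measurable
  qed
  also have "\<dots> = (\<integral>\<^sup>+y. F (\<Sum>a\<in>J. (?M y (a, p))\<^sup>2) \<partial>gauss ?B)"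
  proof -
    have "(\<Sum>a\<in>J. (y (a, p))\<^sup>2) = (\<Sum>a\<in>J. (?M y (a, p))\<^sup>2)" for y
      by (intro sum.cong refl) (use M2 J(1) in auto)
    then show ?thesis by simp
  qed
  finally show "(\<integral>\<^sup>+y. F (t * t / inv_form R (Suc p) (\<lambda>j. if j = p then t else 0) (?M y)) \<partial>gauss ?B)
      = (\<integral>\<^sup>+y. F (\<Sum>a\<in>J. (?M y (a, p))\<^sup>2) \<partial>gauss ?B)" .
qed

text \<open>
  Add the columns one by one: given the earlier columns, the new column almost surely has a nonzero
  component orthogonal to them, because its coordinates in an orthonormal basis are again standard normal.
\<close>

lemma AE_col_indep:
  assumes "finite R" "p \<le> card R"
  shows "AE z in gauss (R \<times> {..<p}). col_indep R p z"
  using assms(2)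
proof (induction p)
  case 0 then show ?case by (simp add: col_indep_def)
next
  case (Suc p)
  obtain J where J: "J \<subseteq> R" "card J = card R - p"
    by (rule obtain_subset_with_card_n[of "card R - p" R]) auto
  have J': "card J + p = card R" "J \<noteq> {}" using J Suc.prems by auto
  have un: "R \<times> {..<p} \<union> R \<times> {p} = R \<times> {..<Suc p}" by auto
  have "AE x in gauss (R \<times> {..<p}). AE y in gauss (R \<times> {p}).
      col_indep R (Suc p) (merge (R \<times> {..<p}) (R \<times> {p}) (x, y))"
    using Suc.IH[OF Suc_leD[OF Suc.prems]]
    by eventually_elim (rule last_column_conditional(1)[OF assms(1) J(1) J'])
  then show ?case
    using AE_gauss_merge[of "R \<times> {..<p}" "R \<times> {p}" "col_indep R (Suc p)"] assms(1)
      pred_col_indep[OF assms(1), of "Suc p" "R \<times> {..<Suc p}"] unfolding un by fastforce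
qed

lemma law_inv_form_axis:
  assumes R: "finite R" and J: "J \<subseteq> R" "card J + p = card R" "J \<noteq> {}"
    and t: "t \<noteq> 0" and F: "F \<in> borel_measurable borel"
  shows "(\<integral>\<^sup>+z. F (t * t / inv_form R (Suc p) (\<lambda>j. if j = p then t else 0) z) \<partial>gauss (R \<times> {..<Suc p}))
      = (\<integral>\<^sup>+z. F (\<Sum>a\<in>J. (z (a, p))\<^sup>2) \<partial>gauss (R \<times> {..<Suc p}))"
proof -
  let ?A = "R \<times> {..<p}" and ?B = "R \<times> {p}"
  have un: "?A \<union> ?B = R \<times> {..<Suc p}" by auto
  have disj: "?A \<inter> ?B = {}" and fin: "finite ?A" "finite ?B" using R by auto
  have fold: "(\<integral>\<^sup>+z. g z \<partial>gauss (R \<times> {..<Suc p})) = (\<integral>\<^sup>+x. \<integral>\<^sup>+y. g (merge ?A ?B (x, y)) \<partial>gauss ?B \<partial>gauss ?A)"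
    if "g \<in> borel_measurable (Pi\<^sub>M (R \<times> {..<Suc p}) (\<lambda>_. borel))" for g
    using gs.product_nn_integral_fold[OF disj fin, of g] that unfolding un measurable_gauss_iff by blast
  have "J \<times> {p} \<subseteq> R \<times> {..<Suc p}" using J by auto
  have comp: "(\<lambda>y. y (a, j)) \<in> borel_measurable (Pi\<^sub>M (R \<times> {..<Suc p}) (\<lambda>_. borel))" if "a \<in> R" "j < Suc p" for a j
      using that by (intro measurable_component_singleton) auto
  note F[measurable]
  have m1: "(\<lambda>z. F (t * t / inv_form R (Suc p) (\<lambda>j. if j = p then t else 0) z)) \<in> borel_measurable (Pi\<^sub>M (R \<times> {..<Suc p}) (\<lambda>_. borel))"
    by (intro measurable_compose[OF _ F] borel_measurable_divide borel_measurable_const measurable_inv_form comp)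
  have [measurable]: "(\<lambda>y. y (a, p)) \<in> borel_measurable (Pi\<^sub>M (R \<times> {..<Suc p}) (\<lambda>_. borel))" if "a \<in> J" for a
    using comp that J by auto
  have m2: "(\<lambda>z. F (\<Sum>a\<in>J. (z (a, p))\<^sup>2)) \<in> borel_measurable (Pi\<^sub>M (R \<times> {..<Suc p}) (\<lambda>_. borel))" by measurable
  show ?thesis unfolding fold[OF m1] fold[OF m2]
    by (rule nn_integral_cong_AE, rule AE_mp[OF AE_col_indep[OF R, of p] AE_I2])
       (use J last_column_conditional(2)[OF R J _ t F] in auto)
qed

text \<open>
  \<open>row_action\<close> applies \<open>P\<close> to every row of an array, \<open>col_action\<close> applies \<open>Q\<close> to every column; both are
  matrices on the index set of the whole array, so that \<open>gauss_orthogonal\<close> covers them.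
\<close>

definition row_action :: "('c \<Rightarrow> 'c \<Rightarrow> real) \<Rightarrow> 'r \<times> 'c \<Rightarrow> 'r \<times> 'c \<Rightarrow> real" where
  "row_action P e e' = (if fst e = fst e' then P (snd e) (snd e') else 0)"

definition col_action :: "('r \<Rightarrow> 'r \<Rightarrow> real) \<Rightarrow> 'r \<times> 'c \<Rightarrow> 'r \<times> 'c \<Rightarrow> real" where
  "col_action Q e e' = (if snd e = snd e' then Q (fst e) (fst e') else 0)"

lemma ip_row_action:
  assumes "finite R" "finite C" "a \<in> R"
  shows "ip (R \<times> C) (row_action P (a, j)) z = ip C (P j) (\<lambda>l. z (a, l))"
proof -
  have "ip (R \<times> C) (row_action P (a, j)) z = (\<Sum>i\<in>R. \<Sum>l\<in>C. (if i = a then P j l * z (a, l) else 0))"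
    unfolding ip_def row_action_def by (subst sum.cartesian_product) (auto intro!: sum.cong)
  also have "\<dots> = (\<Sum>l\<in>C. P j l * z (a, l))"
    by (subst sum.swap) (use assms in simp)
  finally show ?thesis by (simp add: ip_def)
qed

lemma ip_col_action:
  assumes "finite R" "finite C" "j \<in> C"
  shows "ip (R \<times> C) (col_action Q (a, j)) z = ip R (Q a) (\<lambda>i. z (i, j))"
proof -
  have "ip (R \<times> C) (col_action Q (a, j)) z = (\<Sum>i\<in>R. \<Sum>l\<in>C. (if l = j then Q a i * z (i, j) else 0))"
    unfolding ip_def col_action_def by (subst sum.cartesian_product) (auto intro!: sum.cong)
  also have "\<dots> = (\<Sum>i\<in>R. Q a i * z (i, j))" using assms by simp
  finally show ?thesis by (simp add: ip_def)
qed

lemma orthonormal_row_action: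
  fixes R :: "'r set" and C :: "'c set"
  assumes "finite R" "finite C" "orthonormal_on C C P"
  shows "orthonormal_on (R \<times> C) (R \<times> C) (row_action P)"
proof -
  have "ip C (P j) (\<lambda>l. row_action P (b, k) (a, l)) = (if (a, j) = (b, k) then 1 else 0)"
    if "j \<in> C" "k \<in> C" for a b :: 'r and j k
  proof (cases "a = b")
    case True then show ?thesis using assms(3) that by (simp add: row_action_def orthonormal_on_def)
  next
    case False then show ?thesis by (simp add: row_action_def ip_def)
  qed
  then show ?thesis unfolding orthonormal_on_def by (auto simp: ip_row_action[OF assms(1,2)])
qed

lemma orthonormal_col_action:
  fixes R :: "'r set" and C :: "'c set"
  assumes "finite R" "finite C" "orthonormal_on R R Q"
  shows "orthonormal_on (R \<times> C) (R \<times> C) (col_action Q)"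
proof -
  have "ip R (Q a) (\<lambda>i. col_action Q (b, k) (i, j)) = (if (a, j) = (b, k) then 1 else 0)"
    if "a \<in> R" "b \<in> R" for a b and j k :: 'c
  proof (cases "j = k")
    case True then show ?thesis using assms(3) that by (simp add: col_action_def orthonormal_on_def)
  next
    case False then show ?thesis by (simp add: col_action_def ip_def)
  qed
  then show ?thesis unfolding orthonormal_on_def by (auto simp: ip_col_action[OF assms(1,2)])
qed

text \<open>
  Rotating the columns of the array and the vector together preserves \<open>w' (Z' Z)\<^sup>-\<^sup>1 w\<close>.
\<close>

lemma inv_form_rotate:
  assumes R: "finite R" and P: "orthonormal_on {..<n} {..<n} P" and ci: "col_indep R n z"
    and z': "\<And>a j. a \<in> R \<Longrightarrow> j < n \<Longrightarrow> z' (a, j) = ip {..<n} (P j) (\<lambda>l. z (a, l))"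
    and w': "\<And>j. j < n \<Longrightarrow> w' j = ip {..<n} (P j) w"
  shows "inv_form R n w z = inv_form R n w' z'"
proof -
  let ?C = "{..<n}"
  note pars = orthonormal_parseval[OF finite_lessThan P]
  obtain u where u: "\<And>j. j < n \<Longrightarrow> (\<Sum>i\<in>R. z (i, j) * (\<Sum>l<n. u l * z (i, l))) = w j"
    using inv_form_solution[OF R ci, of w] by blast
  define u' where "u' j = ip ?C u (P j)" for j
  have row: "(\<Sum>l<n. u' l * z' (i, l)) = (\<Sum>l<n. u l * z (i, l))" if "i \<in> R" for i
  proof -
    have "(\<Sum>l<n. u' l * z' (i, l)) = (\<Sum>l<n. ip ?C u (P l) * ip ?C (\<lambda>l. z (i, l)) (P l))"
      using that by (intro sum.cong refl) (simp add: u'_def z' ip_commute[of _ "P _"])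
    also have "\<dots> = ip ?C u (\<lambda>l. z (i, l))" by (rule pars)
    finally show ?thesis by (simp add: ip_def)
  qed
  have ci': "col_indep R n z'" unfolding col_indep_def
  proof (intro allI impI)
    fix c j assume c: "\<forall>i\<in>R. (\<Sum>j<n. c j * z' (i, j)) = 0" and j: "j < n"
    define d where "d l = (\<Sum>j<n. c j * P j l)" for l
    have "(\<Sum>l<n. d l * z (i, l)) = 0" if "i \<in> R" for i
    proof -
      have "(\<Sum>l<n. d l * z (i, l)) = ip ?C (\<lambda>l. \<Sum>j<n. c j * P j l) (\<lambda>l. z (i, l))"
        by (simp add: ip_def d_def)
      also have "\<dots> = (\<Sum>j<n. c j * z' (i, j))" unfolding ip_sum_left using z' that by simp
      finally show ?thesis using c that by simp
    qed
    then have "\<forall>l<n. d l = 0" using ci unfolding col_indep_def by blast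
    then have "ip ?C d (P j) = 0" by (simp add: ip_def)
    moreover have "ip ?C d (P j) = c j" unfolding d_def using ip_orthonormal_sum[OF P, of j c] j by simp
    ultimately show "c j = 0" by simp
  qed
  have sol: "(\<Sum>i\<in>R. z' (i, j) * (\<Sum>l<n. u' l * z' (i, l))) = w' j" if "j < n" for j
  proof -
    have "(\<Sum>i\<in>R. z' (i, j) * (\<Sum>l<n. u' l * z' (i, l)))
        = (\<Sum>i\<in>R. (\<Sum>k<n. P j k * z (i, k)) * (\<Sum>l<n. u l * z (i, l)))"
      using that by (intro sum.cong refl) (use that in \<open>simp only: row, simp add: z' ip_def\<close>)
    also have "\<dots> = (\<Sum>k<n. P j k * (\<Sum>i\<in>R. z (i, k) * (\<Sum>l<n. u l * z (i, l))))"
      by (rule gram_quadratic[symmetric])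
    also have "\<dots> = w' j" using u w' that by (simp add: ip_def)
    finally show ?thesis .
  qed
  have "inv_form R n w z = ip ?C w u" using inv_form_eq[OF R ci u] by (simp add: ip_def)
  also have "\<dots> = (\<Sum>j<n. ip ?C w (P j) * ip ?C u (P j))" by (rule pars[symmetric])
  also have "\<dots> = (\<Sum>j<n. w' j * u' j)"
    by (intro sum.cong refl) (simp add: w' u'_def ip_commute[of _ "P _"])
  also have "\<dots> = inv_form R n w' z'" by (rule inv_form_eq[symmetric, OF R ci' sol])
  finally show ?thesis .
qed

text \<open>
  Rotate the columns so that \<open>w\<close> lies on the last axis.  The law on the right does not involve \<open>w\<close>; this
  is what makes the ratio independent of the vector when the vector is random.
\<close>

lemma law_inv_form:
  assumes R: "finite R" and J: "J \<subseteq> R" "card J + p = card R" "J \<noteq> {}"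
    and w: "ip {..<Suc p} w w \<noteq> 0" and F: "F \<in> borel_measurable borel"
  shows "(\<integral>\<^sup>+z. F (ip {..<Suc p} w w / inv_form R (Suc p) w z) \<partial>gauss (R \<times> {..<Suc p}))
      = (\<integral>\<^sup>+z. F (\<Sum>a\<in>J. (z (a, p))\<^sup>2) \<partial>gauss (R \<times> {..<Suc p}))"
proof -
  let ?C = "{..<Suc p}" and ?I = "R \<times> {..<Suc p}"
  define t where "t = sqrt (ip ?C w w)"
  have tt: "t * t = ip ?C w w" and t0: "t \<noteq> 0"
    using ip_self_nonneg[of ?C w] w by (simp_all add: t_def)
  define v where "v l = (1 / t) * w l" for l
  have "ip ?C v v = 1" unfolding v_def ip_linear_left ip_linear_right tt[symmetric] using t0 by simp
  then have "orthonormal_on ?C {p} (\<lambda>_. v)" by (simp add: orthonormal_on_def)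
  then obtain P where P: "orthonormal_on ?C ?C P" "P p = v"
    using extend_orthonormal[of ?C "{}" ?C "{p}" "\<lambda>_. v" "\<lambda>j i. 0"] by auto
  have Pw: "ip ?C (P j) w = (if j = p then t else 0)" if "j < Suc p" for j
  proof -
    have "w l = t * P p l" for l using t0 by (simp add: P v_def)
    then have "ip ?C (P j) w = ip ?C (P j) (\<lambda>l. t * P p l)" by (simp add: ip_def)
    also have "\<dots> = t * ip ?C (P j) (P p)" by (rule ip_linear_right)
    also have "\<dots> = (if j = p then t else 0)" using P(1) that by (simp add: orthonormal_on_def)
    finally show ?thesis .
  qed
  let ?Q = "row_action P :: _ \<times> nat \<Rightarrow> _"
  have fI: "finite ?I" using R by auto
  have Q: "orthonormal_on ?I ?I ?Q" by (rule orthonormal_row_action[OF R _ P(1)]) simp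
  have rot: "inv_form R (Suc p) w z = inv_form R (Suc p) (\<lambda>j. if j = p then t else 0) (lin_map ?I ?Q z)"
    if "col_indep R (Suc p) z" for z
    by (rule inv_form_rotate[OF R P(1) that])
       (simp_all add: lin_map_def ip_row_action[OF R finite_lessThan] Pw)
  have le: "Suc p \<le> card R"
  proof -
    have "card J > 0" using J R finite_subset by (metis card_gt_0_iff)
    then show ?thesis using J by simp
  qed
  have comp: "(\<lambda>y. y (a, j)) \<in> borel_measurable (Pi\<^sub>M ?I (\<lambda>_. borel))" if "a \<in> R" "j < Suc p" for a j
    using that by (intro measurable_component_singleton) auto
  have m1: "(\<lambda>z. F (t * t / inv_form R (Suc p) (\<lambda>j. if j = p then t else 0) z)) \<in> borel_measurable (Pi\<^sub>M ?I (\<lambda>_. borel))"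
    by (intro measurable_compose[OF _ F] borel_measurable_divide borel_measurable_const measurable_inv_form comp)
  have "(\<integral>\<^sup>+z. F (ip ?C w w / inv_form R (Suc p) w z) \<partial>gauss ?I)
      = (\<integral>\<^sup>+z. F (t * t / inv_form R (Suc p) (\<lambda>j. if j = p then t else 0) (lin_map ?I ?Q z)) \<partial>gauss ?I)"
    unfolding tt
    by (rule nn_integral_cong_AE, rule AE_mp[OF AE_col_indep[OF R le] AE_I2]) (simp add: rot)
  also have "\<dots> = (\<integral>\<^sup>+z. F (t * t / inv_form R (Suc p) (\<lambda>j. if j = p then t else 0) z) \<partial>gauss ?I)"
    by (rule nn_integral_gauss_orthogonal[OF fI Q m1])
  also have "\<dots> = (\<integral>\<^sup>+z. F (\<Sum>a\<in>J. (z (a, p))\<^sup>2) \<partial>gauss ?I)"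
    by (rule law_inv_form_axis[OF R J t0 F])
  finally show ?thesis .
qed

section \<open>Hotelling's ratio and the first row\<close>

lemma inv_form_cong:
  assumes "\<And>i j. i \<in> R \<Longrightarrow> j < p \<Longrightarrow> z (i, j) = z' (i, j)" "\<And>j. j < p \<Longrightarrow> w j = w' j"
  shows "inv_form R p w z = inv_form R p w' z'"
proof -
  have "gram R p z = gram R p z'" unfolding gram_def using assms(1) by (intro eq_matI) auto
  moreover have "Matrix.vec p w = Matrix.vec p w'" using assms(2) by (intro eq_vecI) auto
  ultimately show ?thesis by (simp add: inv_form_def)
qed

definition first_row :: "nat \<Rightarrow> (nat \<times> nat \<Rightarrow> real) \<Rightarrow> nat \<Rightarrow> real" where
  "first_row p z = (\<lambda>j\<in>{..<p}. z (0, j))"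

definition shifted_row :: "(nat \<Rightarrow> real) \<Rightarrow> (nat \<times> nat \<Rightarrow> real) \<Rightarrow> nat \<Rightarrow> real" where
  "shifted_row m z j = z (0, j) + m j"

text \<open>
  A \<open>\<chi>\<^sup>2\<close> variable with \<open>N - p\<close> degrees of freedom that uses no entry of row \<open>0\<close>: it serves as the independent
  partner of the first row in the law of \<open>(first_row, hot_ratio)\<close>.
\<close>

definition chi_part :: "nat \<Rightarrow> nat \<Rightarrow> (nat \<times> nat \<Rightarrow> real) \<Rightarrow> real" where
  "chi_part N p z = (\<Sum>a\<in>{p..<N}. (z (a, p - 1))\<^sup>2)"

text \<open>
  The variable \<open>V\<close> with \<open>T\<^sup>2 / n = |w|\<^sup>2 / V\<close>, where \<open>w = shifted_row m z\<close>.
\<close>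

definition hot_ratio :: "nat \<Rightarrow> nat \<Rightarrow> (nat \<Rightarrow> real) \<Rightarrow> (nat \<times> nat \<Rightarrow> real) \<Rightarrow> real" where
  "hot_ratio N p m z = ip {..<p} (shifted_row m z) (shifted_row m z)
     / inv_form {1..<N} p (shifted_row m z) z"

abbreviation grid :: "nat \<Rightarrow> nat \<Rightarrow> (nat \<times> nat) set" where
  "grid N p \<equiv> {..<N} \<times> {..<p}"

lemma measurable_hot_ratio:
  assumes "0 < N"
  shows "hot_ratio N p m \<in> borel_measurable (Pi\<^sub>M (grid N p) (\<lambda>_. borel))"
proof -
  have comp: "(\<lambda>y. y (a, j)) \<in> borel_measurable (Pi\<^sub>M (grid N p) (\<lambda>_. borel))" if "a < N" "j < p" for a j
    using that by (intro measurable_component_singleton) auto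
  show ?thesis unfolding hot_ratio_def[abs_def] ip_def shifted_row_def
    by (intro borel_measurable_divide borel_measurable_sum borel_measurable_times borel_measurable_add
        measurable_inv_form comp borel_measurable_const) (use assms in auto)
qed

lemma measurable_chi_part:
  assumes "0 < p"
  shows "chi_part N p \<in> borel_measurable (Pi\<^sub>M (grid N p) (\<lambda>_. borel))"
  unfolding chi_part_def[abs_def]
  by (intro borel_measurable_sum borel_measurable_power measurable_component_singleton) (use assms in auto)

lemma measurable_first_row:
  assumes "0 < N"
  shows "first_row p \<in> Pi\<^sub>M (grid N p) (\<lambda>_. borel) \<rightarrow>\<^sub>M Pi\<^sub>M {..<p} (\<lambda>_. borel)"
  unfolding first_row_def[abs_def]
  by (intro measurable_restrict measurable_component_singleton) (use assms in auto)

lemma nn_integral_hot_ratio: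
  assumes p: "0 < p" "p < N"
    and f: "f \<in> borel_measurable (Pi\<^sub>M {..<p} (\<lambda>_. borel) \<Otimes>\<^sub>M borel)"
  shows "(\<integral>\<^sup>+z. f (first_row p z, hot_ratio N p m z) \<partial>gauss (grid N p))
       = (\<integral>\<^sup>+z. f (first_row p z, chi_part N p z) \<partial>gauss (grid N p))"
proof -
  let ?C = "{..<p}" and ?R = "{1..<N}"
  let ?A = "{0} \<times> {..<p} :: (nat \<times> nat) set" and ?B = "?R \<times> {..<p}"
  have un: "?A \<union> ?B = grid N p" using p by auto
  have disj: "?A \<inter> ?B = {}" and fin: "finite ?A" "finite ?B" by auto
  have fold: "(\<integral>\<^sup>+z. g z \<partial>gauss (grid N p)) = (\<integral>\<^sup>+x. \<integral>\<^sup>+y. g (merge ?A ?B (x, y)) \<partial>gauss ?B \<partial>gauss ?A)"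
    if "g \<in> borel_measurable (Pi\<^sub>M (grid N p) (\<lambda>_. borel))" for g
    using gs.product_nn_integral_fold[OF disj fin, of g] that unfolding un measurable_gauss_iff by blast
  have m1: "(\<lambda>z. f (first_row p z, hot_ratio N p m z)) \<in> borel_measurable (Pi\<^sub>M (grid N p) (\<lambda>_. borel))"
    using p by (intro measurable_compose[OF _ f] measurable_Pair measurable_hot_ratio measurable_first_row) auto
  have m2: "(\<lambda>z. f (first_row p z, chi_part N p z)) \<in> borel_measurable (Pi\<^sub>M (grid N p) (\<lambda>_. borel))"
    using p by (intro measurable_compose[OF _ f] measurable_Pair measurable_chi_part measurable_first_row) auto
  have card: "card {p..<N} + (p - 1) = card ?R" "{p..<N} \<subseteq> ?R" "{p..<N} \<noteq> {}" using p by auto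
  have Sp: "Suc (p - 1) = p" using p by simp
  have inner: "(\<integral>\<^sup>+y. f (first_row p (merge ?A ?B (x, y)), hot_ratio N p m (merge ?A ?B (x, y))) \<partial>gauss ?B)
     = (\<integral>\<^sup>+y. f (first_row p (merge ?A ?B (x, y)), chi_part N p (merge ?A ?B (x, y))) \<partial>gauss ?B)"
    if x: "x (0, 0) \<noteq> - m 0" for x
  proof -
    define w where "w = shifted_row m x"
    have M1: "merge ?A ?B (x, y) (0, j) = x (0, j)" if "j < p" for y j
      using that by (auto simp: merge_def)
    have M2: "merge ?A ?B (x, y) (a, j) = y (a, j)" if "j < p" "a \<in> ?R" for y a j
      using that by (auto simp: merge_def)
    have fr: "first_row p (merge ?A ?B (x, y)) = first_row p x" for y
      using M1 by (auto simp: first_row_def)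
    have sr: "shifted_row m (merge ?A ?B (x, y)) j = w j" if "j < p" for y j
      using M1 that by (simp add: shifted_row_def w_def)
    have hr: "hot_ratio N p m (merge ?A ?B (x, y)) = ip ?C w w / inv_form ?R p w y" for y
      unfolding hot_ratio_def
      by (intro arg_cong2[where f="(/)"] ip_cong inv_form_cong) (use sr M2 in auto)
    have cp: "chi_part N p (merge ?A ?B (x, y)) = (\<Sum>a\<in>{p..<N}. (y (a, p - 1))\<^sup>2)" for y
      unfolding chi_part_def by (intro sum.cong refl, subst M2) (use p in auto)
    have w0: "ip {..<Suc (p - 1)} w w \<noteq> 0"
    proof
      assume "ip {..<Suc (p - 1)} w w = 0"
      then have "w 0 = 0" using ip_self_eq_0_iff[OF finite_lessThan, of "Suc (p - 1)" w] by auto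
      then show False using x by (simp add: w_def shifted_row_def)
    qed
    have sp: "first_row p x \<in> space (Pi\<^sub>M {..<p} (\<lambda>_. borel))"
      by (simp add: first_row_def space_PiM)
    have F: "(\<lambda>v. f (first_row p x, v)) \<in> borel_measurable borel"
      by (rule measurable_compose[OF measurable_Pair1'[OF sp] f])
    show ?thesis unfolding fr hr cp
      using law_inv_form[OF _ card(2,1,3) w0 F] unfolding Sp by simp
  qed
  have "AE x in gauss ?A. x (0, 0) \<noteq> - m 0" by (rule AE_gauss_neq) (use p in auto)
  then have "AE x in gauss ?A. (\<integral>\<^sup>+y. f (first_row p (merge ?A ?B (x, y)), hot_ratio N p m (merge ?A ?B (x, y))) \<partial>gauss ?B)
     = (\<integral>\<^sup>+y. f (first_row p (merge ?A ?B (x, y)), chi_part N p (merge ?A ?B (x, y))) \<partial>gauss ?B)"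
    by eventually_elim (rule inner)
  then show ?thesis unfolding fold[OF m1] fold[OF m2] by (rule nn_integral_cong_AE)
qed

text \<open>
  Jointly with the first row: conditionally on that row, \<open>law_inv_form\<close> applies with a fixed vector \<open>w\<close> and
  gives a law that does not depend on the row.  The vector \<open>w\<close> vanishes with probability zero.
\<close>

lemma distr_hot_ratio:
  assumes p: "0 < p" "p < N"
  shows "distr (gauss (grid N p)) (Pi\<^sub>M {..<p} (\<lambda>_. borel) \<Otimes>\<^sub>M borel) (\<lambda>z. (first_row p z, hot_ratio N p m z))
       = distr (gauss (grid N p)) (Pi\<^sub>M {..<p} (\<lambda>_. borel) \<Otimes>\<^sub>M borel) (\<lambda>z. (first_row p z, chi_part N p z))"
proof (rule measure_eqI)
  let ?P = "Pi\<^sub>M {..<p} (\<lambda>_. borel :: real measure) \<Otimes>\<^sub>M (borel :: real measure)"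
  have N: "0 < N" using p by simp
  have m1: "(\<lambda>z. (first_row p z, hot_ratio N p m z)) \<in> gauss (grid N p) \<rightarrow>\<^sub>M ?P"
    unfolding measurable_gauss_iff by (intro measurable_Pair measurable_hot_ratio measurable_first_row N)
  have m2: "(\<lambda>z. (first_row p z, chi_part N p z)) \<in> gauss (grid N p) \<rightarrow>\<^sub>M ?P"
    unfolding measurable_gauss_iff by (intro measurable_Pair measurable_chi_part measurable_first_row N p)
  fix E assume "E \<in> sets (distr (gauss (grid N p)) ?P (\<lambda>z. (first_row p z, hot_ratio N p m z)))"
  then have E: "E \<in> sets ?P" by simp
  have e: "emeasure (distr (gauss (grid N p)) ?P T) E = (\<integral>\<^sup>+z. indicator E (T z) \<partial>gauss (grid N p))"
    if T: "T \<in> gauss (grid N p) \<rightarrow>\<^sub>M ?P" for T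
  proof -
    have "emeasure (distr (gauss (grid N p)) ?P T) E = (\<integral>\<^sup>+z. indicator E z \<partial>distr (gauss (grid N p)) ?P T)"
      using E by (intro nn_integral_indicator[symmetric]) simp
    also have "\<dots> = (\<integral>\<^sup>+z. indicator E (T z) \<partial>gauss (grid N p))"
      using E T by (intro nn_integral_distr) auto
    finally show ?thesis .
  qed
  show "emeasure (distr (gauss (grid N p)) ?P (\<lambda>z. (first_row p z, hot_ratio N p m z))) E
      = emeasure (distr (gauss (grid N p)) ?P (\<lambda>z. (first_row p z, chi_part N p z))) E"
    unfolding e[OF m1] e[OF m2]
    by (rule nn_integral_hot_ratio[OF p]) (use E in \<open>rule borel_measurable_indicator\<close>)
qed simp

lemma AE_gauss_restrict:
  assumes "J \<subseteq> I" "Measurable.pred (Pi\<^sub>M J (\<lambda>_. borel)) P" "AE z in gauss J. P z"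
  shows "AE z in gauss I. P (restrict z J)"
proof -
  have m: "(\<lambda>z. restrict z J) \<in> gauss I \<rightarrow>\<^sub>M gauss J" using assms(1) by (rule measurable_restrict_subset)
  have d: "distr (gauss I) (gauss J) (\<lambda>z. restrict z J) = gauss J"
    using distr_PiM_reindex[of I "\<lambda>_. std_normal_distribution" "\<lambda>x. x" J] assms(1) prob_space_std_normal
    by (auto simp: restrict_def)
  have S: "{z \<in> space (gauss J). P z} \<in> sets (gauss J)"
    using assms(2) measurable_gauss_iff[of P J "count_space UNIV"] by (simp add: pred_def)
  have "AE z in distr (gauss I) (gauss J) (\<lambda>z. restrict z J). P z"
    unfolding d by (rule assms(3))
  then show ?thesis by (subst (asm) AE_distr_iff[OF m S])
qed

lemma AE_grid_col_indep:
  assumes "p < N"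
  shows "AE z in gauss (grid N p). col_indep {1..<N} p z"
proof -
  have "AE z in gauss (grid N p). col_indep {1..<N} p (restrict z ({1..<N} \<times> {..<p}))"
    by (rule AE_gauss_restrict[OF _ pred_col_indep AE_col_indep]) (use assms in auto)
  then show ?thesis
    by eventually_elim (use col_indep_cong in \<open>fastforce simp: col_indep_def\<close>)
qed

section \<open>The spectral theorem for real symmetric matrices\<close>

lemma symmetric_form_ip:
  assumes "\<And>a b. a < p \<Longrightarrow> b < p \<Longrightarrow> A a b = A b a"
  shows "ip {..<p} (\<lambda>a. ip {..<p} (A a) x) y = ip {..<p} x (\<lambda>a. ip {..<p} (A a) y)"
proof -
  have "ip {..<p} (\<lambda>a. ip {..<p} (A a) x) y = (\<Sum>a<p. \<Sum>b<p. A a b * x b * y a)"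
    unfolding ip_def by (simp add: sum_distrib_right)
  also have "\<dots> = (\<Sum>b<p. \<Sum>a<p. A a b * x b * y a)" by (rule sum.swap)
  also have "\<dots> = (\<Sum>b<p. \<Sum>a<p. x b * (A b a * y a))"
    using assms by (intro sum.cong refl) (auto simp: mult_ac)
  also have "\<dots> = ip {..<p} x (\<lambda>a. ip {..<p} (A a) y)" unfolding ip_def by (simp add: sum_distrib_left)
  finally show ?thesis .
qed

text \<open>
  A maximiser of the quadratic form on the unit sphere of the orthogonal complement of the eigenvectors
  already found is an eigenvector: a first order perturbation in the direction of its residual would
  otherwise increase the form.
\<close>

lemma next_eigenvector:
  fixes A :: "nat \<Rightarrow> nat \<Rightarrow> real"
  assumes sym: "\<And>a b. a < p \<Longrightarrow> b < p \<Longrightarrow> A a b = A b a"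
    and k: "k < p" and U: "orthonormal_on {..<p} {..<k} U"
    and eig: "\<And>j a. j < k \<Longrightarrow> a < p \<Longrightarrow> ip {..<p} (A a) (U j) = l j * U j a"
  shows "\<exists>v mu. ip {..<p} v v = 1 \<and> (\<forall>j<k. ip {..<p} v (U j) = 0) \<and> (\<forall>a<p. ip {..<p} (A a) v = mu * v a)"
proof -
  let ?C = "{..<p}"
  define T where "T x a = ip ?C (A a) x" for x a
  \<comment> \<open>the coordinates outside the index range are pinned to \<open>0\<close>, which makes the sphere compact in the product topology\<close>
  define S where "S i = (if i < p then {-1..1} else {0::real})" for i
  define K where "K = PiE UNIV S \<inter> {x. ip ?C x x = 1} \<inter> (\<Inter>j\<in>{..<k}. {x. ip ?C x (U j) = 0})"
  have cont: "continuous_on UNIV (\<lambda>x. ip ?C (f x) (g x))"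
    if "\<And>i. i < p \<Longrightarrow> continuous_on UNIV (\<lambda>x. f x i)" "\<And>i. i < p \<Longrightarrow> continuous_on UNIV (\<lambda>x. g x i)"
    for f g :: "(nat \<Rightarrow> real) \<Rightarrow> nat \<Rightarrow> real"
    unfolding ip_def using that by (intro continuous_intros) auto
  have coord: "continuous_on UNIV (\<lambda>x::nat \<Rightarrow> real. x i)" for i by simp
  have "compact (PiE UNIV S)"
  proof -
    have "compactin (product_topology (\<lambda>_. euclidean) UNIV) (PiE UNIV S)"
      unfolding compactin_PiE by (simp add: S_def)
    then show ?thesis by (simp add: euclidean_product_topology)
  qed
  moreover have "closed {x. ip ?C x x = 1}"
    by (intro closed_Collect_eq cont coord continuous_on_const)
  moreover have "closed (\<Inter>j\<in>{..<k}. {x. ip ?C x (U j) = 0})"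
    by (intro closed_INT ballI closed_Collect_eq cont coord continuous_on_const)
  ultimately have compK: "compact K" unfolding K_def by (intro compact_Int_closed)
  obtain x0 where x0: "ip ?C x0 x0 = 1" "\<And>j. j \<in> {..<k} \<Longrightarrow> ip ?C (U j) x0 = 0"
    using unit_vector_orthogonal[of "{..<k}" ?C U] k by auto
  have bound: "\<bar>x i\<bar> \<le> 1" if "ip ?C x x = 1" "i < p" for x i
  proof -
    have "x i * x i \<le> ip ?C x x" unfolding ip_def using that(2)
      by (intro member_le_sum) auto
    then show ?thesis using that(1) by (simp add: abs_le_square_iff[of _ 1, simplified] power2_eq_square)
  qed
  define trim where "trim x i = (if i < p then x i else 0 :: real)" for x :: "nat \<Rightarrow> real" and i
  have trim_ip: "ip ?C (trim x) y = ip ?C x y" "ip ?C y (trim x) = ip ?C y x" for x y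
    by (auto intro!: ip_cong simp: trim_def)
  have inK: "trim x \<in> K" if "ip ?C x x = 1" "\<And>j. j < k \<Longrightarrow> ip ?C x (U j) = 0" for x
    using that bound[OF that(1)] unfolding K_def
    by (auto simp: trim_ip S_def trim_def abs_le_iff minus_le_iff)
  have "trim x0 \<in> K" using x0 by (intro inK) (auto simp: ip_commute[of _ x0 "U _"])
  then have "K \<noteq> {}" by auto
  moreover have "continuous_on K (\<lambda>x. ip ?C x (T x))"
    by (rule continuous_on_subset[of UNIV]) (auto simp: T_def intro!: cont coord continuous_on_const)
  ultimately obtain v where v: "v \<in> K" "\<And>x. x \<in> K \<Longrightarrow> ip ?C x (T x) \<le> ip ?C v (T v)"
    using continuous_attains_sup[OF compK] by blast
  define mu where "mu = ip ?C v (T v)"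
  have v1: "ip ?C v v = 1" and v0: "\<And>j. j < k \<Longrightarrow> ip ?C v (U j) = 0" using v(1) by (auto simp: K_def)
  have Tlin: "T (\<lambda>i. x i + c * y i) a = T x a + c * T y a" for x y c a
    unfolding T_def ip_linear_right ..
  have Tsym: "ip ?C (T x) y = ip ?C x (T y)" for x y
    unfolding T_def[abs_def] by (rule symmetric_form_ip[OF sym])
  have Rayleigh: "ip ?C x (T x) \<le> mu * ip ?C x x" if orth: "\<And>j. j < k \<Longrightarrow> ip ?C x (U j) = 0" for x
  proof (cases "ip ?C x x = 0")
    case True
    then have "\<forall>i<p. x i = 0" using ip_self_eq_0_iff[OF finite_lessThan, of p x] by simp
    then show ?thesis by (simp add: ip_def)
  next
    case False
    then have pos: "ip ?C x x > 0" using ip_self_nonneg[of ?C x] by simp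
    define c where "c = 1 / sqrt (ip ?C x x)"
    have cc: "c * c * ip ?C x x = 1" using pos by (simp add: c_def field_simps)
    have c1: "ip ?C (\<lambda>i. c * x i) (\<lambda>i. c * x i) = 1" unfolding ip_linear_left ip_linear_right using cc by (simp add: mult_ac)
    have c2: "ip ?C (\<lambda>i. c * x i) (U j) = 0" if "j < k" for j unfolding ip_linear_left using orth that by simp
    have "T (trim (\<lambda>i. c * x i)) a = c * T x a" for a
      unfolding T_def trim_ip ip_linear_right ..
    then have "T (trim (\<lambda>i. c * x i)) = (\<lambda>a. c * T x a)" by auto
    then have "ip ?C (trim (\<lambda>i. c * x i)) (T (trim (\<lambda>i. c * x i))) = c * c * ip ?C x (T x)"
      by (simp only: trim_ip ip_linear_left ip_linear_right mult.assoc)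
    then have "c * c * ip ?C x (T x) \<le> mu" using v(2)[OF inK[OF c1 c2]] by (simp add: mu_def)
    then have "c * c * ip ?C x (T x) * ip ?C x x \<le> mu * ip ?C x x" using pos by (intro mult_right_mono) auto
    moreover have "c * c * ip ?C x (T x) * ip ?C x x = (c * c * ip ?C x x) * ip ?C x (T x)" by (simp only: mult_ac)
    ultimately show ?thesis using cc by simp
  qed
  \<comment> \<open>perturb \<open>v\<close> in the direction of the residual\<close>
  define y where "y a = T v a - mu * v a" for a
  have Tu: "ip ?C (T v) (U j) = 0" if "j < k" for j
  proof -
    have "ip ?C (T v) (U j) = ip ?C v (T (U j))" by (rule Tsym)
    also have "\<dots> = ip ?C v (\<lambda>a. l j * U j a)" using eig that by (intro ip_cong) (auto simp: T_def)
    also have "\<dots> = 0" unfolding ip_linear_right using v0 that by simp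
    finally show ?thesis .
  qed
  have yU: "ip ?C y (U j) = 0" if "j < k" for j
    unfolding y_def ip_linear_left using Tu v0 that by simp
  have yv: "ip ?C v y = 0" unfolding y_def ip_linear_right v1 mu_def by simp
  have vy: "ip ?C y v = 0" using yv by (subst ip_commute)
  have Ty: "ip ?C v (T y) = ip ?C y y"
  proof -
    have "ip ?C v (T y) = ip ?C (T v) y" by (rule Tsym[symmetric])
    also have "\<dots> = ip ?C (\<lambda>a. y a + mu * v a) y" by (intro ip_cong) (auto simp: y_def)
    also have "\<dots> = ip ?C y y" unfolding ip_linear_left yv by simp
    finally show ?thesis .
  qed
  define B where "B = mu * ip ?C y y - ip ?C y (T y)"
  have ineq: "2 * e * ip ?C y y \<le> e * e * B" for e
  proof -
    let ?x = "\<lambda>i. v i + e * y i"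
    have "ip ?C ?x (U j) = 0" if "j < k" for j unfolding ip_linear_left using v0 yU that by simp
    then have le: "ip ?C ?x (T ?x) \<le> mu * ip ?C ?x ?x" by (rule Rayleigh)
    have Tx: "T ?x = (\<lambda>a. T v a + e * T y a)" by (rule ext) (rule Tlin)
    have "ip ?C y (T v) = ip ?C v (T y)" by (subst Tsym[symmetric]) (rule ip_commute)
    then have "ip ?C ?x (T ?x) = mu + 2 * e * ip ?C y y + e * e * ip ?C y (T y)"
      unfolding Tx ip_linear_left ip_linear_right Ty mu_def[symmetric] by (simp add: algebra_simps Ty)
    moreover have "ip ?C ?x ?x = 1 + e * e * ip ?C y y"
      unfolding ip_linear_left ip_linear_right v1 yv vy by simp
    ultimately show ?thesis using le unfolding B_def by (simp add: algebra_simps)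
  qed
  have "ip ?C y y = 0"
  proof (rule ccontr)
    assume "ip ?C y y \<noteq> 0"
    then have pos: "ip ?C y y > 0" using ip_self_nonneg[of ?C y] by simp
    define e where "e = ip ?C y y / (\<bar>B\<bar> + 1)"
    have e: "e > 0" using pos by (simp add: e_def)
    have "2 * e * ip ?C y y \<le> e * (e * \<bar>B\<bar>)"
      using ineq[of e] e by (smt (verit) mult.assoc mult_left_mono abs_ge_self)
    then have "2 * ip ?C y y \<le> e * \<bar>B\<bar>" using e by (simp add: mult.assoc mult.left_commute)
    also have "\<dots> \<le> ip ?C y y" unfolding e_def using pos by (simp add: field_simps)
    finally show False using pos by simp
  qed
  then have "\<forall>a<p. y a = 0" using ip_self_eq_0_iff[OF finite_lessThan, of p y] by simp
  then have "\<forall>a<p. ip ?C (A a) v = mu * v a" by (simp add: y_def T_def)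
  then show ?thesis using v1 v0 by blast
qed

lemma spectral_symmetric:
  fixes A :: "nat \<Rightarrow> nat \<Rightarrow> real"
  assumes sym: "\<And>a b. a < p \<Longrightarrow> b < p \<Longrightarrow> A a b = A b a"
  obtains U l where "orthonormal_on {..<p} {..<p} U"
    "\<And>j a. j < p \<Longrightarrow> a < p \<Longrightarrow> ip {..<p} (A a) (U j) = l j * U j a"
    "\<And>a b. a < p \<Longrightarrow> b < p \<Longrightarrow> A a b = (\<Sum>j<p. l j * U j a * U j b)"
proof -
  have "\<exists>U l. orthonormal_on {..<p} {..<k} U \<and> (\<forall>j<k. \<forall>a<p. ip {..<p} (A a) (U j) = l j * U j a)"
    if "k \<le> p" for k using that
  proof (induction k)
    case 0 then show ?case by (simp add: orthonormal_on_def)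
  next
    case (Suc k)
    then obtain U l where U: "orthonormal_on {..<p} {..<k} U"
      "\<forall>j<k. \<forall>a<p. ip {..<p} (A a) (U j) = l j * U j a" by auto
    obtain v mu where v: "ip {..<p} v v = 1" "\<forall>j<k. ip {..<p} v (U j) = 0"
      "\<forall>a<p. ip {..<p} (A a) v = mu * v a"
      using next_eigenvector[of p A k U l, OF sym _ U(1)] U(2) Suc.prems by auto
    have "\<forall>j<k. ip {..<p} (U j) v = 0" using v(2) by (simp add: ip_commute[of _ "U _" v])
    then have "orthonormal_on {..<p} {..<Suc k} (U(k := v))"
      using U(1) v unfolding orthonormal_on_def by (auto simp: less_Suc_eq)
    moreover have "\<forall>j<Suc k. \<forall>a<p. ip {..<p} (A a) ((U(k := v)) j) = (l(k := mu)) j * (U(k := v)) j a"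
      using U(2) v(3) by (auto simp: less_Suc_eq)
    ultimately show ?case by blast
  qed
  from this[of p] obtain U l where U: "orthonormal_on {..<p} {..<p} U"
    "\<forall>j<p. \<forall>a<p. ip {..<p} (A a) (U j) = l j * U j a" by auto
  have "A a b = (\<Sum>j<p. l j * U j a * U j b)" if "a < p" "b < p" for a b
    using orthonormal_complete[OF finite_lessThan U(1), of b "A a"] U(2) that by simp
  with U that show ?thesis by blast
qed

section \<open>Normal laws in spectral coordinates\<close>

lemma indep_gauss: "prob_space.indep_vars (gauss I) (\<lambda>_. borel) (\<lambda>i z. z i) I"
proof (cases "I = {}")
  case True
  interpret prob_space "gauss I" by (rule prob_space_gauss)
  show ?thesis unfolding indep_vars_def indep_sets_def using True by (auto simp del: PiM_empty)
next
  case False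
  interpret prob_space "gauss I" by (rule prob_space_gauss)
  show ?thesis
  proof (subst indep_vars_iff_distr_eq_PiM'[OF False])
    have m: "(\<lambda>z. z i) \<in> gauss I \<rightarrow>\<^sub>M std_normal_distribution" if "i \<in> I" for i
      using that by (rule measurable_component_singleton)
    show "random_variable borel (\<lambda>z. z i)" if "i \<in> I" for i
      using m[OF that] by simp
    have "distr (gauss I) (Pi\<^sub>M I (\<lambda>_. borel)) (\<lambda>z. \<lambda>i\<in>I. z i) = distr (gauss I) (gauss I) (\<lambda>z. z)"
      by (rule distr_cong) (auto simp: sets_gauss space_PiM fun_eq_iff PiE_def extensional_def)
    also have "\<dots> = gauss I" by (rule distr_id)
    also have "\<dots> = Pi\<^sub>M I (\<lambda>i. distr (gauss I) borel (\<lambda>z. z i))"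
    proof (rule PiM_cong[OF refl])
      fix i assume i: "i \<in> I"
      have "distr (gauss I) borel (\<lambda>z. z i) = distr (gauss I) std_normal_distribution (\<lambda>z. z i)"
        by (rule distr_cong) auto
      also have "\<dots> = std_normal_distribution"
        using distr_PiM_component[of I "\<lambda>_. std_normal_distribution" i] i prob_space_std_normal by simp
      finally show "std_normal_distribution = distr (gauss I) borel (\<lambda>z. z i)" by simp
    qed
    finally show "distr (gauss I) (Pi\<^sub>M I (\<lambda>_. borel)) (\<lambda>z. \<lambda>i\<in>I. z i) = Pi\<^sub>M I (\<lambda>i. distr (gauss I) borel (\<lambda>z. z i))" .
  qed
qed

lemma gauss_reindex:
  assumes "inj_on f J" "\<And>j. j \<in> J \<Longrightarrow> f j \<in> I"
  shows "distr (gauss I) (gauss J) (\<lambda>z. \<lambda>n\<in>J. z (f n)) = gauss J"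
  using distr_PiM_reindex[of I "\<lambda>_. std_normal_distribution" f J] assms prob_space_std_normal
  by auto

lemma leb_translate:
  assumes "finite I" and f: "f \<in> borel_measurable (leb I)"
  shows "(\<integral>\<^sup>+z. f (\<lambda>a\<in>I. m a + z a) \<partial>leb I) = (\<integral>\<^sup>+z. f z \<partial>leb I)"
proof -
  have T: "(\<lambda>z. \<lambda>a\<in>I. m a + z a) \<in> leb I \<rightarrow>\<^sub>M leb I"
    by (intro measurable_restrict) auto
  have "distr (leb I) (leb I) (\<lambda>z. \<lambda>a\<in>I. m a + z a) = leb I"
  proof (rule leb.PiM_eqI[OF assms(1)])
    fix A :: "'a \<Rightarrow> real set" assume "\<And>i. i \<in> I \<Longrightarrow> A i \<in> sets lborel"
    then have A: "A i \<in> sets borel" if "i \<in> I" for i using that by simp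
    have PE: "Pi\<^sub>E I A \<in> sets (leb I)" using A by (intro sets_PiM_I_finite assms) auto
    have "emeasure (distr (leb I) (leb I) (\<lambda>z. \<lambda>a\<in>I. m a + z a)) (Pi\<^sub>E I A)
        = emeasure (leb I) ((\<lambda>z. \<lambda>a\<in>I. m a + z a) -` Pi\<^sub>E I A \<inter> space (leb I))"
      by (rule emeasure_distr[OF T PE])
    also have "(\<lambda>z. \<lambda>a\<in>I. m a + z a) -` Pi\<^sub>E I A \<inter> space (leb I) = Pi\<^sub>E I (\<lambda>i. (+) (m i) -` A i)"
      by (auto simp: space_PiM PiE_def Pi_iff)
    also have "emeasure (leb I) \<dots> = (\<Prod>i\<in>I. emeasure lborel ((+) (m i) -` A i))"
    proof (rule leb.emeasure_PiM[OF assms(1)])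
      fix i assume "i \<in> I"
      have "(+) (m i) -` A i \<inter> space lborel \<in> sets lborel"
        by (rule measurable_sets[of _ lborel borel]) (use A \<open>i \<in> I\<close> in auto)
      then show "(+) (m i) -` A i \<in> sets lborel" by simp
    qed
    also have "\<dots> = (\<Prod>i\<in>I. emeasure lborel (A i))"
    proof (rule prod.cong[OF refl])
      fix i assume i: "i \<in> I"
      have "emeasure (distr lborel borel ((+) (m i))) (A i) = emeasure lborel ((+) (m i) -` A i \<inter> space lborel)"
        by (rule emeasure_distr) (use A i in auto)
      then show "emeasure lborel ((+) (m i) -` A i) = emeasure lborel (A i)"
        by (simp add: lborel_distr_plus)
    qed
    finally show "emeasure (distr (leb I) (leb I) (\<lambda>z. \<lambda>a\<in>I. m a + z a)) (Pi\<^sub>E I A) = (\<Prod>i\<in>I. emeasure lborel (A i))" .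
  qed simp
  then show ?thesis using nn_integral_distr[OF T, of f] f by simp
qed

lemma quad_form_inv_solution:
  assumes A: "A \<in> carrier_mat n n" "Determinant.det A \<noteq> 0"
    and x: "\<And>i. i < n \<Longrightarrow> (\<Sum>j<n. A $$ (i, j) * x j) = y i"
  shows "quad_form (inv_mat A) (Matrix.vec n y) = (\<Sum>j<n. y j * x j)"
proof -
  note inv = inv_mat_inverse[OF A]
  have "A *\<^sub>v Matrix.vec n x = Matrix.vec n y"
    using A(1) x by (intro eq_vecI) (auto simp: scalar_prod_def atLeast0LessThan)
  then have "inv_mat A *\<^sub>v Matrix.vec n y = inv_mat A *\<^sub>v (A *\<^sub>v Matrix.vec n x)" by simp
  also have "\<dots> = (inv_mat A * A) *\<^sub>v Matrix.vec n x"
    by (rule assoc_mult_mat_vec[symmetric, OF inv(1) A(1)]) simp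
  also have "\<dots> = Matrix.vec n x" using inv by simp
  finally show ?thesis
    unfolding quad_form_def by (simp add: scalar_prod_def atLeast0LessThan)
qed

locale spectral_cov =
  fixes p :: nat and Sig :: "real Matrix.mat" and U :: "nat \<Rightarrow> nat \<Rightarrow> real" and lam :: "nat \<Rightarrow> real"
  assumes Sig: "Sig \<in> carrier_mat p p"
    and U: "orthonormal_on {..<p} {..<p} U"
    and lam: "\<And>j. j < p \<Longrightarrow> 0 < lam j"
    and Sig_entry: "\<And>a b. a < p \<Longrightarrow> b < p \<Longrightarrow> Sig $$ (a, b) = (\<Sum>j<p. lam j * U j a * U j b)"
begin

abbreviation "C \<equiv> {..<p}"

text \<open>
  The coordinates of \<open>\<Sigma>\<^sup>1\<^sup>/\<^sup>2 z\<close> when \<open>z\<close> is given in the eigenbasis \<open>U\<close>.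
\<close>

definition emb :: "(nat \<Rightarrow> real) \<Rightarrow> nat \<Rightarrow> real" where
  "emb z a = (\<Sum>j<p. sqrt (lam j) * z j * U j a)"

lemma ip_emb_U: "j < p \<Longrightarrow> ip C (emb z) (U j) = sqrt (lam j) * z j"
  unfolding emb_def[abs_def] using ip_orthonormal_sum[OF U, of j "\<lambda>j. sqrt (lam j) * z j"] by simp

lemma ip_emb_emb: "ip C (emb y) (emb z) = (\<Sum>j<p. lam j * y j * z j)"
proof -
  have "ip C (emb y) (emb z) = (\<Sum>j<p. ip C (emb y) (U j) * ip C (emb z) (U j))"
    by (rule orthonormal_parseval[symmetric, OF _ U]) simp
  also have "\<dots> = (\<Sum>j<p. lam j * y j * z j)"
  proof (intro sum.cong refl)
    fix j assume "j \<in> C"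
    then have j: "j < p" by simp
    have "sqrt (lam j) * y j * (sqrt (lam j) * z j) = (sqrt (lam j) * sqrt (lam j)) * y j * z j"
      by (simp only: mult_ac)
    also have "sqrt (lam j) * sqrt (lam j) = lam j" using lam[OF j] by simp
    finally show "ip C (emb y) (U j) * ip C (emb z) (U j) = lam j * y j * z j" by (simp only: ip_emb_U[OF j])
  qed
  finally show ?thesis .
qed

lemma Sig_apply: "a < p \<Longrightarrow> (\<Sum>b<p. Sig $$ (a, b) * x b) = (\<Sum>j<p. lam j * ip C x (U j) * U j a)"
proof -
  assume a: "a < p"
  have "(\<Sum>b<p. Sig $$ (a, b) * x b) = (\<Sum>b<p. \<Sum>j<p. lam j * U j a * U j b * x b)"
    using Sig_entry[OF a] by (simp add: sum_distrib_right)
  also have "\<dots> = (\<Sum>j<p. \<Sum>b<p. lam j * U j a * U j b * x b)" by (rule sum.swap)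
  also have "\<dots> = (\<Sum>j<p. lam j * ip C x (U j) * U j a)"
    unfolding ip_def by (intro sum.cong refl) (simp add: sum_distrib_left sum_distrib_right mult_ac)
  finally show ?thesis .
qed

lemma expand_U: "a < p \<Longrightarrow> (\<Sum>j<p. ip C x (U j) * U j a) = x a"
  by (rule orthonormal_complete[OF _ U]) auto

lemma det_Sig: "Determinant.det Sig \<noteq> 0"
proof
  assume "Determinant.det Sig = 0"
  then obtain v where v: "v \<in> carrier_vec p" "v \<noteq> 0\<^sub>v p" "Sig *\<^sub>v v = 0\<^sub>v p"
    using det_0_iff_vec_prod_zero[OF Sig] by blast
  define x where "x j = v $ j" for j
  have "(\<Sum>b<p. Sig $$ (a, b) * x b) = 0" if "a < p" for a
  proof -
    have "(\<Sum>b<p. Sig $$ (a, b) * x b) = (Sig *\<^sub>v v) $ a"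
      using Sig v(1) that by (simp add: scalar_prod_def atLeast0LessThan x_def)
    then show ?thesis using v(3) that by simp
  qed
  then have S0: "(\<Sum>j<p. lam j * ip C x (U j) * U j a) = 0" if "a < p" for a using Sig_apply that by simp
  have "lam j * ip C x (U j) = 0" if "j < p" for j
  proof -
    have "lam j * ip C x (U j) = ip C (\<lambda>a. \<Sum>j<p. lam j * ip C x (U j) * U j a) (U j)"
      using ip_orthonormal_sum[OF U, of j "\<lambda>j. lam j * ip C x (U j)"] that by simp
    also have "\<dots> = ip C (\<lambda>_. 0) (U j)" using S0 by (intro ip_cong) auto
    finally show ?thesis by (simp add: ip_def)
  qed
  then have "ip C x (U j) = 0" if "j < p" for j using lam[OF that] that by force
  then have "x a = 0" if "a < p" for a using expand_U[OF that, of x] by simp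
  then have "v = 0\<^sub>v p" using v(1) by (intro eq_vecI) (auto simp: x_def)
  then show False using v by simp
qed

lemma quad_form_inv_Sig:
  "quad_form (inv_mat Sig) (Matrix.vec p y) = (\<Sum>j<p. (ip C y (U j))\<^sup>2 / lam j)"
proof -
  define x where "x b = (\<Sum>j<p. ip C y (U j) / lam j * U j b)" for b
  have xU: "ip C x (U j) = ip C y (U j) / lam j" if "j < p" for j
    unfolding x_def[abs_def] using ip_orthonormal_sum[OF U, of j "\<lambda>j. ip C y (U j) / lam j"] that by simp
  have "(\<Sum>b<p. Sig $$ (a, b) * x b) = y a" if "a < p" for a
  proof -
    have "(\<Sum>b<p. Sig $$ (a, b) * x b) = (\<Sum>j<p. ip C y (U j) * U j a)"
      unfolding Sig_apply[OF that] by (intro sum.cong refl) (use lam xU in force)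
    then show ?thesis using expand_U[OF that, of y] by simp
  qed
  from quad_form_inv_solution[OF Sig det_Sig this]
  have "quad_form (inv_mat Sig) (Matrix.vec p y) = ip C y x" by (simp add: ip_def)
  also have "\<dots> = (\<Sum>j<p. ip C y (U j) * ip C x (U j))"
    by (rule orthonormal_parseval[symmetric, OF _ U]) simp
  also have "\<dots> = (\<Sum>j<p. (ip C y (U j))\<^sup>2 / lam j)"
    by (intro sum.cong refl) (simp add: xU power2_eq_square)
  finally show ?thesis .
qed

lemma emb_surj: "\<exists>z. \<forall>a<p. emb z a = y a"
proof -
  have "emb (\<lambda>j. ip C y (U j) / sqrt (lam j)) a = y a" if "a < p" for a
  proof -
    have "emb (\<lambda>j. ip C y (U j) / sqrt (lam j)) a = (\<Sum>j<p. ip C y (U j) * U j a)"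
      unfolding emb_def by (intro sum.cong refl) (use lam in force)
    then show ?thesis using expand_U[OF that, of y] by simp
  qed
  then show ?thesis by blast
qed

definition row_map :: "real Matrix.vec \<Rightarrow> (nat \<Rightarrow> real) \<Rightarrow> nat \<Rightarrow> real" where
  "row_map mu z = (\<lambda>a\<in>C. mu $ a + emb z a)"

lemma measurable_row_map: "row_map mu \<in> Pi\<^sub>M C (\<lambda>_. borel) \<rightarrow>\<^sub>M Pi\<^sub>M C (\<lambda>_. borel)"
  unfolding row_map_def[abs_def] emb_def
  by (intro measurable_restrict borel_measurable_add borel_measurable_sum borel_measurable_times
      borel_measurable_const measurable_component_singleton) auto

text \<open>
  The affine image of a standard normal vector has a density proportional to the normal one, because a
  linear bijection scales Lebesgue measure by a constant; two probability densities that are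
  proportional agree.  This avoids evaluating the determinant in the density.
\<close>

lemma gauss_row_map:
  assumes mu: "mu \<in> carrier_vec p"
    and h: "(\<lambda>y. ennreal (mvn_density p mu Sig y)) \<in> borel_measurable (lborel_n p)"
    and prob: "prob_space (density (lborel_n p) (\<lambda>y. ennreal (mvn_density p mu Sig y)))"
  shows "distr (gauss C) (lborel_n p) (row_map mu) = density (lborel_n p) (\<lambda>y. ennreal (mvn_density p mu Sig y))"
proof -
  define A where "A a j = sqrt (lam j) * U j a" for a j
  have ipA: "ip C (A a) z = emb z a" for a z by (simp add: ip_def A_def emb_def mult_ac)
  have "surjective_on C A" unfolding surjective_on_def ipA
  proof
    fix y
    obtain z where "\<forall>a<p. emb z a = y a" using emb_surj by blast
    then show "\<exists>z. \<forall>i\<in>C. emb z i = y i" by (intro exI[of _ z]) auto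
  qed
  then obtain K where K: "K > 0" "\<And>f. f\<in>borel_measurable (leb C) \<Longrightarrow>
          (\<integral>\<^sup>+z. f (lin_map C A z) \<partial>leb C) = ennreal K * (\<integral>\<^sup>+z. f z \<partial>leb C)"
    using lin_map_scales_leb[of C A] by (auto simp: scales_leb_def)
  let ?T = "row_map mu" and ?h = "\<lambda>y. ennreal (mvn_density p mu Sig y)"
  have Teq: "?T z = (\<lambda>a\<in>C. mu $ a + lin_map C A z a)" for z
    by (auto simp: row_map_def lin_map_def ipA)
  have trans: "(\<integral>\<^sup>+z. f (?T z) \<partial>leb C) = ennreal K * (\<integral>\<^sup>+z. f z \<partial>leb C)"
    if f: "f \<in> borel_measurable (leb C)" for f :: "_ \<Rightarrow> ennreal"
  proof -
    have "(\<lambda>z. \<lambda>a\<in>C. mu $ a + z a) \<in> leb C \<rightarrow>\<^sub>M leb C" by (intro measurable_restrict) auto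
    from measurable_compose[OF this f] K(2)[of "\<lambda>z. f (\<lambda>a\<in>C. mu $ a + z a)"] leb_translate[OF _ f, of "\<lambda>a. mu $ a"]
    show ?thesis unfolding Teq by simp
  qed
  define c where "c = 1 / sqrt ((2 * pi) ^ p * Determinant.det Sig) / (1 / sqrt (2 * pi)) ^ p"
  define g where "g z = ennreal (\<Prod>j\<in>C. std_normal_density (z j))" for z :: "nat \<Rightarrow> real"
  have hT: "?h (?T z) = ennreal c * g z" for z
  proof -
    have "Matrix.vec p (?T z) - mu = Matrix.vec p (emb z)"
      using mu by (intro eq_vecI) (auto simp: row_map_def)
    then have "quad_form (inv_mat Sig) (Matrix.vec p (?T z) - mu) = (\<Sum>j<p. (sqrt (lam j) * z j)\<^sup>2 / lam j)"
      by (simp add: quad_form_inv_Sig ip_emb_U)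
    also have "\<dots> = ip C z z" unfolding ip_def
    proof (intro sum.cong refl)
      fix j assume "j \<in> C"
      then have "0 < lam j" using lam by simp
      then show "(sqrt (lam j) * z j)\<^sup>2 / lam j = z j * z j"
        by (simp add: power_mult_distrib) (simp add: power2_eq_square)
    qed
    finally have "mvn_density p mu Sig (?T z) = exp (- ip C z z / 2) / sqrt ((2 * pi) ^ p * Determinant.det Sig)"
      by (simp add: mvn_density_def)
    also have "\<dots> = c * (\<Prod>j\<in>C. std_normal_density (z j))"
      unfolding prod_std_normal_density[OF finite_lessThan] c_def by simp
    finally show ?thesis unfolding g_def
      by (simp only: ennreal_mult'' prod_nonneg normal_density_nonneg)
  qed
  have g: "g \<in> borel_measurable (leb C)"
  proof -
    have "(\<lambda>z. \<Prod>j\<in>C. std_normal_density (z j)) \<in> borel_measurable (leb C)" by measurable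
    then show ?thesis unfolding g_def by (rule measurable_compose[OF _ measurable_ennreal])
  qed
  have gd: "gauss C = density (leb C) g" unfolding g_def by (rule gauss_eq_density) simp
  have T: "?T \<in> leb C \<rightarrow>\<^sub>M leb C"
    using measurable_row_map measurable_cong_sets[OF sets_leb sets_leb] by blast
  have T': "?T \<in> gauss C \<rightarrow>\<^sub>M lborel_n p"
    using measurable_row_map measurable_cong_sets[OF sets_gauss sets_leb] by blast
  have Q: "ennreal K * (\<integral>\<^sup>+y. ?h y * f y \<partial>leb C) = ennreal c * (\<integral>\<^sup>+z. f (?T z) \<partial>gauss C)"
    if f: "f \<in> borel_measurable (leb C)" for f
  proof -
    have "ennreal K * (\<integral>\<^sup>+y. ?h y * f y \<partial>leb C) = (\<integral>\<^sup>+z. ?h (?T z) * f (?T z) \<partial>leb C)"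
      by (rule trans[symmetric]) (rule borel_measurable_times_ennreal[OF h f])
    also have "\<dots> = (\<integral>\<^sup>+z. ennreal c * (g z * f (?T z)) \<partial>leb C)" unfolding hT by (simp only: mult.assoc)
    also have "\<dots> = ennreal c * (\<integral>\<^sup>+z. g z * f (?T z) \<partial>leb C)"
      by (rule nn_integral_cmult) (rule borel_measurable_times_ennreal[OF g measurable_compose[OF T f]])
    also have "(\<integral>\<^sup>+z. g z * f (?T z) \<partial>leb C) = (\<integral>\<^sup>+z. f (?T z) \<partial>gauss C)"
      unfolding gd by (rule nn_integral_density[symmetric, OF g measurable_compose[OF T f]])
    finally show ?thesis .
  qed
  interpret G: prob_space "gauss C" by (rule prob_space_gauss)
  interpret D: prob_space "density (lborel_n p) ?h" by (rule prob)
  have h1: "(\<integral>\<^sup>+y. ?h y \<partial>leb C) = 1"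
  proof -
    have "(\<integral>\<^sup>+y. ?h y * indicator (space (leb C)) y \<partial>leb C) = 1"
      using D.emeasure_space_1 by (simp add: emeasure_density[OF h])
    moreover have "(\<integral>\<^sup>+y. ?h y * indicator (space (leb C)) y \<partial>leb C) = (\<integral>\<^sup>+y. ?h y \<partial>leb C)"
      by (rule nn_integral_cong) (simp add: indicator_def)
    ultimately show ?thesis by simp
  qed
  have "(\<integral>\<^sup>+z. 1 \<partial>gauss C) = 1" using G.emeasure_space_1 by (simp only: nn_integral_const mult_1)
  then have Kc: "ennreal K = ennreal c" using Q[of "\<lambda>_. 1"] h1 by (simp only: mult_1_right borel_measurable_const)
  have cancel: "(\<integral>\<^sup>+y. ?h y * f y \<partial>leb C) = (\<integral>\<^sup>+z. f (?T z) \<partial>gauss C)"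
    if f: "f \<in> borel_measurable (leb C)" for f
  proof -
    have "ennreal K * (\<integral>\<^sup>+y. ?h y * f y \<partial>leb C) = ennreal K * (\<integral>\<^sup>+z. f (?T z) \<partial>gauss C)"
      using Q[OF f] unfolding Kc .
    then show ?thesis using K(1) by (subst (asm) ennreal_mult_cancel_left) auto
  qed
  show ?thesis
  proof (rule measure_eqI)
    fix E assume "E \<in> sets (distr (gauss C) (lborel_n p) ?T)"
    then have E: "E \<in> sets (leb C)" by simp
    have "emeasure (distr (gauss C) (lborel_n p) ?T) E = (\<integral>\<^sup>+y. indicator E y \<partial>distr (gauss C) (lborel_n p) ?T)"
      using E by (intro nn_integral_indicator[symmetric]) simp
    also have "\<dots> = (\<integral>\<^sup>+z. indicator E (?T z) \<partial>gauss C)"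
      using E by (intro nn_integral_distr T') simp
    also have "\<dots> = (\<integral>\<^sup>+y. ?h y * indicator E y \<partial>leb C)"
      using E by (intro cancel[symmetric]) simp
    also have "\<dots> = emeasure (density (lborel_n p) ?h) E" by (rule emeasure_density[symmetric, OF h E])
    finally show "emeasure (distr (gauss C) (lborel_n p) ?T) E = emeasure (density (lborel_n p) ?h) E" .
  qed simp
qed

end

section \<open>A normal sample as a rotated Gaussian array\<close>

context spectral_cov begin

text \<open>
  The sample that a Gaussian array produces: row \<open>k\<close> of the array is mapped to \<open>\<Sigma>\<^sup>1\<^sup>/\<^sup>2 z\<^sub>k\<close>, and the orthogonal
  matrix \<open>H\<close> mixes the rows.
\<close>

definition smp :: "nat \<Rightarrow> (nat \<Rightarrow> nat \<Rightarrow> real) \<Rightarrow> real Matrix.vec \<Rightarrow> (nat \<times> nat \<Rightarrow> real) \<Rightarrow> nat \<Rightarrow> nat \<Rightarrow> real" where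
  "smp N H mu z i a = mu $ a + (\<Sum>k<N. H k i * emb (\<lambda>j. z (k, j)) a)"

lemma emb_cong: "(\<And>j. j < p \<Longrightarrow> y j = z j) \<Longrightarrow> emb y = emb z"
  by (auto simp: emb_def fun_eq_iff)

lemma emb_sum: "emb (\<lambda>j. \<Sum>k\<in>K. c k * z k j) a = (\<Sum>k\<in>K. c k * emb (z k) a)"
  unfolding emb_def sum_distrib_left sum_distrib_right
  by (subst sum.swap) (simp add: mult_ac)

definition rows_map :: "nat \<Rightarrow> real Matrix.vec \<Rightarrow> (nat \<times> nat \<Rightarrow> real) \<Rightarrow> nat \<Rightarrow> nat \<Rightarrow> real" where
  "rows_map N mu z = (\<lambda>i\<in>{..<N}. row_map mu (\<lambda>j\<in>C. z (i, j)))"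

lemma distr_rows_map:
  assumes N: "0 < N" and mu: "mu \<in> carrier_vec p"
    and h: "(\<lambda>y. ennreal (mvn_density p mu Sig y)) \<in> borel_measurable (lborel_n p)"
    and prob: "prob_space (density (lborel_n p) (\<lambda>y. ennreal (mvn_density p mu Sig y)))"
  shows "rows_map N mu \<in> gauss (grid N p) \<rightarrow>\<^sub>M Pi\<^sub>M {..<N} (\<lambda>_. lborel_n p)"
    and "distr (gauss (grid N p)) (Pi\<^sub>M {..<N} (\<lambda>_. lborel_n p)) (rows_map N mu)
     = Pi\<^sub>M {..<N} (\<lambda>_. density (lborel_n p) (\<lambda>y. ennreal (mvn_density p mu Sig y)))"
proof -
  let ?G = "gauss (grid N p)"
  interpret G: prob_space ?G by (rule prob_space_gauss)
  define Y where "Y i v = row_map mu (\<lambda>j\<in>C. v (i, j))" for i and v :: "nat \<times> nat \<Rightarrow> real"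
  have Ym: "Y i \<in> Pi\<^sub>M ({i} \<times> C) (\<lambda>_. borel) \<rightarrow>\<^sub>M lborel_n p" for i
  proof -
    have "(\<lambda>v. \<lambda>j\<in>C. v (i, j)) \<in> Pi\<^sub>M ({i} \<times> C) (\<lambda>_. borel) \<rightarrow>\<^sub>M Pi\<^sub>M C (\<lambda>_. borel :: real measure)"
      by (intro measurable_restrict measurable_component_singleton) auto
    from measurable_compose[OF this measurable_row_map[of mu]] show ?thesis
      unfolding Y_def[abs_def] using measurable_cong_sets[OF refl sets_leb] by blast
  qed
  have "G.indep_vars (\<lambda>i. Pi\<^sub>M ({i} \<times> C) (\<lambda>_. borel)) (\<lambda>i \<omega>. restrict (\<lambda>e. \<omega> e) ({i} \<times> C)) {..<N}"
    by (rule G.indep_vars_restrict[OF indep_gauss]) (auto simp: disjoint_family_on_def)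
  from G.indep_vars_compose2[OF this, of Y "\<lambda>_. lborel_n p"] Ym
  have "G.indep_vars (\<lambda>_. lborel_n p) (\<lambda>i \<omega>. Y i (restrict \<omega> ({i} \<times> C))) {..<N}" by simp
  moreover have Yr: "Y i (restrict \<omega> ({i} \<times> C)) = Y i \<omega>" for i \<omega>
    unfolding Y_def by (rule arg_cong[where f="row_map mu"]) auto
  ultimately have ind: "G.indep_vars (\<lambda>_. lborel_n p) Y {..<N}" by simp
  then have rv: "Y i \<in> ?G \<rightarrow>\<^sub>M lborel_n p" if "i \<in> {..<N}" for i
    using that by (auto simp: G.indep_vars_def)
  have rm: "rows_map N mu = (\<lambda>z. \<lambda>i\<in>{..<N}. Y i z)" by (auto simp: rows_map_def Y_def fun_eq_iff)
  show "rows_map N mu \<in> ?G \<rightarrow>\<^sub>M Pi\<^sub>M {..<N} (\<lambda>_. lborel_n p)"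
    unfolding rm by (rule measurable_restrict) (rule rv)
  have "distr ?G (Pi\<^sub>M {..<N} (\<lambda>_. lborel_n p)) (rows_map N mu) = Pi\<^sub>M {..<N} (\<lambda>i. distr ?G (lborel_n p) (Y i))"
    unfolding rm using G.indep_vars_iff_distr_eq_PiM'[of "{..<N}" Y "\<lambda>_. lborel_n p"] ind rv N by auto
  also have "\<dots> = Pi\<^sub>M {..<N} (\<lambda>_. density (lborel_n p) (\<lambda>y. ennreal (mvn_density p mu Sig y)))"
  proof (rule PiM_cong[OF refl])
    fix i assume i: "i \<in> {..<N}"
    have "distr ?G (gauss C) (\<lambda>z. \<lambda>j\<in>C. z (i, j)) = gauss C"
      by (rule gauss_reindex) (use i in \<open>auto simp: inj_on_def\<close>)
    moreover have "(\<lambda>z. \<lambda>j\<in>C. z (i, j)) \<in> ?G \<rightarrow>\<^sub>M gauss C"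
      by (intro measurable_restrict measurable_component_singleton) (use i in auto)
    moreover have "row_map mu \<in> gauss C \<rightarrow>\<^sub>M lborel_n p"
      using measurable_row_map measurable_cong_sets[OF sets_gauss sets_leb] by blast
    ultimately have "distr ?G (lborel_n p) (Y i) = distr (gauss C) (lborel_n p) (row_map mu)"
      using distr_distr[of "row_map mu" "gauss C" "lborel_n p" "\<lambda>z. \<lambda>j\<in>C. z (i, j)" ?G]
      by (simp add: comp_def Y_def[abs_def])
    also have "\<dots> = density (lborel_n p) (\<lambda>y. ennreal (mvn_density p mu Sig y))"
      by (rule gauss_row_map[OF mu h prob])
    finally show "distr ?G (lborel_n p) (Y i) = density (lborel_n p) (\<lambda>y. ennreal (mvn_density p mu Sig y))" .
  qed
  finally show "distr ?G (Pi\<^sub>M {..<N} (\<lambda>_. lborel_n p)) (rows_map N mu)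
     = Pi\<^sub>M {..<N} (\<lambda>_. density (lborel_n p) (\<lambda>y. ennreal (mvn_density p mu Sig y)))" .
qed

lemma sets_sample_space: "sets (Pi\<^sub>M {..<N} (\<lambda>_. lborel_n p)) = sets (Pi\<^sub>M {..<N} (\<lambda>_. Pi\<^sub>M C (\<lambda>_. borel :: real measure)))"
  by (intro sets_PiM_cong refl) simp

text \<open>
  Mixing the rows by an orthogonal matrix does not change the law of the Gaussian array, so the matrix \<open>H\<close>
  may be chosen freely, for instance such that row \<open>0\<close> isolates the sample mean.
\<close>

lemma rejection_prob_eq_gauss:
  assumes sample: "normal_sample M N p mu Sig X"
    and N: "0 < N" and mu: "mu \<in> carrier_vec p"
    and H: "orthonormal_on {..<N} {..<N} H"
    and local: "\<And>x x'. (\<And>i j. i < N \<Longrightarrow> j < p \<Longrightarrow> x i j = x' i j) \<Longrightarrow> rej x = rej x'"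
    and meas: "Measurable.pred (Pi\<^sub>M {..<N} (\<lambda>_. Pi\<^sub>M C (\<lambda>_. borel))) rej"
  shows "{z \<in> space (gauss (grid N p)). rej (smp N H mu z)} \<in> sets (gauss (grid N p))"
    and "rejection_prob M X rej = measure (gauss (grid N p)) {z \<in> space (gauss (grid N p)). rej (smp N H mu z)}"
proof -
  let ?G = "gauss (grid N p)" and ?Q = "Pi\<^sub>M {..<N} (\<lambda>_. lborel_n p)"
  let ?nu = "density (lborel_n p) (\<lambda>y. ennreal (mvn_density p mu Sig y))"
  interpret M: prob_space M using sample by (simp add: normal_sample_def)
  have indX: "M.indep_vars (\<lambda>_. lborel_n p) X {..<N}"
    and distX: "\<And>i. i < N \<Longrightarrow> distributed M (lborel_n p) (X i) (\<lambda>y. ennreal (mvn_density p mu Sig y))"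
    using sample by (auto simp: normal_sample_def)
  have X: "X i \<in> M \<rightarrow>\<^sub>M lborel_n p" if "i \<in> {..<N}" for i using distX that by (auto simp: distributed_def)
  have h: "(\<lambda>y. ennreal (mvn_density p mu Sig y)) \<in> borel_measurable (lborel_n p)"
    using distX[OF N] by (simp add: distributed_def)
  have dX: "distr M (lborel_n p) (X i) = ?nu" if "i < N" for i using distX[OF that] by (simp add: distributed_def)
  have prob: "prob_space ?nu" using M.prob_space_distr[OF X, of 0] dX[OF N] N by simp
  have XM: "(\<lambda>\<omega>. \<lambda>i\<in>{..<N}. X i \<omega>) \<in> M \<rightarrow>\<^sub>M ?Q" by (rule measurable_restrict) (rule X)
  have distM: "distr M ?Q (\<lambda>\<omega>. \<lambda>i\<in>{..<N}. X i \<omega>) = Pi\<^sub>M {..<N} (\<lambda>_. ?nu)"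
  proof -
    have "distr M ?Q (\<lambda>\<omega>. \<lambda>i\<in>{..<N}. X i \<omega>) = Pi\<^sub>M {..<N} (\<lambda>i. distr M (lborel_n p) (X i))"
      using M.indep_vars_iff_distr_eq_PiM'[of "{..<N}" X "\<lambda>_. lborel_n p"] indX X N by auto
    also have "\<dots> = Pi\<^sub>M {..<N} (\<lambda>_. ?nu)" by (rule PiM_cong[OF refl]) (simp add: dX)
    finally show ?thesis .
  qed
  note RM = distr_rows_map[OF N mu h prob]
  define E where "E = {x \<in> space ?Q. rej x}"
  have E: "E \<in> sets ?Q"
    using meas sets_eq_imp_space_eq[OF sets_sample_space[of N]] sets_sample_space[of N] unfolding E_def pred_def by simp
  \<comment> \<open>transposing the rotation\<close>
  define H' where "H' i k = H k i" for i k
  have H': "orthonormal_on {..<N} {..<N} H'"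
    unfolding orthonormal_on_def ip_def H'_def using orthonormal_columns[OF finite_lessThan H] by auto
  let ?A = "col_action H' :: nat \<times> nat \<Rightarrow> _"
  have A: "orthonormal_on (grid N p) (grid N p) ?A"
    by (rule orthonormal_col_action[OF _ _ H']) auto
  let ?T = "\<lambda>z. rows_map N mu (lin_map (grid N p) ?A z)"
  have smp: "?T z i j = smp N H mu z i j" if "i < N" "j < p" for z i j
  proof -
    have "(\<lambda>j\<in>C. lin_map (grid N p) ?A z (i, j)) l = (\<Sum>k<N. H k i * z (k, l))" if "l < p" for l
      using that \<open>i < N\<close> by (simp add: lin_map_def ip_col_action) (simp add: ip_def H'_def)
    then have "emb (\<lambda>j\<in>C. lin_map (grid N p) ?A z (i, j)) = emb (\<lambda>l. \<Sum>k<N. H k i * z (k, l))"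
      by (rule emb_cong)
    then show ?thesis using that by (simp add: rows_map_def row_map_def smp_def emb_sum)
  qed
  have T: "?T \<in> ?G \<rightarrow>\<^sub>M ?Q" by (rule measurable_compose[OF lin_map_measurable_gauss RM(1)])
  have dT: "distr ?G ?Q ?T = Pi\<^sub>M {..<N} (\<lambda>_. ?nu)"
  proof -
    have "distr ?G ?Q ?T = distr (distr ?G ?G (lin_map (grid N p) ?A)) ?Q (rows_map N mu)"
      using distr_distr[OF RM(1) lin_map_measurable_gauss, of ?A] by (simp add: comp_def)
    also have "\<dots> = distr ?G ?Q (rows_map N mu)"
      using gauss_orthogonal[OF _ A] by simp
    finally show ?thesis using RM(2) by simp
  qed
  have set1: "{z \<in> space ?G. rej (smp N H mu z)} = ?T -` E \<inter> space ?G"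
    unfolding E_def using measurable_space[OF T] local[of "?T _" "smp N H mu _"] smp by blast
  show "{z \<in> space ?G. rej (smp N H mu z)} \<in> sets ?G"
    unfolding set1 by (rule measurable_sets[OF T E])
  have set2: "{\<omega> \<in> space M. rej (\<lambda>i. X i \<omega>)} = (\<lambda>\<omega>. \<lambda>i\<in>{..<N}. X i \<omega>) -` E \<inter> space M"
  proof -
    have "rej (\<lambda>i. X i \<omega>) = rej (\<lambda>i\<in>{..<N}. X i \<omega>)" for \<omega> by (rule local) simp
    then show ?thesis unfolding E_def using measurable_space[OF XM] by blast
  qed
  show "rejection_prob M X rej = measure ?G {z \<in> space ?G. rej (smp N H mu z)}"
    unfolding rejection_prob_def set1 set2
      measure_distr[OF XM E, symmetric] measure_distr[OF T E, symmetric] distM dT ..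
qed

end

section \<open>The statistics as functions of the Gaussian array\<close>

text \<open>
  For \<open>S = c (\<Sum>k. y\<^sub>k y\<^sub>k')\<close> the traces of powers become sums over cycles of inner products, which depend
  only on the Gram matrix of the vectors \<open>y\<^sub>k\<close>.
\<close>

lemma trace_sum_outer:
  fixes y :: "'k \<Rightarrow> nat \<Rightarrow> real"
  assumes S: "S = Matrix.mat p p (\<lambda>(a, b). c * (\<Sum>k\<in>K. y k a * y k b))"
  shows "trace_mat S = c * (\<Sum>k\<in>K. ip {..<p} (y k) (y k))"
    and "trace_mat (S ^\<^sub>m 2) = c^2 * (\<Sum>k\<in>K. \<Sum>l\<in>K. (ip {..<p} (y k) (y l))^2)"
    and "trace_mat (S ^\<^sub>m 3) = c^3 * (\<Sum>k\<in>K. \<Sum>l\<in>K. \<Sum>m\<in>K.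
       ip {..<p} (y k) (y l) * ip {..<p} (y l) (y m) * ip {..<p} (y m) (y k))"
proof -
  let ?g = "\<lambda>k l. ip {..<p} (y k) (y l)"
  have Sc: "S \<in> carrier_mat p p" by (simp add: S)
  have e1: "S $$ (a, b) = c * (\<Sum>k\<in>K. y k a * y k b)" if "a < p" "b < p" for a b
    using that by (simp add: S)
  have contract: "(\<Sum>d<p. (\<Sum>k\<in>K. f k * y k d) * (c * (\<Sum>l\<in>K. y l d * y l b)))
      = c * (\<Sum>l\<in>K. (\<Sum>k\<in>K. f k * ?g k l) * y l b)" for f b
  proof -
    have "(\<Sum>d<p. (\<Sum>k\<in>K. f k * y k d) * (c * (\<Sum>l\<in>K. y l d * y l b)))
       = (\<Sum>d<p. \<Sum>k\<in>K. \<Sum>l\<in>K. c * f k * (y k d * y l d) * y l b)"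
      unfolding sum_distrib_left sum_distrib_right
      by (rule sum.cong[OF refl], subst sum.swap) (simp add: mult_ac)
    also have "\<dots> = (\<Sum>k\<in>K. \<Sum>d<p. \<Sum>l\<in>K. c * f k * (y k d * y l d) * y l b)" by (rule sum.swap)
    also have "\<dots> = (\<Sum>k\<in>K. \<Sum>l\<in>K. \<Sum>d<p. c * f k * (y k d * y l d) * y l b)"
      by (rule sum.cong[OF refl]) (rule sum.swap)
    also have "\<dots> = (\<Sum>k\<in>K. \<Sum>l\<in>K. c * (f k * ?g k l * y l b))"
      unfolding ip_def by (intro sum.cong refl) (simp add: sum_distrib_left sum_distrib_right mult_ac)
    also have "\<dots> = (\<Sum>l\<in>K. \<Sum>k\<in>K. c * (f k * ?g k l * y l b))" by (rule sum.swap)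
    also have "\<dots> = c * (\<Sum>l\<in>K. (\<Sum>k\<in>K. f k * ?g k l) * y l b)"
      by (simp add: sum_distrib_left sum_distrib_right)
    finally show ?thesis .
  qed
  have tr: "(\<Sum>a<p. \<Sum>l\<in>K. (\<Sum>k\<in>K. y k a * h k l) * y l a) = (\<Sum>k\<in>K. \<Sum>l\<in>K. ?g k l * h k l)" for h
  proof -
    have "(\<Sum>a<p. \<Sum>l\<in>K. (\<Sum>k\<in>K. y k a * h k l) * y l a) = (\<Sum>a<p. \<Sum>l\<in>K. \<Sum>k\<in>K. y k a * y l a * h k l)"
      by (simp add: sum_distrib_right sum_distrib_left mult_ac)
    also have "\<dots> = (\<Sum>l\<in>K. \<Sum>a<p. \<Sum>k\<in>K. y k a * y l a * h k l)" by (rule sum.swap)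
    also have "\<dots> = (\<Sum>l\<in>K. \<Sum>k\<in>K. \<Sum>a<p. y k a * y l a * h k l)"
      by (rule sum.cong[OF refl]) (rule sum.swap)
    also have "\<dots> = (\<Sum>l\<in>K. \<Sum>k\<in>K. ?g k l * h k l)" by (simp add: ip_def sum_distrib_right)
    also have "\<dots> = (\<Sum>k\<in>K. \<Sum>l\<in>K. ?g k l * h k l)" by (rule sum.swap)
    finally show ?thesis .
  qed
  show "trace_mat S = c * (\<Sum>k\<in>K. ?g k k)"
  proof -
    have "trace_mat S = (\<Sum>a<p. c * (\<Sum>k\<in>K. y k a * y k a))" using Sc e1 by (simp add: trace_mat_def)
    also have "\<dots> = c * (\<Sum>k\<in>K. ?g k k)" unfolding ip_def sum_distrib_left by (rule sum.swap)
    finally show ?thesis .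
  qed
  have e2: "(S * S) $$ (a, b) = c * (c * (\<Sum>l\<in>K. (\<Sum>k\<in>K. y k a * ?g k l) * y l b))" if "a < p" "b < p" for a b
  proof -
    have "(S * S) $$ (a, b) = (\<Sum>d<p. S $$ (a, d) * S $$ (d, b))"
      using Sc that by (simp add: scalar_prod_def atLeast0LessThan)
    also have "\<dots> = c * (\<Sum>d<p. (\<Sum>k\<in>K. y k a * y k d) * (c * (\<Sum>l\<in>K. y l d * y l b)))"
      using that by (simp add: e1 sum_distrib_left mult_ac)
    finally show ?thesis unfolding contract .
  qed
  have S2: "S ^\<^sub>m 2 = S * S" using Sc by (simp add: numeral_2_eq_2)
  have S3: "S ^\<^sub>m 3 = S * S * S" using Sc by (simp add: numeral_3_eq_3)
  show "trace_mat (S ^\<^sub>m 2) = c^2 * (\<Sum>k\<in>K. \<Sum>l\<in>K. (?g k l)^2)"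
  proof -
    have "trace_mat (S ^\<^sub>m 2) = c * c * (\<Sum>a<p. \<Sum>l\<in>K. (\<Sum>k\<in>K. y k a * ?g k l) * y l a)"
      unfolding S2 trace_mat_def using Sc e2 by (simp add: sum_distrib_left mult.assoc)
    then show ?thesis unfolding tr by (simp add: power2_eq_square)
  qed
  show "trace_mat (S ^\<^sub>m 3) = c^3 * (\<Sum>k\<in>K. \<Sum>l\<in>K. \<Sum>m\<in>K. ?g k l * ?g l m * ?g m k)"
  proof -
    have e3: "(S * S * S) $$ (a, a) = c * c * c * (\<Sum>m\<in>K. (\<Sum>k\<in>K. y k a * (\<Sum>l\<in>K. ?g k l * ?g l m)) * y m a)" if "a < p" for a
    proof -
      have "(A * S) $$ (a, a) = (\<Sum>d<p. A $$ (a, d) * S $$ (d, a))" if "A \<in> carrier_mat p p" for A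
        using Sc that \<open>a < p\<close> by (simp add: scalar_prod_def atLeast0LessThan)
      from this[of "S * S"] have "(S * S * S) $$ (a, a) = (\<Sum>d<p. (S * S) $$ (a, d) * S $$ (d, a))"
        using Sc by (simp only: mult_carrier_mat[OF Sc Sc])
      also have "\<dots> = c * c * (\<Sum>d<p. (\<Sum>l\<in>K. (\<Sum>k\<in>K. y k a * ?g k l) * y l d) * (c * (\<Sum>l\<in>K. y l d * y l a)))"
        using that by (simp add: e1 e2 sum_distrib_left mult_ac)
      also have "\<dots> = c * c * (c * (\<Sum>m\<in>K. (\<Sum>l\<in>K. (\<Sum>k\<in>K. y k a * ?g k l) * ?g l m) * y m a))"
        unfolding contract ..
      also have "(\<lambda>m. \<Sum>l\<in>K. (\<Sum>k\<in>K. y k a * ?g k l) * ?g l m) = (\<lambda>m. \<Sum>k\<in>K. y k a * (\<Sum>l\<in>K. ?g k l * ?g l m))"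
        unfolding sum_distrib_left sum_distrib_right by (rule ext, subst sum.swap) (simp add: mult_ac)
      finally show ?thesis by (simp add: mult_ac)
    qed
    have "trace_mat (S ^\<^sub>m 3) = c * c * c * (\<Sum>a<p. \<Sum>m\<in>K. (\<Sum>k\<in>K. y k a * (\<Sum>l\<in>K. ?g k l * ?g l m)) * y m a)"
      unfolding S3 trace_mat_def using Sc e3 by (simp add: sum_distrib_left mult.assoc)
    also have "\<dots> = c^3 * (\<Sum>k\<in>K. \<Sum>m\<in>K. ?g k m * (\<Sum>l\<in>K. ?g k l * ?g l m))"
      unfolding tr by (simp add: power3_eq_cube)
    also have "(\<Sum>k\<in>K. \<Sum>m\<in>K. ?g k m * (\<Sum>l\<in>K. ?g k l * ?g l m)) = (\<Sum>k\<in>K. \<Sum>l\<in>K. \<Sum>m\<in>K. ?g k l * ?g l m * ?g m k)"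
      unfolding sum_distrib_left
      by (rule sum.cong[OF refl], subst sum.swap) (intro sum.cong refl, simp add: ip_commute[of _ "y _" "y _"] mult_ac)
    finally show ?thesis .
  qed
qed

context spectral_cov begin

lemma a_pop_Sig:
  shows "a_pop p Sig 1 = (\<Sum>j<p. lam j) / p" "a_pop p Sig 2 = (\<Sum>j<p. (lam j)^2) / p"
    "a_pop p Sig 3 = (\<Sum>j<p. (lam j)^3) / p"
proof -
  define y where "y j a = sqrt (lam j) * U j a" for j a
  have ipy: "ip C (y j) (y k) = (if j = k then lam j else 0)" if "j < p" "k < p" for j k
  proof -
    have "ip C (y j) (y k) = sqrt (lam j) * (sqrt (lam k) * ip C (U j) (U k))"
      unfolding y_def ip_linear_left ip_linear_right ..
    then show ?thesis using U that lam[OF that(1)] by (auto simp: orthonormal_on_def)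
  qed
  have S: "Sig = Matrix.mat p p (\<lambda>(a, b). 1 * (\<Sum>k\<in>C. y k a * y k b))"
  proof (rule eq_matI)
    fix a b assume "a < dim_row (Matrix.mat p p (\<lambda>(a, b). 1 * (\<Sum>k\<in>C. y k a * y k b)))"
      "b < dim_col (Matrix.mat p p (\<lambda>(a, b). 1 * (\<Sum>k\<in>C. y k a * y k b)))"
    then have ab: "a < p" "b < p" by auto
    have "y k a * y k b = lam k * U k a * U k b" if "k < p" for k
    proof -
      have "y k a * y k b = (sqrt (lam k) * sqrt (lam k)) * U k a * U k b" by (simp only: y_def mult_ac)
      then show ?thesis using lam[OF that] by simp
    qed
    then show "Sig $$ (a, b) = Matrix.mat p p (\<lambda>(a, b). 1 * (\<Sum>k\<in>C. y k a * y k b)) $$ (a, b)"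
      using ab Sig_entry by simp
  qed (use Sig in auto)
  note tr = trace_sum_outer[OF S]
  have p1: "Sig ^\<^sub>m 1 = Sig" using Sig by simp
  show "a_pop p Sig 1 = (\<Sum>j<p. lam j) / p"
    unfolding a_pop_def p1 tr(1) using ipy by simp
  show "a_pop p Sig 2 = (\<Sum>j<p. (lam j)^2) / p"
    unfolding a_pop_def tr(2) using ipy by (simp add: if_distrib[of "\<lambda>x. x^2"] cong: if_cong)
  have "(\<Sum>l<p. \<Sum>m<p. ip C (y k) (y l) * ip C (y l) (y m) * ip C (y m) (y k)) = (lam k)^3" if k: "k < p" for k
  proof -
    have "(\<Sum>l<p. \<Sum>m<p. ip C (y k) (y l) * ip C (y l) (y m) * ip C (y m) (y k))
       = (\<Sum>l<p. \<Sum>m<p. if m = k then (if l = k then (lam k)^3 else 0) else 0)"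
      using k by (intro sum.cong refl) (auto simp: ipy power3_eq_cube)
    then show ?thesis using k by simp
  qed
  then show "a_pop p Sig 3 = (\<Sum>j<p. (lam j)^3) / p"
    unfolding a_pop_def tr(3) by simp
qed

end

text \<open>
  The first row of \<open>H\<close> is constant, so row \<open>0\<close> of the array determines the sample mean and the other rows
  sum up to zero over the sample: they determine the centred observations.
\<close>

locale sample_frame = spectral_cov +
  fixes N :: nat and H :: "nat \<Rightarrow> nat \<Rightarrow> real" and mu mu0 :: "real Matrix.vec"
  assumes N: "1 < N" and H: "orthonormal_on {..<N} {..<N} H" and H0: "\<And>i. i < N \<Longrightarrow> H 0 i = 1 / sqrt N"
    and mu: "mu \<in> carrier_vec p" and mu0: "mu0 \<in> carrier_vec p"
begin

definition x :: "(nat \<times> nat \<Rightarrow> real) \<Rightarrow> nat \<Rightarrow> nat \<Rightarrow> real" where "x z = smp N H mu z"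
definition y :: "(nat \<times> nat \<Rightarrow> real) \<Rightarrow> nat \<Rightarrow> nat \<Rightarrow> real" where "y z k = emb (\<lambda>j. z (k, j))"
definition g :: "(nat \<times> nat \<Rightarrow> real) \<Rightarrow> nat \<Rightarrow> nat \<Rightarrow> real" where "g z k l = (\<Sum>j<p. lam j * z (k, j) * z (l, j))"
definition m :: "nat \<Rightarrow> real" where "m j = sqrt N * ip C (\<lambda>a. mu $ a - mu0 $ a) (U j) / sqrt (lam j)"
definition n :: real where "n = real N - 1"

lemma n_pos: "0 < n" using N by (simp add: n_def)

lemma ip_y: "ip C (y z k) (y z l) = g z k l"
  unfolding y_def g_def by (rule ip_emb_emb)

lemma sum_H: "k < N \<Longrightarrow> (\<Sum>i<N. H k i) = (if k = 0 then sqrt N else 0)"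
proof -
  assume k: "k < N"
  have "(\<Sum>i<N. H k i) = (\<Sum>i<N. sqrt N * (H k i * H 0 i))"
    by (intro sum.cong refl) (use N H0 in auto)
  then have "(\<Sum>i<N. H k i) = sqrt N * ip {..<N} (H k) (H 0)"
    by (simp add: ip_def sum_distrib_left)
  then show ?thesis using H k N by (auto simp: orthonormal_on_def)
qed

lemma mean_x: "a < p \<Longrightarrow> (\<Sum>i<N. x z i a) / N = mu $ a + y z 0 a / sqrt N"
proof -
  have "(\<Sum>i<N. x z i a) = N * mu $ a + (\<Sum>i<N. \<Sum>k<N. H k i * y z k a)"
    by (simp add: x_def smp_def y_def sum.distrib)
  also have "(\<Sum>i<N. \<Sum>k<N. H k i * y z k a) = (\<Sum>k<N. \<Sum>i<N. H k i * y z k a)" by (rule sum.swap)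
  also have "\<dots> = (\<Sum>k<N. (if k = 0 then sqrt N * y z 0 a else 0))"
    by (intro sum.cong refl) (simp add: sum_H flip: sum_distrib_right)
  also have "\<dots> = sqrt N * y z 0 a" using N by simp
  finally have "(\<Sum>i<N. x z i a) / N = mu $ a + sqrt N / N * y z 0 a" using N by (simp add: field_simps)
  also have "sqrt N / N = 1 / sqrt N" using N by (simp add: real_div_sqrt field_simps)
  finally show ?thesis by simp
qed

lemma sample_mean_x: "sample_mean N p (x z) = Matrix.vec p (\<lambda>a. mu $ a + y z 0 a / sqrt N)"
  unfolding sample_mean_def using mean_x by (intro eq_vecI) auto

lemma centered_x: "i < N \<Longrightarrow> a < p \<Longrightarrow> x z i a - sample_mean N p (x z) $ a = (\<Sum>k\<in>{1..<N}. H k i * y z k a)"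
proof -
  assume i: "i < N" and a: "a < p"
  have "{..<N} = insert 0 {1..<N}" using N by auto
  then have "x z i a = mu $ a + H 0 i * y z 0 a + (\<Sum>k\<in>{1..<N}. H k i * y z k a)"
    by (simp add: x_def smp_def y_def)
  then show ?thesis using i a by (simp add: sample_mean_x H0)
qed

lemma sample_cov_x: "sample_cov N p (x z) = Matrix.mat p p (\<lambda>(a, b). 1 / n * (\<Sum>k\<in>{1..<N}. y z k a * y z k b))"
proof -
  have "(\<Sum>i<N. (x z i a - sample_mean N p (x z) $ a) * (x z i b - sample_mean N p (x z) $ b))
      = (\<Sum>k\<in>{1..<N}. y z k a * y z k b)" if "a < p" "b < p" for a b
  proof -
    have "(\<Sum>i<N. (x z i a - sample_mean N p (x z) $ a) * (x z i b - sample_mean N p (x z) $ b))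
        = (\<Sum>i<N. \<Sum>k\<in>{1..<N}. \<Sum>l\<in>{1..<N}. H k i * H l i * (y z k a * y z l b))"
      using that by (intro sum.cong refl) (simp add: centered_x sum_product mult_ac)
    also have "\<dots> = (\<Sum>k\<in>{1..<N}. \<Sum>i<N. \<Sum>l\<in>{1..<N}. H k i * H l i * (y z k a * y z l b))" by (rule sum.swap)
    also have "\<dots> = (\<Sum>k\<in>{1..<N}. \<Sum>l\<in>{1..<N}. \<Sum>i<N. H k i * H l i * (y z k a * y z l b))"
      by (rule sum.cong[OF refl]) (rule sum.swap)
    also have "\<dots> = (\<Sum>k\<in>{1..<N}. \<Sum>l\<in>{1..<N}. (if l = k then y z k a * y z k b else 0))"
    proof (intro sum.cong refl)
      fix k l assume "k \<in> {1..<N}" "l \<in> {1..<N}"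
      then have "ip {..<N} (H k) (H l) = (if k = l then 1 else 0)" using H by (auto simp: orthonormal_on_def)
      then show "(\<Sum>i<N. H k i * H l i * (y z k a * y z l b)) = (if l = k then y z k a * y z k b else 0)"
        by (auto simp: ip_def simp flip: sum_distrib_right)
    qed
    also have "\<dots> = (\<Sum>k\<in>{1..<N}. y z k a * y z k b)" by (intro sum.cong refl) simp
    finally show ?thesis .
  qed
  then show ?thesis unfolding sample_cov_def n_def by (intro eq_matI) auto
qed

lemmas trace_cov = trace_sum_outer[OF sample_cov_x, unfolded ip_y]

lemma emb_shifted: "a < p \<Longrightarrow> emb (shifted_row m z) a = y z 0 a + sqrt N * (mu $ a - mu0 $ a)"
proof -
  assume a: "a < p"
  have "emb (shifted_row m z) a = y z 0 a + (\<Sum>j<p. sqrt (lam j) * m j * U j a)"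
    by (simp add: emb_def y_def shifted_row_def algebra_simps sum.distrib)
  also have "(\<Sum>j<p. sqrt (lam j) * m j * U j a) = sqrt N * (\<Sum>j<p. ip C (\<lambda>a. mu $ a - mu0 $ a) (U j) * U j a)"
    unfolding sum_distrib_left m_def by (intro sum.cong refl) (use lam in force)
  also have "\<dots> = sqrt N * (mu $ a - mu0 $ a)" using expand_U[OF a, of "\<lambda>a. mu $ a - mu0 $ a"] by simp
  finally show ?thesis .
qed

lemma mean_minus_mu0: "sample_mean N p (x z) - mu0 = Matrix.vec p (\<lambda>a. emb (shifted_row m z) a / sqrt N)"
  using mu0 N by (intro eq_vecI) (auto simp: sample_mean_x emb_shifted field_simps)

lemma dempster_x: "dempster_D N p mu0 (x z)
    = (\<Sum>j<p. lam j * (shifted_row m z j)^2) / trace_mat (sample_cov N p (x z))"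
proof -
  have "(sample_mean N p (x z) - mu0) \<bullet> (sample_mean N p (x z) - mu0)
      = (\<Sum>a<p. (emb (shifted_row m z) a / sqrt N) * (emb (shifted_row m z) a / sqrt N))"
    unfolding mean_minus_mu0 by (simp add: scalar_prod_def atLeast0LessThan)
  also have "\<dots> = ip C (emb (shifted_row m z)) (emb (shifted_row m z)) / N"
    by (simp add: ip_def sum_divide_distrib)
  finally show ?thesis using N
    by (simp add: dempster_D_def ip_emb_emb power2_eq_square mult.assoc)
qed

text \<open>
  With \<open>A = \<Sigma>\<^sup>1\<^sup>/\<^sup>2\<close> one has \<open>n S = A (Z' Z) A'\<close> and the centred mean is \<open>A w / \<surd>N\<close>, so \<open>A\<close> cancels in \<open>T\<^sup>2\<close>.
\<close>

lemma hotelling_x: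
  assumes ci: "col_indep {1..<N} p z"
  shows "hotelling_T2 N p mu0 (x z) = n * inv_form {1..<N} p (shifted_row m z) z"
proof -
  let ?R = "{1..<N}" and ?w = "shifted_row m z"
  obtain u where u: "\<And>j. j < p \<Longrightarrow> (\<Sum>k\<in>?R. z (k, j) * (\<Sum>l<p. u l * z (k, l))) = ?w j"
    using inv_form_solution[OF _ ci, of ?w] by auto
  have iv: "inv_form ?R p ?w z = (\<Sum>j<p. ?w j * u j)" by (rule inv_form_eq[OF _ ci u]) auto
  have ap: "(\<Sum>b<p. sample_cov N p (x z) $$ (a, b) * v b) = 1 / n * (\<Sum>k\<in>?R. y z k a * ip C (y z k) v)"
    if "a < p" for a v
  proof -
    have "(\<Sum>b<p. sample_cov N p (x z) $$ (a, b) * v b) = (\<Sum>b<p. \<Sum>k\<in>?R. 1 / n * y z k a * (y z k b * v b))"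
      using that by (simp add: sample_cov_x sum_distrib_left sum_distrib_right mult_ac)
    also have "\<dots> = (\<Sum>k\<in>?R. \<Sum>b<p. 1 / n * y z k a * (y z k b * v b))" by (rule sum.swap)
    finally show ?thesis by (simp add: ip_def sum_distrib_left mult.assoc)
  qed
  have yv: "ip C (y z k) v = (\<Sum>j<p. sqrt (lam j) * ip C v (U j) * z (k, j))" for k v
  proof -
    have "ip C (y z k) v = (\<Sum>j<p. ip C (y z k) (U j) * ip C v (U j))"
      by (rule orthonormal_parseval[symmetric, OF _ U]) simp
    then show ?thesis by (simp add: y_def ip_emb_U mult_ac)
  qed
  have det: "Determinant.det (sample_cov N p (x z)) \<noteq> 0"
  proof
    have Sc: "sample_cov N p (x z) \<in> carrier_mat p p" by (simp add: sample_cov_x)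
    assume "Determinant.det (sample_cov N p (x z)) = 0"
    then obtain t where t: "t \<in> carrier_vec p" "t \<noteq> 0\<^sub>v p" "sample_cov N p (x z) *\<^sub>v t = 0\<^sub>v p"
      using det_0_iff_vec_prod_zero[OF Sc] by blast
    define v where "v j = t $ j" for j
    have 0: "1 / n * (\<Sum>k\<in>?R. y z k a * ip C (y z k) v) = 0" if "a < p" for a
    proof -
      have "(\<Sum>b<p. sample_cov N p (x z) $$ (a, b) * v b) = (sample_cov N p (x z) *\<^sub>v t) $ a"
        using Sc t(1) that by (simp add: scalar_prod_def atLeast0LessThan v_def)
      then show ?thesis using t(3) that ap[OF that] by simp
    qed
    have "0 = (\<Sum>a<p. v a * (\<Sum>k\<in>?R. y z k a * ip C (y z k) v))" using 0 n_pos by simp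
    also have "\<dots> = (\<Sum>a<p. \<Sum>k\<in>?R. v a * y z k a * ip C (y z k) v)" by (simp add: sum_distrib_left mult.assoc)
    also have "\<dots> = (\<Sum>k\<in>?R. \<Sum>a<p. v a * y z k a * ip C (y z k) v)" by (rule sum.swap)
    also have "\<dots> = (\<Sum>k\<in>?R. ip C (y z k) v * ip C (y z k) v)"
      by (simp add: ip_def sum_distrib_right mult_ac)
    finally have "\<forall>k\<in>?R. ip C (y z k) v = 0" by (simp add: sum_nonneg_eq_0_iff)
    then have "\<forall>j<p. sqrt (lam j) * ip C v (U j) = 0"
      using ci unfolding yv col_indep_def by (elim allE[of _ "\<lambda>j. sqrt (lam j) * ip C v (U j)"]) blast
    then have "ip C v (U j) = 0" if "j < p" for j using lam[OF that] that by auto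
    then have "v a = 0" if "a < p" for a using expand_U[OF that, of v] by simp
    then have "t = 0\<^sub>v p" using t(1) by (intro eq_vecI) (auto simp: v_def)
    then show False using t by simp
  qed
  define v where "v b = n / sqrt N * (\<Sum>j<p. u j / sqrt (lam j) * U j b)" for b
  have vU: "ip C v (U j) = n / sqrt N * (u j / sqrt (lam j))" if "j < p" for j
    unfolding v_def[abs_def] ip_linear_left(3) using ip_orthonormal_sum[OF U, of j "\<lambda>j. u j / sqrt (lam j)"] that by simp
  have yv': "ip C (y z k) v = n / sqrt N * (\<Sum>j<p. u j * z (k, j))" for k
    unfolding yv sum_distrib_left by (intro sum.cong refl) (use lam in \<open>force simp: vU\<close>)
  have sol: "(\<Sum>b<p. sample_cov N p (x z) $$ (a, b) * v b) = emb ?w a / sqrt N" if "a < p" for a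
  proof -
    have "(\<Sum>b<p. sample_cov N p (x z) $$ (a, b) * v b) = 1 / sqrt N * (\<Sum>k\<in>?R. (\<Sum>j<p. u j * z (k, j)) * y z k a)"
      unfolding ap[OF that] yv' using n_pos by (simp add: sum_distrib_left mult_ac)
    also have "(\<Sum>k\<in>?R. (\<Sum>j<p. u j * z (k, j)) * y z k a) = emb (\<lambda>j. \<Sum>k\<in>?R. (\<Sum>l<p. u l * z (k, l)) * z (k, j)) a"
      unfolding emb_sum y_def ..
    also have "emb (\<lambda>j. \<Sum>k\<in>?R. (\<Sum>l<p. u l * z (k, l)) * z (k, j)) = emb ?w"
      by (rule emb_cong) (use u in \<open>simp add: mult.commute\<close>)
    finally show ?thesis by simp
  qed
  have "quad_form (inv_mat (sample_cov N p (x z))) (sample_mean N p (x z) - mu0) = (\<Sum>a<p. emb ?w a / sqrt N * v a)"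
    unfolding mean_minus_mu0 by (rule quad_form_inv_solution[OF _ det sol]) (simp add: sample_cov_x)
  also have "\<dots> = 1 / sqrt N * ip C (emb ?w) v" by (simp add: ip_def sum_distrib_left)
  also have "ip C (emb ?w) v = (\<Sum>j<p. ip C (emb ?w) (U j) * ip C v (U j))"
    by (rule orthonormal_parseval[symmetric, OF _ U]) simp
  also have "\<dots> = n / sqrt N * (\<Sum>j<p. ?w j * u j)"
    unfolding sum_distrib_left by (intro sum.cong refl) (use lam in \<open>force simp: vU ip_emb_U\<close>)
  finally have "quad_form (inv_mat (sample_cov N p (x z))) (sample_mean N p (x z) - mu0)
     = n / (sqrt N * sqrt N) * inv_form ?R p ?w z" unfolding iv by simp
  then show ?thesis using N by (simp add: hotelling_T2_def)
qed

text \<open>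
  The three noncentralities in the eigenbasis, where \<open>\<surd>N \<Sigma>\<^sup>-\<^sup>1\<^sup>/\<^sup>2 (\<mu> - \<mu>0)\<close> has the coordinates \<open>m j\<close>.
\<close>

lemma Delta_sums:
  shows "real N * Delta2 mu mu0 Sig = (\<Sum>j<p. (m j)^2)"
    "real N * DeltaI2 mu mu0 = (\<Sum>j<p. lam j * (m j)^2)"
    "real N * DeltaS2 mu mu0 Sig = (\<Sum>j<p. (lam j)^2 * (m j)^2)"
proof -
  let ?d = "\<lambda>a. mu $ a - mu0 $ a"
  have v: "mu - mu0 = Matrix.vec p ?d" using mu mu0 by (intro eq_vecI) auto
  have m2: "(m j)^2 = real N * (ip C ?d (U j))^2 / lam j" if "j < p" for j
    using lam[OF that] by (simp add: m_def power_mult_distrib power_divide)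
  show "real N * Delta2 mu mu0 Sig = (\<Sum>j<p. (m j)^2)"
    unfolding Delta2_def v quad_form_inv_Sig by (simp add: m2 sum_distrib_left)
  have "DeltaI2 mu mu0 = ip C ?d ?d" unfolding DeltaI2_def v by (simp add: scalar_prod_def atLeast0LessThan ip_def)
  also have "\<dots> = (\<Sum>j<p. ip C ?d (U j) * ip C ?d (U j))"
    by (rule orthonormal_parseval[symmetric, OF _ U]) simp
  finally have "real N * DeltaI2 mu mu0 = (\<Sum>j<p. real N * (ip C ?d (U j))^2)"
    by (simp add: sum_distrib_left power2_eq_square)
  also have "\<dots> = (\<Sum>j<p. lam j * (m j)^2)" by (intro sum.cong refl) (use lam in \<open>force simp: m2\<close>)
  finally show "real N * DeltaI2 mu mu0 = (\<Sum>j<p. lam j * (m j)^2)" .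
  have "DeltaS2 mu mu0 Sig = (\<Sum>a<p. ?d a * (\<Sum>b<p. Sig $$ (a, b) * ?d b))"
    unfolding DeltaS2_def v quad_form_def using Sig by (simp add: scalar_prod_def atLeast0LessThan)
  also have "\<dots> = (\<Sum>a<p. ?d a * (\<Sum>j<p. lam j * ip C ?d (U j) * U j a))" using Sig_apply[of _ ?d] by simp
  also have "\<dots> = ip C ?d (\<lambda>a. \<Sum>j<p. lam j * ip C ?d (U j) * U j a)" by (simp add: ip_def)
  also have "\<dots> = (\<Sum>j<p. lam j * (ip C ?d (U j))^2)" unfolding ip_linear_right by (simp add: power2_eq_square mult.assoc)
  finally have "real N * DeltaS2 mu mu0 Sig = (\<Sum>j<p. real N * (lam j * (ip C ?d (U j))^2))" by (simp add: sum_distrib_left)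
  also have "\<dots> = (\<Sum>j<p. (lam j)^2 * (m j)^2)"
  proof (intro sum.cong refl)
    fix j assume "j \<in> C"
    then have j: "j < p" and "lam j \<noteq> 0" using lam by force+
    then show "real N * (lam j * (ip C ?d (U j))^2) = (lam j)^2 * (m j)^2"
      unfolding m2[OF j] by (simp add: power2_eq_square)
  qed
  finally show "real N * DeltaS2 mu mu0 Sig = (\<Sum>j<p. (lam j)^2 * (m j)^2)" .
qed

end

section \<open>Convergence in probability along a sequence of spaces\<close>

text \<open>
  Outer probabilities, so that exceptional sets need no proof of measurability.
\<close>

definition vanishing :: "(nat \<Rightarrow> 'a measure) \<Rightarrow> (nat \<Rightarrow> 'a set) \<Rightarrow> bool" where
  "vanishing M A \<longleftrightarrow> (\<forall>\<delta>>0. \<forall>\<^sub>F k in sequentially. \<exists>B\<in>sets (M k). A k \<subseteq> B \<and> measure (M k) B < \<delta>)"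

definition tends_prob :: "(nat \<Rightarrow> 'a measure) \<Rightarrow> (nat \<Rightarrow> 'a \<Rightarrow> 'b::metric_space) \<Rightarrow> 'b \<Rightarrow> bool" where
  "tends_prob M f c \<longleftrightarrow> (\<forall>\<epsilon>>0. vanishing M (\<lambda>k. {\<omega> \<in> space (M k). \<epsilon> \<le> dist (f k \<omega>) c}))"

locale prob_seq =
  fixes M :: "nat \<Rightarrow> 'a measure"
  assumes prob: "\<And>k. prob_space (M k)"
begin

lemma vanishing_mono:
  assumes "vanishing M A'" "\<forall>\<^sub>F k in sequentially. A k \<subseteq> A' k"
  shows "vanishing M A"
  unfolding vanishing_def
proof (intro allI impI)
  fix \<delta> :: real assume "\<delta> > 0"
  with assms(1) have "\<forall>\<^sub>F k in sequentially. \<exists>B\<in>sets (M k). A' k \<subseteq> B \<and> measure (M k) B < \<delta>"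
    by (simp add: vanishing_def)
  with assms(2) show "\<forall>\<^sub>F k in sequentially. \<exists>B\<in>sets (M k). A k \<subseteq> B \<and> measure (M k) B < \<delta>"
    by eventually_elim blast
qed

lemma vanishing_Un:
  assumes "vanishing M A" "vanishing M A'"
  shows "vanishing M (\<lambda>k. A k \<union> A' k)"
  unfolding vanishing_def
proof (intro allI impI)
  fix \<delta> :: real assume "\<delta> > 0"
  then have "\<delta> / 2 > 0" by simp
  with assms have "\<forall>\<^sub>F k in sequentially. \<exists>B\<in>sets (M k). A k \<subseteq> B \<and> measure (M k) B < \<delta> / 2"
    "\<forall>\<^sub>F k in sequentially. \<exists>B\<in>sets (M k). A' k \<subseteq> B \<and> measure (M k) B < \<delta> / 2"
    unfolding vanishing_def by blast+
  then show "\<forall>\<^sub>F k in sequentially. \<exists>B\<in>sets (M k). A k \<union> A' k \<subseteq> B \<and> measure (M k) B < \<delta>"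
  proof eventually_elim
    case (elim k)
    then obtain B B' where B: "B \<in> sets (M k)" "A k \<subseteq> B" "measure (M k) B < \<delta> / 2"
      "B' \<in> sets (M k)" "A' k \<subseteq> B'" "measure (M k) B' < \<delta> / 2" by blast
    interpret prob_space "M k" by (rule prob)
    have "measure (M k) (B \<union> B') \<le> measure (M k) B + measure (M k) B'"
      by (rule measure_Un_le) (use B in auto)
    then show ?case using B by (intro bexI[of _ "B \<union> B'"]) auto
  qed
qed

lemma vanishing_measure:
  assumes "\<And>k. A k \<in> sets (M k)" "(\<lambda>k. measure (M k) (A k)) \<longlonglongrightarrow> 0"
  shows "vanishing M A"
  unfolding vanishing_def
proof (intro allI impI)
  fix \<delta> :: real assume "\<delta> > 0"
  with assms(2) have "\<forall>\<^sub>F k in sequentially. measure (M k) (A k) < \<delta>" by (rule order_tendstoD)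
  then show "\<forall>\<^sub>F k in sequentially. \<exists>B\<in>sets (M k). A k \<subseteq> B \<and> measure (M k) B < \<delta>"
    by eventually_elim (use assms(1) in blast)
qed

lemma vanishing_AE:
  assumes "\<forall>\<^sub>F k in sequentially. AE \<omega> in M k. P k \<omega>"
  shows "vanishing M (\<lambda>k. {\<omega> \<in> space (M k). \<not> P k \<omega>})"
  unfolding vanishing_def
proof (intro allI impI)
  fix \<delta> :: real assume d: "\<delta> > 0"
  show "\<forall>\<^sub>F k in sequentially. \<exists>B\<in>sets (M k). {\<omega> \<in> space (M k). \<not> P k \<omega>} \<subseteq> B \<and> measure (M k) B < \<delta>"
    using assms
  proof eventually_elim
    case (elim k)
    from AE_E[OF this] obtain B where "{\<omega> \<in> space (M k). \<not> P k \<omega>} \<subseteq> B" "emeasure (M k) B = 0" "B \<in> sets (M k)" by blast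
    then show ?case using d by (intro bexI[of _ B]) (auto simp: measure_def)
  qed
qed

lemma tends_probD: "tends_prob M f c \<Longrightarrow> 0 < \<epsilon> \<Longrightarrow> vanishing M (\<lambda>k. {\<omega> \<in> space (M k). \<epsilon> \<le> dist (f k \<omega>) c})"
  by (simp add: tends_prob_def)

lemma tends_prob_const:
  assumes "c \<longlonglongrightarrow> d"
  shows "tends_prob M (\<lambda>k _. c k) d"
  unfolding tends_prob_def
proof (intro allI impI)
  fix \<epsilon> :: real assume "\<epsilon> > 0"
  with assms have "\<forall>\<^sub>F k in sequentially. dist (c k) d < \<epsilon>" by (rule tendstoD)
  then have "\<forall>\<^sub>F k in sequentially. {\<omega> \<in> space (M k). \<epsilon> \<le> dist (c k) d} \<subseteq> {}"
    by eventually_elim auto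
  moreover have "vanishing M (\<lambda>_. {})" by (rule vanishing_measure) auto
  ultimately show "vanishing M (\<lambda>k. {\<omega> \<in> space (M k). \<epsilon> \<le> dist (c k) d})"
    by (rule vanishing_mono[rotated])
qed

lemma tends_prob_cong:
  assumes "tends_prob M f c" "vanishing M (\<lambda>k. {\<omega> \<in> space (M k). \<not> f k \<omega> = g k \<omega>})"
  shows "tends_prob M g c"
  unfolding tends_prob_def
proof (intro allI impI)
  fix \<epsilon> :: real assume "\<epsilon> > 0"
  from vanishing_Un[OF tends_probD[OF assms(1) this] assms(2)]
  show "vanishing M (\<lambda>k. {\<omega> \<in> space (M k). \<epsilon> \<le> dist (g k \<omega>) c})"
    by (rule vanishing_mono) (rule always_eventually, auto)
qed

lemma tends_prob_cong_eventually:
  assumes "tends_prob M f c" "\<forall>\<^sub>F k in sequentially. \<forall>\<omega>\<in>space (M k). f k \<omega> = g k \<omega>"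
  shows "tends_prob M g c"
proof (rule tends_prob_cong[OF assms(1)])
  have "vanishing M (\<lambda>_. {})" by (rule vanishing_measure) auto
  then show "vanishing M (\<lambda>k. {\<omega> \<in> space (M k). \<not> f k \<omega> = g k \<omega>})"
    by (rule vanishing_mono) (use assms(2) in \<open>auto elim!: eventually_mono\<close>)
qed

lemma tends_prob_Pair:
  assumes "tends_prob M f a" "tends_prob M g b"
  shows "tends_prob M (\<lambda>k \<omega>. (f k \<omega>, g k \<omega>)) (a, b)"
  unfolding tends_prob_def
proof (intro allI impI)
  fix \<epsilon> :: real assume "\<epsilon> > 0"
  then have e: "\<epsilon> / 2 > 0" by simp
  have imp: "\<epsilon> / 2 \<le> dist x a \<or> \<epsilon> / 2 \<le> dist y b" if "\<epsilon> \<le> dist (x, y) (a, b)" for x y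
  proof -
    have "dist (x, y) (a, b) \<le> dist x a + dist y b"
      unfolding dist_Pair_Pair by (rule sqrt_sum_squares_le_sum) auto
    then show ?thesis using that by linarith
  qed
  from vanishing_Un[OF tends_probD[OF assms(1) e] tends_probD[OF assms(2) e]]
  show "vanishing M (\<lambda>k. {\<omega> \<in> space (M k). \<epsilon> \<le> dist (f k \<omega>, g k \<omega>) (a, b)})"
    by (rule vanishing_mono) (rule always_eventually, use imp in blast)
qed

lemma tends_prob_isCont:
  assumes "tends_prob M f a" "isCont h a"
  shows "tends_prob M (\<lambda>k \<omega>. h (f k \<omega>)) (h a)"
  unfolding tends_prob_def
proof (intro allI impI)
  fix \<epsilon> :: real assume "\<epsilon> > 0"
  then obtain d where d: "d > 0" "\<And>x. dist x a < d \<Longrightarrow> dist (h x) (h a) < \<epsilon>"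
    using assms(2) unfolding continuous_at_eps_delta by metis
  from tends_probD[OF assms(1) d(1)]
  show "vanishing M (\<lambda>k. {\<omega> \<in> space (M k). \<epsilon> \<le> dist (h (f k \<omega>)) (h a)})"
    by (rule vanishing_mono) (rule always_eventually, use d(2) in \<open>force simp: not_less[symmetric]\<close>)
qed

lemma tends_prob_isCont2:
  assumes "tends_prob M f a" "tends_prob M g b" "isCont (\<lambda>x. h (fst x) (snd x)) (a, b)"
  shows "tends_prob M (\<lambda>k \<omega>. h (f k \<omega>) (g k \<omega>)) (h a b)"
  using tends_prob_isCont[OF tends_prob_Pair[OF assms(1,2)] assms(3)] by simp

lemma tends_prob_add:
  fixes f g :: "nat \<Rightarrow> 'a \<Rightarrow> real"
  shows "tends_prob M f a \<Longrightarrow> tends_prob M g b \<Longrightarrow> tends_prob M (\<lambda>k \<omega>. f k \<omega> + g k \<omega>) (a + b)"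
  by (erule (1) tends_prob_isCont2) (intro continuous_intros)

lemma tends_prob_diff:
  fixes f g :: "nat \<Rightarrow> 'a \<Rightarrow> real"
  shows "tends_prob M f a \<Longrightarrow> tends_prob M g b \<Longrightarrow> tends_prob M (\<lambda>k \<omega>. f k \<omega> - g k \<omega>) (a - b)"
  by (erule (1) tends_prob_isCont2) (intro continuous_intros)

lemma tends_prob_mult:
  fixes f g :: "nat \<Rightarrow> 'a \<Rightarrow> real"
  shows "tends_prob M f a \<Longrightarrow> tends_prob M g b \<Longrightarrow> tends_prob M (\<lambda>k \<omega>. f k \<omega> * g k \<omega>) (a * b)"
  by (erule (1) tends_prob_isCont2) (intro continuous_intros)

lemma tends_prob_divide:
  fixes f g :: "nat \<Rightarrow> 'a \<Rightarrow> real"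
  assumes "tends_prob M f a" "tends_prob M g b" "b \<noteq> 0"
  shows "tends_prob M (\<lambda>k \<omega>. f k \<omega> / g k \<omega>) (a / b)"
  by (rule tends_prob_isCont2[OF assms(1,2)]) (use assms(3) in \<open>auto intro!: continuous_intros\<close>)

lemma measure_ge_le_second_moment:
  fixes f :: "'a \<Rightarrow> real"
  assumes f: "f \<in> borel_measurable (M k)" "integrable (M k) (\<lambda>\<omega>. (f \<omega>)\<^sup>2)" and T: "T > 0"
  shows "{\<omega> \<in> space (M k). T \<le> \<bar>f \<omega>\<bar>} \<in> sets (M k)"
    "measure (M k) {\<omega> \<in> space (M k). T \<le> \<bar>f \<omega>\<bar>} \<le> (LINT \<omega>|M k. (f \<omega>)\<^sup>2) / T\<^sup>2"
proof -
  interpret prob_space "M k" by (rule prob)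
  note f(1)[measurable]
  show "{\<omega> \<in> space (M k). T \<le> \<bar>f \<omega>\<bar>} \<in> sets (M k)" by measurable
  have eq: "{\<omega> \<in> space (M k). T \<le> \<bar>f \<omega>\<bar>} = {\<omega> \<in> space (M k). T\<^sup>2 \<le> (f \<omega>)\<^sup>2}"
    using T by (auto simp: abs_le_square_iff[symmetric] power2_le_iff_abs_le)
  show "measure (M k) {\<omega> \<in> space (M k). T \<le> \<bar>f \<omega>\<bar>} \<le> (LINT \<omega>|M k. (f \<omega>)\<^sup>2) / T\<^sup>2"
    unfolding eq using T
    by (intro integral_Markov_inequality_measure[OF f(2), where A="{}", simplified]) auto
qed

lemma tends_prob_second_moment:
  fixes f :: "nat \<Rightarrow> 'a \<Rightarrow> real"
  assumes f: "\<forall>\<^sub>F k in sequentially. f k \<in> borel_measurable (M k) \<and> integrable (M k) (\<lambda>\<omega>. (f k \<omega>)\<^sup>2)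
      \<and> (LINT \<omega>|M k. (f k \<omega>)\<^sup>2) \<le> b k"
    and b: "b \<longlonglongrightarrow> 0"
  shows "tends_prob M f 0"
  unfolding tends_prob_def vanishing_def
proof (intro allI impI)
  fix \<epsilon> \<delta> :: real assume e: "\<epsilon> > 0" and d: "\<delta> > 0"
  have "(\<lambda>k. b k / \<epsilon>\<^sup>2) \<longlonglongrightarrow> 0 / \<epsilon>\<^sup>2" using e by (intro tendsto_intros b) auto
  then have "(\<lambda>k. b k / \<epsilon>\<^sup>2) \<longlonglongrightarrow> 0" by simp
  then have "\<forall>\<^sub>F k in sequentially. b k / \<epsilon>\<^sup>2 < \<delta>" using d by (rule order_tendstoD)
  with f show "\<forall>\<^sub>F k in sequentially. \<exists>B\<in>sets (M k). {\<omega> \<in> space (M k). \<epsilon> \<le> dist (f k \<omega>) 0} \<subseteq> B \<and> measure (M k) B < \<delta>"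
  proof eventually_elim
    case (elim k)
    have "(LINT \<omega>|M k. (f k \<omega>)\<^sup>2) / \<epsilon>\<^sup>2 \<le> b k / \<epsilon>\<^sup>2" using elim e by (intro divide_right_mono) auto
    then have "measure (M k) {\<omega> \<in> space (M k). \<epsilon> \<le> \<bar>f k \<omega>\<bar>} < \<delta>"
      using measure_ge_le_second_moment(2)[of "f k" k \<epsilon>] elim e by linarith
    moreover have "{\<omega> \<in> space (M k). \<epsilon> \<le> \<bar>f k \<omega>\<bar>} \<in> sets (M k)"
      using measure_ge_le_second_moment(1)[of "f k" k \<epsilon>] elim e by blast
    ultimately show ?case by (auto simp: dist_real_def)
  qed
qed

lemma tends_prob_first_moment:
  fixes f :: "nat \<Rightarrow> 'a \<Rightarrow> real"
  assumes f: "\<forall>\<^sub>F k in sequentially. integrable (M k) (f k) \<and> (\<forall>\<omega>. 0 \<le> f k \<omega>) \<and> (LINT \<omega>|M k. f k \<omega>) \<le> b k"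
    and b: "b \<longlonglongrightarrow> 0"
  shows "tends_prob M f 0"
proof -
  have "tends_prob M (\<lambda>k \<omega>. sqrt (f k \<omega>)) 0"
  proof (rule tends_prob_second_moment[OF _ b])
    show "\<forall>\<^sub>F k in sequentially. (\<lambda>\<omega>. sqrt (f k \<omega>)) \<in> borel_measurable (M k) \<and>
        integrable (M k) (\<lambda>\<omega>. (sqrt (f k \<omega>))\<^sup>2) \<and> (LINT \<omega>|M k. (sqrt (f k \<omega>))\<^sup>2) \<le> b k"
      using f by eventually_elim auto
  qed
  from tends_prob_mult[OF this this]
  have "tends_prob M (\<lambda>k \<omega>. sqrt (f k \<omega>) * sqrt (f k \<omega>)) 0" by simp
  then show ?thesis by (rule tends_prob_cong_eventually) (use f in \<open>auto elim!: eventually_mono\<close>)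
qed

text \<open>
  A second moment bound makes \<open>f\<close> tight by Chebyshev's inequality.
\<close>

lemma tends_prob_mult_bounded:
  fixes f g :: "nat \<Rightarrow> 'a \<Rightarrow> real"
  assumes g: "tends_prob M g 0"
    and f: "\<forall>\<^sub>F k in sequentially. f k \<in> borel_measurable (M k) \<and> integrable (M k) (\<lambda>\<omega>. (f k \<omega>)\<^sup>2)
      \<and> (LINT \<omega>|M k. (f k \<omega>)\<^sup>2) \<le> K"
  shows "tends_prob M (\<lambda>k \<omega>. g k \<omega> * f k \<omega>) 0"
  unfolding tends_prob_def vanishing_def
proof (intro allI impI)
  fix \<epsilon> \<delta> :: real assume e: "\<epsilon> > 0" and d: "\<delta> > 0"
  define T where "T = sqrt (2 * (\<bar>K\<bar> + 1) / \<delta>)"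
  have T: "T > 0" "T\<^sup>2 = 2 * (\<bar>K\<bar> + 1) / \<delta>" using d by (auto simp: T_def)
  have "\<bar>K\<bar> / T\<^sup>2 < \<delta> / 2" unfolding T(2) using d by (simp add: field_simps)
  then have KT: "K / T\<^sup>2 < \<delta> / 2"
    by (rule order_le_less_trans[OF divide_right_mono[OF abs_ge_self zero_le_power2]])
  have eT: "\<epsilon> / T > 0" and d2: "\<delta> / 2 > 0" using e T d by simp_all
  have "\<forall>\<^sub>F k in sequentially. \<exists>B\<in>sets (M k). {\<omega> \<in> space (M k). \<epsilon> / T \<le> dist (g k \<omega>) 0} \<subseteq> B \<and> measure (M k) B < \<delta> / 2"
    using tends_probD[OF g eT] d2 unfolding vanishing_def by blast
  with f show "\<forall>\<^sub>F k in sequentially. \<exists>B\<in>sets (M k). {\<omega> \<in> space (M k). \<epsilon> \<le> dist (g k \<omega> * f k \<omega>) 0} \<subseteq> B \<and> measure (M k) B < \<delta>"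
  proof eventually_elim
    case (elim k)
    then obtain B where B: "B \<in> sets (M k)" "{\<omega> \<in> space (M k). \<epsilon> / T \<le> dist (g k \<omega>) 0} \<subseteq> B" "measure (M k) B < \<delta> / 2" by blast
    interpret prob_space "M k" by (rule prob)
    let ?A = "{\<omega> \<in> space (M k). T \<le> \<bar>f k \<omega>\<bar>}"
    have A: "?A \<in> sets (M k)" using measure_ge_le_second_moment(1)[of "f k" k T] elim T by blast
    have "(LINT \<omega>|M k. (f k \<omega>)\<^sup>2) / T\<^sup>2 \<le> K / T\<^sup>2" using elim by (intro divide_right_mono) auto
    then have "measure (M k) ?A < \<delta> / 2"
      using measure_ge_le_second_moment(2)[of "f k" k T] elim T KT by linarith
    moreover have "measure (M k) (B \<union> ?A) \<le> measure (M k) B + measure (M k) ?A"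
      by (rule measure_Un_le) (use A B in auto)
    ultimately have "measure (M k) (B \<union> ?A) < \<delta>" using B by linarith
    moreover have "{\<omega> \<in> space (M k). \<epsilon> \<le> dist (g k \<omega> * f k \<omega>) 0} \<subseteq> B \<union> ?A"
    proof
      fix \<omega> assume w: "\<omega> \<in> {\<omega> \<in> space (M k). \<epsilon> \<le> dist (g k \<omega> * f k \<omega>) 0}"
      show "\<omega> \<in> B \<union> ?A"
      proof (cases "T \<le> \<bar>f k \<omega>\<bar>")
        case False
        have "\<epsilon> \<le> \<bar>g k \<omega>\<bar> * \<bar>f k \<omega>\<bar>" using w by (simp add: abs_mult)
        also have "\<dots> \<le> \<bar>g k \<omega>\<bar> * T" using False by (intro mult_left_mono) auto
        finally have "\<epsilon> / T \<le> dist (g k \<omega>) 0" using T by (simp add: field_simps)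
        then show ?thesis using B w by blast
      qed (use w in auto)
    qed
    ultimately show ?case using A B by (intro bexI[of _ "B \<union> ?A"]) auto
  qed
qed

text \<open>
  \<open>E k\<close> is up to a vanishing set the event \<open>0 \<le> R k\<close>, and \<open>R k - L k\<close> is close to \<open>s\<close>, so \<open>E k\<close> is squeezed between
  events on \<open>L k\<close> with thresholds slightly above and below \<open>-s\<close>.
\<close>

lemma slutsky:
  fixes R L :: "nat \<Rightarrow> 'a \<Rightarrow> real"
  assumes L: "\<forall>\<^sub>F k in sequentially. L k \<in> borel_measurable (M k)"
    and F: "\<And>x. (\<lambda>k. measure (M k) {\<omega> \<in> space (M k). L k \<omega> \<le> x}) \<longlonglongrightarrow> F x" "isCont F (- s)"
    and RL: "tends_prob M (\<lambda>k \<omega>. R k \<omega> - L k \<omega>) s"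
    and E: "\<forall>\<^sub>F k in sequentially. E k \<in> sets (M k)"
    and ER: "vanishing M (\<lambda>k. {\<omega> \<in> space (M k). \<not> (\<omega> \<in> E k \<longleftrightarrow> 0 \<le> R k \<omega>)})"
  shows "(\<lambda>k. measure (M k) (E k)) \<longlonglongrightarrow> 1 - F (- s)"
proof (rule LIMSEQ_I)
  fix e :: real assume e: "e > 0"
  then have e4: "e / 4 > 0" by simp
  then obtain d where d: "d > 0" "\<And>x. dist x (- s) < d \<Longrightarrow> dist (F x) (F (- s)) < e / 4"
    using F(2) unfolding continuous_at_eps_delta by metis
  define h where "h = d / 3"
  have h: "h > 0" using d by (simp add: h_def)
  have f1: "\<bar>F (- s - 2 * h) - F (- s)\<bar> < e / 4" using d(2)[of "- s - 2 * h"] d(1) by (simp add: dist_real_def h_def)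
  have f2: "\<bar>F (- s + h) - F (- s)\<bar> < e / 4" using d(2)[of "- s + h"] d(1) by (simp add: dist_real_def h_def)
  let ?D = "\<lambda>k. {\<omega> \<in> space (M k). h \<le> dist (R k \<omega> - L k \<omega>) s} \<union> {\<omega> \<in> space (M k). \<not> (\<omega> \<in> E k \<longleftrightarrow> 0 \<le> R k \<omega>)}"
  have "vanishing M ?D" using RL ER h by (intro vanishing_Un tends_probD)
  then have v: "\<forall>\<^sub>F k in sequentially. \<exists>B\<in>sets (M k). ?D k \<subseteq> B \<and> measure (M k) B < e / 4"
    using e4 unfolding vanishing_def by blast
  have l1: "\<forall>\<^sub>F k in sequentially. \<bar>measure (M k) {\<omega> \<in> space (M k). L k \<omega> \<le> - s - 2 * h} - F (- s - 2 * h)\<bar> < e / 4"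
    using tendstoD[OF F(1)[of "- s - 2 * h"] e4] by (simp add: dist_real_def)
  have l2: "\<forall>\<^sub>F k in sequentially. \<bar>measure (M k) {\<omega> \<in> space (M k). L k \<omega> \<le> - s + h} - F (- s + h)\<bar> < e / 4"
    using tendstoD[OF F(1)[of "- s + h"] e4] by (simp add: dist_real_def)
  have "\<forall>\<^sub>F k in sequentially. \<bar>measure (M k) (E k) - (1 - F (- s))\<bar> < e"
    using L E v l1 l2
  proof eventually_elim
    case (elim k)
    interpret prob_space "M k" by (rule prob)
    note [measurable] = elim(1)
    obtain B where B: "B \<in> sets (M k)" "?D k \<subseteq> B" "measure (M k) B < e / 4" using elim by blast
    let ?L1 = "{\<omega> \<in> space (M k). L k \<omega> \<le> - s - 2 * h}" and ?L2 = "{\<omega> \<in> space (M k). L k \<omega> \<le> - s + h}"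
    have L12: "?L1 \<in> sets (M k)" "?L2 \<in> sets (M k)" by measurable
    have sub1: "E k \<subseteq> (space (M k) - ?L1) \<union> B"
    proof
      fix \<omega> assume w: "\<omega> \<in> E k"
      have ws: "\<omega> \<in> space (M k)" using w elim(2) sets.sets_into_space by blast
      show "\<omega> \<in> (space (M k) - ?L1) \<union> B"
      proof (cases "\<omega> \<in> ?D k")
        case False
        then have "0 \<le> R k \<omega>" "\<bar>R k \<omega> - L k \<omega> - s\<bar> < h" using w ws by (auto simp: dist_real_def not_le)
        then have "\<not> L k \<omega> \<le> - s - 2 * h" using h by linarith
        then show ?thesis using ws by auto
      qed (use B in blast)
    qed
    have sub2: "space (M k) - ?L2 \<subseteq> E k \<union> B"
    proof
      fix \<omega> assume w: "\<omega> \<in> space (M k) - ?L2"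
      show "\<omega> \<in> E k \<union> B"
      proof (cases "\<omega> \<in> ?D k")
        case False
        then have "\<bar>R k \<omega> - L k \<omega> - s\<bar> < h" "\<omega> \<in> E k \<longleftrightarrow> 0 \<le> R k \<omega>" using w by (auto simp: dist_real_def not_le)
        moreover have "L k \<omega> > - s + h" using w by auto
        ultimately show ?thesis by auto
      qed (use B in blast)
    qed
    have "measure (M k) (E k) \<le> measure (M k) ((space (M k) - ?L1) \<union> B)"
      by (rule finite_measure_mono[OF sub1]) (use L12 B in auto)
    also have "\<dots> \<le> measure (M k) (space (M k) - ?L1) + measure (M k) B"
      by (rule measure_Un_le) (use L12 B in auto)
    also have "measure (M k) (space (M k) - ?L1) = 1 - measure (M k) ?L1" by (rule prob_compl[OF L12(1)])
    finally have u: "measure (M k) (E k) \<le> 1 - measure (M k) ?L1 + measure (M k) B" .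
    have "measure (M k) (space (M k) - ?L2) \<le> measure (M k) (E k \<union> B)"
      by (rule finite_measure_mono[OF sub2]) (use elim(2) B in auto)
    also have "\<dots> \<le> measure (M k) (E k) + measure (M k) B"
      by (rule measure_Un_le) (use elim(2) B in auto)
    finally have l: "1 - measure (M k) ?L2 \<le> measure (M k) (E k) + measure (M k) B"
      unfolding prob_compl[OF L12(2)] .
    show ?case using u l B(3) elim(4,5) f1 f2 by linarith
  qed
  then show "\<exists>no. \<forall>k\<ge>no. norm (measure (M k) (E k) - (1 - F (- s))) < e"
    by (simp add: eventually_sequentially)
qed

end

section \<open>A central limit theorem for weighted centred squares\<close>

abbreviation Phi :: "real \<Rightarrow> real" where "Phi \<equiv> cdf std_normal_distribution"

lemma isCont_Phi: "isCont Phi x"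
proof -
  interpret real_distribution std_normal_distribution by (rule real_dist_normal_dist)
  have "emeasure std_normal_distribution {x} = 0"
    by (subst emeasure_density) (auto intro!: nn_integral_null_set null_setsI)
  then show ?thesis by (simp add: isCont_cdf measure_def)
qed

lemma Phi_strict_mono: "x < y \<Longrightarrow> Phi x < Phi y"
proof -
  interpret real_distribution std_normal_distribution by (rule real_dist_normal_dist)
  assume xy: "x < y"
  have "measure std_normal_distribution {x<..y} \<noteq> 0"
  proof
    assume "measure std_normal_distribution {x<..y} = 0"
    then have "{x<..y} \<in> null_sets std_normal_distribution" by (auto simp: emeasure_eq_measure)
    then have "AE u in lborel. u \<in> {x<..y} \<longrightarrow> ennreal (std_normal_density u) = 0"
      by (subst (asm) null_sets_density_iff) auto
    moreover have "ennreal (std_normal_density u) \<noteq> 0" for u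
      using normal_density_pos[of 1 0 u] by (simp add: ennreal_eq_0_iff not_le)
    ultimately have "AE u in lborel. u \<notin> {x<..y}" by simp
    then have "{x<..y} \<in> null_sets lborel" by (simp add: AE_iff_null_sets)
    then show False using xy by (simp add: null_sets_def)
  qed
  then have "0 < measure std_normal_distribution {x<..y}" by (simp add: zero_less_measure_iff)
  then show "Phi x < Phi y" using cdf_diff_eq[OF xy] by simp
qed

lemma Phi_less_iff: "Phi x < Phi y \<longleftrightarrow> x < y"
  using Phi_strict_mono by (metis less_asym' not_less_iff_gr_or_eq)

lemma Phi_le_iff: "Phi x \<le> Phi y \<longleftrightarrow> x \<le> y"
  using Phi_less_iff by (meson not_less)

lemma Phi_z_perc:
  assumes "0 < \<alpha>" "\<alpha> < 1"
  shows "Phi (z_perc \<alpha>) = 1 - \<alpha>"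
proof -
  interpret real_distribution std_normal_distribution by (rule real_dist_normal_dist)
  have "\<forall>\<^sub>F x in at_bot. Phi x < 1 - \<alpha>" using cdf_lim_at_bot by (rule order_tendstoD) (use assms in auto)
  then obtain a where a: "\<And>x. x \<le> a \<Longrightarrow> Phi x < 1 - \<alpha>" unfolding eventually_at_bot_linorder by blast
  have "\<forall>\<^sub>F x in at_top. 1 - \<alpha> < Phi x" using cdf_lim_at_top_prob by (rule order_tendstoD) (use assms in auto)
  then obtain b where b: "\<And>x. x \<ge> b \<Longrightarrow> 1 - \<alpha> < Phi x" unfolding eventually_at_top_linorder by blast
  have ab: "a \<le> b" using Phi_less_iff[of a b] a[of a] b[of b] by simp
  have "\<exists>x\<ge>a. x \<le> b \<and> Phi x = 1 - \<alpha>"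
    by (rule IVT') (use a[of a] b[of b] ab isCont_Phi in \<open>auto intro!: continuous_at_imp_continuous_on\<close>)
  then obtain t where t: "Phi t = 1 - \<alpha>" by blast
  have "{u. 1 - \<alpha> \<le> Phi u} = {t..}" unfolding t[symmetric] Phi_le_iff by auto
  then have "z_perc \<alpha> = t" unfolding z_perc_def upper_percentile_def by simp
  then show ?thesis using t by simp
qed

subsection \<open>moments\<close>

lemma std_normal_moments:
  shows "integral\<^sup>L std_normal_distribution (\<lambda>x. x) = 0"
    "integral\<^sup>L std_normal_distribution (\<lambda>x. x\<^sup>2) = 1"
    "integral\<^sup>L std_normal_distribution (\<lambda>x. x ^ 4) = 3"
    "integrable std_normal_distribution (\<lambda>x. x ^ k)"
    "integrable std_normal_distribution (\<lambda>x. x)"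
proof -
  show "integral\<^sup>L std_normal_distribution (\<lambda>x. x) = 0"
    using integral_std_normal_distribution_moment_odd[of 1] by simp
  show "integral\<^sup>L std_normal_distribution (\<lambda>x. x\<^sup>2) = 1"
    using std_normal_distribution_even_moments(1)[of 1] by simp
  show "integral\<^sup>L std_normal_distribution (\<lambda>x. x ^ 4) = 3"
    using std_normal_distribution_even_moments(1)[of 2] by (simp add: fact_numeral)
  show "integrable std_normal_distribution (\<lambda>x. x ^ k)" by (rule integrable_std_normal_distribution_moment)
  show "integrable std_normal_distribution (\<lambda>x. x)" using integrable_std_normal_distribution_moment[of 1] by simp
qed

lemma integrable_std_normal_poly: "integrable std_normal_distribution (\<lambda>x. poly q x)"
  unfolding poly_altdef by (intro Bochner_Integration.integrable_sum integrable_mult_right integrable_std_normal_distribution_moment)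

abbreviation sqc :: "real \<Rightarrow> real" where "sqc x \<equiv> x\<^sup>2 - 1"

lemma integrable_sqc_power: "integrable std_normal_distribution (\<lambda>x. sqc x ^ k)"
  using integrable_std_normal_poly[of "[:-1, 0, 1:] ^ k"] by (simp add: poly_power power2_eq_square)

lemma sqc_moments:
  shows "integral\<^sup>L std_normal_distribution sqc = 0"
    "integral\<^sup>L std_normal_distribution (\<lambda>x. (sqc x)\<^sup>2) = 2"
proof -
  interpret prob_space std_normal_distribution by (rule prob_space_std_normal)
  have i: "integrable std_normal_distribution (\<lambda>x::real. x\<^sup>2)" "integrable std_normal_distribution (\<lambda>x::real. x ^ 4)"
    by (rule integrable_std_normal_distribution_moment)+
  show "integral\<^sup>L std_normal_distribution sqc = 0"
    using i std_normal_moments(2) prob_space by simp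
  have "(\<lambda>x::real. (sqc x)\<^sup>2) = (\<lambda>x. x ^ 4 - 2 * x\<^sup>2 + 1)"
    by (auto simp: power2_eq_square algebra_simps power4_eq_xxxx)
  then show "integral\<^sup>L std_normal_distribution (\<lambda>x. (sqc x)\<^sup>2) = 2"
    using i std_normal_moments(2,3) prob_space by simp
qed

definition sqc_char :: "real \<Rightarrow> complex" where
  "sqc_char = char (distr std_normal_distribution borel sqc)"

lemma exp_minus_bound:
  fixes v :: real
  assumes "0 \<le> v"
  shows "\<bar>exp (- v) - (1 - v)\<bar> \<le> v\<^sup>2"
proof -
  have 1: "1 - v \<le> exp (- v)" using exp_ge_add_one_self[of "- v"] by simp
  have "exp (- v) * (1 + v) \<le> exp (- v) * exp v"
    by (rule mult_left_mono) (use exp_ge_add_one_self[of v] in \<open>simp_all add: add.commute\<close>)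
  also have "\<dots> = 1" by (simp flip: exp_add)
  also have "\<dots> \<le> (1 - v + v\<^sup>2) * (1 + v)"
  proof -
    have "(1 - v + v\<^sup>2) * (1 + v) = 1 + v ^ 3" by (simp add: algebra_simps power2_eq_square power3_eq_cube)
    then show ?thesis using assms by simp
  qed
  finally have "exp (- v) \<le> 1 - v + v\<^sup>2" using assms by simp
  then show ?thesis using 1 by (simp add: abs_le_iff)
qed

text \<open>
  The centred square has mean \<open>0\<close>, variance \<open>2\<close> and a finite third absolute moment, so its characteristic
  function agrees with \<open>exp (-u\<^sup>2)\<close> up to third order.
\<close>

lemma sqc_char_bound:
  obtains K where "0 \<le> K" "\<And>u. \<bar>u\<bar> \<le> 1 \<Longrightarrow> cmod (sqc_char u - of_real (exp (- u\<^sup>2))) \<le> K * \<bar>u\<bar> ^ 3"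
proof -
  interpret prob_space std_normal_distribution by (rule prob_space_std_normal)
  define K3 where "K3 = expectation (\<lambda>x. \<bar>sqc x\<bar> ^ 3)"
  have i3: "integrable std_normal_distribution (\<lambda>x. \<bar>sqc x\<bar> ^ 3)"
    using integrable_abs[OF integrable_sqc_power[of 3]] by (simp add: power_abs)
  have i1: "integrable std_normal_distribution sqc" using integrable_sqc_power[of 1] by simp
  have K3: "0 \<le> K3" unfolding K3_def by (rule integral_nonneg_AE) auto
  have "cmod (sqc_char u - of_real (exp (- u\<^sup>2))) \<le> (K3 / 6 + 1) * \<bar>u\<bar> ^ 3" if u: "\<bar>u\<bar> \<le> 1" for u
  proof -
    have "cmod (sqc_char u - (1 - u^2 * 2 / 2)) \<le> (u^2 / 6) * expectation (\<lambda>x. min (6 * (sqc x)^2) (\<bar>u\<bar> * \<bar>sqc x\<bar>^3))"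
      unfolding sqc_char_def
      by (rule char_approx3'[OF _ i1 integrable_sqc_power sqc_moments(1)]) (use sqc_moments in \<open>simp_all\<close>)
    also have "\<dots> \<le> (u^2 / 6) * expectation (\<lambda>x. \<bar>u\<bar> * \<bar>sqc x\<bar>^3)"
    proof (intro mult_left_mono integral_mono)
      show "integrable std_normal_distribution (\<lambda>x. min (6 * (sqc x)^2) (\<bar>u\<bar> * \<bar>sqc x\<bar>^3))"
        by (intro integrable_min integrable_mult_right integrable_sqc_power i3)
    qed (use i3 in auto)
    also have "\<dots> = K3 / 6 * (u^2 * \<bar>u\<bar>)" using i3 by (simp add: K3_def)
    also have "u^2 * \<bar>u\<bar> = \<bar>u\<bar> ^ 3" by (simp add: power3_eq_cube power2_eq_square)
    finally have 1: "cmod (sqc_char u - of_real (1 - u^2)) \<le> K3 / 6 * \<bar>u\<bar> ^ 3" by simp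
    have "cmod (of_real (exp (- u\<^sup>2)) - of_real (1 - u^2)) = \<bar>exp (- u\<^sup>2) - (1 - u^2)\<bar>"
      by (metis norm_of_real of_real_diff)
    also have "\<dots> \<le> (u\<^sup>2)\<^sup>2" by (rule exp_minus_bound) simp
    also have "\<dots> = \<bar>u\<bar> ^ 3 * \<bar>u\<bar>" by (simp add: power_even_abs flip: power_Suc2 power_mult)
    also have "\<dots> \<le> \<bar>u\<bar> ^ 3 * 1" by (rule mult_left_mono) (use u in auto)
    finally have 2: "cmod (of_real (1 - u^2) - of_real (exp (- u\<^sup>2))) \<le> \<bar>u\<bar> ^ 3" by (simp add: norm_minus_commute)
    have "cmod (sqc_char u - of_real (exp (- u\<^sup>2))) \<le> cmod (sqc_char u - of_real (1 - u^2)) + cmod (of_real (1 - u^2) - of_real (exp (- u\<^sup>2)))"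
      using norm_triangle_ineq[of "sqc_char u - of_real (1 - u^2)" "of_real (1 - u^2) - of_real (exp (- u\<^sup>2))"] by simp
    then show ?thesis using 1 2 by (simp add: algebra_simps)
  qed
  then show ?thesis using that[of "K3 / 6 + 1"] K3 by auto
qed

lemma distr_gauss_coordinate:
  assumes "e \<in> I" shows "distr (gauss I) borel (\<lambda>z. z e) = std_normal_distribution"
proof -
  have "distr (gauss I) borel (\<lambda>z. z e) = distr (gauss I) std_normal_distribution (\<lambda>z. z e)"
    by (rule distr_cong) auto
  also have "\<dots> = std_normal_distribution"
    using distr_PiM_component[of I "\<lambda>_. std_normal_distribution" e] assms prob_space_std_normal by simp
  finally show ?thesis .
qed

lemma measurable_gauss_coordinate: "e \<in> I \<Longrightarrow> (\<lambda>z. z e) \<in> borel_measurable (gauss I)"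
  unfolding measurable_gauss_iff by (rule measurable_component_singleton)

lemma char_weighted_sqc:
  assumes "finite J" "J \<subseteq> I"
  shows "char (distr (gauss I) borel (\<lambda>z. \<Sum>e\<in>J. w e * sqc (z e))) t = (\<Prod>e\<in>J. sqc_char (t * w e))"
proof -
  interpret prob_space "gauss I" by (rule prob_space_gauss)
  have "indep_vars (\<lambda>_. borel) (\<lambda>e z. w e * sqc (z e)) J"
    by (rule indep_vars_compose2[OF indep_vars_subset[OF indep_gauss assms(2)]]) auto
  then have "char (distr (gauss I) borel (\<lambda>z. \<Sum>e\<in>J. w e * sqc (z e))) t
      = (\<Prod>e\<in>J. char (distr (gauss I) borel (\<lambda>z. w e * sqc (z e))) t)"
    by (rule char_distr_sum)
  also have "\<dots> = (\<Prod>e\<in>J. sqc_char (t * w e))"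
  proof (rule prod.cong[OF refl])
    fix e assume "e \<in> J"
    then have e: "e \<in> I" using assms by auto
    note me = measurable_gauss_coordinate[OF e]
    have "char (distr (gauss I) borel (\<lambda>z. w e * sqc (z e))) t = (CLINT z|gauss I. iexp (t * (w e * sqc (z e))))"
      unfolding char_def by (rule integral_distr) (use me in measurable)
    also have "\<dots> = (CLINT x|distr (gauss I) borel (\<lambda>z. z e). iexp (t * (w e * sqc x)))"
      by (rule integral_distr[symmetric, OF me]) measurable
    also have "\<dots> = sqc_char (t * w e)"
      unfolding distr_gauss_coordinate[OF e] sqc_char_def char_def
      by (subst integral_distr) (auto simp: mult.assoc)
    finally show "char (distr (gauss I) borel (\<lambda>z. w e * sqc (z e))) t = sqc_char (t * w e)" .
  qed
  finally show ?thesis .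
qed

text \<open>
  Lyapunov's central limit theorem for centred squares.  The characteristic function of the sum is a
  product; replacing each factor by the Gaussian one costs \<open>K |t w|\<^sup>3\<close> by \<open>sqc_char_bound\<close>, and these costs
  sum to zero in the limit.
\<close>

lemma gauss_clt:
  fixes I J :: "nat \<Rightarrow> 'i set" and w :: "nat \<Rightarrow> 'i \<Rightarrow> real"
  assumes J: "\<And>k. finite (J k)" "\<And>k. J k \<subseteq> I k"
    and var: "(\<lambda>k. \<Sum>e\<in>J k. 2 * (w k e)\<^sup>2) \<longlonglongrightarrow> 1"
    and lyap: "(\<lambda>k. \<Sum>e\<in>J k. \<bar>w k e\<bar> ^ 3) \<longlonglongrightarrow> 0"
  shows "(\<lambda>k. measure (gauss (I k)) {z \<in> space (gauss (I k)). (\<Sum>e\<in>J k. w k e * sqc (z e)) \<le> x}) \<longlonglongrightarrow> Phi x"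
proof -
  define L where "L k z = (\<Sum>e\<in>J k. w k e * sqc (z e))" for k z
  define D where "D k = distr (gauss (I k)) borel (L k)" for k
  have Lm: "L k \<in> borel_measurable (gauss (I k))" for k
    unfolding L_def
    by (intro borel_measurable_sum borel_measurable_times borel_measurable_diff borel_measurable_power
        borel_measurable_const measurable_gauss_coordinate) (use J in auto)
  have rd: "real_distribution (D k)" for k
    unfolding D_def
    by (rule prob_space.real_distribution_distr[OF prob_space_gauss Lm])
  obtain K where K: "0 \<le> K" "\<And>u. \<bar>u\<bar> \<le> 1 \<Longrightarrow> cmod (sqc_char u - of_real (exp (- u\<^sup>2))) \<le> K * \<bar>u\<bar> ^ 3"
    using sqc_char_bound by blast
  have rd1: "real_distribution (distr std_normal_distribution borel sqc)"
    by (rule prob_space.real_distribution_distr[OF prob_space_std_normal]) auto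
  have n1: "cmod (sqc_char u) \<le> 1" for u
    unfolding sqc_char_def by (rule real_distribution.cmod_char_le_1[OF rd1])
  have "(\<lambda>k. char (D k) t) \<longlonglongrightarrow> char std_normal_distribution t" for t
  proof -
    let ?s = "\<lambda>k. \<Sum>e\<in>J k. 2 * (w k e)\<^sup>2" and ?l = "\<lambda>k. \<Sum>e\<in>J k. \<bar>w k e\<bar> ^ 3"
    have "(\<lambda>k. \<bar>t\<bar> ^ 3 * ?l k) \<longlonglongrightarrow> \<bar>t\<bar> ^ 3 * 0" by (intro tendsto_intros lyap)
    then have l0: "(\<lambda>k. \<bar>t\<bar> ^ 3 * ?l k) \<longlonglongrightarrow> 0" by simp
    then have ev: "\<forall>\<^sub>F k in sequentially. \<bar>t\<bar> ^ 3 * ?l k < 1" by (rule order_tendstoD) simp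
    have bound: "cmod (char (D k) t - of_real (exp (- (t\<^sup>2) / 2 * ?s k))) \<le> K * (\<bar>t\<bar> ^ 3 * ?l k)"
      if k: "\<bar>t\<bar> ^ 3 * ?l k < 1" for k
    proof -
      have small: "\<bar>t * w k e\<bar> \<le> 1" if "e \<in> J k" for e
      proof -
        have "\<bar>w k e\<bar> ^ 3 \<le> ?l k" by (rule member_le_sum[OF that]) (use J in auto)
        then have "\<bar>t\<bar> ^ 3 * \<bar>w k e\<bar> ^ 3 \<le> \<bar>t\<bar> ^ 3 * ?l k" by (rule mult_left_mono) simp
        then have "\<bar>t * w k e\<bar> ^ 3 \<le> 1 ^ 3" using k by (simp add: power_mult_distrib abs_mult)
        then show ?thesis using power_mono_iff[of "\<bar>t * w k e\<bar>" 1 3] by simp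
      qed
      have "- (t\<^sup>2) / 2 * ?s k = (\<Sum>e\<in>J k. - (t * w k e)\<^sup>2)"
        by (simp add: sum_distrib_left power_mult_distrib)
      then have "exp (- (t\<^sup>2) / 2 * ?s k) = (\<Prod>e\<in>J k. exp (- (t * w k e)\<^sup>2))"
        by (simp only: exp_sum[OF J(1)])
      then have "cmod (char (D k) t - of_real (exp (- (t\<^sup>2) / 2 * ?s k)))
         = cmod ((\<Prod>e\<in>J k. sqc_char (t * w k e)) - (\<Prod>e\<in>J k. of_real (exp (- (t * w k e)\<^sup>2))))"
        unfolding D_def L_def char_weighted_sqc[OF J(1,2)] by simp
      also have "\<dots> \<le> (\<Sum>e\<in>J k. cmod (sqc_char (t * w k e) - of_real (exp (- (t * w k e)\<^sup>2))))"
        by (rule norm_prod_diff) (auto simp: n1)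
      also have "\<dots> \<le> (\<Sum>e\<in>J k. K * \<bar>t * w k e\<bar> ^ 3)"
        by (intro sum_mono K(2) small)
      also have "\<dots> = K * (\<bar>t\<bar> ^ 3 * ?l k)"
        by (simp add: sum_distrib_left abs_mult power_mult_distrib)
      finally show ?thesis .
    qed
    have "(\<lambda>k. char (D k) t - of_real (exp (- (t\<^sup>2) / 2 * ?s k))) \<longlonglongrightarrow> 0"
    proof (rule Lim_null_comparison)
      show "\<forall>\<^sub>F k in sequentially. cmod (char (D k) t - of_real (exp (- (t\<^sup>2) / 2 * ?s k))) \<le> K * (\<bar>t\<bar> ^ 3 * ?l k)"
        using ev by eventually_elim (rule bound)
      have "(\<lambda>k. K * (\<bar>t\<bar> ^ 3 * ?l k)) \<longlonglongrightarrow> K * 0" by (intro tendsto_mult tendsto_const l0)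
      then show "(\<lambda>k. K * (\<bar>t\<bar> ^ 3 * ?l k)) \<longlonglongrightarrow> 0" by simp
    qed
    moreover have "(\<lambda>k. of_real (exp (- (t\<^sup>2) / 2 * ?s k)) :: complex) \<longlonglongrightarrow> of_real (exp (- (t\<^sup>2) / 2 * 1))"
      by (intro tendsto_of_real tendsto_exp tendsto_mult tendsto_const var)
    ultimately have "(\<lambda>k. (char (D k) t - of_real (exp (- (t\<^sup>2) / 2 * ?s k))) + of_real (exp (- (t\<^sup>2) / 2 * ?s k))) \<longlonglongrightarrow> 0 + of_real (exp (- (t\<^sup>2) / 2 * 1))"
      by (rule tendsto_add)
    then show ?thesis unfolding char_std_normal_distribution by simp
  qed
  then have "weak_conv_m D std_normal_distribution"
    by (rule levy_continuity[OF rd real_dist_normal_dist])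
  then have "(\<lambda>k. cdf (D k) x) \<longlonglongrightarrow> Phi x"
    using isCont_Phi by (simp add: weak_conv_m_def weak_conv_def)
  moreover have "cdf (D k) x = measure (gauss (I k)) {z \<in> space (gauss (I k)). L k z \<le> x}" for k
    unfolding cdf_def D_def by (subst measure_distr[OF Lm]) (auto intro!: arg_cong[where f="measure _"])
  ultimately show ?thesis unfolding L_def by simp
qed

section \<open>Moments and independence of polynomials in Gaussian variables\<close>

text \<open>
  A class of integrands closed under products: integrability of polynomials in Gaussian variables
  follows by structure alone.
\<close>

definition all_moments :: "'a measure \<Rightarrow> ('a \<Rightarrow> real) \<Rightarrow> bool" where
  "all_moments M f \<longleftrightarrow> f \<in> borel_measurable M \<and> (\<forall>k. integrable M (\<lambda>x. \<bar>f x\<bar> ^ k))"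

lemma all_moments_measurable: "all_moments M f \<Longrightarrow> f \<in> borel_measurable M"
  by (simp add: all_moments_def)

lemma all_moments_integrable_power: "all_moments M f \<Longrightarrow> integrable M (\<lambda>x. f x ^ k)"
  unfolding all_moments_def
  by (rule Bochner_Integration.integrable_bound[of M "\<lambda>x. \<bar>f x\<bar> ^ k"]) (auto simp: power_abs)

lemma all_moments_integrable: "all_moments M f \<Longrightarrow> integrable M f"
  using all_moments_integrable_power[of M f 1] by simp

lemma all_moments_mult:
  assumes "all_moments M f" "all_moments M g"
  shows "all_moments M (\<lambda>x. f x * g x)"
  unfolding all_moments_def
proof (intro conjI allI)
  show m: "(\<lambda>x. f x * g x) \<in> borel_measurable M" using assms by (auto simp: all_moments_def)
  fix k
  show "integrable M (\<lambda>x. \<bar>f x * g x\<bar> ^ k)"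
  proof (rule Bochner_Integration.integrable_bound)
    show "integrable M (\<lambda>x. \<bar>f x\<bar> ^ (2 * k) + \<bar>g x\<bar> ^ (2 * k))" using assms by (auto simp: all_moments_def)
    show "AE x in M. norm (\<bar>f x * g x\<bar> ^ k) \<le> norm (\<bar>f x\<bar> ^ (2 * k) + \<bar>g x\<bar> ^ (2 * k))"
    proof (rule AE_I2)
      fix x
      have "\<bar>f x\<bar> ^ k * \<bar>g x\<bar> ^ k \<le> (\<bar>f x\<bar> ^ k)\<^sup>2 + (\<bar>g x\<bar> ^ k)\<^sup>2"
      proof -
        have "0 \<le> \<bar>f x\<bar> ^ k * \<bar>g x\<bar> ^ k" by simp
        then show ?thesis using sum_squares_bound[of "\<bar>f x\<bar> ^ k" "\<bar>g x\<bar> ^ k"] by linarith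
      qed
      then show "norm (\<bar>f x * g x\<bar> ^ k) \<le> norm (\<bar>f x\<bar> ^ (2 * k) + \<bar>g x\<bar> ^ (2 * k))"
        by (simp add: abs_mult power_mult_distrib power_mult[symmetric] mult.commute[of 2])
    qed
  qed (use m in auto)
qed

lemma all_moments_add:
  assumes "all_moments M f" "all_moments M g"
  shows "all_moments M (\<lambda>x. f x + g x)"
  unfolding all_moments_def
proof (intro conjI allI)
  show m: "(\<lambda>x. f x + g x) \<in> borel_measurable M" using assms by (auto simp: all_moments_def)
  fix k
  show "integrable M (\<lambda>x. \<bar>f x + g x\<bar> ^ k)"
  proof (rule Bochner_Integration.integrable_bound)
    show "integrable M (\<lambda>x. 2 ^ k * (\<bar>f x\<bar> ^ k + \<bar>g x\<bar> ^ k))" using assms by (auto simp: all_moments_def)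
    show "AE x in M. norm (\<bar>f x + g x\<bar> ^ k) \<le> norm (2 ^ k * (\<bar>f x\<bar> ^ k + \<bar>g x\<bar> ^ k))"
    proof (rule AE_I2)
      fix x
      have "\<bar>f x + g x\<bar> ^ k \<le> (2 * max \<bar>f x\<bar> \<bar>g x\<bar>) ^ k" by (rule power_mono) auto
      also have "\<dots> = 2 ^ k * (max \<bar>f x\<bar> \<bar>g x\<bar>) ^ k" by (rule power_mult_distrib)
      also have "(max \<bar>f x\<bar> \<bar>g x\<bar>) ^ k \<le> \<bar>f x\<bar> ^ k + \<bar>g x\<bar> ^ k" by (simp add: max_def)
      finally show "norm (\<bar>f x + g x\<bar> ^ k) \<le> norm (2 ^ k * (\<bar>f x\<bar> ^ k + \<bar>g x\<bar> ^ k))" by simp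
    qed
  qed (use m in auto)
qed

lemma all_moments_const: "prob_space M \<Longrightarrow> all_moments M (\<lambda>_. c)"
  by (auto simp: all_moments_def intro: finite_measure.integrable_const[OF prob_space.finite_measure])

lemma all_moments_sum:
  assumes "prob_space M" "\<And>e. e \<in> J \<Longrightarrow> all_moments M (f e)"
  shows "all_moments M (\<lambda>x. \<Sum>e\<in>J. f e x)"
  using assms(2)
  by (induction J rule: infinite_finite_induct) (auto intro: all_moments_const[OF assms(1)] all_moments_add)

lemma all_moments_diff:
  assumes "prob_space M" "all_moments M f" "all_moments M g"
  shows "all_moments M (\<lambda>x. f x - g x)"
  using all_moments_add[OF assms(2) all_moments_mult[OF all_moments_const[OF assms(1), of "-1"] assms(3)]] by simp

lemma all_moments_power:
  assumes "prob_space M" "all_moments M f"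
  shows "all_moments M (\<lambda>x. f x ^ k)"
  by (induction k) (auto intro: all_moments_const[OF assms(1)] all_moments_mult assms)

lemma all_moments_gauss: "e \<in> I \<Longrightarrow> all_moments (gauss I) (\<lambda>z. z e)"
proof -
  assume e: "e \<in> I"
  note me = measurable_gauss_coordinate[OF e]
  have "integrable (gauss I) (\<lambda>z. \<bar>z e\<bar> ^ k)" for k
  proof -
    have "integrable (distr (gauss I) borel (\<lambda>z. z e)) (\<lambda>x. \<bar>x\<bar> ^ k)"
      unfolding distr_gauss_coordinate[OF e]
      using integrable_abs[OF integrable_std_normal_distribution_moment[of k]] by (simp add: power_abs)
    then show ?thesis by (subst (asm) integrable_distr_eq[OF me]) auto
  qed
  then show ?thesis using me by (simp add: all_moments_def)
qed

lemmas all_moments_intros = all_moments_gauss all_moments_mult all_moments_add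
  all_moments_const[OF prob_space_gauss] all_moments_sum[OF prob_space_gauss]
  all_moments_diff[OF prob_space_gauss] all_moments_power[OF prob_space_gauss]

lemma gauss_expectation_coordinate:
  assumes "e \<in> I" "f \<in> borel_measurable borel"
  shows "(LINT z|gauss I. f (z e)) = (LINT x|std_normal_distribution. (f x :: real))"
  using integral_distr[OF measurable_gauss_coordinate[OF assms(1)] assms(2)]
  unfolding distr_gauss_coordinate[OF assms(1)] by simp

lemma gauss_indep_product:
  assumes AB: "A \<subseteq> I" "B \<subseteq> I" "A \<inter> B = {}"
    and F: "F \<in> borel_measurable (Pi\<^sub>M A (\<lambda>_. borel))" "\<And>z. F (restrict z A) = F z" "integrable (gauss I) F"
    and G: "G \<in> borel_measurable (Pi\<^sub>M B (\<lambda>_. borel))" "\<And>z. G (restrict z B) = G z" "integrable (gauss I) G"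
  shows "(LINT z|gauss I. F z * G z) = (LINT z|gauss I. F z) * (LINT z|gauss I. (G z :: real))"
proof -
  interpret prob_space "gauss I" by (rule prob_space_gauss)
  have "indep_var (Pi\<^sub>M A (\<lambda>_. borel)) (\<lambda>\<omega>. restrict (\<lambda>i. \<omega> i) A) (Pi\<^sub>M B (\<lambda>_. borel)) (\<lambda>\<omega>. restrict (\<lambda>i. \<omega> i) B)"
    by (rule indep_var_restrict[OF indep_gauss AB(3,1,2)])
  from indep_var_compose[OF this F(1) G(1)]
  have "indep_var borel F borel G" using F(2) G(2) by (simp add: comp_def)
  then show ?thesis by (rule indep_var_lebesgue_integral[OF _ F(3) G(3)])
qed

lemma indep_blocks:
  assumes "disjoint_family_on B J" "\<And>e. e \<in> J \<Longrightarrow> B e \<subseteq> I"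
    and h: "\<And>e. e \<in> J \<Longrightarrow> h e \<in> borel_measurable (Pi\<^sub>M (B e) (\<lambda>_. borel))" "\<And>e z. e \<in> J \<Longrightarrow> h e (restrict z (B e)) = (h e z :: real)"
  shows "prob_space.indep_vars (gauss I) (\<lambda>_. borel) h J"
proof -
  interpret prob_space "gauss I" by (rule prob_space_gauss)
  have "indep_vars (\<lambda>e. Pi\<^sub>M (B e) (\<lambda>_. borel)) (\<lambda>e \<omega>. restrict (\<lambda>i. \<omega> i) (B e)) J"
    by (rule indep_vars_restrict[OF indep_gauss]) (use assms in auto)
  from indep_vars_compose2[OF this, of h "\<lambda>_. borel"] h(1)
  have "indep_vars (\<lambda>_. borel) (\<lambda>e \<omega>. h e (restrict \<omega> (B e))) J" by simp
  then show ?thesis using h(2) by (subst indep_vars_cong[OF refl _ refl]) auto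
qed

text \<open>
  By induction on \<open>J\<close>: an independent centred summand kills the odd mixed terms of the fourth power, and the
  remaining one, \<open>6 v e (\<Sum>f. v f)\<close>, is at most the cross term \<open>2 K v e (\<Sum>f. v f)\<close> of \<open>K (\<Sum>v)\<^sup>2\<close> when \<open>K \<ge> 3\<close>.
\<close>

lemma (in prob_space) indep_sum_moments:
  assumes J: "finite J" and ind: "indep_vars (\<lambda>_. borel) X J"
    and mom: "\<And>e. e \<in> J \<Longrightarrow> all_moments M (X e)"
    and zero: "\<And>e. e \<in> J \<Longrightarrow> expectation (X e) = 0"
    and var: "\<And>e. e \<in> J \<Longrightarrow> expectation (\<lambda>x. (X e x)\<^sup>2) = v e"
  shows "expectation (\<lambda>x. (\<Sum>e\<in>J. X e x)\<^sup>2) = (\<Sum>e\<in>J. v e)"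
    and "K \<ge> 3 \<Longrightarrow> (\<And>e. e \<in> J \<Longrightarrow> expectation (\<lambda>x. (X e x) ^ 4) \<le> K * (v e)\<^sup>2) \<Longrightarrow>
      expectation (\<lambda>x. (\<Sum>e\<in>J. X e x) ^ 4) \<le> K * (\<Sum>e\<in>J. v e)\<^sup>2"
proof -
  note AM = all_moments_mult all_moments_add all_moments_const[OF prob_space_axioms]
    all_moments_sum[OF prob_space_axioms] all_moments_power[OF prob_space_axioms]
  have "expectation (\<lambda>x. (\<Sum>e\<in>J. X e x)\<^sup>2) = (\<Sum>e\<in>J. v e) \<and> expectation (\<lambda>x. \<Sum>e\<in>J. X e x) = 0 \<and>
    (K \<ge> 3 \<longrightarrow> (\<forall>e\<in>J. expectation (\<lambda>x. (X e x) ^ 4) \<le> K * (v e)\<^sup>2) \<longrightarrow>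
      expectation (\<lambda>x. (\<Sum>e\<in>J. X e x) ^ 4) \<le> K * (\<Sum>e\<in>J. v e)\<^sup>2)" for K
    using J ind mom zero var
  proof (induction J rule: finite_induct)
    case empty then show ?case by simp
  next
    case (insert e F)
    let ?S = "\<lambda>x. \<Sum>e\<in>F. X e x"
    have ind': "indep_vars (\<lambda>_. borel) X F" by (rule indep_vars_subset[OF insert.prems(1)]) auto
    have IH: "expectation (\<lambda>x. (?S x)\<^sup>2) = (\<Sum>e\<in>F. v e)" "expectation ?S = 0"
      "K \<ge> 3 \<longrightarrow> (\<forall>e\<in>F. expectation (\<lambda>x. (X e x) ^ 4) \<le> K * (v e)\<^sup>2) \<longrightarrow>
      expectation (\<lambda>x. (?S x) ^ 4) \<le> K * (\<Sum>e\<in>F. v e)\<^sup>2"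
      using insert.IH[OF ind'] insert.prems by auto
    have aS: "all_moments M ?S" and aX: "all_moments M (X e)" using insert.prems by (auto intro: AM)
    have iv: "indep_var borel (X e) borel ?S"
      by (rule indep_vars_sum[OF insert.hyps insert.prems(1)])
    have prod: "expectation (\<lambda>x. X e x ^ a * ?S x ^ b) = expectation (\<lambda>x. X e x ^ a) * expectation (\<lambda>x. ?S x ^ b)" for a b
      using indep_var_compose[OF iv, of "\<lambda>u. u ^ a" borel "\<lambda>u. u ^ b" borel]
      by (intro indep_var_lebesgue_integral) (auto simp: comp_def intro!: all_moments_integrable AM aS aX)
    have i: "integrable M (\<lambda>x. c * (X e x ^ a * ?S x ^ b))" for a b c
      by (intro all_moments_integrable AM aS aX)
    have ec: "expectation (\<lambda>x. c * (X e x ^ a * ?S x ^ b)) = c * (expectation (\<lambda>x. X e x ^ a) * expectation (\<lambda>x. ?S x ^ b))" for a b c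
      unfolding prod[symmetric] by (rule integral_mult_right_zero)
    have add2: "expectation (\<lambda>x. f x + h x) = expectation f + expectation h"
      if "integrable M f" "integrable M h" for f h :: "'a \<Rightarrow> real"
      using that by simp
    have sum: "(\<Sum>e\<in>insert e F. X e x) = X e x + ?S x" for x using insert by simp
    have XZ: "expectation (X e) = 0" "expectation (\<lambda>x. (X e x)\<^sup>2) = v e" using insert.prems by auto
    have "expectation (\<lambda>x. (X e x + ?S x)\<^sup>2)
        = expectation (\<lambda>x. 1 * (X e x ^ 2 * ?S x ^ 0) + 2 * (X e x ^ 1 * ?S x ^ 1) + 1 * (X e x ^ 0 * ?S x ^ 2))"
      by (rule Bochner_Integration.integral_cong) (auto simp: power2_eq_square algebra_simps)
    also have "\<dots> = v e + (\<Sum>e\<in>F. v e)"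
      by (subst add2, (intro Bochner_Integration.integrable_add i)+)+ (simp only: ec, simp add: XZ IH(1,2) prob_space)
    finally have 1: "expectation (\<lambda>x. (\<Sum>e\<in>insert e F. X e x)\<^sup>2) = (\<Sum>e\<in>insert e F. v e)"
      using insert by (simp only: sum sum.insert[OF insert.hyps] not_False_eq_True)
    have 2: "expectation (\<lambda>x. \<Sum>e\<in>insert e F. X e x) = 0"
      unfolding sum using IH(2) XZ(1) all_moments_integrable[OF aS] all_moments_integrable[OF aX] by simp
    have 3: "expectation (\<lambda>x. (\<Sum>e\<in>insert e F. X e x) ^ 4) \<le> K * (\<Sum>e\<in>insert e F. v e)\<^sup>2"
      if K: "K \<ge> 3" and f4: "\<forall>e\<in>insert e F. expectation (\<lambda>x. (X e x) ^ 4) \<le> K * (v e)\<^sup>2"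
    proof -
      have pos: "0 \<le> v e" "0 \<le> (\<Sum>e\<in>F. v e)"
        unfolding XZ(2)[symmetric] IH(1)[symmetric] by (rule integral_nonneg_AE, simp)+
      have "expectation (\<lambda>x. (X e x + ?S x) ^ 4)
        = expectation (\<lambda>x. 1 * (X e x ^ 4 * ?S x ^ 0) + 4 * (X e x ^ 3 * ?S x ^ 1) + 6 * (X e x ^ 2 * ?S x ^ 2)
            + 4 * (X e x ^ 1 * ?S x ^ 3) + 1 * (X e x ^ 0 * ?S x ^ 4))"
        by (rule Bochner_Integration.integral_cong) (auto simp: power4_eq_xxxx power3_eq_cube power2_eq_square algebra_simps)
      also have "\<dots> = expectation (\<lambda>x. X e x ^ 4) + 6 * (v e * (\<Sum>e\<in>F. v e)) + expectation (\<lambda>x. ?S x ^ 4)"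
        by (subst add2, (intro Bochner_Integration.integrable_add i)+)+ (simp only: ec, simp add: XZ IH(1,2) prob_space)
      also have "\<dots> \<le> K * (v e)\<^sup>2 + 2 * K * (v e * (\<Sum>e\<in>F. v e)) + K * (\<Sum>e\<in>F. v e)\<^sup>2"
      proof -
        have "6 * (v e * (\<Sum>e\<in>F. v e)) \<le> 2 * K * (v e * (\<Sum>e\<in>F. v e))"
          using K pos by (intro mult_right_mono) auto
        then show ?thesis using IH(3) K f4 by auto
      qed
      also have "\<dots> = K * (v e + (\<Sum>e\<in>F. v e))\<^sup>2" by (simp add: power2_eq_square algebra_simps)
      finally show ?thesis using insert.hyps by (simp add: sum)
    qed
    show ?case using 1 2 3 by blast
  qed
  then show "expectation (\<lambda>x. (\<Sum>e\<in>J. X e x)\<^sup>2) = (\<Sum>e\<in>J. v e)"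
    and "K \<ge> 3 \<Longrightarrow> (\<And>e. e \<in> J \<Longrightarrow> expectation (\<lambda>x. (X e x) ^ 4) \<le> K * (v e)\<^sup>2) \<Longrightarrow>
      expectation (\<lambda>x. (\<Sum>e\<in>J. X e x) ^ 4) \<le> K * (\<Sum>e\<in>J. v e)\<^sup>2" by blast+
qed

section \<open>Moments of the traces of powers of a Wishart matrix\<close>

lemma gauss_pair_moment:
  assumes "e \<in> I" "f \<in> I" "e \<noteq> f"
  shows "(LINT z|gauss I. z e ^ a * z f ^ b)
     = (LINT x|std_normal_distribution. x ^ a) * (LINT x|std_normal_distribution. x ^ b)"
proof -
  have "(LINT z|gauss I. z e ^ a * z f ^ b) = (LINT z|gauss I. z e ^ a) * (LINT z|gauss I. z f ^ b)"
    by (rule gauss_indep_product[of "{e}" I "{f}"])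
       (use assms in \<open>auto intro!: all_moments_integrable all_moments_intros\<close>)
  then show ?thesis using gauss_expectation_coordinate[OF assms(1), of "\<lambda>x. x ^ a"]
    gauss_expectation_coordinate[OF assms(2), of "\<lambda>x. x ^ b"] by simp
qed

lemma sqc_fourth_moment: "integral\<^sup>L std_normal_distribution (\<lambda>x. (sqc x) ^ 4) = 60"
proof -
  interpret prob_space std_normal_distribution by (rule prob_space_std_normal)
  have i: "integrable std_normal_distribution (\<lambda>x::real. x ^ k)" for k
    by (rule integrable_std_normal_distribution_moment)
  have m6: "integral\<^sup>L std_normal_distribution (\<lambda>x. x ^ 6) = 15"
    using std_normal_distribution_even_moments(1)[of 3] by (simp add: fact_numeral)
  have m8: "integral\<^sup>L std_normal_distribution (\<lambda>x. x ^ 8) = 105"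
    using std_normal_distribution_even_moments(1)[of 4] by (simp add: fact_numeral)
  have "(\<lambda>x::real. (sqc x) ^ 4) = (\<lambda>x. x ^ 8 - 4 * x ^ 6 + 6 * x ^ 4 - 4 * x\<^sup>2 + 1)"
  proof
    fix x :: real
    have "x ^ 8 = (x\<^sup>2) ^ 4" "x ^ 6 = (x\<^sup>2) ^ 3" "x ^ 4 = (x\<^sup>2)\<^sup>2" by (simp_all flip: power_mult)
    then show "(sqc x) ^ 4 = x ^ 8 - 4 * x ^ 6 + 6 * x ^ 4 - 4 * x\<^sup>2 + 1"
      by (simp only:) (simp add: power4_eq_xxxx power3_eq_cube power2_eq_square algebra_simps)
  qed
  then show ?thesis using i[of 8] i[of 6] i[of 4] i[of 2] m6 m8 std_normal_moments(2,3) prob_space by simp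
qed

text \<open>
  The inner product of rows \<open>k\<close> and \<open>l\<close> of the array with weights \<open>lam\<close>, that is \<open>y\<^sub>k' y\<^sub>l\<close> for \<open>y\<^sub>k = \<Sigma>\<^sup>1\<^sup>/\<^sup>2 z\<^sub>k\<close>.
\<close>

definition wip :: "nat \<Rightarrow> (nat \<Rightarrow> real) \<Rightarrow> (nat \<times> nat \<Rightarrow> real) \<Rightarrow> nat \<Rightarrow> nat \<Rightarrow> real" where
  "wip p lam z k l = (\<Sum>j<p. lam j * z (k, j) * z (l, j))"

locale weighted_grid =
  fixes N p :: nat and lam :: "nat \<Rightarrow> real"
  assumes lam_pos: "\<And>j. j < p \<Longrightarrow> 0 < lam j" and p_pos: "0 < p"
begin

abbreviation "G \<equiv> gauss (grid N p)"
abbreviation "w \<equiv> wip p lam"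
definition s :: "nat \<Rightarrow> real" where "s r = (\<Sum>j<p. lam j ^ r)"

sublocale prob_space G by (rule prob_space_gauss)

lemma s_pos: "0 < s r"
  unfolding s_def by (rule sum_pos) (use lam_pos p_pos in auto)

lemma w_commute: "w z k l = w z l k"
  by (simp add: wip_def mult_ac)

lemma am_coord: "k < N \<Longrightarrow> j < p \<Longrightarrow> all_moments G (\<lambda>z. z (k, j))"
  by (rule all_moments_gauss) auto

lemma am_w: "k < N \<Longrightarrow> l < N \<Longrightarrow> all_moments G (\<lambda>z. w z k l)"
  unfolding wip_def by (intro all_moments_intros) auto

lemmas am = all_moments_mult all_moments_add all_moments_const[OF prob_space_gauss]
  all_moments_sum[OF prob_space_gauss] all_moments_diff[OF prob_space_gauss]
  all_moments_power[OF prob_space_gauss] am_w am_coord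

lemma w_diag_moments:
  assumes k: "k < N"
  shows "expectation (\<lambda>z. w z k k - s 1) = 0"
    and "expectation (\<lambda>z. (w z k k - s 1)\<^sup>2) = 2 * s 2"
    and "expectation (\<lambda>z. (w z k k - s 1) ^ 4) \<le> 60 * (s 2)\<^sup>2"
proof -
  define X where "X j z = lam j * sqc (z (k, j))" for j and z :: "nat \<times> nat \<Rightarrow> real"
  have eq: "w z k k - s 1 = (\<Sum>j<p. X j z)" for z
    by (simp add: wip_def s_def X_def sum_subtractf power2_eq_square algebra_simps)
  have ind: "indep_vars (\<lambda>_. borel) X {..<p}"
    by (rule indep_blocks[of "\<lambda>j. {(k, j)}"]) (use k in \<open>auto simp: disjoint_family_on_def X_def[abs_def]\<close>)
  have amX: "all_moments G (X j)" if "j \<in> {..<p}" for j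
    unfolding X_def[abs_def] using that k by (intro am) auto
  have E: "expectation (\<lambda>z. f (X j z)) = (LINT x|std_normal_distribution. f (lam j * sqc x))"
    if "j \<in> {..<p}" "f \<in> borel_measurable borel" for j and f :: "real \<Rightarrow> real"
    unfolding X_def using that k
    by (intro gauss_expectation_coordinate[of "(k, j)" _ "\<lambda>x. f (lam j * sqc x)"]) auto
  have m1: "expectation (X j) = 0" if "j \<in> {..<p}" for j
    using E[OF that, of "\<lambda>x. x"] sqc_moments(1) by simp
  have m2: "expectation (\<lambda>z. (X j z)\<^sup>2) = 2 * (lam j)\<^sup>2" if "j \<in> {..<p}" for j
    using E[OF that, of "\<lambda>x. x\<^sup>2"] sqc_moments(2) by (simp add: power_mult_distrib)
  have m4: "expectation (\<lambda>z. (X j z) ^ 4) \<le> 15 * (2 * (lam j)\<^sup>2)\<^sup>2" if "j \<in> {..<p}" for j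
    using E[OF that, of "\<lambda>x. x ^ 4"] sqc_fourth_moment by (simp add: power_mult_distrib flip: power_mult)
  have "expectation (\<lambda>z. \<Sum>j<p. X j z) = 0"
    using m1 amX by (subst Bochner_Integration.integral_sum) (auto intro: all_moments_integrable)
  then show "expectation (\<lambda>z. w z k k - s 1) = 0" by (simp only: eq)
  have "expectation (\<lambda>z. (\<Sum>j<p. X j z)\<^sup>2) = (\<Sum>j<p. 2 * (lam j)\<^sup>2)"
    by (rule indep_sum_moments(1)[OF finite_lessThan ind amX m1 m2])
  then have S1: "expectation (\<lambda>z. (\<Sum>j<p. X j z)\<^sup>2) = 2 * s 2"
    by (simp only: s_def sum_distrib_left)
  show "expectation (\<lambda>z. (w z k k - s 1)\<^sup>2) = 2 * s 2"
    using S1 by (simp only: eq)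
  have "expectation (\<lambda>z. (\<Sum>j<p. X j z) ^ 4) \<le> 15 * (\<Sum>j<p. 2 * (lam j)\<^sup>2)\<^sup>2"
    by (rule indep_sum_moments(2)[OF finite_lessThan ind amX m1 m2 _ m4]) simp_all
  also have "(\<Sum>j<p. 2 * (lam j)\<^sup>2) = 2 * s 2" by (simp add: s_def sum_distrib_left)
  finally show "expectation (\<lambda>z. (w z k k - s 1) ^ 4) \<le> 60 * (s 2)\<^sup>2"
    unfolding eq by (simp add: power_mult_distrib)
qed

lemma w_off_moments:
  assumes k: "k < N" "l < N" "k \<noteq> l"
  shows "expectation (\<lambda>z. (w z k l)\<^sup>2) = s 2"
    and "expectation (\<lambda>z. (w z k l) ^ 4) \<le> 9 * (s 2)\<^sup>2"
proof -
  define X where "X j z = lam j * z (k, j) * z (l, j)" for j and z :: "nat \<times> nat \<Rightarrow> real"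
  have eq: "w z k l = (\<Sum>j<p. X j z)" for z by (simp add: wip_def X_def)
  have ind: "indep_vars (\<lambda>_. borel) X {..<p}"
    by (rule indep_blocks[of "\<lambda>j. {(k, j), (l, j)}"]) (use k in \<open>auto simp: disjoint_family_on_def X_def[abs_def]\<close>)
  have amX: "all_moments G (X j)" if "j \<in> {..<p}" for j
    unfolding X_def[abs_def] using that k by (intro am) auto
  have E: "expectation (\<lambda>z. (X j z) ^ a) = lam j ^ a * ((LINT x|std_normal_distribution. x ^ a) * (LINT x|std_normal_distribution. x ^ a))"
    if "j \<in> {..<p}" for j a
  proof -
    have "(X j z) ^ a = lam j ^ a * (z (k, j) ^ a * z (l, j) ^ a)" for z
      by (simp add: X_def power_mult_distrib)
    moreover have "(LINT z|G. z (k, j) ^ a * z (l, j) ^ a)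
        = (LINT x|std_normal_distribution. x ^ a) * (LINT x|std_normal_distribution. x ^ a)"
      by (rule gauss_pair_moment) (use k that in auto)
    ultimately show ?thesis by simp
  qed
  have m1: "expectation (X j) = 0" if "j \<in> {..<p}" for j
    using E[OF that, of 1] std_normal_moments(1) by simp
  have m2: "expectation (\<lambda>z. (X j z)\<^sup>2) = (lam j)\<^sup>2" if "j \<in> {..<p}" for j
    using E[OF that, of 2] std_normal_moments(2) by simp
  have m4: "expectation (\<lambda>z. (X j z) ^ 4) \<le> 9 * ((lam j)\<^sup>2)\<^sup>2" if "j \<in> {..<p}" for j
    using E[OF that, of 4] std_normal_moments(3) by (simp flip: power_mult)
  have "expectation (\<lambda>z. (\<Sum>j<p. X j z)\<^sup>2) = (\<Sum>j<p. (lam j)\<^sup>2)"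
    by (rule indep_sum_moments(1)[OF finite_lessThan ind amX m1 m2])
  then show "expectation (\<lambda>z. (w z k l)\<^sup>2) = s 2" by (simp only: eq s_def)
  have "expectation (\<lambda>z. (\<Sum>j<p. X j z) ^ 4) \<le> 9 * (\<Sum>j<p. (lam j)\<^sup>2)\<^sup>2"
    by (rule indep_sum_moments(2)[OF finite_lessThan ind amX m1 m2 _ m4]) simp_all
  then show "expectation (\<lambda>z. (w z k l) ^ 4) \<le> 9 * (s 2)\<^sup>2" by (simp only: eq s_def)
qed

lemma w_restrict:
  assumes "{k, l} \<times> {..<p} \<subseteq> A" shows "w (restrict z A) k l = w z k l"
  unfolding wip_def using assms by (intro sum.cong refl) (auto simp: subset_eq)

lemma measurable_w:
  assumes "{k, l} \<times> {..<p} \<subseteq> A"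
  shows "(\<lambda>z. w z k l) \<in> borel_measurable (Pi\<^sub>M A (\<lambda>_. borel))"
  unfolding wip_def using assms
  by (intro borel_measurable_sum borel_measurable_times borel_measurable_const measurable_component_singleton) auto

lemma trace_second_moment:
  assumes K: "K \<subseteq> {..<N}"
  shows "expectation (\<lambda>z. (\<Sum>k\<in>K. (w z k k - s 1))\<^sup>2) = card K * (2 * s 2)"
proof -
  have fK: "finite K" using K finite_subset by blast
  have kN: "k < N" if "k \<in> K" for k using K that by auto
  have ind: "indep_vars (\<lambda>_. borel) (\<lambda>k z. w z k k - s 1) K"
  proof (rule indep_blocks[of "\<lambda>k. {k} \<times> {..<p}"])
    show "(\<lambda>z. w z k k - s 1) \<in> borel_measurable (Pi\<^sub>M ({k} \<times> {..<p}) (\<lambda>_. borel))" for k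
      by (intro borel_measurable_diff measurable_w borel_measurable_const) auto
    show "w (restrict z ({k} \<times> {..<p})) k k - s 1 = w z k k - s 1" for k z
      by (subst w_restrict) auto
  qed (use kN in \<open>auto simp: disjoint_family_on_def\<close>)
  have "expectation (\<lambda>z. (\<Sum>k\<in>K. (w z k k - s 1))\<^sup>2) = (\<Sum>k\<in>K. 2 * s 2)"
    by (rule indep_sum_moments(1)[OF fK ind _ w_diag_moments(1,2)]) (auto intro!: am kN)
  then show ?thesis by simp
qed

definition h :: "(nat \<times> nat \<Rightarrow> real) \<Rightarrow> nat \<times> nat \<Rightarrow> real" where
  "h z e = (w z (fst e) (snd e))\<^sup>2 - s 2"

text \<open>
  Two summands are uncorrelated unless their index pairs share a row.  A pair meets at most \<open>4 card K\<close> others,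
  and each covariance is at most \<open>9 (s 2)\<^sup>2\<close>, hence the constant \<open>36\<close>; what counts is the order \<open>(card K)\<^sup>3\<close> in place
  of the trivial \<open>(card K)\<^sup>4\<close>.
\<close>

lemma u_statistic_second_moment:
  assumes K: "K \<subseteq> {..<N}" and P: "P = {e \<in> K \<times> K. fst e \<noteq> snd e}"
  shows "expectation (\<lambda>z. (\<Sum>e\<in>P. h z e)\<^sup>2) \<le> 36 * real (card K) ^ 3 * (s 2)\<^sup>2"
proof -
  have fK: "finite K" using K finite_subset by blast
  have fP: "finite P" using fK by (auto simp: P)
  have PN: "fst e < N" "snd e < N" "fst e \<noteq> snd e" "fst e \<in> K" "snd e \<in> K" if "e \<in> P" for e
    using that K by (auto simp: P)
  have amh: "all_moments G (\<lambda>z. h z e)" if "e \<in> P" for e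
    unfolding h_def using PN[OF that] by (intro am)
  have Eh: "expectation (\<lambda>z. h z e) = 0" if "e \<in> P" for e
    unfolding h_def using w_off_moments(1)[OF PN(1-3)[OF that]] PN[OF that]
    by (subst Bochner_Integration.integral_diff) (auto intro!: all_moments_integrable am simp: prob_space)
  have Eh2: "expectation (\<lambda>z. (h z e)\<^sup>2) \<le> 9 * (s 2)\<^sup>2" if "e \<in> P" for e
  proof -
    let ?w = "\<lambda>z. w z (fst e) (snd e)"
    have i: "integrable G (\<lambda>z. ?w z ^ 4)" "integrable G (\<lambda>z. (?w z)\<^sup>2)"
      using PN[OF that] by (auto intro!: all_moments_integrable am)
    have "expectation (\<lambda>z. (h z e)\<^sup>2) = expectation (\<lambda>z. ?w z ^ 4 - 2 * s 2 * (?w z)\<^sup>2 + (s 2)\<^sup>2)"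
      by (rule Bochner_Integration.integral_cong) (auto simp: h_def power2_eq_square power4_eq_xxxx algebra_simps)
    also have "\<dots> = expectation (\<lambda>z. ?w z ^ 4) - 2 * s 2 * s 2 + (s 2)\<^sup>2"
      using i w_off_moments(1)[OF PN(1-3)[OF that]] by (simp add: prob_space)
    also have "\<dots> \<le> 9 * (s 2)\<^sup>2" using w_off_moments(2)[OF PN(1-3)[OF that]] zero_le_square[of "s 2"]
      unfolding power2_eq_square by linarith
    finally show ?thesis .
  qed
  define share where "share e f \<longleftrightarrow> {fst e, snd e} \<inter> {fst f, snd f} \<noteq> {}" for e f :: "nat \<times> nat"
  have cov: "expectation (\<lambda>z. h z e * h z f) \<le> (if share e f then 9 * (s 2)\<^sup>2 else 0)" if e: "e \<in> P" and f: "f \<in> P" for e f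
  proof (cases "share e f")
    case True
    have "expectation (\<lambda>z. h z e * h z f) \<le> expectation (\<lambda>z. 1 / 2 * ((h z e)\<^sup>2 + (h z f)\<^sup>2))"
    proof (rule integral_mono)
      show "h z e * h z f \<le> 1 / 2 * ((h z e)\<^sup>2 + (h z f)\<^sup>2)" for z
        using sum_squares_bound[of "h z e" "h z f"] by simp
      show "integrable G (\<lambda>z. h z e * h z f)"
        by (intro all_moments_integrable all_moments_mult amh e f)
      show "integrable G (\<lambda>z. 1 / 2 * ((h z e)\<^sup>2 + (h z f)\<^sup>2))"
        by (intro integrable_mult_right Bochner_Integration.integrable_add all_moments_integrable_power amh e f)
    qed
    also have "\<dots> = (expectation (\<lambda>z. (h z e)\<^sup>2) + expectation (\<lambda>z. (h z f)\<^sup>2)) / 2"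
      using amh[OF e] amh[OF f] by (simp add: all_moments_integrable_power)
    also have "\<dots> \<le> 9 * (s 2)\<^sup>2" using Eh2[OF e] Eh2[OF f] by simp
    finally show ?thesis using True by simp
  next
    case False
    let ?B = "\<lambda>e. {fst e, snd e} \<times> {..<p}"
    have "expectation (\<lambda>z. h z e * h z f) = expectation (\<lambda>z. h z e) * expectation (\<lambda>z. h z f)"
    proof (rule gauss_indep_product[of "?B e" _ "?B f"])
      show "?B e \<inter> ?B f = {}" using False by (auto simp: share_def)
      show "?B e \<subseteq> grid N p" "?B f \<subseteq> grid N p" using PN[OF e] PN[OF f] by auto
      show "(\<lambda>z. h z e) \<in> borel_measurable (Pi\<^sub>M (?B e) (\<lambda>_. borel))" "(\<lambda>z. h z f) \<in> borel_measurable (Pi\<^sub>M (?B f) (\<lambda>_. borel))"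
        unfolding h_def by (intro borel_measurable_diff borel_measurable_power measurable_w borel_measurable_const order_refl)+
      show "h (restrict z (?B e)) e = h z e" "h (restrict z (?B f)) f = h z f" for z
        unfolding h_def by (simp_all add: w_restrict)
    qed (use amh[OF e] amh[OF f] in \<open>auto intro: all_moments_integrable\<close>)
    then show ?thesis using Eh[OF e] False by simp
  qed
  have cnt: "card {f \<in> P. share e f} \<le> 4 * card K" if "e \<in> P" for e
  proof -
    obtain k l where e: "e = (k, l)" by (cases e)
    have "{f \<in> P. share e f} \<subseteq> ({k} \<times> K \<union> {l} \<times> K) \<union> (K \<times> {k} \<union> K \<times> {l})"
    proof
      fix f assume "f \<in> {f \<in> P. share e f}"
      then have "f \<in> K \<times> K" "share (k, l) f" by (simp_all add: P e)
      moreover obtain a b where "f = (a, b)" by (cases f)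
      ultimately show "f \<in> ({k} \<times> K \<union> {l} \<times> K) \<union> (K \<times> {k} \<union> K \<times> {l})"
        by (auto simp: share_def)
    qed
    then have "card {f \<in> P. share e f} \<le> card (({k} \<times> K \<union> {l} \<times> K) \<union> (K \<times> {k} \<union> K \<times> {l}))"
      using fK by (intro card_mono) auto
    also have "\<dots> \<le> (card ({k} \<times> K) + card ({l} \<times> K)) + (card (K \<times> {k}) + card (K \<times> {l}))"
      by (intro order_trans[OF card_Un_le] add_mono card_Un_le)
    finally show ?thesis using fK by (simp add: card_cartesian_product)
  qed
  have cP: "card P \<le> card K * card K"
    using fK card_mono[of "K \<times> K" P] by (auto simp: P card_cartesian_product)
  have "expectation (\<lambda>z. (\<Sum>e\<in>P. h z e)\<^sup>2) = expectation (\<lambda>z. \<Sum>e\<in>P. \<Sum>f\<in>P. h z e * h z f)"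
    by (simp add: power2_eq_square sum_product)
  also have "\<dots> = (\<Sum>e\<in>P. \<Sum>f\<in>P. expectation (\<lambda>z. h z e * h z f))"
  proof -
    have int: "integrable G (\<lambda>z. h z e * h z f)" if "e \<in> P" "f \<in> P" for e f
      by (intro all_moments_integrable all_moments_mult amh that)
    have "expectation (\<lambda>z. \<Sum>e\<in>P. \<Sum>f\<in>P. h z e * h z f) = (\<Sum>e\<in>P. expectation (\<lambda>z. \<Sum>f\<in>P. h z e * h z f))"
      by (rule Bochner_Integration.integral_sum) (intro Bochner_Integration.integrable_sum int)
    also have "\<dots> = (\<Sum>e\<in>P. \<Sum>f\<in>P. expectation (\<lambda>z. h z e * h z f))"
      by (intro sum.cong refl Bochner_Integration.integral_sum int)
    finally show ?thesis .
  qed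
  also have "\<dots> \<le> (\<Sum>e\<in>P. \<Sum>f\<in>P. if share e f then 9 * (s 2)\<^sup>2 else 0)"
    by (intro sum_mono cov)
  also have "\<dots> = (\<Sum>e\<in>P. real (card {f \<in> P. share e f}) * (9 * (s 2)\<^sup>2))"
    using fP by (intro sum.cong refl) (simp add: sum.If_cases Int_def)
  also have "\<dots> \<le> (\<Sum>e\<in>P. real (4 * card K) * (9 * (s 2)\<^sup>2))"
    by (intro sum_mono mult_right_mono) (use cnt in \<open>simp_all only: of_nat_le_iff\<close>, simp)
  also have "\<dots> = real (card P) * (36 * real (card K) * (s 2)\<^sup>2)" by simp
  also have "\<dots> \<le> real (card K * card K) * (36 * real (card K) * (s 2)\<^sup>2)"
    by (intro mult_right_mono) (use cP in \<open>simp_all only: of_nat_le_iff\<close>, simp)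
  also have "\<dots> = 36 * real (card K) ^ 3 * (s 2)\<^sup>2" by (simp add: power3_eq_cube)
  finally show ?thesis .
qed


lemma triple_moment_distinct:
  assumes "k < N" "l < N" "q < N" "k \<noteq> l" "l \<noteq> q" "q \<noteq> k"
  shows "expectation (\<lambda>z. w z k l * w z l q * w z q k) = s 3"
proof -
  have coord: "expectation (\<lambda>z. z (k, a) * z (k, b)) = (if a = b then 1 else 0)"
    if k: "k < N" and ab: "a < p" "b < p" for k a b
  proof (cases "a = b")
    case True
    then show ?thesis using gauss_expectation_coordinate[of "(k, a)" "grid N p" "\<lambda>x. x\<^sup>2"] std_normal_moments(2) k ab
      by (simp add: power2_eq_square)
  next
    case False
    then show ?thesis using gauss_pair_moment[of "(k, a)" "grid N p" "(k, b)" 1 1] std_normal_moments(1) k ab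
      by simp
  qed
  have prod: "expectation (\<lambda>z. (z (k, a) * z (k, c)) * ((z (l, a) * z (l, b)) * (z (q, b) * z (q, c))))
      = (if a = c \<and> a = b then 1 else 0)" if abc: "a < p" "b < p" "c < p" for a b c
  proof -
    have "expectation (\<lambda>z. (z (k, a) * z (k, c)) * ((z (l, a) * z (l, b)) * (z (q, b) * z (q, c))))
      = expectation (\<lambda>z. z (k, a) * z (k, c)) * expectation (\<lambda>z. (z (l, a) * z (l, b)) * (z (q, b) * z (q, c)))"
      by (rule gauss_indep_product[of "{(k, a), (k, c)}" _ "{(l, a), (l, b), (q, b), (q, c)}"])
         (use assms abc in \<open>auto intro!: all_moments_integrable am\<close>)
    also have "expectation (\<lambda>z. (z (l, a) * z (l, b)) * (z (q, b) * z (q, c)))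
       = expectation (\<lambda>z. z (l, a) * z (l, b)) * expectation (\<lambda>z. z (q, b) * z (q, c))"
      by (rule gauss_indep_product[of "{(l, a), (l, b)}" _ "{(q, b), (q, c)}"])
         (use assms abc in \<open>auto intro!: all_moments_integrable am\<close>)
    finally show ?thesis using coord assms abc by simp
  qed
  define t where "t a b c z = lam a * lam b * lam c * ((z (k, a) * z (k, c)) * ((z (l, a) * z (l, b)) * (z (q, b) * z (q, c))))" for a b c and z :: "nat \<times> nat \<Rightarrow> real"
  have int: "integrable G (t a b c)" if "a < p" "b < p" "c < p" for a b c
    unfolding t_def using assms that by (auto intro!: all_moments_integrable am)
  have Et: "expectation (t a b c) = (if b = a then (if c = a then lam a ^ 3 else 0) else 0)" if "a < p" "b < p" "c < p" for a b c
    unfolding t_def using prod[OF that] by (auto simp: power3_eq_cube)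
  have "w z k l * w z l q * w z q k = (\<Sum>a<p. \<Sum>b<p. \<Sum>c<p. t a b c z)" for z
  proof -
    have "w z k l * w z l q * w z q k = (\<Sum>c<p. \<Sum>b<p. \<Sum>a<p. t a b c z)"
      unfolding wip_def sum_product sum_distrib_right sum_distrib_left t_def
      by (intro sum.cong refl) (simp add: mult_ac)
    also have "\<dots> = (\<Sum>c<p. \<Sum>a<p. \<Sum>b<p. t a b c z)"
      by (rule sum.cong[OF refl]) (rule sum.swap)
    also have "\<dots> = (\<Sum>a<p. \<Sum>c<p. \<Sum>b<p. t a b c z)" by (rule sum.swap)
    also have "\<dots> = (\<Sum>a<p. \<Sum>b<p. \<Sum>c<p. t a b c z)"
      by (rule sum.cong[OF refl]) (rule sum.swap)
    finally show ?thesis .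
  qed
  then have "expectation (\<lambda>z. w z k l * w z l q * w z q k) = expectation (\<lambda>z. \<Sum>a<p. \<Sum>b<p. \<Sum>c<p. t a b c z)" by simp
  also have "\<dots> = (\<Sum>a<p. expectation (\<lambda>z. \<Sum>b<p. \<Sum>c<p. t a b c z))"
    by (rule Bochner_Integration.integral_sum) (auto intro!: Bochner_Integration.integrable_sum int)
  also have "\<dots> = (\<Sum>a<p. \<Sum>b<p. expectation (\<lambda>z. \<Sum>c<p. t a b c z))"
    by (intro sum.cong refl Bochner_Integration.integral_sum) (auto intro!: Bochner_Integration.integrable_sum int)
  also have "\<dots> = (\<Sum>a<p. \<Sum>b<p. \<Sum>c<p. expectation (t a b c))"
    by (intro sum.cong refl Bochner_Integration.integral_sum) (auto intro!: int)
  also have "\<dots> = (\<Sum>a<p. \<Sum>b<p. \<Sum>c<p. if b = a then (if c = a then lam a ^ 3 else 0) else 0)"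
    by (intro sum.cong refl Et) auto
  also have "\<dots> = (\<Sum>a<p. \<Sum>b<p. if b = a then lam a ^ 3 else 0)"
    by (intro sum.cong refl) simp
  also have "\<dots> = (\<Sum>a<p. lam a ^ 3)" by (intro sum.cong refl) simp
  finally show ?thesis by (simp add: s_def)
qed

lemma w_diag_nonneg: "0 \<le> w z k k"
  unfolding wip_def by (rule sum_nonneg) (use lam_pos in \<open>auto simp: mult.assoc less_imp_le\<close>)

text \<open>
  Crude bounds for the expectations of triple products with a repeated row, see \<open>triple_moment_pair\<close> and
  \<open>triple_moment_diag\<close>.  When \<open>p\<close> grows like \<open>card K\<close> they are of
  the orders \<open>p\<^sup>2\<close> and \<open>p\<^sup>3\<close>, so that every term of \<open>triple_sum_first_moment\<close> has order \<open>p\<^sup>4\<close>.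
\<close>

definition b2 :: real where "b2 = (1/2) * ((s 1)\<^sup>2 + 2 * s 2 + 9 * (s 2)\<^sup>2)"
definition b3 :: real where "b3 = 9 * (s 1) ^ 3 + 480 * (s 2)\<^sup>2 / s 1"

lemma b_nonneg: "0 \<le> b2" "0 \<le> b3"
  unfolding b2_def b3_def using s_pos[of 1] s_pos[of 2] by auto

lemma diag_square_moment: "k < N \<Longrightarrow> expectation (\<lambda>z. (w z k k)\<^sup>2) = (s 1)\<^sup>2 + 2 * s 2"
proof -
  assume k: "k < N"
  have i: "integrable G (\<lambda>z. (w z k k - s 1)\<^sup>2)" "integrable G (\<lambda>z. w z k k - s 1)"
    using k by (auto intro!: all_moments_integrable am)
  have "expectation (\<lambda>z. (w z k k)\<^sup>2) = expectation (\<lambda>z. (w z k k - s 1)\<^sup>2 + 2 * s 1 * (w z k k - s 1) + (s 1)\<^sup>2)"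
    by (rule Bochner_Integration.integral_cong) (auto simp: power2_eq_square algebra_simps)
  also have "\<dots> = expectation (\<lambda>z. (w z k k - s 1)\<^sup>2) + 2 * s 1 * expectation (\<lambda>z. w z k k - s 1) + (s 1)\<^sup>2"
    using i by (subst Bochner_Integration.integral_add Bochner_Integration.integral_mult_right | (intro Bochner_Integration.integrable_add integrable_mult_right integrable_const i)[1])+ (simp add: prob_space)
  finally show ?thesis using w_diag_moments(1,2)[OF k] by simp
qed

lemma triple_moment_pair:
  assumes "k < N" "l < N" "k \<noteq> l"
  shows "expectation (\<lambda>z. w z k k * (w z k l)\<^sup>2) \<le> b2"
proof -
  have "expectation (\<lambda>z. w z k k * (w z k l)\<^sup>2) \<le> expectation (\<lambda>z. 1 / 2 * ((w z k k)\<^sup>2 + (w z k l) ^ 4))"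
  proof (rule integral_mono)
    show "w z k k * (w z k l)\<^sup>2 \<le> 1 / 2 * ((w z k k)\<^sup>2 + (w z k l) ^ 4)" for z
      using sum_squares_bound[of "w z k k" "(w z k l)\<^sup>2"] by (simp flip: power_mult)
  qed (use assms in \<open>auto intro!: all_moments_integrable am simp del: times_divide_eq_left divide_divide_eq_left distrib_left_numeral\<close>)
  also have "\<dots> = 1 / 2 * (expectation (\<lambda>z. (w z k k)\<^sup>2) + expectation (\<lambda>z. (w z k l) ^ 4))"
  proof -
    have "integrable G (\<lambda>z. (w z k k)\<^sup>2)" "integrable G (\<lambda>z. (w z k l) ^ 4)"
      using assms by (auto intro!: all_moments_integrable am)
    then show ?thesis by simp
  qed
  also have "\<dots> \<le> b2" using diag_square_moment[OF assms(1)] w_off_moments(2)[OF assms] by (simp add: b2_def)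
  finally show ?thesis .
qed

text \<open>
  The third power is bounded through the fourth central moment: \<open>v\<^sup>3 \<le> s\<^sup>3 + v\<^sup>4 / s\<close> and
  \<open>v\<^sup>4 \<le> 8 (s\<^sup>4 + (v - s)\<^sup>4)\<close> for \<open>v \<ge> 0\<close> and \<open>s > 0\<close>.
\<close>

lemma triple_moment_diag:
  assumes k: "k < N"
  shows "expectation (\<lambda>z. (w z k k) ^ 3) \<le> b3"
proof -
  have s1: "0 < s 1" by (rule s_pos)
  have i: "integrable G (\<lambda>z. (w z k k - s 1) ^ 4)" using k by (auto intro!: all_moments_integrable am)
  have pt: "(w z k k) ^ 3 \<le> 9 * (s 1) ^ 3 + 8 / s 1 * (w z k k - s 1) ^ 4" for z
  proof -
    define v where "v = w z k k"
    have v: "0 \<le> v" unfolding v_def by (rule w_diag_nonneg)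
    have "v ^ 4 \<le> 8 * ((s 1) ^ 4 + (v - s 1) ^ 4)"
    proof -
      have sq: "(a + b)\<^sup>2 \<le> 2 * (a\<^sup>2 + b\<^sup>2)" for a b :: real using sum_squares_bound[of a b] by (simp add: power2_eq_square algebra_simps)
      have "v\<^sup>2 \<le> 2 * ((s 1)\<^sup>2 + (v - s 1)\<^sup>2)" using sq[of "s 1" "v - s 1"] by simp
      then have "(v\<^sup>2)\<^sup>2 \<le> (2 * ((s 1)\<^sup>2 + (v - s 1)\<^sup>2))\<^sup>2" by (rule power_mono) simp
      also have "\<dots> = 4 * ((s 1)\<^sup>2 + (v - s 1)\<^sup>2)\<^sup>2" unfolding power_mult_distrib by simp
      also have "\<dots> \<le> 4 * (2 * (((s 1)\<^sup>2)\<^sup>2 + ((v - s 1)\<^sup>2)\<^sup>2))" by (rule mult_left_mono[OF sq]) simp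
      finally show ?thesis by (simp flip: power_mult)
    qed
    moreover have "v ^ 3 \<le> (s 1) ^ 3 + v ^ 4 / s 1"
    proof (cases "v \<le> s 1")
      case True
      then have "v ^ 3 \<le> (s 1) ^ 3" by (rule power_mono) (rule v)
      moreover have "0 \<le> v ^ 4 / s 1" using v s1 by simp
      ultimately show ?thesis by linarith
    next
      case False
      then have "v ^ 3 * s 1 \<le> v ^ 3 * v" using v by (intro mult_left_mono) auto
      then have "v ^ 3 \<le> v ^ 4 / s 1" using s1 by (simp add: field_simps power4_eq_xxxx power3_eq_cube)
      moreover have "0 \<le> (s 1) ^ 3" using s1 by simp
      ultimately show ?thesis by linarith
    qed
    ultimately have "v ^ 3 \<le> (s 1) ^ 3 + 8 * ((s 1) ^ 4 + (v - s 1) ^ 4) / s 1"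
      using s1 by (smt (verit) divide_right_mono)
    also have "\<dots> = 9 * (s 1) ^ 3 + 8 / s 1 * (v - s 1) ^ 4"
      using s1 by (simp add: field_simps power4_eq_xxxx power3_eq_cube)
    finally show ?thesis by (simp add: v_def)
  qed
  have "expectation (\<lambda>z. (w z k k) ^ 3) \<le> expectation (\<lambda>z. 9 * (s 1) ^ 3 + 8 / s 1 * (w z k k - s 1) ^ 4)"
  proof (rule integral_mono[OF _ _ pt])
    show "integrable G (\<lambda>z. (w z k k) ^ 3)" using k by (auto intro!: all_moments_integrable am)
    show "integrable G (\<lambda>z. 9 * (s 1) ^ 3 + 8 / s 1 * (w z k k - s 1) ^ 4)"
      by (intro Bochner_Integration.integrable_add integrable_mult_right integrable_const i)
  qed
  also have "\<dots> = 9 * (s 1) ^ 3 + 8 / s 1 * expectation (\<lambda>z. (w z k k - s 1) ^ 4)"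
    by (subst Bochner_Integration.integral_add, rule integrable_const, rule integrable_mult_right[OF i])
       (simp only: integral_mult_right_zero, simp add: prob_space)
  also have "\<dots> \<le> 9 * (s 1) ^ 3 + 8 / s 1 * (60 * (s 2)\<^sup>2)"
    using w_diag_moments(3)[OF k] s1 by (intro add_left_mono mult_left_mono) auto
  also have "\<dots> = b3" by (simp add: b3_def)
  finally show ?thesis .
qed

text \<open>
  Splitting by coincidences among \<open>k, l, q\<close>: all distinct, exactly two equal (three ways), all equal.
\<close>

lemma triple_sum_first_moment:
  assumes K: "K \<subseteq> {..<N}"
  shows "expectation (\<lambda>z. \<Sum>k\<in>K. \<Sum>l\<in>K. \<Sum>q\<in>K. w z k l * w z l q * w z q k)
     \<le> real (card K) ^ 3 * s 3 + 3 * real (card K) ^ 2 * b2 + real (card K) * b3"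
proof -
  have fK: "finite K" using K finite_subset by blast
  have kN: "k < N" if "k \<in> K" for k using K that by auto
  let ?t = "\<lambda>k l q z. w z k l * w z l q * w z q k"
  have int: "integrable G (?t k l q)" if "k \<in> K" "l \<in> K" "q \<in> K" for k l q
    using that by (auto intro!: all_moments_integrable am kN)
  let ?B = "\<lambda>k l q. s 3 + ((if l = k then b2 else 0) + (if q = l then b2 else 0) + (if q = k then b2 else 0))
     + (if q = k then (if l = k then b3 else 0) else 0)"
  have bound: "expectation (?t k l q) \<le> ?B k l q" if "k \<in> K" "l \<in> K" "q \<in> K" for k l q
  proof -
    have s3: "0 \<le> s 3" using s_pos[of 3] by simp
    consider (dist) "k \<noteq> l" "l \<noteq> q" "q \<noteq> k" | (all) "k = l" "l = q" | (kl) "k = l" "l \<noteq> q"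
      | (lq) "l = q" "k \<noteq> l" | (qk) "q = k" "k \<noteq> l" by blast
    then show ?thesis
    proof cases
      case dist then show ?thesis using triple_moment_distinct[of k l q] kN that by simp
    next
      case all
      have "expectation (?t k l q) = expectation (\<lambda>z. (w z k k) ^ 3)"
        using all by (simp add: power3_eq_cube)
      then show ?thesis using triple_moment_diag[OF kN[OF that(1)]] all s3 b_nonneg by simp
    next
      case kl
      have "expectation (?t k l q) = expectation (\<lambda>z. w z k k * (w z k q)\<^sup>2)"
        unfolding kl(1)[symmetric] power2_eq_square by (simp only: w_commute[of _ q k] mult.assoc)
      then show ?thesis using triple_moment_pair[of k q] kN that kl s3 b_nonneg by simp
    next
      case lq
      have "expectation (?t k l q) = expectation (\<lambda>z. w z l l * (w z l k)\<^sup>2)"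
        unfolding lq(1)[symmetric] power2_eq_square by (simp only: w_commute[of _ k l] mult_ac)
      then show ?thesis using triple_moment_pair[of l k] kN that lq s3 b_nonneg by simp
    next
      case qk
      have "expectation (?t k l q) = expectation (\<lambda>z. w z k k * (w z k l)\<^sup>2)"
        using qk by (simp add: power2_eq_square w_commute[of _ l k] mult_ac)
      then show ?thesis using triple_moment_pair[of k l] kN that qk s3 b_nonneg by simp
    qed
  qed
  have "expectation (\<lambda>z. \<Sum>k\<in>K. \<Sum>l\<in>K. \<Sum>q\<in>K. ?t k l q z) = (\<Sum>k\<in>K. expectation (\<lambda>z. \<Sum>l\<in>K. \<Sum>q\<in>K. ?t k l q z))"
    by (rule Bochner_Integration.integral_sum) (intro Bochner_Integration.integrable_sum int)
  also have "\<dots> = (\<Sum>k\<in>K. \<Sum>l\<in>K. expectation (\<lambda>z. \<Sum>q\<in>K. ?t k l q z))"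
    by (intro sum.cong refl Bochner_Integration.integral_sum Bochner_Integration.integrable_sum int)
  also have "\<dots> = (\<Sum>k\<in>K. \<Sum>l\<in>K. \<Sum>q\<in>K. expectation (?t k l q))"
    by (intro sum.cong refl Bochner_Integration.integral_sum int)
  also have "\<dots> \<le> (\<Sum>k\<in>K. \<Sum>l\<in>K. \<Sum>q\<in>K. ?B k l q)" by (intro sum_mono bound)
  also have "\<dots> = real (card K) ^ 3 * s 3 + 3 * real (card K) ^ 2 * b2 + real (card K) * b3"
    using fK by (simp add: sum.distrib flip: sum_distrib_left) (simp add: power3_eq_cube power2_eq_square algebra_simps)
  finally show ?thesis .
qed

text \<open>
  The sum is a positive multiple of \<open>tr S\<^sup>3\<close>.  Together with \<open>triple_sum_first_moment\<close> this bounds the trace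
  in probability by Markov's inequality, without a second moment of degree twelve.
\<close>

lemma triple_sum_nonneg:
  assumes K: "finite K"
  shows "0 \<le> (\<Sum>k\<in>K. \<Sum>l\<in>K. \<Sum>q\<in>K. w z k l * w z l q * w z q k)"
proof -
  have "(\<Sum>k\<in>K. \<Sum>q\<in>K. w z k l * w z l q * w z q k) = (\<Sum>j<p. lam j * (\<Sum>k\<in>K. z (k, j) * w z k l)\<^sup>2)" for l
  proof -
    have "(\<Sum>j<p. lam j * (\<Sum>k\<in>K. z (k, j) * w z k l)\<^sup>2)
        = (\<Sum>j<p. \<Sum>k\<in>K. \<Sum>q\<in>K. lam j * z (q, j) * z (k, j) * (w z k l * w z q l))"
      by (simp add: power2_eq_square sum_product sum_distrib_left mult_ac)
    also have "\<dots> = (\<Sum>k\<in>K. \<Sum>j<p. \<Sum>q\<in>K. lam j * z (q, j) * z (k, j) * (w z k l * w z q l))" by (rule sum.swap)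
    also have "\<dots> = (\<Sum>k\<in>K. \<Sum>q\<in>K. \<Sum>j<p. lam j * z (q, j) * z (k, j) * (w z k l * w z q l))"
      by (rule sum.cong[OF refl]) (rule sum.swap)
    also have "\<dots> = (\<Sum>k\<in>K. \<Sum>q\<in>K. w z q k * (w z k l * w z q l))"
      unfolding wip_def[of p lam z _ _] sum_distrib_right[symmetric] ..
    also have "\<dots> = (\<Sum>k\<in>K. \<Sum>q\<in>K. w z k l * w z l q * w z q k)"
      by (intro sum.cong refl) (simp only: w_commute[of z _ l] mult_ac)
    finally show ?thesis by simp
  qed
  then have "(\<Sum>l\<in>K. \<Sum>k\<in>K. \<Sum>q\<in>K. w z k l * w z l q * w z q k) = (\<Sum>l\<in>K. \<Sum>j<p. lam j * (\<Sum>k\<in>K. z (k, j) * w z k l)\<^sup>2)"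
    by simp
  also have "\<dots> \<ge> 0" using lam_pos by (intro sum_nonneg mult_nonneg_nonneg) (auto simp: less_imp_le)
  finally show ?thesis by (subst sum.swap)
qed

end

section \<open>Measurability and locality of the tests\<close>

lemma sample_mean_cong:
  assumes "\<And>i j. i < N \<Longrightarrow> j < p \<Longrightarrow> x i j = x' i j"
  shows "sample_mean N p x = sample_mean N p x'"
  unfolding sample_mean_def using assms by (intro eq_vecI) auto

lemma sample_cov_cong:
  assumes "\<And>i j. i < N \<Longrightarrow> j < p \<Longrightarrow> x i j = x' i j"
  shows "sample_cov N p x = sample_cov N p x'"
proof -
  have sm: "sample_mean N p x = sample_mean N p x'" by (rule sample_mean_cong) (rule assms)
  show ?thesis unfolding sample_cov_def sm using assms by (intro eq_matI) auto
qed

lemmas statistic_defs = hotelling_T2_def dempster_D_def T_weighted_def a1_hat_def a2_hat_def a3_hat_def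
  rho_hat_def sigma_hat_def x_hat_def

text \<open>
  The tests depend only on the coordinates \<open>x i j\<close> with \<open>i < N\<close> and \<open>j < p\<close>, although a sample is a function on all
  pairs of numbers.
\<close>

lemma tests_local:
  assumes "\<And>i j. i < N \<Longrightarrow> j < p \<Longrightarrow> x i j = x' i j"
  shows "hotelling_rejects N p mu0 \<alpha> x = hotelling_rejects N p mu0 \<alpha> x'"
    "dempster_rejects N p mu0 \<alpha> x = dempster_rejects N p mu0 \<alpha> x'"
    "proposed_rejects N p mu0 \<alpha> x = proposed_rejects N p mu0 \<alpha> x'"
    "proposed_adj_rejects N p mu0 \<alpha> x = proposed_adj_rejects N p mu0 \<alpha> x'"
proof -
  have sm: "sample_mean N p x = sample_mean N p x'" by (rule sample_mean_cong) (rule assms)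
  have sc: "sample_cov N p x = sample_cov N p x'" by (rule sample_cov_cong) (rule assms)
  show "hotelling_rejects N p mu0 \<alpha> x = hotelling_rejects N p mu0 \<alpha> x'"
    "dempster_rejects N p mu0 \<alpha> x = dempster_rejects N p mu0 \<alpha> x'"
    "proposed_rejects N p mu0 \<alpha> x = proposed_rejects N p mu0 \<alpha> x'"
    "proposed_adj_rejects N p mu0 \<alpha> x = proposed_adj_rejects N p mu0 \<alpha> x'"
    unfolding hotelling_rejects_def dempster_rejects_def proposed_rejects_def proposed_adj_rejects_def
      statistic_defs sm sc by (rule refl)+
qed

context
  fixes N p :: nat and mu0 :: "real Matrix.vec"
  assumes mu0: "mu0 \<in> carrier_vec p"
begin

abbreviation "SS \<equiv> Pi\<^sub>M {..<N} (\<lambda>_. Pi\<^sub>M {..<p} (\<lambda>_. borel :: real measure))"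

lemma measurable_entry [measurable]: "i < N \<Longrightarrow> j < p \<Longrightarrow> (\<lambda>x. x i j) \<in> borel_measurable SS"
  using measurable_compose[OF measurable_component_singleton[of i "{..<N}" "\<lambda>_. Pi\<^sub>M {..<p} (\<lambda>_. borel :: real measure)"]
      measurable_component_singleton[of j "{..<p}" "\<lambda>_. borel"]] by simp

definition me :: "(nat \<Rightarrow> nat \<Rightarrow> real) \<Rightarrow> nat \<Rightarrow> real" where "me x j = (\<Sum>i<N. x i j) / real N"
definition ce :: "(nat \<Rightarrow> nat \<Rightarrow> real) \<Rightarrow> nat \<Rightarrow> nat \<Rightarrow> real" where
  "ce x j l = (\<Sum>i<N. (x i j - me x j) * (x i l - me x l)) / (real N - 1)"

lemma measurable_me: "j < p \<Longrightarrow> (\<lambda>x. me x j) \<in> borel_measurable SS"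
  unfolding me_def
  by (intro borel_measurable_divide borel_measurable_sum borel_measurable_const measurable_entry) auto

lemma measurable_ce: "j < p \<Longrightarrow> l < p \<Longrightarrow> (\<lambda>x. ce x j l) \<in> borel_measurable SS"
  unfolding ce_def
  by (intro borel_measurable_divide borel_measurable_sum borel_measurable_const borel_measurable_times
      borel_measurable_diff measurable_entry measurable_me) auto

lemma sample_cov_ce: "sample_cov N p x = Matrix.mat p p (\<lambda>(j, l). ce x j l)"
  unfolding sample_cov_def by (intro eq_matI) (auto simp: ce_def me_def sample_mean_def)

lemma mean_diff: "sample_mean N p x - mu0 = Matrix.vec p (\<lambda>j. me x j - mu0 $ j)"
  using mu0 by (intro eq_vecI) (auto simp: sample_mean_def me_def)

lemma measurable_hotelling [measurable]: "hotelling_T2 N p mu0 \<in> borel_measurable SS"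
  unfolding hotelling_T2_def[abs_def] mean_diff sample_cov_ce
  by (intro borel_measurable_times borel_measurable_const measurable_quad_form_inv measurable_ce
      borel_measurable_diff measurable_me)

lemma measurable_trace:
  "(\<lambda>x. trace_mat (sample_cov N p x)) \<in> borel_measurable SS"
  "(\<lambda>x. trace_mat (sample_cov N p x ^\<^sub>m 2)) \<in> borel_measurable SS"
  "(\<lambda>x. trace_mat (sample_cov N p x ^\<^sub>m 3)) \<in> borel_measurable SS"
proof -
  have 1: "trace_mat (sample_cov N p x) = (\<Sum>a<p. ce x a a)" for x
    by (simp add: trace_mat_def sample_cov_ce)
  have mm: "(A * sample_cov N p x) $$ (a, b) = (\<Sum>d<p. A $$ (a, d) * ce x d b)"
    if "a < p" "b < p" "A \<in> carrier_mat p p" for A x a b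
    using that by (simp add: sample_cov_ce scalar_prod_def atLeast0LessThan)
  have c: "sample_cov N p x \<in> carrier_mat p p" for x by (simp add: sample_cov_ce)
  have e2: "(sample_cov N p x * sample_cov N p x) $$ (a, b) = (\<Sum>d<p. ce x a d * ce x d b)" if "a < p" "b < p" for x a b
    unfolding mm[OF that c] using that by (simp add: sample_cov_ce)
  have p2: "sample_cov N p x ^\<^sub>m 2 = sample_cov N p x * sample_cov N p x" for x
    using c[of x] by (simp add: numeral_2_eq_2)
  have p3: "sample_cov N p x ^\<^sub>m 3 = sample_cov N p x * sample_cov N p x * sample_cov N p x" for x
    using c[of x] by (simp add: numeral_3_eq_3)
  have 2: "trace_mat (sample_cov N p x ^\<^sub>m 2) = (\<Sum>a<p. \<Sum>d<p. ce x a d * ce x d a)" for x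
    unfolding trace_mat_def p2 using c[of x] e2[of _ _ x] by simp
  have 3: "trace_mat (sample_cov N p x ^\<^sub>m 3) = (\<Sum>a<p. \<Sum>d<p. (\<Sum>f<p. ce x a f * ce x f d) * ce x d a)" for x
  proof -
    have "(sample_cov N p x * sample_cov N p x * sample_cov N p x) $$ (a, a) = (\<Sum>d<p. (\<Sum>f<p. ce x a f * ce x f d) * ce x d a)"
      if "a < p" for a
      by (subst mm[OF that that mult_carrier_mat[OF c c]]) (use that in \<open>simp add: e2\<close>)
    then show ?thesis unfolding trace_mat_def p3 using c[of x] by simp
  qed
  show "(\<lambda>x. trace_mat (sample_cov N p x)) \<in> borel_measurable SS"
    unfolding 1 by (intro borel_measurable_sum measurable_ce) auto
  show "(\<lambda>x. trace_mat (sample_cov N p x ^\<^sub>m 2)) \<in> borel_measurable SS"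
    unfolding 2 by (intro borel_measurable_sum borel_measurable_times measurable_ce) auto
  show "(\<lambda>x. trace_mat (sample_cov N p x ^\<^sub>m 3)) \<in> borel_measurable SS"
    unfolding 3 by (intro borel_measurable_sum borel_measurable_times measurable_ce) auto
qed

lemma measurable_dempster [measurable]: "dempster_D N p mu0 \<in> borel_measurable SS"
proof -
  have "dempster_D N p mu0 = (\<lambda>x. real N * (\<Sum>j<p. (me x j - mu0 $ j) * (me x j - mu0 $ j)) / trace_mat (sample_cov N p x))"
    by (simp add: dempster_D_def mean_diff scalar_prod_def atLeast0LessThan fun_eq_iff)
  moreover have "\<dots> \<in> borel_measurable SS"
    by (intro borel_measurable_divide borel_measurable_times borel_measurable_const borel_measurable_sum
        borel_measurable_diff measurable_me measurable_trace) auto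
  ultimately show ?thesis by simp
qed

lemma measurable_hats [measurable]:
  "a1_hat N p \<in> borel_measurable SS" "a2_hat N p \<in> borel_measurable SS" "a3_hat N p \<in> borel_measurable SS"
  unfolding a1_hat_def[abs_def] a2_hat_def[abs_def] a3_hat_def[abs_def] Let_def
  by (intro borel_measurable_divide borel_measurable_times borel_measurable_const borel_measurable_diff
      borel_measurable_add borel_measurable_power measurable_trace)+

lemma measurable_rho_hat [measurable]: "rho_hat N p \<in> borel_measurable SS"
  unfolding rho_hat_def[abs_def] rho_star_def
  by (intro borel_measurable_add borel_measurable_times borel_measurable_divide borel_measurable_diff
      borel_measurable_power borel_measurable_const borel_measurable_inverse
      measurable_compose[OF _ borel_measurable_sqrt] measurable_hats)

lemma measurable_sigma_hat [measurable]: "sigma_hat N p \<in> borel_measurable SS"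
  unfolding sigma_hat_def[abs_def] sigma_def sigma2_def
  by (intro borel_measurable_add borel_measurable_times borel_measurable_divide borel_measurable_diff
      borel_measurable_power borel_measurable_const borel_measurable_inverse
      measurable_compose[OF _ borel_measurable_sqrt] measurable_hats measurable_rho_hat)

lemma measurable_x_hat [measurable]: "x_hat N p \<alpha> \<in> borel_measurable SS"
  unfolding x_hat_def[abs_def] b1_def b3_def nu1_def nu3_def sigma2_def Let_def
  by (intro borel_measurable_add borel_measurable_times borel_measurable_divide borel_measurable_diff
      borel_measurable_power borel_measurable_const measurable_rho_hat measurable_sigma_hat measurable_hats)

lemma measurable_T_weighted [measurable]:
  "(\<lambda>x. T_weighted N p mu0 (rho_hat N p x) x) \<in> borel_measurable SS"
  unfolding T_weighted_def Let_def
  by (intro borel_measurable_add borel_measurable_times borel_measurable_divide borel_measurable_diff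
      borel_measurable_power borel_measurable_const borel_measurable_inverse
      measurable_compose[OF _ borel_measurable_sqrt] measurable_hotelling measurable_dempster measurable_rho_hat)

lemma pred_tests:
  "Measurable.pred SS (hotelling_rejects N p mu0 \<alpha>)"
  "Measurable.pred SS (dempster_rejects N p mu0 \<alpha>)"
  "Measurable.pred SS (proposed_rejects N p mu0 \<alpha>)"
  "Measurable.pred SS (proposed_adj_rejects N p mu0 \<alpha>)"
proof -
  have le: "Measurable.pred SS (\<lambda>x. f x \<le> g x)" if "f \<in> borel_measurable SS" "g \<in> borel_measurable SS" for f g :: "_ \<Rightarrow> real"
    unfolding pred_def by (rule borel_measurable_le) (rule that)+
  note intros = borel_measurable_times borel_measurable_divide borel_measurable_diff borel_measurable_power
    borel_measurable_const measurable_compose[OF _ borel_measurable_sqrt] measurable_hotelling measurable_dempster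
    measurable_hats measurable_T_weighted measurable_sigma_hat measurable_x_hat
  show "Measurable.pred SS (hotelling_rejects N p mu0 \<alpha>)"
    "Measurable.pred SS (dempster_rejects N p mu0 \<alpha>)"
    "Measurable.pred SS (proposed_rejects N p mu0 \<alpha>)"
    "Measurable.pred SS (proposed_adj_rejects N p mu0 \<alpha>)"
    unfolding hotelling_rejects_def[abs_def] dempster_rejects_def[abs_def] proposed_rejects_def[abs_def]
      proposed_adj_rejects_def[abs_def] by (intro le intros)+
qed

end

section \<open>The joint limit of the two quadratic forms\<close>

text \<open>
  Under every function of the first row, \<open>hot_ratio\<close> may be replaced by the independent \<open>chi_part\<close>.
\<close>

lemma row_transfer_integral:
  fixes f :: "(nat \<Rightarrow> real) \<times> real \<Rightarrow> real"
  assumes p: "0 < p" "p < N" and f: "f \<in> borel_measurable (Pi\<^sub>M {..<p} (\<lambda>_. borel) \<Otimes>\<^sub>M borel)"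
  shows "(LINT z|gauss (grid N p). f (first_row p z, hot_ratio N p m z)) = (LINT z|gauss (grid N p). f (first_row p z, chi_part N p z))"
    and "integrable (gauss (grid N p)) (\<lambda>z. f (first_row p z, hot_ratio N p m z)) \<longleftrightarrow> integrable (gauss (grid N p)) (\<lambda>z. f (first_row p z, chi_part N p z))"
    and "measure (gauss (grid N p)) {z \<in> space (gauss (grid N p)). f (first_row p z, hot_ratio N p m z) \<le> u}
       = measure (gauss (grid N p)) {z \<in> space (gauss (grid N p)). f (first_row p z, chi_part N p z) \<le> u}"
proof -
  let ?G = "gauss (grid N p)" and ?P = "Pi\<^sub>M {..<p} (\<lambda>_. borel :: real measure) \<Otimes>\<^sub>M (borel :: real measure)"
  have N: "0 < N" using p by simp
  have m1: "(\<lambda>z. (first_row p z, hot_ratio N p m z)) \<in> ?G \<rightarrow>\<^sub>M ?P"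
    unfolding measurable_gauss_iff by (intro measurable_Pair measurable_hot_ratio measurable_first_row N)
  have m2: "(\<lambda>z. (first_row p z, chi_part N p z)) \<in> ?G \<rightarrow>\<^sub>M ?P"
    unfolding measurable_gauss_iff by (intro measurable_Pair measurable_chi_part measurable_first_row N p)
  note d = distr_hot_ratio[OF p, of m]
  show "(LINT z|?G. f (first_row p z, hot_ratio N p m z)) = (LINT z|?G. f (first_row p z, chi_part N p z))"
    using integral_distr[OF m1 f] integral_distr[OF m2 f] unfolding d by simp
  show "integrable ?G (\<lambda>z. f (first_row p z, hot_ratio N p m z)) \<longleftrightarrow> integrable ?G (\<lambda>z. f (first_row p z, chi_part N p z))"
    using integrable_distr_eq[OF m1 f] integrable_distr_eq[OF m2 f] unfolding d by simp
  have S: "{x \<in> space ?P. f x \<le> u} \<in> sets ?P"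
    by (rule borel_measurable_le[OF f borel_measurable_const])
  have "measure ?G {z \<in> space ?G. f (T z) \<le> u} = measure (distr ?G ?P T) {x \<in> space ?P. f x \<le> u}"
    if T: "T \<in> ?G \<rightarrow>\<^sub>M ?P" for T
    by (subst measure_distr[OF T S]) (rule arg_cong[where f="measure ?G"], use measurable_space[OF T] in blast)
  from this[OF m1] this[OF m2]
  show "measure ?G {z \<in> space ?G. f (first_row p z, hot_ratio N p m z) \<le> u}
       = measure ?G {z \<in> space ?G. f (first_row p z, chi_part N p z) \<le> u}"
    unfolding d by simp
qed

text \<open>
  The cells of the array whose squares enter a combination of the two test statistics: row \<open>0\<close> with weights
  \<open>u\<close>, and the \<open>N - p\<close> cells of \<open>chi_part\<close> with the common weight \<open>v\<close>.
\<close>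

definition sq_index :: "nat \<Rightarrow> nat \<Rightarrow> (nat \<times> nat) set" where
  "sq_index N p = (if p = 0 then {} else {0} \<times> {..<p} \<union> {p..<N} \<times> {p - 1})"

definition sq_weight :: "nat \<Rightarrow> (nat \<Rightarrow> real) \<Rightarrow> real \<Rightarrow> nat \<times> nat \<Rightarrow> real" where
  "sq_weight p u v e = (if fst e = 0 then u (snd e) else v)"

lemma sq_index_sum:
  assumes "0 < p"
  shows "(\<Sum>e\<in>sq_index N p. f (sq_weight p u v e) * g e) = (\<Sum>j<p. f (u j) * g (0, j)) + (\<Sum>i\<in>{p..<N}. f v * g (i, p - 1))"
proof -
  let ?A = "{0} \<times> {..<p}" and ?B = "{p..<N} \<times> {p - 1}" and ?F = "\<lambda>e. f (sq_weight p u v e) * g e"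
  have im: "?A = Pair 0 ` {..<p}" "?B = (\<lambda>i. (i, p - 1)) ` {p..<N}" by auto
  have "(\<Sum>e\<in>?A \<union> ?B. ?F e) = (\<Sum>e\<in>?A. ?F e) + (\<Sum>e\<in>?B. ?F e)"
    by (rule sum.union_disjoint) (use assms in auto)
  also have "(\<Sum>e\<in>?A. ?F e) = (\<Sum>j<p. f (u j) * g (0, j))"
    unfolding im by (subst sum.reindex) (auto simp: inj_on_def sq_weight_def)
  also have "(\<Sum>e\<in>?B. ?F e) = (\<Sum>i\<in>{p..<N}. f v * g (i, p - 1))"
    unfolding im by (subst sum.reindex) (use assms in \<open>auto simp: inj_on_def sq_weight_def intro!: sum.cong\<close>)
  finally show ?thesis using assms by (simp add: sq_index_def)
qed

lemma finite_sq_index: "finite (sq_index N p)" and sq_index_subset: "sq_index N p \<subseteq> grid N p" if "p < N \<or> p = 0"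
  using that by (auto simp: sq_index_def)

lemma sq_index_second_moment:
  assumes "0 < p" "p < N"
  shows "all_moments (gauss (grid N p)) (\<lambda>z. (\<Sum>j<p. u j * sqc (z (0, j))) + v * (chi_part N p z - (real N - real p)))"
    and "(LINT z|gauss (grid N p). ((\<Sum>j<p. u j * sqc (z (0, j))) + v * (chi_part N p z - (real N - real p)))\<^sup>2)
       = 2 * (\<Sum>j<p. (u j)\<^sup>2) + 2 * v\<^sup>2 * (real N - real p)"
    and "(\<Sum>e\<in>sq_index N p. sq_weight p u v e * sqc (z e)) = (\<Sum>j<p. u j * sqc (z (0, j))) + v * (chi_part N p z - (real N - real p))"
proof -
  interpret prob_space "gauss (grid N p)" by (rule prob_space_gauss)
  let ?J = "sq_index N p" and ?w = "sq_weight p u v"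
  have J: "?J \<subseteq> grid N p" "finite ?J" using assms sq_index_subset finite_sq_index by auto
  show eq: "(\<Sum>e\<in>?J. ?w e * sqc (z e)) = (\<Sum>j<p. u j * sqc (z (0, j))) + v * (chi_part N p z - (real N - real p))" for z
    unfolding sq_index_sum[OF assms(1), of "\<lambda>x. x", simplified]
    using assms by (simp add: chi_part_def sum_subtractf of_nat_diff flip: sum_distrib_left)
  have am: "all_moments (gauss (grid N p)) (\<lambda>z. ?w e * sqc (z e))" if "e \<in> ?J" for e
    using that J by (intro all_moments_intros) auto
  have "all_moments (gauss (grid N p)) (\<lambda>z. \<Sum>e\<in>?J. ?w e * sqc (z e))"
    by (intro all_moments_sum[OF prob_space_gauss] am)
  then show "all_moments (gauss (grid N p)) (\<lambda>z. (\<Sum>j<p. u j * sqc (z (0, j))) + v * (chi_part N p z - (real N - real p)))"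
    unfolding eq .
  have ind: "indep_vars (\<lambda>_. borel) (\<lambda>e z. ?w e * sqc (z e)) ?J"
    by (rule indep_vars_compose2[OF indep_vars_subset[OF indep_gauss J(1)]]) auto
  have E: "expectation (\<lambda>z. f (?w e * sqc (z e))) = (LINT x|std_normal_distribution. f (?w e * sqc x))"
    if "e \<in> ?J" "f \<in> borel_measurable borel" for e and f :: "real \<Rightarrow> real"
    using that J by (intro gauss_expectation_coordinate[of e _ "\<lambda>x. f (?w e * sqc x)"]) auto
  have "expectation (\<lambda>z. (\<Sum>e\<in>?J. ?w e * sqc (z e))\<^sup>2) = (\<Sum>e\<in>?J. 2 * (?w e)\<^sup>2)"
  proof (rule indep_sum_moments(1)[OF J(2) ind am])
    show "expectation (\<lambda>z. ?w e * sqc (z e)) = 0" if "e \<in> ?J" for e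
      using E[OF that, of "\<lambda>x. x"] sqc_moments(1) by simp
    show "expectation (\<lambda>z. (?w e * sqc (z e))\<^sup>2) = 2 * (?w e)\<^sup>2" if "e \<in> ?J" for e
      using E[OF that, of "\<lambda>x. x\<^sup>2"] sqc_moments(2) by (simp add: power_mult_distrib)
  qed
  also have "(\<Sum>e\<in>?J. 2 * (?w e)\<^sup>2) = 2 * (\<Sum>j<p. (u j)\<^sup>2) + 2 * v\<^sup>2 * (real N - real p)"
    using sq_index_sum[OF assms(1), of "\<lambda>x. 2 * x\<^sup>2" u v "\<lambda>_. 1" N] assms by (simp add: sum_distrib_left of_nat_diff)
  finally show "expectation (\<lambda>z. ((\<Sum>j<p. u j * sqc (z (0, j))) + v * (chi_part N p z - (real N - real p)))\<^sup>2)
       = 2 * (\<Sum>j<p. (u j)\<^sup>2) + 2 * v\<^sup>2 * (real N - real p)" unfolding eq .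
qed

lemma linear_second_moment:
  assumes "0 < N"
  shows "all_moments (gauss (grid N p)) (\<lambda>z. \<Sum>j<p. u j * z (0, j))"
    and "(LINT z|gauss (grid N p). (\<Sum>j<p. u j * z (0, j))\<^sup>2) = (\<Sum>j<p. (u j)\<^sup>2)"
proof -
  interpret prob_space "gauss (grid N p)" by (rule prob_space_gauss)
  have am: "all_moments (gauss (grid N p)) (\<lambda>z. u j * z (0, j))" if "j \<in> {..<p}" for j
    using that assms by (intro all_moments_intros) auto
  then show "all_moments (gauss (grid N p)) (\<lambda>z. \<Sum>j<p. u j * z (0, j))"
    by (intro all_moments_sum[OF prob_space_gauss])
  have ind: "indep_vars (\<lambda>_. borel) (\<lambda>j z. u j * z (0, j)) {..<p}"
    by (rule indep_blocks[of "\<lambda>j. {(0, j)}"]) (use assms in \<open>auto simp: disjoint_family_on_def\<close>)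
  have E: "expectation (\<lambda>z. f (u j * z (0, j))) = (LINT x|std_normal_distribution. f (u j * x))"
    if "j \<in> {..<p}" "f \<in> borel_measurable borel" for j and f :: "real \<Rightarrow> real"
    using that assms by (intro gauss_expectation_coordinate[of "(0, j)" _ "\<lambda>x. f (u j * x)"]) auto
  show "expectation (\<lambda>z. (\<Sum>j<p. u j * z (0, j))\<^sup>2) = (\<Sum>j<p. (u j)\<^sup>2)"
  proof (rule indep_sum_moments(1)[OF _ ind am])
    show "expectation (\<lambda>z. u j * z (0, j)) = 0" if "j \<in> {..<p}" for j
      using E[OF that, of "\<lambda>x. x"] std_normal_moments(1) by simp
    show "expectation (\<lambda>z. (u j * z (0, j))\<^sup>2) = (u j)\<^sup>2" if "j \<in> {..<p}" for j
      using E[OF that, of "\<lambda>x. x\<^sup>2"] std_normal_moments(2) by (simp add: power_mult_distrib)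
  qed simp_all
qed


text \<open>
  In law, a combination of centred squares of the first row and of the centred ratio is a weighted sum of
  independent centred squares.
\<close>

lemma hot_combination:
  fixes N p :: nat and u m :: "nat \<Rightarrow> real" and v :: real
  assumes p: "0 < p" "p < N"
  defines "X \<equiv> \<lambda>z. (\<Sum>j<p. u j * sqc (z (0, j))) + v * (hot_ratio N p m z - (real N - real p))"
  shows "X \<in> borel_measurable (gauss (grid N p))" "integrable (gauss (grid N p)) (\<lambda>z. (X z)\<^sup>2)"
    "(LINT z|gauss (grid N p). (X z)\<^sup>2) = 2 * (\<Sum>j<p. (u j)\<^sup>2) + 2 * v\<^sup>2 * (real N - real p)"
    "measure (gauss (grid N p)) {z \<in> space (gauss (grid N p)). X z \<le> t}
      = measure (gauss (grid N p)) {z \<in> space (gauss (grid N p)). (\<Sum>e\<in>sq_index N p. sq_weight p u v e * sqc (z e)) \<le> t}"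
proof -
  let ?G = "gauss (grid N p)" and ?P = "Pi\<^sub>M {..<p} (\<lambda>_. borel :: real measure) \<Otimes>\<^sub>M (borel :: real measure)"
  define f where "f xy = (\<Sum>j<p. u j * sqc (fst xy j)) + v * (snd xy - (real N - real p))" for xy :: "(nat \<Rightarrow> real) \<times> real"
  have comp: "(\<lambda>xy. fst xy j) \<in> borel_measurable ?P" if "j < p" for j :: nat
  proof -
    have "(\<lambda>x. x j) \<in> borel_measurable (Pi\<^sub>M {..<p} (\<lambda>_. borel :: real measure))"
      using that by (intro measurable_component_singleton) auto
    from measurable_compose[OF measurable_fst this] show ?thesis .
  qed
  have f: "f \<in> borel_measurable ?P"
  proof -
    have "(\<lambda>xy. \<Sum>j<p. u j * sqc (fst xy j)) \<in> borel_measurable ?P"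
    proof (rule borel_measurable_sum)
      fix j assume "j \<in> {..<p}"
      then have "(\<lambda>xy. fst xy j) \<in> borel_measurable ?P" using comp by simp
      then show "(\<lambda>xy. u j * sqc (fst xy j)) \<in> borel_measurable ?P"
        by (rule borel_measurable_times[OF borel_measurable_const
              borel_measurable_diff[OF borel_measurable_power borel_measurable_const]])
    qed
    moreover have "(\<lambda>xy. v * (snd xy - (real N - real p))) \<in> borel_measurable ?P"
      by (rule borel_measurable_times[OF borel_measurable_const
            borel_measurable_diff[OF measurable_snd borel_measurable_const]])
    ultimately show ?thesis unfolding f_def by (rule borel_measurable_add)
  qed
  have f2: "(\<lambda>xy. (f xy)\<^sup>2) \<in> borel_measurable ?P" using f by (rule borel_measurable_power)
  have X: "X = (\<lambda>z. f (first_row p z, hot_ratio N p m z))"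
    by (auto simp: X_def f_def first_row_def fun_eq_iff)
  have Y: "f (first_row p z, chi_part N p z) = (\<Sum>j<p. u j * sqc (z (0, j))) + v * (chi_part N p z - (real N - real p))" for z
    by (simp add: f_def first_row_def)
  note tr = row_transfer_integral[OF p, where m=m]
  have N: "0 < N" using p by simp
  have "(\<lambda>z. (first_row p z, hot_ratio N p m z)) \<in> ?G \<rightarrow>\<^sub>M ?P"
    unfolding measurable_gauss_iff by (intro measurable_Pair measurable_hot_ratio measurable_first_row N)
  then show "X \<in> borel_measurable ?G" unfolding X using f by (rule measurable_compose)
  show "integrable ?G (\<lambda>z. (X z)\<^sup>2)"
    unfolding X tr(2)[OF f2] Y by (rule all_moments_integrable_power[OF sq_index_second_moment(1)[OF p]])
  show "(LINT z|?G. (X z)\<^sup>2) = 2 * (\<Sum>j<p. (u j)\<^sup>2) + 2 * v\<^sup>2 * (real N - real p)"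
    unfolding X tr(1)[OF f2] Y by (rule sq_index_second_moment(2)[OF p])
  show "measure ?G {z \<in> space ?G. X z \<le> t}
      = measure ?G {z \<in> space ?G. (\<Sum>e\<in>sq_index N p. sq_weight p u v e * sqc (z e)) \<le> t}"
    unfolding X tr(3)[OF f] Y sq_index_second_moment(3)[OF p] ..
qed

text \<open>
  The asymptotic setting after diagonalisation: eigenvalues \<open>lam\<close>, and \<open>m\<close> the shift of row \<open>0\<close>.
\<close>

locale asym =
  fixes N p :: "nat \<Rightarrow> nat" and lam m :: "nat \<Rightarrow> nat \<Rightarrow> real" and c a1 a2 a3 d dI dS :: real
  assumes N_lim: "filterlim N at_top sequentially" and p_lim: "filterlim p at_top sequentially"
    and ratio: "(\<lambda>k. real (p k) / (real (N k) - 1)) \<longlonglongrightarrow> c" and c: "0 < c" "c < 1"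
    and lam: "\<And>k j. j < p k \<Longrightarrow> 0 < lam k j"
    and a_lim: "(\<lambda>k. (\<Sum>j<p k. lam k j) / p k) \<longlonglongrightarrow> a1" "(\<lambda>k. (\<Sum>j<p k. (lam k j)^2) / p k) \<longlonglongrightarrow> a2"
      "(\<lambda>k. (\<Sum>j<p k. (lam k j)^3) / p k) \<longlonglongrightarrow> a3"
    and a_pos: "0 < a1" "0 < a2"
    and shift: "(\<lambda>k. (\<Sum>j<p k. (m k j)^2) / sqrt (real (N k) - 1)) \<longlonglongrightarrow> d"
      "(\<lambda>k. (\<Sum>j<p k. lam k j * (m k j)^2) / sqrt (real (N k) - 1)) \<longlonglongrightarrow> dI"
      "(\<lambda>k. (\<Sum>j<p k. (lam k j)^2 * (m k j)^2) / sqrt (real (N k) - 1)) \<longlonglongrightarrow> dS"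
begin

abbreviation "G k \<equiv> gauss (grid (N k) (p k))"

sublocale prob_seq "\<lambda>k. G k" by (rule prob_seq.intro) (rule prob_space_gauss)

definition n :: "nat \<Rightarrow> real" where "n k = real (N k) - 1"
definition S :: "nat \<Rightarrow> nat \<Rightarrow> real" where "S i k = (\<Sum>j<p k. lam k j ^ i)"
definition V :: "nat \<Rightarrow> (nat \<times> nat \<Rightarrow> real) \<Rightarrow> real" where "V k = hot_ratio (N k) (p k) (m k)"
definition pr :: "nat \<Rightarrow> real" where "pr k = real (p k) / (real (N k) - real (p k))"
text \<open>
  \<open>A\<close> and \<open>B\<close> are the numerators of Hotelling's and Dempster's statistic, centred and scaled; \<open>A0\<close> and \<open>B0\<close> are
  the same without the shift of row \<open>0\<close>.  The centring \<open>pr k * V\<close> is random: \<open>\<surd>n (T\<^sup>2/n - pr) = (n / V) A\<close>.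
\<close>

definition A0 where "A0 k z = ((\<Sum>j<p k. sqc (z (0, j))) - pr k * (V k z - (real (N k) - real (p k)))) / sqrt (n k)"
definition B0 where "B0 k z = (\<Sum>j<p k. lam k j * sqc (z (0, j))) / sqrt (n k)"
definition A where "A k z = ((\<Sum>j<p k. (shifted_row (m k) z j)\<^sup>2) - pr k * V k z) / sqrt (n k)"
definition B where "B k z = ((\<Sum>j<p k. lam k j * (shifted_row (m k) z j)\<^sup>2) - S 1 k) / sqrt (n k)"

lemma n_top: "filterlim n at_top sequentially"
proof -
  have "filterlim (\<lambda>k. real (N k)) at_top sequentially"
    by (rule filterlim_compose[OF filterlim_real_sequentially N_lim])
  then have "filterlim (\<lambda>k. -1 + real (N k)) at_top sequentially"
    by (rule filterlim_tendsto_add_at_top[OF tendsto_const])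
  then show ?thesis by (simp add: n_def[abs_def])
qed

lemma inv_n: "(\<lambda>k. 1 / n k) \<longlonglongrightarrow> 0"
  using tendsto_inverse_0_at_top[OF n_top] by (simp add: inverse_eq_divide)

lemma inv_sqrt_n: "(\<lambda>k. 1 / sqrt (n k)) \<longlonglongrightarrow> 0"
  using tendsto_real_sqrt[OF inv_n] by (simp add: real_sqrt_divide)

lemma pn: "(\<lambda>k. real (p k) / n k) \<longlonglongrightarrow> c"
  using ratio by (simp add: n_def)

lemma ev: "\<forall>\<^sub>F k in sequentially. 0 < p k \<and> p k < N k \<and> 1 < N k \<and> 0 < n k"
proof -
  have 1: "\<forall>\<^sub>F k in sequentially. 1 \<le> p k" using p_lim by (simp add: filterlim_at_top)
  have 2: "\<forall>\<^sub>F k in sequentially. 2 \<le> N k" using N_lim by (simp add: filterlim_at_top)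
  have 3: "\<forall>\<^sub>F k in sequentially. real (p k) / n k < 1" by (rule order_tendstoD(2)[OF pn c(2)])
  show ?thesis using 1 2 3
  proof eventually_elim
    case (elim k)
    then have n: "0 < n k" by (simp add: n_def)
    then have "real (p k) < n k" using elim by (simp add: field_simps)
    then have "p k < N k" by (simp add: n_def)
    then show ?case using elim n by simp
  qed
qed

lemma Np_n: "(\<lambda>k. (real (N k) - real (p k)) / n k) \<longlonglongrightarrow> 1 - c"
proof -
  have "(\<lambda>k. 1 + 1 / n k - real (p k) / n k) \<longlonglongrightarrow> 1 + 0 - c" by (intro tendsto_intros inv_n pn)
  moreover have "\<forall>\<^sub>F k in sequentially. 1 + 1 / n k - real (p k) / n k = (real (N k) - real (p k)) / n k"
    using ev
  proof eventually_elim
    case (elim k)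
    have "real (N k) = n k + 1" by (simp add: n_def)
    then show ?case using elim by (simp add: diff_divide_distrib add_divide_distrib)
  qed
  ultimately show ?thesis by (simp add: tendsto_cong)
qed

lemma pr_lim: "pr \<longlonglongrightarrow> c / (1 - c)"
proof -
  have "(\<lambda>k. (real (p k) / n k) / ((real (N k) - real (p k)) / n k)) \<longlonglongrightarrow> c / (1 - c)"
    using c by (intro tendsto_divide pn Np_n) simp
  moreover have "\<forall>\<^sub>F k in sequentially. (real (p k) / n k) / ((real (N k) - real (p k)) / n k) = pr k"
    using ev by eventually_elim (simp add: pr_def)
  ultimately show ?thesis by (simp add: tendsto_cong)
qed

lemma S_n:
  "(\<lambda>k. S 1 k / n k) \<longlonglongrightarrow> c * a1" "(\<lambda>k. S 2 k / n k) \<longlonglongrightarrow> c * a2" "(\<lambda>k. S 3 k / n k) \<longlonglongrightarrow> c * a3"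
proof -
  have *: "(\<lambda>k. f k / n k) \<longlonglongrightarrow> c * a" if "(\<lambda>k. f k / real (p k)) \<longlonglongrightarrow> a" for f :: "nat \<Rightarrow> real" and a
  proof -
    have "(\<lambda>k. real (p k) / n k * (f k / real (p k))) \<longlonglongrightarrow> c * a" by (intro tendsto_mult pn that)
    moreover have "\<forall>\<^sub>F k in sequentially. real (p k) / n k * (f k / real (p k)) = f k / n k"
      using ev by eventually_elim simp
    ultimately show ?thesis by (simp add: tendsto_cong)
  qed
  show "(\<lambda>k. S 1 k / n k) \<longlonglongrightarrow> c * a1" "(\<lambda>k. S 2 k / n k) \<longlonglongrightarrow> c * a2" "(\<lambda>k. S 3 k / n k) \<longlonglongrightarrow> c * a3"
    using *[OF a_lim(1)] *[OF a_lim(2)] *[OF a_lim(3)] by (simp_all add: S_def)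
qed

lemma tends_V: "tends_prob G (\<lambda>k z. V k z / n k) (1 - c)"
proof -
  let ?D = "\<lambda>k z. (\<Sum>j<p k. 0 * sqc (z (0, j))) + 1 / n k * (hot_ratio (N k) (p k) (m k) z - (real (N k) - real (p k)))"
  have "tends_prob G ?D 0"
  proof (rule tends_prob_second_moment)
    show "\<forall>\<^sub>F k in sequentially. ?D k \<in> borel_measurable (G k) \<and> integrable (G k) (\<lambda>z. (?D k z)\<^sup>2) \<and>
        (LINT z|G k. (?D k z)\<^sup>2) \<le> 2 * (1 / n k) * ((real (N k) - real (p k)) / n k)"
      using ev
    proof eventually_elim
      case (elim k)
      then have p: "0 < p k" "p k < N k" by auto
      have "2 * (\<Sum>j<p k. 0\<^sup>2) + 2 * (1 / n k)\<^sup>2 * (real (N k) - real (p k)) \<le> 2 * (1 / n k) * ((real (N k) - real (p k)) / n k)"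
        by (simp add: power2_eq_square)
      with hot_combination(1-3)[OF p, of "\<lambda>_. 0" "1 / n k" "m k"] show ?case by (simp only: simp_thms)
    qed
    have "(\<lambda>k. 2 * (1 / n k) * ((real (N k) - real (p k)) / n k)) \<longlonglongrightarrow> 2 * 0 * (1 - c)"
      by (intro tendsto_mult tendsto_const inv_n Np_n)
    then show "(\<lambda>k. 2 * (1 / n k) * ((real (N k) - real (p k)) / n k)) \<longlonglongrightarrow> 0" by simp
  qed
  from tends_prob_add[OF this tends_prob_const[OF Np_n]]
  have "tends_prob G (\<lambda>k z. ?D k z + (real (N k) - real (p k)) / n k) (1 - c)" by simp
  then show ?thesis
    by (rule tends_prob_cong_eventually) (rule always_eventually, simp add: V_def diff_divide_distrib add_divide_distrib)
qed

lemma AB0_combination: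
  assumes "0 < p k" "p k < N k" "0 < n k"
  shows "\<alpha> * A0 k z + \<beta> * B0 k z = (\<Sum>j<p k. (\<alpha> + \<beta> * lam k j) / sqrt (n k) * sqc (z (0, j)))
     + - (\<alpha> * pr k / sqrt (n k)) * (hot_ratio (N k) (p k) (m k) z - (real (N k) - real (p k)))"
proof -
  have e: "(\<alpha> + \<beta> * l) / r * q = (\<alpha> * q + \<beta> * (l * q)) / r" for l r q :: real
    by (simp add: algebra_simps)
  have "(\<Sum>j<p k. (\<alpha> + \<beta> * lam k j) / sqrt (n k) * sqc (z (0, j)))
      = (\<alpha> * (\<Sum>j<p k. sqc (z (0, j))) + \<beta> * (\<Sum>j<p k. lam k j * sqc (z (0, j)))) / sqrt (n k)"
    by (simp only: e sum_divide_distrib[symmetric] sum.distrib sum_distrib_left[symmetric])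
  then show ?thesis unfolding A0_def B0_def V_def
    by (simp add: add_divide_distrib diff_divide_distrib right_diff_distrib mult.assoc)
qed

lemma AB0_variance:
  assumes "0 < p k" "p k < N k" "0 < n k"
  shows "2 * (\<Sum>j<p k. ((\<alpha> + \<beta> * lam k j) / sqrt (n k))\<^sup>2) + 2 * (- (\<alpha> * pr k / sqrt (n k)))\<^sup>2 * (real (N k) - real (p k))
    = 2 * (\<alpha>\<^sup>2 * (real (p k) / n k) + 2 * \<alpha> * \<beta> * (S 1 k / n k) + \<beta>\<^sup>2 * (S 2 k / n k)
        + \<alpha>\<^sup>2 * pr k * (real (p k) / n k))"
proof -
  have r: "2 * X + 2 * Y * R = 2 * (X + Y * R)" for X Y R :: real by (simp add: algebra_simps)
  have "(\<Sum>j<p k. (\<alpha> + \<beta> * lam k j)\<^sup>2) = (\<Sum>j<p k. \<alpha>\<^sup>2 + (2 * \<alpha> * \<beta>) * lam k j + \<beta>\<^sup>2 * (lam k j)\<^sup>2)"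
    by (intro sum.cong refl) (simp add: power2_eq_square algebra_simps)
  also have "\<dots> = real (p k) * \<alpha>\<^sup>2 + 2 * \<alpha> * \<beta> * S 1 k + \<beta>\<^sup>2 * S 2 k"
    by (simp only: sum.distrib sum_distrib_left[symmetric] S_def power_one_right sum_constant card_lessThan)
  finally have s: "(\<Sum>j<p k. (\<alpha> + \<beta> * lam k j)\<^sup>2) = real (p k) * \<alpha>\<^sup>2 + 2 * \<alpha> * \<beta> * S 1 k + \<beta>\<^sup>2 * S 2 k" .
  have sq: "(sqrt (n k))\<^sup>2 = n k" using assms by simp
  have 1: "(\<Sum>j<p k. ((\<alpha> + \<beta> * lam k j) / sqrt (n k))\<^sup>2)
     = \<alpha>\<^sup>2 * (real (p k) / n k) + 2 * \<alpha> * \<beta> * (S 1 k / n k) + \<beta>\<^sup>2 * (S 2 k / n k)"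
    unfolding power_divide sq sum_divide_distrib[symmetric] s by (simp add: add_divide_distrib mult.commute)
  have pk: "pr k * (real (N k) - real (p k)) = real (p k)" using assms by (simp add: pr_def)
  have "(- (\<alpha> * pr k / sqrt (n k)))\<^sup>2 * (real (N k) - real (p k)) = \<alpha>\<^sup>2 * pr k * (pr k * (real (N k) - real (p k))) / n k"
    unfolding power2_minus power_divide power_mult_distrib sq power2_eq_square[of "pr k"] by simp
  then have 2: "(- (\<alpha> * pr k / sqrt (n k)))\<^sup>2 * (real (N k) - real (p k)) = \<alpha>\<^sup>2 * pr k * (real (p k) / n k)"
    unfolding pk by simp
  show ?thesis unfolding r 1 2 by (rule refl)
qed

text \<open>
  The limiting variance of \<open>\<alpha> A0 + \<beta> B0\<close>.
\<close>

definition var :: "real \<Rightarrow> real \<Rightarrow> real" where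
  "var \<alpha> \<beta> = 2 * (\<alpha>\<^sup>2 * c / (1 - c) + 2 * \<alpha> * \<beta> * (c * a1) + \<beta>\<^sup>2 * (c * a2))"

lemma var_lim: "(\<lambda>k. 2 * (\<alpha>\<^sup>2 * (real (p k) / n k) + 2 * \<alpha> * \<beta> * (S 1 k / n k) + \<beta>\<^sup>2 * (S 2 k / n k)
        + \<alpha>\<^sup>2 * pr k * (real (p k) / n k))) \<longlonglongrightarrow> var \<alpha> \<beta>"
proof -
  have "(\<lambda>k. 2 * (\<alpha>\<^sup>2 * (real (p k) / n k) + 2 * \<alpha> * \<beta> * (S 1 k / n k) + \<beta>\<^sup>2 * (S 2 k / n k)
        + \<alpha>\<^sup>2 * pr k * (real (p k) / n k))) \<longlonglongrightarrow>
     2 * (\<alpha>\<^sup>2 * c + 2 * \<alpha> * \<beta> * (c * a1) + \<beta>\<^sup>2 * (c * a2) + \<alpha>\<^sup>2 * (c / (1 - c)) * c)"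
    by (intro tendsto_intros pn S_n pr_lim)
  also have "\<alpha>\<^sup>2 * c + 2 * \<alpha> * \<beta> * (c * a1) + \<beta>\<^sup>2 * (c * a2) + \<alpha>\<^sup>2 * (c / (1 - c)) * c
     = \<alpha>\<^sup>2 * c / (1 - c) + 2 * \<alpha> * \<beta> * (c * a1) + \<beta>\<^sup>2 * (c * a2)"
    using c by (simp add: field_simps)
  finally show ?thesis by (simp add: var_def)
qed

lemma AB0_measurable:
  "\<forall>\<^sub>F k in sequentially. (\<lambda>z. \<alpha> * A0 k z + \<beta> * B0 k z) \<in> borel_measurable (G k)"
  using ev
proof eventually_elim
  case (elim k)
  then have p: "0 < p k" "p k < N k" "0 < n k" by auto
  show ?case unfolding AB0_combination[OF p] by (rule hot_combination(1)[OF p(1,2)])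
qed

lemma AB0_bounded:
  "\<exists>K. \<forall>\<^sub>F k in sequentially. (\<lambda>z. \<alpha> * A0 k z + \<beta> * B0 k z) \<in> borel_measurable (G k) \<and>
     integrable (G k) (\<lambda>z. (\<alpha> * A0 k z + \<beta> * B0 k z)\<^sup>2) \<and> (LINT z|G k. (\<alpha> * A0 k z + \<beta> * B0 k z)\<^sup>2) \<le> K"
proof (intro exI)
  have "\<forall>\<^sub>F k in sequentially. 2 * (\<alpha>\<^sup>2 * (real (p k) / n k) + 2 * \<alpha> * \<beta> * (S 1 k / n k) + \<beta>\<^sup>2 * (S 2 k / n k)
        + \<alpha>\<^sup>2 * pr k * (real (p k) / n k)) < var \<alpha> \<beta> + 1"
    by (rule order_tendstoD(2)[OF var_lim]) simp
  with ev show "\<forall>\<^sub>F k in sequentially. (\<lambda>z. \<alpha> * A0 k z + \<beta> * B0 k z) \<in> borel_measurable (G k) \<and>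
     integrable (G k) (\<lambda>z. (\<alpha> * A0 k z + \<beta> * B0 k z)\<^sup>2) \<and> (LINT z|G k. (\<alpha> * A0 k z + \<beta> * B0 k z)\<^sup>2) \<le> var \<alpha> \<beta> + 1"
  proof eventually_elim
    case (elim k)
    then have p: "0 < p k" "p k < N k" "0 < n k" by auto
    show ?case unfolding AB0_combination[OF p] hot_combination(3)[OF p(1,2)] AB0_variance[OF p]
      by (intro conjI hot_combination(1,2)[OF p(1,2)] less_imp_le elim(2))
  qed
qed

text \<open>
  The Lyapunov sum is of order \<open>n\<^sup>-\<^sup>1\<^sup>/\<^sup>2\<close> because there are order \<open>n\<close> cells with weights of order
  \<open>n\<^sup>-\<^sup>1\<^sup>/\<^sup>2\<close> on average; the third moment of the eigenvalues controls the uneven ones.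
\<close>

lemma AB0_clt:
  assumes "var \<alpha> \<beta> = 1"
  shows "(\<lambda>k. measure (G k) {z \<in> space (G k). \<alpha> * A0 k z + \<beta> * B0 k z \<le> x}) \<longlonglongrightarrow> Phi x"
proof -
  define u where "u k j = (\<alpha> + \<beta> * lam k j) / sqrt (n k)" for k j
  define v where "v k = - (\<alpha> * pr k / sqrt (n k))" for k
  \<comment> \<open>the conditional covers the finitely many \<open>k\<close> for which the cells do not fit into the array\<close>
  define J where "J k = (if p k < N k \<or> p k = 0 then sq_index (N k) (p k) else {})" for k
  let ?w = "\<lambda>k. sq_weight (p k) (u k) (v k)"
  have J: "finite (J k)" "J k \<subseteq> grid (N k) (p k)" for k
    using finite_sq_index[of "p k" "N k"] sq_index_subset[of "p k" "N k"] by (auto simp: J_def)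
  have var: "(\<lambda>k. \<Sum>e\<in>J k. 2 * (?w k e)\<^sup>2) \<longlonglongrightarrow> 1"
  proof (rule Lim_transform_eventually[OF var_lim[of \<alpha> \<beta>, unfolded assms]])
    show "\<forall>\<^sub>F k in sequentially. 2 * (\<alpha>\<^sup>2 * (real (p k) / n k) + 2 * \<alpha> * \<beta> * (S 1 k / n k) + \<beta>\<^sup>2 * (S 2 k / n k)
        + \<alpha>\<^sup>2 * pr k * (real (p k) / n k)) = (\<Sum>e\<in>J k. 2 * (?w k e)\<^sup>2)"
      using ev
    proof eventually_elim
      case (elim k)
      then have p: "0 < p k" "p k < N k" "0 < n k" by auto
      have "(\<Sum>e\<in>J k. 2 * (?w k e)\<^sup>2) = 2 * (\<Sum>j<p k. (u k j)\<^sup>2) + 2 * (v k)\<^sup>2 * (real (N k) - real (p k))"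
        using sq_index_sum[OF p(1), of "\<lambda>x. 2 * x\<^sup>2" "u k" "v k" "\<lambda>_. 1" "N k"] p
        by (simp add: J_def sum_distrib_left of_nat_diff)
      then show ?case using AB0_variance[OF p, of \<alpha> \<beta>] by (simp add: u_def v_def)
    qed
  qed
  have lyap: "(\<lambda>k. \<Sum>e\<in>J k. \<bar>?w k e\<bar> ^ 3) \<longlonglongrightarrow> 0"
  proof -
    let ?b = "\<lambda>k. 1 / sqrt (n k) * (4 * \<bar>\<alpha>\<bar> ^ 3 * (real (p k) / n k) + 4 * \<bar>\<beta>\<bar> ^ 3 * (S 3 k / n k)
        + \<bar>\<alpha> * pr k\<bar> ^ 3 * ((real (N k) - real (p k)) / n k))"
    have "?b \<longlonglongrightarrow> 0 * (4 * \<bar>\<alpha>\<bar> ^ 3 * c + 4 * \<bar>\<beta>\<bar> ^ 3 * (c * a3) + \<bar>\<alpha> * (c / (1 - c))\<bar> ^ 3 * (1 - c))"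
      by (intro tendsto_intros inv_sqrt_n pn S_n Np_n pr_lim)
    then have b0: "?b \<longlonglongrightarrow> 0" by simp
    have le: "\<forall>\<^sub>F k in sequentially. (\<Sum>e\<in>J k. \<bar>?w k e\<bar> ^ 3) \<le> ?b k"
      using ev
    proof eventually_elim
      case (elim k)
      then have p: "0 < p k" "p k < N k" "0 < n k" by auto
      have n3: "sqrt (n k) ^ 3 = n k * sqrt (n k)" using p by (simp add: power3_eq_cube)
      have cube: "\<bar>x + y\<bar> ^ 3 \<le> 4 * \<bar>x\<bar> ^ 3 + 4 * \<bar>y\<bar> ^ 3" for x y :: real
      proof -
        have "\<bar>x + y\<bar> ^ 3 \<le> (\<bar>x\<bar> + \<bar>y\<bar>) ^ 3" by (intro power_mono) auto
        also have "\<dots> \<le> 4 * \<bar>x\<bar> ^ 3 + 4 * \<bar>y\<bar> ^ 3"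
        proof -
          have "4 * \<bar>x\<bar> ^ 3 + 4 * \<bar>y\<bar> ^ 3 - (\<bar>x\<bar> + \<bar>y\<bar>) ^ 3 = 3 * (\<bar>x\<bar> + \<bar>y\<bar>) * (\<bar>x\<bar> - \<bar>y\<bar>)\<^sup>2"
            by (simp add: power3_eq_cube power2_eq_square algebra_simps)
          also have "\<dots> \<ge> 0" by simp
          finally show ?thesis by simp
        qed
        finally show ?thesis .
      qed
      have "(\<Sum>e\<in>J k. \<bar>?w k e\<bar> ^ 3) = (\<Sum>j<p k. \<bar>u k j\<bar> ^ 3) + (real (N k) - real (p k)) * \<bar>v k\<bar> ^ 3"
        using sq_index_sum[OF p(1), of "\<lambda>x. \<bar>x\<bar> ^ 3" "u k" "v k" "\<lambda>_. 1" "N k"] p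
        by (simp add: J_def of_nat_diff)
      also have "(\<Sum>j<p k. \<bar>u k j\<bar> ^ 3) \<le> (\<Sum>j<p k. (4 * \<bar>\<alpha>\<bar> ^ 3 + 4 * \<bar>\<beta>\<bar> ^ 3 * (lam k j) ^ 3) / (n k * sqrt (n k)))"
      proof (rule sum_mono)
        fix j assume "j \<in> {..<p k}"
        then have l: "0 < lam k j" using lam by simp
        have "\<bar>u k j\<bar> ^ 3 = \<bar>\<alpha> + \<beta> * lam k j\<bar> ^ 3 / (n k * sqrt (n k))"
          using p by (simp add: u_def power_divide n3 flip: power_abs)
        also have "\<dots> \<le> (4 * \<bar>\<alpha>\<bar> ^ 3 + 4 * \<bar>\<beta> * lam k j\<bar> ^ 3) / (n k * sqrt (n k))"
          using p by (intro divide_right_mono cube) auto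
        finally show "\<bar>u k j\<bar> ^ 3 \<le> (4 * \<bar>\<alpha>\<bar> ^ 3 + 4 * \<bar>\<beta>\<bar> ^ 3 * (lam k j) ^ 3) / (n k * sqrt (n k))"
          using l by (simp add: abs_mult power_mult_distrib mult.assoc)
      qed
      also have "(\<Sum>j<p k. (4 * \<bar>\<alpha>\<bar> ^ 3 + 4 * \<bar>\<beta>\<bar> ^ 3 * (lam k j) ^ 3) / (n k * sqrt (n k)))
          = 1 / sqrt (n k) * (4 * \<bar>\<alpha>\<bar> ^ 3 * (real (p k) / n k) + 4 * \<bar>\<beta>\<bar> ^ 3 * (S 3 k / n k))"
        by (simp add: S_def sum.distrib add_divide_distrib flip: sum_divide_distrib sum_distrib_left)
      also have "(real (N k) - real (p k)) * \<bar>v k\<bar> ^ 3 = 1 / sqrt (n k) * (\<bar>\<alpha> * pr k\<bar> ^ 3 * ((real (N k) - real (p k)) / n k))"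
        using p by (simp add: v_def power_divide n3 mult_ac flip: power_abs)
      finally show ?case by (simp add: distrib_left)
    qed
    show ?thesis
      by (rule tendsto_sandwich[OF _ le tendsto_const b0]) (auto intro!: always_eventually sum_nonneg)
  qed
  have "(\<lambda>k. measure (G k) {z \<in> space (G k). (\<Sum>e\<in>J k. ?w k e * sqc (z e)) \<le> x}) \<longlonglongrightarrow> Phi x"
    by (rule gauss_clt[OF J var lyap])
  then show ?thesis
  proof (rule Lim_transform_eventually)
    show "\<forall>\<^sub>F k in sequentially. measure (G k) {z \<in> space (G k). (\<Sum>e\<in>J k. ?w k e * sqc (z e)) \<le> x}
       = measure (G k) {z \<in> space (G k). \<alpha> * A0 k z + \<beta> * B0 k z \<le> x}"
      using ev
    proof eventually_elim
      case (elim k)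
      then have p: "0 < p k" "p k < N k" "0 < n k" by auto
      have "J k = sq_index (N k) (p k)" using p by (simp add: J_def)
      then show ?case unfolding AB0_combination[OF p]
        using hot_combination(4)[OF p(1,2), of "u k" "v k" "m k" x] by (simp only: u_def v_def)
    qed
  qed
qed

end

section \<open>Consistency of the trace statistics and the limiting power\<close>

lemma sum_offdiag:
  fixes f :: "nat \<Rightarrow> nat \<Rightarrow> real"
  assumes "finite K"
  shows "(\<Sum>k\<in>K. \<Sum>l\<in>K. f k l) = (\<Sum>e\<in>{e \<in> K \<times> K. fst e \<noteq> snd e}. f (fst e) (snd e)) + (\<Sum>k\<in>K. f k k)"
proof -
  let ?P = "{e \<in> K \<times> K. fst e \<noteq> snd e}"
  have K: "K \<times> K = ?P \<union> (\<lambda>k. (k, k)) ` K" by auto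
  have "(\<Sum>k\<in>K. \<Sum>l\<in>K. f k l) = (\<Sum>e\<in>K \<times> K. f (fst e) (snd e))"
    by (simp add: sum.cartesian_product split_def)
  also have "\<dots> = (\<Sum>e\<in>?P. f (fst e) (snd e)) + (\<Sum>e\<in>(\<lambda>k. (k, k)) ` K. f (fst e) (snd e))"
    by (subst K, rule sum.union_disjoint) (use assms in auto)
  also have "(\<Sum>e\<in>(\<lambda>k. (k, k)) ` K. f (fst e) (snd e)) = (\<Sum>k\<in>K. f k k)"
    by (subst sum.reindex) (auto simp: inj_on_def)
  finally show ?thesis .
qed

lemma card_offdiag:
  fixes K :: "nat set"
  assumes "finite K"
  shows "real (card {e \<in> K \<times> K. fst e \<noteq> snd e}) = real (card K) * (real (card K) - 1)"
  using sum_offdiag[OF assms, of "\<lambda>_ _. 1"] by (simp add: algebra_simps)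

context asym begin

abbreviation "w k z \<equiv> wip (p k) (lam k) z"
abbreviation "Ks k \<equiv> {1..<N k}"
definition t1 where "t1 k z = 1 / n k * (\<Sum>i\<in>Ks k. w k z i i)"
definition t2 where "t2 k z = (1 / n k)^2 * (\<Sum>i\<in>Ks k. \<Sum>l\<in>Ks k. (w k z i l)^2)"
definition t3 where "t3 k z = (1 / n k)^3 * (\<Sum>i\<in>Ks k. \<Sum>l\<in>Ks k. \<Sum>q\<in>Ks k. w k z i l * w k z l q * w k z q i)"

lemma wg: "0 < p k \<Longrightarrow> weighted_grid (p k) (lam k)"
  by (simp add: weighted_grid_def lam)

lemma wg_s: "0 < p k \<Longrightarrow> weighted_grid.s (p k) (lam k) i = S i k"
  using weighted_grid.s_def[OF wg] by (simp add: S_def)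

lemma card_Ks: "1 < N k \<Longrightarrow> real (card (Ks k)) = n k"
  by (simp add: n_def)

lemma Ks_sub: "Ks k \<subseteq> {..<N k}" by auto

lemma am_wip: "0 < p k \<Longrightarrow> i < N k \<Longrightarrow> l < N k \<Longrightarrow> all_moments (G k) (\<lambda>z. w k z i l)"
  by (rule weighted_grid.am_w[OF wg])

text \<open>
  The variance of \<open>tr S\<close> is \<open>2 tr \<Sigma>\<^sup>2 / n\<close>, which stays bounded.  Hence replacing \<open>tr \<Sigma>\<close> by \<open>tr S\<close> in
  Dempster's statistic has no effect on the scale \<open>\<surd>n\<close>.
\<close>

lemma tends_trace: "tends_prob G (\<lambda>k z. (t1 k z - S 1 k) / sqrt (n k)) 0"
proof (rule tends_prob_second_moment)
  have "(\<lambda>k. 2 * (S 2 k / n k) * (1 / n k)) \<longlonglongrightarrow> 2 * (c * a2) * 0"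
    by (intro tendsto_intros S_n inv_n)
  then show "(\<lambda>k. 2 * (S 2 k / n k) * (1 / n k)) \<longlonglongrightarrow> 0" by simp
  show "\<forall>\<^sub>F k in sequentially. (\<lambda>z. (t1 k z - S 1 k) / sqrt (n k)) \<in> borel_measurable (G k) \<and>
     integrable (G k) (\<lambda>z. ((t1 k z - S 1 k) / sqrt (n k))\<^sup>2) \<and>
     (LINT z|G k. ((t1 k z - S 1 k) / sqrt (n k))\<^sup>2) \<le> 2 * (S 2 k / n k) * (1 / n k)"
    using ev
  proof eventually_elim
    case (elim k)
    then have p: "0 < p k" and n: "0 < n k" and N: "1 < N k" by auto
    let ?X = "\<lambda>z. \<Sum>i\<in>Ks k. (w k z i i - S 1 k)"
    have eq: "(t1 k z - S 1 k) / sqrt (n k) = 1 / (n k * sqrt (n k)) * ?X z" for z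
    proof -
      have "?X z = (\<Sum>i\<in>Ks k. w k z i i) - n k * S 1 k" using card_Ks[OF N] by (simp add: sum_subtractf)
      then show ?thesis using n by (simp add: t1_def field_simps)
    qed
    have am: "all_moments (G k) (\<lambda>z. 1 / (n k * sqrt (n k)) * ?X z)"
      using p by (intro all_moments_mult all_moments_const[OF prob_space_gauss] all_moments_sum[OF prob_space_gauss]
          all_moments_diff[OF prob_space_gauss] am_wip) auto
    have "(LINT z|G k. (?X z)\<^sup>2) = n k * (2 * S 2 k)"
      using weighted_grid.trace_second_moment[OF wg[OF p] Ks_sub, of k] card_Ks[OF N] wg_s[OF p] by simp
    then have "(LINT z|G k. (1 / (n k * sqrt (n k)) * ?X z)\<^sup>2) = (1 / (n k * sqrt (n k)))\<^sup>2 * (n k * (2 * S 2 k))"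
      by (simp only: power_mult_distrib integral_mult_right_zero)
    also have "\<dots> = 2 * (S 2 k / n k) * (1 / n k)" using n by (simp add: power_divide power_mult_distrib) (simp add: power2_eq_square)
    finally show ?case unfolding eq using all_moments_measurable[OF am] all_moments_integrable_power[OF am, of 2] by (simp only: order_refl simp_thms)
  qed
qed

lemma tends_t1: "tends_prob G (\<lambda>k z. t1 k z / n k) (c * a1)"
proof -
  have "tends_prob G (\<lambda>k z. (t1 k z - S 1 k) / sqrt (n k) * (1 / sqrt (n k)) + S 1 k / n k) (0 * 0 + c * a1)"
    by (intro tends_prob_add tends_prob_mult tends_trace tends_prob_const inv_sqrt_n S_n)
  then have "tends_prob G (\<lambda>k z. (t1 k z - S 1 k) / sqrt (n k) * (1 / sqrt (n k)) + S 1 k / n k) (c * a1)" by simp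
  then show ?thesis
  proof (rule tends_prob_cong_eventually)
    show "\<forall>\<^sub>F k in sequentially. \<forall>z\<in>space (G k). (t1 k z - S 1 k) / sqrt (n k) * (1 / sqrt (n k)) + S 1 k / n k = t1 k z / n k"
      using ev by eventually_elim (simp add: diff_divide_distrib)
  qed
qed

text \<open>
  The bias correction in \<open>a2_hat\<close> leaves three parts: a centred U-statistic \<open>U\<close> over pairs of distinct rows, the
  deterministic main term, and the empirical variance \<open>Q\<close> of the squared row lengths, which is nonnegative and
  bounded by the centred sum of squares.
\<close>

lemma tends_bracket: "tends_prob G (\<lambda>k z. (t2 k z - (t1 k z)\<^sup>2 / n k) / n k) (c * a2)"
proof -
  let ?P = "\<lambda>k. {e \<in> Ks k \<times> Ks k. fst e \<noteq> snd e}"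
  define U where "U k z = (\<Sum>e\<in>?P k. weighted_grid.h (p k) (lam k) z e)" for k z
  define Q where "Q k z = (\<Sum>i\<in>Ks k. (w k z i i)\<^sup>2) - (\<Sum>i\<in>Ks k. w k z i i)\<^sup>2 / n k" for k z
  have U: "tends_prob G (\<lambda>k z. 1 / (n k)^3 * U k z) 0"
  proof (rule tends_prob_second_moment)
    have "(\<lambda>k. 36 * (S 2 k / n k)\<^sup>2 * (1 / n k)) \<longlonglongrightarrow> 36 * (c * a2)\<^sup>2 * 0" by (intro tendsto_intros S_n inv_n)
    then show "(\<lambda>k. 36 * (S 2 k / n k)\<^sup>2 * (1 / n k)) \<longlonglongrightarrow> 0" by simp
    show "\<forall>\<^sub>F k in sequentially. (\<lambda>z. 1 / (n k)^3 * U k z) \<in> borel_measurable (G k) \<and>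
       integrable (G k) (\<lambda>z. (1 / (n k)^3 * U k z)\<^sup>2) \<and> (LINT z|G k. (1 / (n k)^3 * U k z)\<^sup>2) \<le> 36 * (S 2 k / n k)\<^sup>2 * (1 / n k)"
      using ev
    proof eventually_elim
      case (elim k)
      then have p: "0 < p k" and n: "0 < n k" and N: "1 < N k" by auto
      have am: "all_moments (G k) (\<lambda>z. 1 / (n k)^3 * U k z)"
        unfolding U_def weighted_grid.h_def[OF wg[OF p]] using p
        by (intro all_moments_mult all_moments_const[OF prob_space_gauss] all_moments_sum[OF prob_space_gauss]
          all_moments_diff[OF prob_space_gauss] all_moments_power[OF prob_space_gauss] am_wip) auto
      have "(LINT z|G k. (U k z)\<^sup>2) \<le> 36 * (n k)^3 * (S 2 k)\<^sup>2"
        using weighted_grid.u_statistic_second_moment[OF wg[OF p] Ks_sub refl, of k] card_Ks[OF N] wg_s[OF p]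
        by (simp add: U_def)
      then have "(1 / (n k)^3)\<^sup>2 * (LINT z|G k. (U k z)\<^sup>2) \<le> (1 / (n k)^3)\<^sup>2 * (36 * (n k)^3 * (S 2 k)\<^sup>2)"
        by (rule mult_left_mono) simp
      also have "\<dots> = 36 * (S 2 k / n k)\<^sup>2 * (1 / n k)"
        using n by (simp only: power2_eq_square power3_eq_cube) (simp add: divide_simps)
      finally have "(LINT z|G k. (1 / (n k)^3 * U k z)\<^sup>2) \<le> 36 * (S 2 k / n k)\<^sup>2 * (1 / n k)"
        by (simp only: power_mult_distrib integral_mult_right_zero)
      then show ?case using all_moments_measurable[OF am] all_moments_integrable_power[OF am, of 2] by (simp only: simp_thms)
    qed
  qed
  \<comment> \<open>the empirical variance is smallest when centred at the empirical mean\<close>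
  have Qnn: "0 \<le> Q k z \<and> Q k z \<le> (\<Sum>i\<in>Ks k. (w k z i i - S 1 k)\<^sup>2)" if N: "1 < N k" for k z
  proof -
    have n: "0 < n k" using N by (simp add: n_def)
    have ex: "(\<Sum>i\<in>Ks k. (w k z i i - b)\<^sup>2) = (\<Sum>i\<in>Ks k. (w k z i i)\<^sup>2) - 2 * b * (\<Sum>i\<in>Ks k. w k z i i) + n k * b\<^sup>2" for b
    proof -
      have "(\<Sum>i\<in>Ks k. (w k z i i - b)\<^sup>2) = (\<Sum>i\<in>Ks k. (w k z i i)\<^sup>2 - (2 * b) * w k z i i + b\<^sup>2)"
        by (intro sum.cong refl) (simp add: power2_eq_square algebra_simps)
      then show ?thesis using card_Ks[OF N] by (simp add: sum.distrib sum_subtractf flip: sum_distrib_left)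
    qed
    define T where "T = (\<Sum>i\<in>Ks k. w k z i i)"
    have "Q k z = (\<Sum>i\<in>Ks k. (w k z i i - T / n k)\<^sup>2)"
      unfolding ex Q_def T_def[symmetric] using n by (simp add: power2_eq_square field_simps)
    then have 1: "0 \<le> Q k z" by (simp add: sum_nonneg)
    have "(\<Sum>i\<in>Ks k. (w k z i i - S 1 k)\<^sup>2) - Q k z = n k * (S 1 k - T / n k)\<^sup>2"
      unfolding ex Q_def T_def[symmetric] using n by (simp add: power2_eq_square field_simps)
    then have "0 \<le> (\<Sum>i\<in>Ks k. (w k z i i - S 1 k)\<^sup>2) - Q k z" using n by simp
    then show ?thesis using 1 by simp
  qed
  have Q: "tends_prob G (\<lambda>k z. 1 / (n k)^3 * max 0 (Q k z)) 0"
  proof (rule tends_prob_first_moment)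
    have "(\<lambda>k. 2 * (S 2 k / n k) * (1 / n k)) \<longlonglongrightarrow> 2 * (c * a2) * 0" by (intro tendsto_intros S_n inv_n)
    then show "(\<lambda>k. 2 * (S 2 k / n k) * (1 / n k)) \<longlonglongrightarrow> 0" by simp
    show "\<forall>\<^sub>F k in sequentially. integrable (G k) (\<lambda>z. 1 / (n k)^3 * max 0 (Q k z)) \<and>
        (\<forall>z. 0 \<le> 1 / (n k)^3 * max 0 (Q k z)) \<and> (LINT z|G k. 1 / (n k)^3 * max 0 (Q k z)) \<le> 2 * (S 2 k / n k) * (1 / n k)"
      using ev
    proof eventually_elim
      case (elim k)
      then have p: "0 < p k" and n: "0 < n k" and N: "1 < N k" by auto
      have mx: "max 0 (Q k z) = Q k z" for z using Qnn[OF N] by (simp add: max_absorb2)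
      have am: "all_moments (G k) (Q k)"
        unfolding Q_def[abs_def] divide_inverse using p
        by (intro all_moments_mult all_moments_const[OF prob_space_gauss] all_moments_sum[OF prob_space_gauss]
          all_moments_diff[OF prob_space_gauss] all_moments_power[OF prob_space_gauss] am_wip) auto
      have am2: "all_moments (G k) (\<lambda>z. w k z i i - S 1 k)" if "i \<in> Ks k" for i
        using p that by (intro all_moments_const[OF prob_space_gauss] all_moments_diff[OF prob_space_gauss] am_wip) auto
      have "(LINT z|G k. Q k z) \<le> (LINT z|G k. (\<Sum>i\<in>Ks k. (w k z i i - S 1 k)\<^sup>2))"
        using Qnn[OF N] by (intro integral_mono all_moments_integrable[OF am] Bochner_Integration.integrable_sum
            all_moments_integrable_power am2) auto
      also have "\<dots> = (\<Sum>i\<in>Ks k. LINT z|G k. (w k z i i - S 1 k)\<^sup>2)"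
        by (intro Bochner_Integration.integral_sum all_moments_integrable_power am2)
      also have "\<dots> = (\<Sum>i\<in>Ks k. 2 * S 2 k)"
        using weighted_grid.w_diag_moments(2)[OF wg[OF p], of _ "N k"] wg_s[OF p] by (intro sum.cong refl) auto
      also have "\<dots> = n k * (2 * S 2 k)" using card_Ks[OF N] by simp
      finally have "1 / (n k)^3 * (LINT z|G k. Q k z) \<le> 1 / (n k)^3 * (n k * (2 * S 2 k))"
        using n by (intro mult_left_mono) auto
      also have "\<dots> = 2 * (S 2 k / n k) * (1 / n k)" using n by (simp add: power3_eq_cube)
      finally have "(LINT z|G k. 1 / (n k)^3 * Q k z) \<le> 2 * (S 2 k / n k) * (1 / n k)"
        by (simp only: integral_mult_right_zero)
      moreover have "0 \<le> 1 / (n k)^3 * Q k z" for z using Qnn[OF N, of z] n by simp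
      ultimately show ?case unfolding mx using all_moments_integrable[OF am] by (simp only: integrable_mult_right simp_thms)
    qed
  qed
  have "tends_prob G (\<lambda>k z. 1 / (n k)^3 * U k z + (1 - 1 / n k) * (S 2 k / n k) + 1 / (n k)^3 * max 0 (Q k z)) (0 + (1 - 0) * (c * a2) + 0)"
    by (intro tends_prob_add U Q tends_prob_const) (intro tendsto_intros inv_n S_n)
  then have "tends_prob G (\<lambda>k z. 1 / (n k)^3 * U k z + (1 - 1 / n k) * (S 2 k / n k) + 1 / (n k)^3 * max 0 (Q k z)) (c * a2)" by simp
  then show ?thesis
  proof (rule tends_prob_cong_eventually)
    show "\<forall>\<^sub>F k in sequentially. \<forall>z\<in>space (G k). 1 / (n k)^3 * U k z + (1 - 1 / n k) * (S 2 k / n k) + 1 / (n k)^3 * max 0 (Q k z)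
       = (t2 k z - (t1 k z)\<^sup>2 / n k) / n k"
      using ev
    proof (eventually_elim, intro ballI)
      fix k z assume "0 < p k \<and> p k < N k \<and> 1 < N k \<and> 0 < n k"
      then have p: "0 < p k" and n: "0 < n k" and N: "1 < N k" by auto
      have mx: "max 0 (Q k z) = Q k z" using Qnn[OF N] by (simp add: max_absorb2)
      have "U k z = (\<Sum>e\<in>?P k. (w k z (fst e) (snd e))\<^sup>2) - n k * (n k - 1) * S 2 k"
        unfolding U_def weighted_grid.h_def[OF wg[OF p]] wg_s[OF p]
        using card_offdiag[of "Ks k"] card_Ks[OF N] by (simp add: sum_subtractf)
      then have W: "(\<Sum>i\<in>Ks k. \<Sum>l\<in>Ks k. (w k z i l)^2) = U k z + n k * (n k - 1) * S 2 k + (\<Sum>i\<in>Ks k. (w k z i i)^2)"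
        using sum_offdiag[of "Ks k" "\<lambda>i l. (w k z i l)^2"] by simp
      define T where "T = (\<Sum>i\<in>Ks k. w k z i i)"
      define D where "D = (\<Sum>i\<in>Ks k. (w k z i i)^2)"
      show "1 / (n k)^3 * U k z + (1 - 1 / n k) * (S 2 k / n k) + 1 / (n k)^3 * max 0 (Q k z)
       = (t2 k z - (t1 k z)\<^sup>2 / n k) / n k"
        apply (subst mx)
        unfolding t1_def t2_def W Q_def T_def[symmetric] D_def[symmetric] using n
        apply (simp only: power2_eq_square power3_eq_cube)
        apply (simp add: field_simps)
        done
    qed
  qed
qed

lemma tends_t2: "tends_prob G (\<lambda>k z. t2 k z / n k) (c * a2 + c * a1 * (c * a1))"
proof -
  have "tends_prob G (\<lambda>k z. (t2 k z - (t1 k z)\<^sup>2 / n k) / n k + t1 k z / n k * (t1 k z / n k)) (c * a2 + c * a1 * (c * a1))"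
    by (intro tends_prob_add tends_prob_mult tends_bracket tends_t1)
  then show ?thesis
    by (rule tends_prob_cong_eventually) (rule always_eventually, simp add: power2_eq_square diff_divide_distrib)
qed

lemma tends_t3: "tends_prob G (\<lambda>k z. t3 k z / (n k * sqrt (n k))) 0"
proof -
  let ?T = "\<lambda>k z. \<Sum>i\<in>Ks k. \<Sum>l\<in>Ks k. \<Sum>q\<in>Ks k. w k z i l * w k z l q * w k z q i"
  let ?b = "\<lambda>k. 1 / sqrt (n k) * (S 3 k / n k + 3 * (1 / 2 * ((S 1 k / n k)\<^sup>2 + 2 * (S 2 k / n k) * (1 / n k) + 9 * (S 2 k / n k)\<^sup>2))
      + (9 * (S 1 k / n k)^3 + 480 * (S 2 k / n k)\<^sup>2 / (S 1 k / n k) * (1 / n k) * (1 / n k)))"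
  let ?c = "\<lambda>k. 1 / (n k ^ 4 * sqrt (n k))"
  have "tends_prob G (\<lambda>k z. ?c k * max 0 (?T k z)) 0"
  proof (rule tends_prob_first_moment)
    have "?b \<longlonglongrightarrow> 0 * (c * a3 + 3 * (1 / 2 * ((c * a1)\<^sup>2 + 2 * (c * a2) * 0 + 9 * (c * a2)\<^sup>2))
      + (9 * (c * a1)^3 + 480 * (c * a2)\<^sup>2 / (c * a1) * 0 * 0))"
      by (intro tendsto_intros inv_sqrt_n inv_n S_n) (use c a_pos in auto)
    then show "?b \<longlonglongrightarrow> 0" by simp
    show "\<forall>\<^sub>F k in sequentially. integrable (G k) (\<lambda>z. ?c k * max 0 (?T k z)) \<and>
        (\<forall>z. 0 \<le> ?c k * max 0 (?T k z)) \<and> (LINT z|G k. ?c k * max 0 (?T k z)) \<le> ?b k"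
      using ev
    proof eventually_elim
      case (elim k)
      then have p: "0 < p k" and n: "0 < n k" and N: "1 < N k" by auto
      have nn: "0 \<le> ?T k z" for z using weighted_grid.triple_sum_nonneg[OF wg[OF p]] by simp
      have mx: "max 0 (?T k z) = ?T k z" for z using nn[of z] by (rule max_absorb2)
      have am: "all_moments (G k) (?T k)" using p
        by (intro all_moments_mult all_moments_sum[OF prob_space_gauss] am_wip) auto
      have S1: "0 < S 1 k" using weighted_grid.s_pos[OF wg[OF p], of 1] wg_s[OF p] by simp
      have "(LINT z|G k. ?T k z) \<le> n k ^ 3 * S 3 k + 3 * n k ^ 2 * (1 / 2 * ((S 1 k)\<^sup>2 + 2 * S 2 k + 9 * (S 2 k)\<^sup>2))
          + n k * (9 * (S 1 k)^3 + 480 * (S 2 k)\<^sup>2 / S 1 k)"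
        using weighted_grid.triple_sum_first_moment[OF wg[OF p] Ks_sub, of k]
        unfolding card_Ks[OF N] wg_s[OF p] weighted_grid.b2_def[OF wg[OF p]] weighted_grid.b3_def[OF wg[OF p]] by simp
      then have "?c k * (LINT z|G k. ?T k z) \<le> ?c k * (n k ^ 3 * S 3 k + 3 * n k ^ 2 * (1 / 2 * ((S 1 k)\<^sup>2 + 2 * S 2 k + 9 * (S 2 k)\<^sup>2))
          + n k * (9 * (S 1 k)^3 + 480 * (S 2 k)\<^sup>2 / S 1 k))"
        using n by (intro mult_left_mono) auto
      also have "\<dots> = ?b k"
      proof -
        define r where "r = sqrt (n k)"
        have r: "r > 0" using n by (simp add: r_def)
        show ?thesis unfolding r_def[symmetric] using n r S1
          by (simp add: power2_eq_square power3_eq_cube power4_eq_xxxx field_simps)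
      qed
      finally have "(LINT z|G k. ?c k * ?T k z) \<le> ?b k" by (simp only: integral_mult_right_zero)
      moreover have "0 \<le> ?c k * ?T k z" for z using nn n by simp
      ultimately show ?case unfolding mx using all_moments_integrable[OF am] by (simp only: integrable_mult_right simp_thms)
    qed
  qed
  then show ?thesis
  proof (rule tends_prob_cong_eventually)
    show "\<forall>\<^sub>F k in sequentially. \<forall>z\<in>space (G k). ?c k * max 0 (?T k z) = t3 k z / (n k * sqrt (n k))"
      using ev
    proof (eventually_elim, intro ballI)
      fix k z assume "0 < p k \<and> p k < N k \<and> 1 < N k \<and> 0 < n k"
      then have p: "0 < p k" and n: "0 < n k" by auto
      have "max 0 (?T k z) = ?T k z" using weighted_grid.triple_sum_nonneg[OF wg[OF p]] by (simp add: max_absorb2)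
      then show "?c k * max 0 (?T k z) = t3 k z / (n k * sqrt (n k))"
        using n by (simp only: t3_def) (simp add: power3_eq_cube power4_eq_xxxx)
    qed
  qed
qed

text \<open>
  The square of the shifted row differs from the square of the row by the squared shift, which converges
  by assumption, and by a linear Gaussian term with vanishing variance.
\<close>

lemma tends_A: "tends_prob G (\<lambda>k z. A k z - A0 k z) d"
  and tends_B: "tends_prob G (\<lambda>k z. B k z - B0 k z) dI"
proof -
  have lin: "tends_prob G (\<lambda>k z. \<Sum>j<p k. u k j * z (0, j)) 0"
    if u: "(\<lambda>k. \<Sum>j<p k. (u k j)\<^sup>2) \<longlonglongrightarrow> 0" for u
  proof (rule tends_prob_second_moment[OF _ u])
    show "\<forall>\<^sub>F k in sequentially. (\<lambda>z. \<Sum>j<p k. u k j * z (0, j)) \<in> borel_measurable (G k) \<and>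
       integrable (G k) (\<lambda>z. (\<Sum>j<p k. u k j * z (0, j))\<^sup>2) \<and> (LINT z|G k. (\<Sum>j<p k. u k j * z (0, j))\<^sup>2) \<le> (\<Sum>j<p k. (u k j)\<^sup>2)"
      using ev
    proof eventually_elim
      case (elim k)
      then have N: "0 < N k" by auto
      note am = linear_second_moment(1)[OF N, of "p k" "u k"]
      show ?case using all_moments_measurable[OF am] all_moments_integrable_power[OF am, of 2]
          linear_second_moment(2)[OF N, of "p k" "u k"] by simp
    qed
  qed
  have small: "(\<lambda>k. \<Sum>j<p k. (2 * f k j / sqrt (n k))\<^sup>2) \<longlonglongrightarrow> 0"
    if "(\<lambda>k. (\<Sum>j<p k. (f k j)\<^sup>2) / sqrt (n k)) \<longlonglongrightarrow> l" for f l
  proof -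
    have "(\<lambda>k. 4 * ((\<Sum>j<p k. (f k j)\<^sup>2) / sqrt (n k)) * (1 / sqrt (n k))) \<longlonglongrightarrow> 4 * l * 0"
      by (intro tendsto_mult tendsto_const that inv_sqrt_n)
    moreover have "\<forall>\<^sub>F k in sequentially. 4 * ((\<Sum>j<p k. (f k j)\<^sup>2) / sqrt (n k)) * (1 / sqrt (n k)) = (\<Sum>j<p k. (2 * f k j / sqrt (n k))\<^sup>2)"
      using ev by eventually_elim (simp add: power_divide power_mult_distrib sum_distrib_left sum_divide_distrib)
    ultimately show ?thesis by (simp add: tendsto_cong)
  qed
  have s1: "(\<lambda>k. (\<Sum>j<p k. (m k j)\<^sup>2) / sqrt (n k)) \<longlonglongrightarrow> d" using shift(1) by (simp add: n_def)
  have s2: "(\<lambda>k. (\<Sum>j<p k. lam k j * (m k j)\<^sup>2) / sqrt (n k)) \<longlonglongrightarrow> dI" using shift(2) by (simp add: n_def)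
  have s3: "(\<lambda>k. (\<Sum>j<p k. (lam k j * m k j)\<^sup>2) / sqrt (n k)) \<longlonglongrightarrow> dS" using shift(3) by (simp add: n_def power_mult_distrib)
  have "tends_prob G (\<lambda>k z. (\<Sum>j<p k. 2 * m k j / sqrt (n k) * z (0, j)) + (\<Sum>j<p k. (m k j)\<^sup>2) / sqrt (n k)) (0 + d)"
    by (intro tends_prob_add lin small[OF s1] tends_prob_const s1)
  then have "tends_prob G (\<lambda>k z. (\<Sum>j<p k. 2 * m k j / sqrt (n k) * z (0, j)) + (\<Sum>j<p k. (m k j)\<^sup>2) / sqrt (n k)) d" by simp
  then show "tends_prob G (\<lambda>k z. A k z - A0 k z) d"
  proof (rule tends_prob_cong_eventually)
    show "\<forall>\<^sub>F k in sequentially. \<forall>z\<in>space (G k). (\<Sum>j<p k. 2 * m k j / sqrt (n k) * z (0, j)) + (\<Sum>j<p k. (m k j)\<^sup>2) / sqrt (n k) = A k z - A0 k z"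
      using ev
    proof (eventually_elim, intro ballI)
      fix k z assume "0 < p k \<and> p k < N k \<and> 1 < N k \<and> 0 < n k"
      then have pk: "pr k * (real (N k) - real (p k)) = real (p k)" by (simp add: pr_def)
      have "(\<Sum>j<p k. (shifted_row (m k) z j)\<^sup>2) = (\<Sum>j<p k. sqc (z (0, j))) + real (p k) + (\<Sum>j<p k. 2 * m k j * z (0, j)) + (\<Sum>j<p k. (m k j)\<^sup>2)"
        by (simp add: shifted_row_def power2_sum sum.distrib sum_subtractf mult_ac)
      then have "A k z - A0 k z = ((\<Sum>j<p k. 2 * m k j * z (0, j)) + (\<Sum>j<p k. (m k j)\<^sup>2)) / sqrt (n k)"
        unfolding A_def A0_def diff_divide_distrib[symmetric] using pk by (simp add: right_diff_distrib)
      then show "(\<Sum>j<p k. 2 * m k j / sqrt (n k) * z (0, j)) + (\<Sum>j<p k. (m k j)\<^sup>2) / sqrt (n k) = A k z - A0 k z"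
        by (simp add: add_divide_distrib sum_divide_distrib)
    qed
  qed
  have "tends_prob G (\<lambda>k z. (\<Sum>j<p k. 2 * (lam k j * m k j) / sqrt (n k) * z (0, j)) + (\<Sum>j<p k. lam k j * (m k j)\<^sup>2) / sqrt (n k)) (0 + dI)"
    by (intro tends_prob_add lin small[OF s3] tends_prob_const s2)
  then have "tends_prob G (\<lambda>k z. (\<Sum>j<p k. 2 * (lam k j * m k j) / sqrt (n k) * z (0, j)) + (\<Sum>j<p k. lam k j * (m k j)\<^sup>2) / sqrt (n k)) dI" by simp
  then show "tends_prob G (\<lambda>k z. B k z - B0 k z) dI"
  proof (rule tends_prob_cong_eventually, intro always_eventually allI ballI)
    fix k z
    have "(\<Sum>j<p k. lam k j * (shifted_row (m k) z j)\<^sup>2) = (\<Sum>j<p k. lam k j * sqc (z (0, j))) + S 1 k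
        + (\<Sum>j<p k. 2 * (lam k j * m k j) * z (0, j)) + (\<Sum>j<p k. lam k j * (m k j)\<^sup>2)"
      unfolding S_def sum.distrib[symmetric]
      by (intro sum.cong refl) (simp add: shifted_row_def power2_eq_square algebra_simps)
    then have "B k z - B0 k z = ((\<Sum>j<p k. 2 * (lam k j * m k j) * z (0, j)) + (\<Sum>j<p k. lam k j * (m k j)\<^sup>2)) / sqrt (n k)"
      unfolding B_def B0_def diff_divide_distrib[symmetric] by simp
    then show "(\<Sum>j<p k. 2 * (lam k j * m k j) / sqrt (n k) * z (0, j)) + (\<Sum>j<p k. lam k j * (m k j)\<^sup>2) / sqrt (n k) = B k z - B0 k z"
      by (simp add: add_divide_distrib sum_divide_distrib)
  qed
qed

text \<open>
  All rejection rules considered have, outside vanishing sets, the form on the right with random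
  coefficients that converge in probability.  The difference of the test quantity and the linear
  combination \<open>\<alpha> A0 + \<beta> B0\<close> then converges to the constant \<open>\<alpha> d + \<beta> dI - \<theta>\<close>.
\<close>

lemma limiting_power:
  assumes kA: "tends_prob G kA \<alpha>" and kB: "tends_prob G kB \<beta>" and thr: "tends_prob G thr \<theta>"
    and s: "0 < s" "var \<alpha> \<beta> = s\<^sup>2"
    and E: "\<forall>\<^sub>F k in sequentially. E k \<in> sets (G k)"
    and EE: "vanishing G (\<lambda>k. {z \<in> space (G k). \<not> (z \<in> E k \<longleftrightarrow>
        thr k z \<le> kA k z * A k z + kB k z * (B k z - (t1 k z - S 1 k) / sqrt (n k)))})"
  shows "(\<lambda>k. measure (G k) (E k)) \<longlonglongrightarrow> 1 - Phi ((\<theta> - \<alpha> * d - \<beta> * dI) / s)"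
proof -
  define L where "L k z = \<alpha> / s * A0 k z + \<beta> / s * B0 k z" for k z
  define R where "R k z = (kA k z * A k z + kB k z * (B k z - (t1 k z - S 1 k) / sqrt (n k)) - thr k z) / s" for k z
  have v1: "var (\<alpha> / s) (\<beta> / s) = 1"
  proof -
    have "var (\<alpha> / s) (\<beta> / s) = var \<alpha> \<beta> / s\<^sup>2" unfolding var_def using s(1)
      by (simp add: power_divide power2_eq_square add_divide_distrib mult.assoc)
    then show ?thesis using s by simp
  qed
  obtain KA where KA: "\<forall>\<^sub>F k in sequentially. A0 k \<in> borel_measurable (G k) \<and> integrable (G k) (\<lambda>z. (A0 k z)\<^sup>2) \<and> (LINT z|G k. (A0 k z)\<^sup>2) \<le> KA"
    using AB0_bounded[of 1 0] by auto
  obtain KB where KB: "\<forall>\<^sub>F k in sequentially. B0 k \<in> borel_measurable (G k) \<and> integrable (G k) (\<lambda>z. (B0 k z)\<^sup>2) \<and> (LINT z|G k. (B0 k z)\<^sup>2) \<le> KB"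
    using AB0_bounded[of 0 1] by auto
  have cA: "tends_prob G (\<lambda>k z. kA k z - \<alpha>) 0" using tends_prob_diff[OF kA tends_prob_const[OF tendsto_const[of \<alpha>]]] by simp
  have cB: "tends_prob G (\<lambda>k z. kB k z - \<beta>) 0" using tends_prob_diff[OF kB tends_prob_const[OF tendsto_const[of \<beta>]]] by simp
  have "tends_prob G (\<lambda>k z. (kA k z * (A k z - A0 k z) + (kA k z - \<alpha>) * A0 k z + (kB k z * (B k z - B0 k z) + (kB k z - \<beta>) * B0 k z)
      - kB k z * ((t1 k z - S 1 k) / sqrt (n k)) - thr k z) / s) ((\<alpha> * d + 0 + (\<beta> * dI + 0) - \<beta> * 0 - \<theta>) / s)"
    by (intro tends_prob_divide tends_prob_diff tends_prob_add tends_prob_mult kA kB thr tends_A tends_B tends_trace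
        tends_prob_mult_bounded[OF cA KA] tends_prob_mult_bounded[OF cB KB] tends_prob_const tendsto_const) (use s in auto)
  then have RL: "tends_prob G (\<lambda>k z. R k z - L k z) ((\<alpha> * d + \<beta> * dI - \<theta>) / s)"
  proof -
    assume a: "tends_prob G (\<lambda>k z. (kA k z * (A k z - A0 k z) + (kA k z - \<alpha>) * A0 k z + (kB k z * (B k z - B0 k z) + (kB k z - \<beta>) * B0 k z)
      - kB k z * ((t1 k z - S 1 k) / sqrt (n k)) - thr k z) / s) ((\<alpha> * d + 0 + (\<beta> * dI + 0) - \<beta> * 0 - \<theta>) / s)"
    have "(kA k z * (A k z - A0 k z) + (kA k z - \<alpha>) * A0 k z + (kB k z * (B k z - B0 k z) + (kB k z - \<beta>) * B0 k z)
      - kB k z * ((t1 k z - S 1 k) / sqrt (n k)) - thr k z) / s = R k z - L k z" for k z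
      unfolding R_def L_def times_divide_eq_left add_divide_distrib[symmetric] diff_divide_distrib[symmetric]
      by (rule arg_cong[where f="\<lambda>x. x / s"]) (simp add: algebra_simps)
    with a show ?thesis by simp
  qed
  have LM: "\<forall>\<^sub>F k in sequentially. L k \<in> borel_measurable (G k)"
    using AB0_measurable[of "\<alpha> / s" "\<beta> / s"] unfolding L_def .
  have "(\<lambda>k. measure (G k) (E k)) \<longlonglongrightarrow> 1 - Phi (- ((\<alpha> * d + \<beta> * dI - \<theta>) / s))"
  proof (rule slutsky[OF LM _ isCont_Phi RL E])
    show "(\<lambda>k. measure (G k) {z \<in> space (G k). L k z \<le> x}) \<longlonglongrightarrow> Phi x" for x
      unfolding L_def by (rule AB0_clt[OF v1])
    have "0 \<le> R k z \<longleftrightarrow> thr k z \<le> kA k z * A k z + kB k z * (B k z - (t1 k z - S 1 k) / sqrt (n k))" for k z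
      using s(1) by (simp add: R_def zero_le_divide_iff)
    then show "vanishing G (\<lambda>k. {z \<in> space (G k). \<not> (z \<in> E k \<longleftrightarrow> 0 \<le> R k z)})" using EE by (simp only:)
  qed
  moreover have "- ((\<alpha> * d + \<beta> * dI - \<theta>) / s) = (\<theta> - \<alpha> * d - \<beta> * dI) / s"
    unfolding minus_divide_left by (simp add: algebra_simps)
  ultimately show ?thesis by simp
qed

end

section \<open>Asymptotics of the F percentile\<close>

lemma distr_sum_squares:
  assumes "inj_on f {..<d}" "\<And>i. i < d \<Longrightarrow> f i \<in> I"
  shows "distr (gauss I) borel (\<lambda>z. \<Sum>i<d. (z (f i))\<^sup>2) = chi_square_distr d"
proof -
  have r: "distr (gauss I) (gauss {..<d}) (\<lambda>z. \<lambda>i\<in>{..<d}. z (f i)) = gauss {..<d}"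
    by (rule gauss_reindex) (use assms in auto)
  have m1: "(\<lambda>z. \<lambda>i\<in>{..<d}. z (f i)) \<in> gauss I \<rightarrow>\<^sub>M gauss {..<d}"
    by (intro measurable_restrict measurable_component_singleton) (use assms in auto)
  have m2: "(\<lambda>z. \<Sum>i<d. (z i)\<^sup>2) \<in> borel_measurable (gauss {..<d})"
    by (intro borel_measurable_sum borel_measurable_power measurable_gauss_coordinate)
  have "chi_square_distr d = distr (distr (gauss I) (gauss {..<d}) (\<lambda>z. \<lambda>i\<in>{..<d}. z (f i))) borel (\<lambda>z. \<Sum>i<d. (z i)\<^sup>2)"
    unfolding r chi_square_distr_def ..
  also have "\<dots> = distr (gauss I) borel ((\<lambda>z. \<Sum>i<d. (z i)\<^sup>2) \<circ> (\<lambda>z. \<lambda>i\<in>{..<d}. z (f i)))"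
    by (rule distr_distr[OF m2 m1])
  also have "(\<lambda>z. \<Sum>i<d. (z i)\<^sup>2) \<circ> (\<lambda>z. \<lambda>i\<in>{..<d}. z (f i)) = (\<lambda>z. \<Sum>i<d. (z (f i))\<^sup>2)"
    by (auto simp: fun_eq_iff intro!: sum.cong)
  finally show ?thesis by simp
qed

text \<open>
  The F statistic as a function of a vector and of the denominator, so that \<open>row_transfer_integral\<close> applies.
\<close>

definition F_ratio :: "nat \<Rightarrow> nat \<Rightarrow> (nat \<Rightarrow> real) \<times> real \<Rightarrow> real" where
  "F_ratio p e wv = ((\<Sum>j<p. (fst wv j)\<^sup>2) / real p) / (snd wv / real e)"

lemma measurable_F_ratio: "F_ratio p e \<in> borel_measurable (Pi\<^sub>M {..<p} (\<lambda>_. borel) \<Otimes>\<^sub>M borel)"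
  unfolding F_ratio_def[abs_def]
  by (intro borel_measurable_divide borel_measurable_sum borel_measurable_power borel_measurable_const
      measurable_compose[OF measurable_fst measurable_component_singleton] measurable_snd) auto

lemma F_distr_eq:
  assumes p: "0 < p" "p < N"
  shows "F_distr p (N - p) = distr (gauss (grid N p)) borel (\<lambda>z. F_ratio p (N - p) (first_row p z, chi_part N p z))"
proof -
  let ?G = "gauss (grid N p)"
  interpret prob_space ?G by (rule prob_space_gauss)
  let ?X = "\<lambda>z :: nat \<times> nat \<Rightarrow> real. \<Sum>j<p. (z (0, j))\<^sup>2"
  let ?Y = "\<lambda>z :: nat \<times> nat \<Rightarrow> real. \<Sum>i<N - p. (z (p + i, p - 1))\<^sup>2"
  let ?A = "{0} \<times> {..<p}" and ?B = "{p..<N} \<times> {p - 1}"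
  let ?r = "\<lambda>J z. restrict (\<lambda>i. z i) J"
  have "indep_var (Pi\<^sub>M ?A (\<lambda>_. borel)) (?r ?A) (Pi\<^sub>M ?B (\<lambda>_. borel)) (?r ?B)"
    by (rule indep_var_restrict[OF indep_gauss]) (use p in auto)
  then have "indep_var borel (?X \<circ> ?r ?A) borel (?Y \<circ> ?r ?B)"
    by (rule indep_var_compose)
      (intro borel_measurable_sum borel_measurable_power measurable_component_singleton, use p in auto)+
  moreover have "?X \<circ> ?r ?A = ?X" "?Y \<circ> ?r ?B = ?Y"
    using p by (auto simp: fun_eq_iff intro!: sum.cong)
  ultimately have ind: "indep_var borel ?X borel ?Y" by simp
  have dX: "distr ?G borel ?X = chi_square_distr p"
    by (rule distr_sum_squares) (use p in \<open>auto simp: inj_on_def\<close>)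
  have dY: "distr ?G borel ?Y = chi_square_distr (N - p)"
    by (rule distr_sum_squares) (use p in \<open>auto simp: inj_on_def\<close>)
  have rX: "?X \<in> borel_measurable ?G" and rY: "?Y \<in> borel_measurable ?G"
    using ind unfolding indep_var_distribution_eq by auto
  have pr: "chi_square_distr p \<Otimes>\<^sub>M chi_square_distr (N - p) = distr ?G (borel \<Otimes>\<^sub>M borel) (\<lambda>z. (?X z, ?Y z))"
    using ind unfolding indep_var_distribution_eq dX dY by simp
  have m: "(\<lambda>(u, v). (u / real p) / (v / real (N - p))) \<in> borel_measurable (borel \<Otimes>\<^sub>M borel)"
    unfolding case_prod_beta by (intro borel_measurable_divide measurable_fst measurable_snd borel_measurable_const)
  have c: "chi_part N p z = ?Y z" for z
    unfolding chi_part_def by (rule sum.reindex_bij_witness[of _ "\<lambda>i. p + i" "\<lambda>a. a - p"]) (use p in auto)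
  have "F_distr p (N - p) = distr ?G borel ((\<lambda>(u, v). (u / real p) / (v / real (N - p))) \<circ> (\<lambda>z. (?X z, ?Y z)))"
    unfolding F_distr_def pr by (rule distr_distr[OF m]) (intro measurable_Pair rX rY)
  also have "(\<lambda>(u, v). (u / real p) / (v / real (N - p))) \<circ> (\<lambda>z. (?X z, ?Y z))
      = (\<lambda>z. F_ratio p (N - p) (first_row p z, chi_part N p z))"
    by (auto simp: fun_eq_iff F_ratio_def first_row_def c)
  finally show ?thesis .
qed

context asym begin

abbreviation "s_hot \<equiv> sqrt (2 * c / (1 - c) ^ 3)"

lemma s_hot: "0 < s_hot" "var (1 / (1 - c)) 0 = s_hot\<^sup>2"
  using c by (auto simp: var_def power2_eq_square power3_eq_cube)

lemma tends_n_V: "tends_prob G (\<lambda>k z. n k / V k z) (1 / (1 - c))"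
proof -
  have "tends_prob G (\<lambda>k z. 1 / (V k z / n k)) (1 / (1 - c))"
    by (intro tends_prob_divide tends_V tends_prob_const tendsto_const) (use c in auto)
  then show ?thesis by simp
qed

lemma V_nonzero: "vanishing G (\<lambda>k. {z \<in> space (G k). \<not> V k z \<noteq> 0})"
proof (rule vanishing_mono[OF tends_probD[OF tends_V]])
  show "0 < 1 - c" using c by simp
  show "\<forall>\<^sub>F k in sequentially. {z \<in> space (G k). \<not> V k z \<noteq> 0} \<subseteq> {z \<in> space (G k). 1 - c \<le> dist (V k z / n k) (1 - c)}"
    by (intro always_eventually) (auto simp: dist_real_def)
qed

lemma pr_sqrt_pos: "\<forall>\<^sub>F k in sequentially. 0 < pr k * sqrt (n k)"
  using ev by eventually_elim (auto simp: pr_def)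

definition Q where "Q k u = 1 + u / (pr k * sqrt (n k))"

text \<open>
  For zero shift Hotelling's statistic is an F variable, so its limit theorem gives the distribution
  function of the F law on the scale \<open>\<surd>n\<close>.
\<close>

lemma F_tail_null:
  assumes m0: "m = (\<lambda>_ _. 0)" and d: "d = 0" "dI = 0"
  shows "(\<lambda>k. measure (F_distr (p k) (N k - p k)) {x. x < Q k u}) \<longlonglongrightarrow> Phi (u / s_hot)"
proof -
  let ?R = "\<lambda>k z. F_ratio (p k) (N k - p k) (first_row (p k) z, V k z)"
  let ?E = "\<lambda>k. {z \<in> space (G k). Q k u \<le> ?R k z}"
  have "(\<lambda>k. measure (G k) (?E k)) \<longlonglongrightarrow> 1 - Phi ((u - 1 / (1 - c) * d - 0 * dI) / s_hot)"
  proof (rule limiting_power[OF tends_n_V _ _ s_hot])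
    show "tends_prob G (\<lambda>k z. 0) (0::real)" "tends_prob G (\<lambda>k z. u) u" by (intro tends_prob_const tendsto_const)+
    show "\<forall>\<^sub>F k in sequentially. ?E k \<in> sets (G k)"
      using ev
    proof eventually_elim
      case (elim k)
      then have N: "0 < N k" by simp
      have "?R k \<in> borel_measurable (G k)"
        unfolding V_def by (rule measurable_compose[OF _ measurable_F_ratio], unfold measurable_gauss_iff)
          (intro measurable_Pair measurable_first_row measurable_hot_ratio N)
      then show ?case by (intro borel_measurable_le borel_measurable_const)
    qed
    show "vanishing G (\<lambda>k. {z \<in> space (G k). \<not> (z \<in> ?E k \<longleftrightarrow>
        u \<le> n k / V k z * A k z + 0 * (B k z - (t1 k z - S 1 k) / sqrt (n k)))})"
    proof (rule vanishing_mono[OF V_nonzero])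
      show "\<forall>\<^sub>F k in sequentially. {z \<in> space (G k). \<not> (z \<in> ?E k \<longleftrightarrow>
        u \<le> n k / V k z * A k z + 0 * (B k z - (t1 k z - S 1 k) / sqrt (n k)))} \<subseteq> {z \<in> space (G k). \<not> V k z \<noteq> 0}"
        using ev pr_sqrt_pos
      proof (eventually_elim, intro subsetI)
        fix k z
        assume k: "0 < p k \<and> p k < N k \<and> 1 < N k \<and> 0 < n k" and q: "0 < pr k * sqrt (n k)"
          and z: "z \<in> {z \<in> space (G k). \<not> (z \<in> ?E k \<longleftrightarrow>
            u \<le> n k / V k z * A k z + 0 * (B k z - (t1 k z - S 1 k) / sqrt (n k)))}"
        have e1: "n k / V k z * A k z = pr k * sqrt (n k) * (?R k z - 1)" if V: "V k z \<noteq> 0"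
        proof -
          define W where "W = (\<Sum>j<p k. (z (0, j))\<^sup>2)"
          define r where "r = sqrt (n k)"
          have r: "r > 0" "n k = r * r" using k by (auto simp: r_def)
          have R: "pr k * ?R k z = W / V k z"
            using k V by (simp add: F_ratio_def first_row_def pr_def W_def of_nat_diff)
          have W: "(\<Sum>j<p k. (shifted_row (m k) z j)\<^sup>2) = W" by (simp add: W_def shifted_row_def m0)
          have A: "A k z = (W - pr k * V k z) / r" by (simp only: A_def W r_def)
          have "pr k * r * (?R k z - 1) = r * (pr k * ?R k z) - r * pr k" by (simp add: algebra_simps)
          also have "\<dots> = n k / V k z * A k z" unfolding R A r(2) using r(1) V by (simp add: field_simps)
          finally show ?thesis by (simp add: r_def)
        qed
        have e2: "Q k u \<le> x \<longleftrightarrow> u \<le> pr k * sqrt (n k) * (x - 1)" for x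
        proof -
          have "Q k u \<le> x \<longleftrightarrow> u / (pr k * sqrt (n k)) \<le> x - 1" by (auto simp: Q_def)
          then show ?thesis using q by (simp only: pos_divide_le_eq mult.commute)
        qed
        have zs: "z \<in> space (G k)" and ne: "\<not> (Q k u \<le> ?R k z \<longleftrightarrow> u \<le> n k / V k z * A k z)"
          using z unfolding mem_Collect_eq mult_zero_left add_0_right by (rule conjunct1, metis)
        have "V k z = 0" using ne e1 unfolding e2 by metis
        then show "z \<in> {z \<in> space (G k). \<not> V k z \<noteq> 0}" using zs by simp
      qed
    qed
  qed
  then have "(\<lambda>k. 1 - measure (G k) (?E k)) \<longlonglongrightarrow> 1 - (1 - Phi (u / s_hot))"
    unfolding d by (intro tendsto_diff tendsto_const) simp
  moreover have "\<forall>\<^sub>F k in sequentially. 1 - measure (G k) (?E k) = measure (F_distr (p k) (N k - p k)) {x. x < Q k u}"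
    using ev
  proof eventually_elim
    case (elim k)
    then have k: "0 < p k" "p k < N k" "0 < N k" by auto
    interpret prob_space "G k" by (rule prob_space_gauss)
    let ?C = "\<lambda>z. F_ratio (p k) (N k - p k) (first_row (p k) z, chi_part (N k) (p k) z)"
    have mC: "?C \<in> borel_measurable (G k)"
      by (rule measurable_compose[OF _ measurable_F_ratio], unfold measurable_gauss_iff)
        (intro measurable_Pair measurable_first_row measurable_chi_part k)
    have "measure (G k) (?E k) = measure (G k) {z \<in> space (G k). - ?R k z \<le> - Q k u}" by simp
    also have "\<dots> = measure (G k) {z \<in> space (G k). - ?C z \<le> - Q k u}"
      unfolding V_def
      by (rule row_transfer_integral(3)[OF k(1,2), of "\<lambda>x. - F_ratio (p k) (N k - p k) x"])
        (intro borel_measurable_uminus measurable_F_ratio)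
    also have "\<dots> = measure (G k) {z \<in> space (G k). \<not> ?C z < Q k u}" by (simp add: not_less)
    also have "\<dots> = 1 - measure (G k) {z \<in> space (G k). ?C z < Q k u}"
      by (rule prob_neg) (intro borel_measurable_less mC borel_measurable_const)
    also have "measure (G k) {z \<in> space (G k). ?C z < Q k u} = measure (F_distr (p k) (N k - p k)) {x. x < Q k u}"
      unfolding F_distr_eq[OF k(1,2)]
      by (subst measure_distr[OF mC]) (auto intro!: arg_cong[where f="measure (G k)"])
    finally show ?case by simp
  qed
  ultimately show ?thesis by (simp add: tendsto_cong)
qed

lemma asym_null: "asym N p lam (\<lambda>_ _. 0) c a1 a2 a3 0 0 0"
  using N_lim p_lim ratio c lam a_lim a_pos by unfold_locales auto

lemma F_tail: "(\<lambda>k. measure (F_distr (p k) (N k - p k)) {x. x < Q k u}) \<longlonglongrightarrow> Phi (u / s_hot)"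
proof -
  interpret null: asym N p lam "\<lambda>_ _. 0" c a1 a2 a3 0 0 0 by (rule asym_null)
  show ?thesis using null.F_tail_null[of u] by simp
qed

text \<open>
  Convergence of the distribution functions to a strictly increasing limit forces the quantiles to
  converge: for every \<open>\<epsilon> > 0\<close> the quantile is eventually trapped between the thresholds of two nearby levels.
\<close>

lemma F_perc_tends:
  assumes al: "0 < \<alpha>" "\<alpha> < 1"
  shows "(\<lambda>k. pr k * sqrt (n k) * (F_perc (p k) (N k - p k) \<alpha> - 1)) \<longlonglongrightarrow> z_perc \<alpha> * s_hot"
proof (rule tendstoI)
  fix e :: real assume "0 < e"
  then have e: "0 < e / 4" by simp
  define u where "u = z_perc \<alpha> * s_hot"
  note s = s_hot(1)
  have uz: "Phi (u / s_hot) = 1 - \<alpha>" using s Phi_z_perc[OF al] unfolding u_def by (metis nonzero_mult_div_cancel_right less_irrefl)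
  have 1: "\<forall>\<^sub>F k in sequentially. measure (F_distr (p k) (N k - p k)) {x. x < Q k (u - e / 4)} < 1 - \<alpha>"
    using F_tail by (rule order_tendstoD(2)) (use e s in \<open>simp add: uz[symmetric] Phi_less_iff divide_strict_right_mono\<close>)
  have 2: "\<forall>\<^sub>F k in sequentially. 1 - \<alpha> < measure (F_distr (p k) (N k - p k)) {x. x < Q k (u + e / 4)}"
    using F_tail by (rule order_tendstoD(1)) (use e s in \<open>simp add: uz[symmetric] Phi_less_iff divide_strict_right_mono\<close>)
  show "\<forall>\<^sub>F k in sequentially. dist (pr k * sqrt (n k) * (F_perc (p k) (N k - p k) \<alpha> - 1)) (z_perc \<alpha> * s_hot) < e"
    using 1 2 ev pr_sqrt_pos
  proof eventually_elim
    case (elim k)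
    let ?F = "F_distr (p k) (N k - p k)" and ?q = "pr k * sqrt (n k)"
    have k: "0 < p k" "p k < N k" using elim by auto
    have F: "prob_space ?F" and sF: "sets ?F = sets borel"
      unfolding F_distr_eq[OF k]
      by (intro prob_space.prob_space_distr prob_space_gauss, rule measurable_compose[OF _ measurable_F_ratio],
          unfold measurable_gauss_iff, intro measurable_Pair measurable_first_row measurable_chi_part)
        (use k in auto)
    interpret F: prob_space ?F by (rule F)
    have Q: "Q k v < Q k v'" if "v < v'" for v v' using that elim by (simp add: Q_def divide_strict_right_mono)
    have mono: "measure ?F X \<le> measure ?F Y" if "X \<subseteq> Y" "Y \<in> sets borel" for X Y
      using that sF by (intro F.finite_measure_mono) auto
    let ?T = "{t. 1 - \<alpha> \<le> cdf ?F t}"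
    have low: "Q k (u - e / 2) \<le> t" if t: "t \<in> ?T" for t
    proof (rule ccontr)
      assume "\<not> Q k (u - e / 2) \<le> t"
      then have "{..t} \<subseteq> {x. x < Q k (u - e / 4)}" using Q[of "u - e / 2" "u - e / 4"] e by auto
      then have "cdf ?F t \<le> measure ?F {x. x < Q k (u - e / 4)}" unfolding cdf_def by (rule mono) simp
      then show False using elim t by simp
    qed
    have mem: "Q k (u + e / 4) \<in> ?T"
    proof -
      have "measure ?F {x. x < Q k (u + e / 4)} \<le> cdf ?F (Q k (u + e / 4))"
        unfolding cdf_def by (rule mono) auto
      then show ?thesis using elim by simp
    qed
    have "Q k (u - e / 2) \<le> Inf ?T" by (rule cInf_greatest[OF _ low]) (use mem in auto)
    moreover have "Inf ?T \<le> Q k (u + e / 4)" by (rule cInf_lower[OF mem]) (use low in \<open>auto simp: bdd_below_def\<close>)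
    ultimately have "Q k (u - e / 2) - 1 \<le> F_perc (p k) (N k - p k) \<alpha> - 1" "F_perc (p k) (N k - p k) \<alpha> - 1 \<le> Q k (u + e / 4) - 1"
      by (auto simp: F_perc_def upper_percentile_def)
    then have "?q * (Q k (u - e / 2) - 1) \<le> ?q * (F_perc (p k) (N k - p k) \<alpha> - 1)"
      "?q * (F_perc (p k) (N k - p k) \<alpha> - 1) \<le> ?q * (Q k (u + e / 4) - 1)"
      using elim by (simp_all only: mult_left_mono less_imp_le)
    moreover have "?q * (Q k v - 1) = v" for v
      using elim(4) unfolding Q_def
      by (metis add_diff_cancel_left' less_irrefl nonzero_mult_div_cancel_left times_divide_eq_right)
    ultimately show ?case using e by (simp add: dist_real_def u_def)
  qed
qed

end

section \<open>The estimated weight, the critical values and the comparison of powers\<close>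

text \<open>
  With \<open>sH\<^sup>2\<close> and \<open>sD\<^sup>2\<close> the limiting variances of the two statistics, the weight \<open>\<rho>\<close> satisfies
  \<open>\<rho> sH = (1 - \<rho>) sD\<close>: both standardised statistics enter with the same coefficient.  Their correlation is
  \<open>a1 \<surd>((1 - c) / a2)\<close>, whence the factor \<open>K\<close>.
\<close>

lemma sigma_at_rho_star:
  fixes c a1 a2 :: real
  assumes c: "0 < c" "c < 1" and a: "0 < a1" "0 < a2"
  defines "\<rho> \<equiv> rho_star c a1 a2" and "sH \<equiv> sqrt (2 * c / (1 - c) ^ 3)" and "sD \<equiv> sqrt (2 * a2 / (c * a1\<^sup>2))"
    and "K \<equiv> sqrt 2 * sqrt (1 + a1 * sqrt ((1 - c) / a2))"
  shows "0 < \<rho>" "\<rho> < 1" "0 < sigma2 \<rho> c a1 a2"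
    and "\<rho> / sigma \<rho> c a1 a2 = 1 / (sH * K)" "(1 - \<rho>) / sigma \<rho> c a1 a2 = 1 / (sD * K)"
    and "c * a1 * sD = (1 - c) * sH * sqrt (a2 * (1 - c))"
proof -
  \<comment> \<open>naming the square roots turns every identity below into one between rational functions\<close>
  define b where "b = sqrt a2"
  define e where "e = sqrt (1 - c)"
  have be: "0 < b" "0 < e" "a2 = b\<^sup>2" "1 - c = e\<^sup>2" using c a by (auto simp: b_def e_def)
  define t where "t = sqrt (2 * c)"
  have t: "0 < t" "2 * c = t\<^sup>2" "c = t\<^sup>2 / 2" using c by (auto simp: t_def)
  have sH: "sH = t / e ^ 3"
  proof -
    have "2 * c / (1 - c) ^ 3 = (t / e ^ 3)\<^sup>2" unfolding t(2) be(4) by (simp add: power_divide flip: power_mult)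
    then have "sH = \<bar>t / e ^ 3\<bar>" unfolding sH_def by (simp only: real_sqrt_abs)
    then show ?thesis using be(2) t(1) by simp
  qed
  have sD: "sD = 2 * b / (t * a1)"
  proof -
    have "2 * a2 / (c * a1\<^sup>2) = (2 * b / (t * a1))\<^sup>2" unfolding t(3) be(3) by (simp add: power_divide power_mult_distrib)
    then have "sD = \<bar>2 * b / (t * a1)\<bar>" unfolding sD_def by (simp only: real_sqrt_abs)
    then show ?thesis using be(1) t(1) a(1) by simp
  qed
  have q: "sqrt (a2 * (1 - c)) = b * e" unfolding be(3,4) using be by (simp add: real_sqrt_mult)
  have r: "a1 * sqrt ((1 - c) / a2) = a1 * e / b" unfolding be(3,4) using be by (simp add: real_sqrt_divide)
  have K: "K = sqrt (2 * (1 + a1 * e / b))" unfolding K_def r by (rule real_sqrt_mult[symmetric])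
  have K2: "K\<^sup>2 = 2 * (1 + a1 * e / b)" and K0: "0 < K" unfolding K using a be by (auto intro!: add_pos_nonneg)
  have "(1 - c)^2 = e^2 * e^2" by (simp add: be(4) power2_eq_square)
  then have "rho_star c a1 a2 = inverse (a1 * c * (b * e) / (b\<^sup>2 * (e\<^sup>2 * e\<^sup>2)) + 1)"
    unfolding rho_star_def q by (simp only: be(3))
  also have "a1 * c * (b * e) / (b\<^sup>2 * (e\<^sup>2 * e\<^sup>2)) = sH / sD"
    unfolding sH sD t(3) using be(1,2) t a by (simp add: field_simps power2_eq_square power3_eq_cube)
  finally have \<rho>: "\<rho> = inverse (sH / sD + 1)" by (simp add: \<rho>_def)
  have s0: "0 < sH" "0 < sD" unfolding sH sD using be t a by auto
  have s1: "sH + sD \<noteq> 0" using s0 by simp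
  have \<rho>1: "\<rho> = sD / (sH + sD)" unfolding \<rho> using s0 by (simp add: field_simps)
  have "sH / (sH + sD) + sD / (sH + sD) = 1" using s1 by (simp flip: add_divide_distrib)
  then have "1 - \<rho> = sH / (sH + sD)" unfolding \<rho>1 by linarith
  note \<rho>' = \<rho>1 this
  show "0 < \<rho>" "\<rho> < 1" unfolding \<rho>'(1) using s0 by auto
  define w where "w = sH * sD / (sH + sD)"
  have w: "\<rho> * sH = w" "(1 - \<rho>) * sD = w" "0 < w"
    by (simp add: w_def \<rho>1 mult.commute, simp only: w_def \<rho>'(2) times_divide_eq_left, use s0 in \<open>simp add: w_def\<close>)
  have H2: "2 * c / (1 - c)^3 = sH\<^sup>2" "2 * a2 / (c * a1^2) = sD\<^sup>2" unfolding sH_def sD_def using c a by auto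
  have HD: "4 / (1 - c) = 2 * (a1 * e / b) * sH * sD"
    unfolding sH sD be(4) using be(1,2) t a by (simp add: power2_eq_square power3_eq_cube)
  have "sigma2 \<rho> c a1 a2 = (\<rho> * sH)\<^sup>2 + ((1 - \<rho>) * sD)\<^sup>2 + \<rho> * (1 - \<rho>) * (4 / (1 - c))"
    unfolding sigma2_def H2 by (simp add: power_mult_distrib)
  also have "\<dots> = (\<rho> * sH)\<^sup>2 + ((1 - \<rho>) * sD)\<^sup>2 + 2 * (a1 * e / b) * (\<rho> * sH) * ((1 - \<rho>) * sD)"
    unfolding HD by (simp only: mult_ac)
  also have "\<dots> = w\<^sup>2 * K\<^sup>2" unfolding w K2 by (simp add: power2_eq_square algebra_simps)
  finally have s2: "sigma2 \<rho> c a1 a2 = (w * K)\<^sup>2" by (simp add: power_mult_distrib)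
  show "0 < sigma2 \<rho> c a1 a2" unfolding s2 using w K0 by simp
  have s: "sigma \<rho> c a1 a2 = w * K" unfolding sigma_def s2 using w K0 by simp
  have wH: "\<rho> = w / sH" unfolding w(1)[symmetric] using s0 by simp
  have wD: "1 - \<rho> = w / sD" unfolding w(2)[symmetric] using s0 by simp
  have "w / sH / (w * K) = 1 / (sH * K)" "w / sD / (w * K) = 1 / (sD * K)" using w(3) by simp_all
  then show "\<rho> / sigma \<rho> c a1 a2 = 1 / (sH * K)" "(1 - \<rho>) / sigma \<rho> c a1 a2 = 1 / (sD * K)"
    unfolding s wD by (simp_all only: wH)
  show "c * a1 * sD = (1 - c) * sH * sqrt (a2 * (1 - c))"
    unfolding q sH sD unfolding be(4) unfolding t(3) using be(1,2) t(1) a by (simp add: power2_eq_square power3_eq_cube)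
qed

text \<open>
  The gain \<open>(x + y) / K\<close> is compared with \<open>x\<close> and with \<open>y\<close>.  It beats \<open>min x y\<close> because \<open>K < 2\<close>, and it can
  fail to reach at most one of \<open>x\<close> and \<open>y\<close>.
\<close>

lemma power_comparison:
  fixes x y z K :: real
  assumes xy: "0 < x" "0 < y" and K: "1 < K" "K < 2"
    and H: "\<beta>H = 1 - Phi (z - x)" and D: "\<beta>D = 1 - Phi (z - y)" and P: "\<beta>P = 1 - Phi (z - (x + y) / K)"
  shows "K - 1 \<le> x / y \<and> x / y \<le> inverse (K - 1) \<Longrightarrow> max \<beta>H \<beta>D \<le> \<beta>P"
    and "\<not> (K - 1 \<le> x / y \<and> x / y \<le> inverse (K - 1)) \<Longrightarrow> min \<beta>H \<beta>D < \<beta>P \<and> \<beta>P < max \<beta>H \<beta>D"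
proof -
  have K0: "0 < K" "0 < K - 1" using K by auto
  have 1: "K - 1 \<le> x / y \<longleftrightarrow> y \<le> (x + y) / K" using K0 xy by (simp add: field_simps)
  have 2: "x / y \<le> inverse (K - 1) \<longleftrightarrow> x \<le> (x + y) / K"
  proof -
    have "x / y \<le> inverse (K - 1) \<longleftrightarrow> x * (K - 1) \<le> y"
      using K0(2) xy by (simp add: inverse_eq_divide pos_divide_le_eq pos_le_divide_eq mult.commute)
    also have "\<dots> \<longleftrightarrow> x \<le> (x + y) / K" using K0(1) by (simp add: pos_le_divide_eq algebra_simps)
    finally show ?thesis .
  qed
  show "max \<beta>H \<beta>D \<le> \<beta>P" if "K - 1 \<le> x / y \<and> x / y \<le> inverse (K - 1)"
    using that unfolding 1 2 H D P by (simp add: Phi_le_iff)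
  show "min \<beta>H \<beta>D < \<beta>P \<and> \<beta>P < max \<beta>H \<beta>D" if "\<not> (K - 1 \<le> x / y \<and> x / y \<le> inverse (K - 1))"
  proof -
    have lt: "min x y < (x + y) / K"
    proof -
      have "min x y * K < min x y * 2" using K xy by (intro mult_strict_left_mono) auto
      also have "\<dots> \<le> x + y" by simp
      finally show ?thesis using K0 by (simp add: pos_less_divide_eq)
    qed
    have "(x + y) / K < max x y" using that unfolding 1 2 by auto
    then show ?thesis using lt unfolding H D P
      by (auto simp: min_def max_def Phi_less_iff Phi_le_iff split: if_splits)
  qed
qed

context asym begin

text \<open>
  \<open>h1\<close>, \<open>h2\<close>, \<open>h3\<close>, \<open>rh\<close>, \<open>sh\<close> and \<open>xh\<close> are \<open>a1_hat\<close>, \<open>a2_hat\<close>, \<open>a3_hat\<close>, \<open>rho_hat\<close>, \<open>sigma_hat\<close> and \<open>x_hat\<close> as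
  functions of the Gaussian array.
\<close>

definition h1 where "h1 k z = t1 k z / real (p k)"
definition h2 where "h2 k z = (n k)^2 / (real (p k) * (n k + 2) * (n k - 1)) * (t2 k z - (t1 k z)^2 / n k)"
definition h3 where "h3 k z = (n k)^2 / ((n k + 4) * (n k + 2) * (n k - 1) * (n k - 2) * real (p k)) *
     ((n k)^2 * t3 k z - 3 * n k * t2 k z * t1 k z + 2 * (t1 k z)^3)"
abbreviation "ch k \<equiv> real (p k) / n k"
definition rh where "rh k z = rho_star (ch k) (h1 k z) (h2 k z)"
definition sh where "sh k z = sigma (rh k z) (ch k) (h1 k z) (h2 k z)"
definition xh where "xh \<alpha> k z = z_perc \<alpha> + 1 / sqrt (n k) * (b1 (rh k z) (ch k) / sh k z
    + b3 (rh k z) (ch k) (h1 k z) (h2 k z) (h3 k z) / sh k z ^ 3 * ((z_perc \<alpha>)^2 - 1))"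

lemma ev4: "\<forall>\<^sub>F k in sequentially. 4 < n k \<and> 0 < p k"
proof -
  have "\<forall>\<^sub>F k in sequentially. 4 < n k" using n_top unfolding filterlim_at_top_dense by blast
  then show ?thesis using ev by eventually_elim simp
qed

lemma tends_ch: "tends_prob G (\<lambda>k z. ch k) c" by (rule tends_prob_const) (rule pn)

lemma tends_h1: "tends_prob G h1 a1"
proof -
  have "tends_prob G (\<lambda>k z. (t1 k z / n k) / ch k) (c * a1 / c)"
    by (rule tends_prob_divide[OF tends_t1 tends_ch]) (use c in simp)
  then have "tends_prob G (\<lambda>k z. (t1 k z / n k) / ch k) a1" using c by simp
  then show ?thesis
    by (rule tends_prob_cong_eventually) (use ev4 in eventually_elim, simp add: h1_def)
qed

lemma tends_h2: "tends_prob G h2 a2"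
proof -
  have "(\<lambda>k. 1 / ((1 + 2 * (1 / n k)) * (1 - 1 / n k)) * (1 / ch k)) \<longlonglongrightarrow> 1 / ((1 + 2 * 0) * (1 - 0)) * (1 / c)"
    by (intro tendsto_intros inv_n pn) (use c in auto)
  then have "tends_prob G (\<lambda>k z. 1 / ((1 + 2 * (1 / n k)) * (1 - 1 / n k)) * (1 / ch k) * ((t2 k z - (t1 k z)\<^sup>2 / n k) / n k))
     (1 / ((1 + 2 * 0) * (1 - 0)) * (1 / c) * (c * a2))"
    by (intro tends_prob_mult tends_bracket tends_prob_const)
  then have "tends_prob G (\<lambda>k z. 1 / ((1 + 2 * (1 / n k)) * (1 - 1 / n k)) * (1 / ch k) * ((t2 k z - (t1 k z)\<^sup>2 / n k) / n k)) a2"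
    using c by simp
  then show ?thesis
  proof (rule tends_prob_cong_eventually)
    show "\<forall>\<^sub>F k in sequentially. \<forall>z\<in>space (G k). 1 / ((1 + 2 * (1 / n k)) * (1 - 1 / n k)) * (1 / ch k) * ((t2 k z - (t1 k z)\<^sup>2 / n k) / n k) = h2 k z"
      using ev4
    proof (eventually_elim, intro ballI)
      fix k z assume k: "4 < n k \<and> 0 < p k"
      define q where "q = n k"
      define T where "T = t2 k z - (t1 k z)\<^sup>2 / n k"
      have q: "q > 0" "q + 2 > 0" "q - 1 > 0" using k by (auto simp: q_def)
      have "1 + 2 * (1 / q) = (q + 2) / q" "1 - 1 / q = (q - 1) / q" using q by (auto simp: field_simps)
      then show "1 / ((1 + 2 * (1 / n k)) * (1 - 1 / n k)) * (1 / ch k) * ((t2 k z - (t1 k z)\<^sup>2 / n k) / n k) = h2 k z"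
        unfolding h2_def T_def[symmetric] q_def[symmetric] using q k by (simp add: power2_eq_square mult_ac)
    qed
  qed
qed

text \<open>
  Consistency of \<open>a3_hat\<close> is more than the adjusted critical value asks for: there it is divided by \<open>\<surd>n\<close>.
  The crude bound \<open>tends_t3\<close> then suffices, and the bias correction can be estimated term by term.
\<close>

lemma tends_h3: "tends_prob G (\<lambda>k z. h3 k z / sqrt (n k)) 0"
proof -
  let ?f = "\<lambda>k. 1 / ((1 + 4 * (1 / n k)) * (1 + 2 * (1 / n k)) * (1 - 1 / n k) * (1 - 2 * (1 / n k))) * (1 / ch k)"
  let ?g = "\<lambda>k z. t3 k z / (n k * sqrt (n k)) - 3 * (t2 k z / n k) * (t1 k z / n k) * (1 / sqrt (n k))
      + 2 * (t1 k z / n k * (t1 k z / n k) * (t1 k z / n k)) * (1 / sqrt (n k))"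
  have "?f \<longlonglongrightarrow> 1 / ((1 + 4 * 0) * (1 + 2 * 0) * (1 - 0) * (1 - 2 * 0)) * (1 / c)"
    by (intro tendsto_intros inv_n pn) (use c in auto)
  then have "tends_prob G (\<lambda>k z. ?f k * ?g k z) (1 / ((1 + 4 * 0) * (1 + 2 * 0) * (1 - 0) * (1 - 2 * 0)) * (1 / c) *
      (0 - 3 * (c * a2 + c * a1 * (c * a1)) * (c * a1) * 0 + 2 * (c * a1 * (c * a1) * (c * a1)) * 0))"
    by (intro tends_prob_mult tends_prob_add tends_prob_diff tends_t3 tends_t2 tends_t1 tends_prob_const inv_sqrt_n tendsto_const)
  then have "tends_prob G (\<lambda>k z. ?f k * ?g k z) 0" by simp
  then show ?thesis
  proof (rule tends_prob_cong_eventually)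
    show "\<forall>\<^sub>F k in sequentially. \<forall>z\<in>space (G k). ?f k * ?g k z = h3 k z / sqrt (n k)"
      using ev4
    proof (eventually_elim, intro ballI)
      fix k z assume k: "4 < n k \<and> 0 < p k"
      define q where "q = n k"
      define r where "r = sqrt (n k)"
      define T where "T = q^2 * t3 k z - 3 * q * t2 k z * t1 k z + 2 * (t1 k z)^3"
      have q: "q > 0" "q + 4 > 0" "q + 2 > 0" "q - 1 > 0" "q - 2 > 0" "r > 0" using k by (auto simp: q_def r_def)
      have e: "1 + 4 * (1 / q) = (q + 4) / q" "1 + 2 * (1 / q) = (q + 2) / q" "1 - 1 / q = (q - 1) / q" "1 - 2 * (1 / q) = (q - 2) / q"
        using q by (auto simp: field_simps)
      have "?g k z = T / (q^3 * r)"
        unfolding T_def unfolding r_def[symmetric] unfolding q_def[symmetric] using q(1,6) by (simp add: power2_eq_square power3_eq_cube field_simps)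
      then show "?f k * ?g k z = h3 k z / sqrt (n k)"
        unfolding h3_def unfolding r_def[symmetric] unfolding q_def[symmetric] T_def[symmetric] e using q k
        by (simp add: power2_eq_square power3_eq_cube mult_ac)
    qed
  qed
qed

lemma tends_prob_power: "tends_prob G f a \<Longrightarrow> tends_prob G (\<lambda>k z. (f k z :: real) ^ i) (a ^ i)"
  by (erule tends_prob_isCont) (intro continuous_intros)

lemma tends_prob_sqrt: "tends_prob G f a \<Longrightarrow> tends_prob G (\<lambda>k z. sqrt (f k z)) (sqrt a)"
  by (erule tends_prob_isCont) (intro continuous_intros)

lemma tends_prob_inverse: "tends_prob G f a \<Longrightarrow> a \<noteq> 0 \<Longrightarrow> tends_prob G (\<lambda>k z. inverse (f k z :: real)) (inverse a)"
  by (erule tends_prob_isCont) (intro continuous_intros)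

lemma tends_prob_constant: "tends_prob G (\<lambda>k z. a) a" by (intro tends_prob_const tendsto_const)

lemmas tp_intros = tends_prob_add tends_prob_diff tends_prob_mult tends_prob_divide tends_prob_power tends_prob_sqrt
  tends_prob_inverse tends_h1 tends_h2 tends_ch tends_prob_constant

abbreviation "\<rho> \<equiv> rho_star c a1 a2"
abbreviation "\<sigma> \<equiv> sigma \<rho> c a1 a2"

lemmas \<rho>\<sigma> = sigma_at_rho_star[OF c a_pos]

lemma tends_rh: "tends_prob G rh \<rho>"
  unfolding rh_def[abs_def] rho_star_def
proof (intro tp_intros)
  show "a2 * (1 - c)\<^sup>2 \<noteq> 0" using c a_pos by simp
  have "0 \<le> a1 * c * sqrt (a2 * (1 - c)) / (a2 * (1 - c)\<^sup>2)" using c a_pos by (intro divide_nonneg_nonneg mult_nonneg_nonneg) auto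
  then show "a1 * c * sqrt (a2 * (1 - c)) / (a2 * (1 - c)\<^sup>2) + 1 \<noteq> 0" by linarith
qed

lemma nz: "c \<noteq> 0" "1 - c \<noteq> 0" "(1 - c) ^ i \<noteq> 0" "c * a1\<^sup>2 \<noteq> 0" "a1\<^sup>2 * (1 - c)\<^sup>2 * c \<noteq> 0" "a1 ^ 3 * c\<^sup>2 \<noteq> 0" "c * a1 \<noteq> 0"
  using c a_pos by auto

lemma tends_sh: "tends_prob G sh \<sigma>"
  unfolding sh_def[abs_def] sigma_def sigma2_def by (intro tp_intros tends_rh nz)

lemma \<sigma>_pos: "0 < \<sigma>" unfolding sigma_def using \<rho>\<sigma>(3) by simp

text \<open>
  \<open>b3\<close> is affine in its last argument, so \<open>b3 / \<surd>n\<close> splits into a convergent expression times \<open>1 / \<surd>n\<close> and a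
  multiple of \<open>a3_hat / \<surd>n\<close>.
\<close>

lemma tends_xh: "tends_prob G (xh \<alpha>) (z_perc \<alpha>)"
proof -
  let ?b = "\<lambda>k z. b3 (rh k z) (ch k) (h1 k z) (h2 k z) 0"
  have nz': "\<sigma> ^ 3 \<noteq> 0" "\<sigma> \<noteq> 0" using \<sigma>_pos by auto
  have sq: "tends_prob G (\<lambda>k z. 1 / sqrt (n k)) 0" by (rule tends_prob_const) (rule inv_sqrt_n)
  have "tends_prob G (\<lambda>k z. z_perc \<alpha> + (1 / sqrt (n k) * (b1 (rh k z) (ch k) / sh k z)
     + (1 / sqrt (n k) * ?b k z + 8 * (1 - rh k z)^3 * (h3 k z / sqrt (n k)) / ((h1 k z)^3 * (ch k)^2) / 6) / sh k z ^ 3 * ((z_perc \<alpha>)^2 - 1)))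
    (z_perc \<alpha> + (0 * (b1 \<rho> c / \<sigma>) + (0 * b3 \<rho> c a1 a2 0 + 8 * (1 - \<rho>)^3 * 0 / (a1^3 * c^2) / 6) / \<sigma> ^ 3 * ((z_perc \<alpha>)^2 - 1)))"
    unfolding b1_def b3_def nu1_def nu3_def sigma2_def
    by (intro tp_intros tends_rh tends_sh tends_h3 sq nz nz') simp_all
  then have "tends_prob G (\<lambda>k z. z_perc \<alpha> + (1 / sqrt (n k) * (b1 (rh k z) (ch k) / sh k z)
     + (1 / sqrt (n k) * ?b k z + 8 * (1 - rh k z)^3 * (h3 k z / sqrt (n k)) / ((h1 k z)^3 * (ch k)^2) / 6) / sh k z ^ 3 * ((z_perc \<alpha>)^2 - 1)))
    (z_perc \<alpha>)" by simp
  then show ?thesis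
  proof (rule tends_prob_cong_eventually, intro always_eventually allI ballI)
    fix k z
    have b3: "b3 (rh k z) (ch k) (h1 k z) (h2 k z) (h3 k z) = ?b k z + 8 * (1 - rh k z)^3 * h3 k z / ((h1 k z)^3 * (ch k)^2) / 6"
      unfolding b3_def nu3_def by (simp add: add_divide_distrib)
    show "z_perc \<alpha> + (1 / sqrt (n k) * (b1 (rh k z) (ch k) / sh k z)
     + (1 / sqrt (n k) * ?b k z + 8 * (1 - rh k z)^3 * (h3 k z / sqrt (n k)) / ((h1 k z)^3 * (ch k)^2) / 6) / sh k z ^ 3 * ((z_perc \<alpha>)^2 - 1))
     = xh \<alpha> k z"
      unfolding xh_def b3
      by (simp only: distrib_left distrib_right add_divide_distrib divide_inverse mult_1_left mult_ac)
  qed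
qed

text \<open>
  \<open>\<surd>n (T\<^sup>2/n - p/(N - p))\<close> and \<open>\<surd>n (D\<^sub>n - 1)\<close> on the Gaussian array, outside a vanishing set.
\<close>

definition TA where "TA k z = n k / V k z * A k z"
definition TD where "TD k z = n k / t1 k z * (B k z - (t1 k z - S 1 k) / sqrt (n k))"

lemma tends_n_t1: "tends_prob G (\<lambda>k z. n k / t1 k z) (1 / (c * a1))"
proof -
  have "tends_prob G (\<lambda>k z. 1 / (t1 k z / n k)) (1 / (c * a1))"
    by (intro tends_prob_divide tends_t1 tends_prob_constant nz)
  then show ?thesis by simp
qed

lemma t1_nonzero: "vanishing G (\<lambda>k. {z \<in> space (G k). \<not> t1 k z \<noteq> 0})"
proof (rule vanishing_mono[OF tends_probD[OF tends_t1]])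
  show "0 < c * a1" using c a_pos by simp
  then show "\<forall>\<^sub>F k in sequentially. {z \<in> space (G k). \<not> t1 k z \<noteq> 0} \<subseteq> {z \<in> space (G k). c * a1 \<le> dist (t1 k z / n k) (c * a1)}"
    by (intro always_eventually) (auto simp: dist_real_def)
qed

abbreviation "s_dem \<equiv> sqrt (2 * a2 / (c * a1\<^sup>2))"

lemma hotelling_power:
  assumes "0 < \<alpha>" "\<alpha> < 1" and "\<forall>\<^sub>F k in sequentially. E k \<in> sets (G k)"
    and "vanishing G (\<lambda>k. {z \<in> space (G k). \<not> (z \<in> E k \<longleftrightarrow> pr k * sqrt (n k) * (F_perc (p k) (N k - p k) \<alpha> - 1) \<le> TA k z)})"
  shows "(\<lambda>k. measure (G k) (E k)) \<longlonglongrightarrow> 1 - Phi (z_perc \<alpha> - d / ((1 - c) * s_hot))"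
proof -
  have "(\<lambda>k. measure (G k) (E k)) \<longlonglongrightarrow> 1 - Phi ((z_perc \<alpha> * s_hot - 1 / (1 - c) * d - 0 * dI) / s_hot)"
    by (rule limiting_power[OF tends_n_V tends_prob_constant tends_prob_const[OF F_perc_tends[OF assms(1,2)]] s_hot assms(3)])
      (use assms(4) in \<open>simp add: TA_def\<close>)
  also have "(z_perc \<alpha> * s_hot - 1 / (1 - c) * d - 0 * dI) / s_hot = z_perc \<alpha> - d / ((1 - c) * s_hot)"
  proof -
    define s where "s = s_hot"
    have "s \<noteq> 0" unfolding s_def using s_hot(1) by (metis less_irrefl)
    then show ?thesis unfolding s_def[symmetric] by (simp add: diff_divide_distrib)
  qed
  finally show ?thesis .
qed

lemma dempster_power:
  assumes "\<forall>\<^sub>F k in sequentially. E k \<in> sets (G k)"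
    and "vanishing G (\<lambda>k. {z \<in> space (G k). \<not> (z \<in> E k \<longleftrightarrow> z_perc \<alpha> \<le> TD k z / sqrt (2 * h2 k z / (ch k * (h1 k z)\<^sup>2)))})"
  shows "(\<lambda>k. measure (G k) (E k)) \<longlonglongrightarrow> 1 - Phi (z_perc \<alpha> - dI / (c * a1 * s_dem))"
proof -
  have s: "0 < s_dem" using c a_pos by simp
  have kB: "tends_prob G (\<lambda>k z. n k / t1 k z / sqrt (2 * h2 k z / (ch k * (h1 k z)\<^sup>2))) (1 / (c * a1) / s_dem)"
    by (rule tends_prob_divide[OF tends_n_t1]) (intro tp_intros nz, use s in \<open>metis less_irrefl\<close>)
  have "var 0 (1 / (c * a1) / s_dem) = (1 / (c * a1) / s_dem)\<^sup>2 * (2 * (c * a2))" by (simp add: var_def)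
  also have "\<dots> = (1 / (c * a1))\<^sup>2 / s_dem\<^sup>2 * (2 * (c * a2))" by (simp only: power_divide)
  also have "s_dem\<^sup>2 = 2 * a2 / (c * a1\<^sup>2)" using c a_pos by simp
  finally have v: "var 0 (1 / (c * a1) / s_dem) = 1\<^sup>2" using c a_pos by (simp add: power2_eq_square)
  have "(\<lambda>k. measure (G k) (E k)) \<longlonglongrightarrow> 1 - Phi ((z_perc \<alpha> - 0 * d - 1 / (c * a1) / s_dem * dI) / 1)"
    by (rule limiting_power[of "\<lambda>k z. 0" 0 _ _ "\<lambda>k z. z_perc \<alpha>" _ 1, OF tends_prob_constant kB tends_prob_constant _ v assms(1)])
      (use assms(2) in \<open>simp_all add: TD_def\<close>)
  then show ?thesis by simp
qed

lemma proposed_power: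
  assumes thr: "tends_prob G thr (z_perc \<alpha>)" and E: "\<forall>\<^sub>F k in sequentially. E k \<in> sets (G k)"
    and EE: "vanishing G (\<lambda>k. {z \<in> space (G k). \<not> (z \<in> E k \<longleftrightarrow> thr k z \<le> (rh k z * TA k z + (1 - rh k z) * TD k z) / sh k z)})"
  shows "(\<lambda>k. measure (G k) (E k)) \<longlonglongrightarrow> 1 - Phi (z_perc \<alpha> - (d / ((1 - c) * s_hot) + dI / (c * a1 * s_dem))
     / (sqrt 2 * sqrt (1 + a1 * sqrt ((1 - c) / a2))))"
proof -
  let ?K = "sqrt 2 * sqrt (1 + a1 * sqrt ((1 - c) / a2))"
  have s: "\<sigma> \<noteq> 0" using \<sigma>_pos by simp
  have kA: "tends_prob G (\<lambda>k z. rh k z / sh k z * (n k / V k z)) (\<rho> / \<sigma> * (1 / (1 - c)))"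
    and kB: "tends_prob G (\<lambda>k z. (1 - rh k z) / sh k z * (n k / t1 k z)) ((1 - \<rho>) / \<sigma> * (1 / (c * a1)))"
    by (rule tends_prob_mult[OF tends_prob_divide[OF tends_rh tends_sh s] tends_n_V],
        rule tends_prob_mult[OF tends_prob_divide[OF tends_prob_diff[OF tends_prob_constant tends_rh] tends_sh s] tends_n_t1])
  have "\<sigma>\<^sup>2 = sigma2 \<rho> c a1 a2" unfolding sigma_def using \<rho>\<sigma>(3) by simp
  also have "\<dots> = var (\<rho> * (1 / (1 - c))) ((1 - \<rho>) * (1 / (c * a1)))"
    unfolding sigma2_def var_def using nz c by (simp add: power2_eq_square power3_eq_cube field_simps)
  finally have v: "var (\<rho> * (1 / (1 - c))) ((1 - \<rho>) * (1 / (c * a1))) = \<sigma>\<^sup>2" by simp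
  have "var (\<rho> / \<sigma> * (1 / (1 - c))) ((1 - \<rho>) / \<sigma> * (1 / (c * a1))) = var (\<rho> * (1 / (1 - c))) ((1 - \<rho>) * (1 / (c * a1))) / \<sigma>\<^sup>2"
    unfolding var_def using s by (simp add: power2_eq_square add_divide_distrib mult_ac)
  then have v1: "var (\<rho> / \<sigma> * (1 / (1 - c))) ((1 - \<rho>) / \<sigma> * (1 / (c * a1))) = 1\<^sup>2" unfolding v using s by simp
  have eq: "rh k z / sh k z * (n k / V k z) * A k z + (1 - rh k z) / sh k z * (n k / t1 k z) * (B k z - (t1 k z - S 1 k) / sqrt (n k))
      = (rh k z * TA k z + (1 - rh k z) * TD k z) / sh k z" for k z
    unfolding TA_def TD_def by (simp only: add_divide_distrib times_divide_eq_left mult.assoc)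
  have "(\<lambda>k. measure (G k) (E k)) \<longlonglongrightarrow> 1 - Phi ((z_perc \<alpha> - \<rho> / \<sigma> * (1 / (1 - c)) * d - (1 - \<rho>) / \<sigma> * (1 / (c * a1)) * dI) / 1)"
    by (rule limiting_power[of _ _ _ _ _ _ 1, OF kA kB thr _ v1 E]) (simp, unfold eq, rule EE)
  also have "(z_perc \<alpha> - \<rho> / \<sigma> * (1 / (1 - c)) * d - (1 - \<rho>) / \<sigma> * (1 / (c * a1)) * dI) / 1
     = z_perc \<alpha> - (d / ((1 - c) * s_hot) + dI / (c * a1 * s_dem)) / ?K"
    unfolding \<rho>\<sigma>(4,5) by (simp add: add_divide_distrib mult_ac)
  finally show ?thesis .
qed

lemma a1_sq_le: "a1\<^sup>2 \<le> a2"
proof (rule LIMSEQ_le)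
  show "(\<lambda>k. ((\<Sum>j<p k. lam k j) / p k)\<^sup>2) \<longlonglongrightarrow> a1\<^sup>2" by (intro tendsto_power a_lim)
  show "(\<lambda>k. (\<Sum>j<p k. (lam k j)^2) / p k) \<longlonglongrightarrow> a2" by (rule a_lim)
  obtain K where K: "\<And>k. K \<le> k \<Longrightarrow> 0 < p k" using ev unfolding eventually_sequentially by auto
  show "\<exists>K. \<forall>k\<ge>K. ((\<Sum>j<p k. lam k j) / p k)\<^sup>2 \<le> (\<Sum>j<p k. (lam k j)^2) / p k"
  proof (intro exI allI impI)
    fix k assume "K \<le> k"
    then have p: "0 < real (p k)" using K by simp
    have "(\<Sum>j<p k. lam k j * 1)\<^sup>2 \<le> (\<Sum>j<p k. (lam k j)\<^sup>2) * (\<Sum>j<p k. 1\<^sup>2)" by (rule Cauchy_Schwarz_ineq_sum)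
    then have "(\<Sum>j<p k. lam k j)\<^sup>2 \<le> (\<Sum>j<p k. (lam k j)\<^sup>2) * real (p k)" by simp
    then have "(\<Sum>j<p k. lam k j)\<^sup>2 / (real (p k))\<^sup>2 \<le> (\<Sum>j<p k. (lam k j)\<^sup>2) * real (p k) / (real (p k))\<^sup>2"
      by (rule divide_right_mono) simp
    then show "((\<Sum>j<p k. lam k j) / p k)\<^sup>2 \<le> (\<Sum>j<p k. (lam k j)^2) / p k"
      using p by (simp add: power_divide power2_eq_square)
  qed
qed

text \<open>
  The correlation \<open>a1 \<surd>((1 - c) / a2)\<close> is at most \<open>\<surd>(1 - c) < 1\<close> by the Cauchy-Schwarz inequality.
\<close>

lemma K_bounds: "1 < sqrt 2 * sqrt (1 + a1 * sqrt ((1 - c) / a2))" "sqrt 2 * sqrt (1 + a1 * sqrt ((1 - c) / a2)) < 2"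
proof -
  let ?r = "a1 * sqrt ((1 - c) / a2)"
  have r0: "0 \<le> ?r" using c a_pos by simp
  have two: "1 < 2 * (1 + x)" if "0 \<le> x" for x :: real using that by simp
  have "?r\<^sup>2 = a1\<^sup>2 * (1 - c) / a2" using c a_pos by (simp add: power_mult_distrib)
  also have "\<dots> \<le> 1 - c" using a1_sq_le a_pos c by (simp add: divide_le_eq mult.commute[of "a1\<^sup>2"] mult_left_mono)
  also have "\<dots> < 1\<^sup>2" using c by simp
  finally have r1: "?r < 1" by (rule power_less_imp_less_base) simp
  have e: "sqrt 2 * sqrt (1 + ?r) = sqrt (2 * (1 + ?r))" by (simp only: real_sqrt_mult)
  have "sqrt 1 < sqrt (2 * (1 + ?r))" using two[OF r0] by (rule real_sqrt_less_mono)
  then show "1 < sqrt 2 * sqrt (1 + ?r)" unfolding e by simp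
  have "sqrt (2 * (1 + ?r)) < sqrt (2^2)" using r1 by (intro real_sqrt_less_mono) simp
  then show "sqrt 2 * sqrt (1 + ?r) < 2" unfolding e by simp
qed

end

section \<open>From the normal model to the limiting powers\<close>

text \<open>
  A Helmert matrix.
\<close>

lemma exists_frame:
  assumes "1 < N"
  shows "\<exists>H. orthonormal_on {..<N} {..<N} H \<and> (\<forall>i<N. H 0 i = 1 / sqrt (real N))"
proof -
  have "orthonormal_on {..<N} {0} (\<lambda>_ _. 1 / sqrt (real N))"
    using assms by (auto simp: orthonormal_on_def ip_def)
  from extend_orthonormal[of "{..<N}" "{}" "{..<N}" "{0}", OF _ _ _ _ _ this] assms
  obtain H where "orthonormal_on {..<N} {..<N} H" "\<forall>a\<in>{0}. H a = (\<lambda>_. 1 / sqrt (real N))" by auto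
  then show ?thesis by (intro exI[of _ H]) simp
qed

lemma exists_spectral_cov:
  assumes "pos_def_mat p A"
  shows "\<exists>U lam. spectral_cov p A U lam"
proof -
  have A: "A \<in> carrier_mat p p" and sym: "transpose_mat A = A"
    and pos: "\<And>v. v \<in> carrier_vec p \<Longrightarrow> v \<noteq> 0\<^sub>v p \<Longrightarrow> 0 < quad_form A v"
    using assms by (auto simp: pos_def_mat_def)
  have "A $$ (a, b) = A $$ (b, a)" if "a < p" "b < p" for a b
  proof -
    have "transpose_mat A $$ (a, b) = A $$ (b, a)" using A that by simp
    then show ?thesis unfolding sym .
  qed
  then obtain U l where U: "orthonormal_on {..<p} {..<p} U"
    and eig: "\<And>j a. j < p \<Longrightarrow> a < p \<Longrightarrow> ip {..<p} (\<lambda>b. A $$ (a, b)) (U j) = l j * U j a"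
    and ent: "\<And>a b. a < p \<Longrightarrow> b < p \<Longrightarrow> A $$ (a, b) = (\<Sum>j<p. l j * U j a * U j b)"
    using spectral_symmetric[of p "\<lambda>a b. A $$ (a, b)"] by blast
  have "0 < l j" if j: "j < p" for j
  proof -
    let ?v = "Matrix.vec p (U j)"
    have one: "ip {..<p} (U j) (U j) = 1" using U j by (auto simp: orthonormal_on_def)
    have "?v \<noteq> 0\<^sub>v p"
    proof
      assume z: "?v = 0\<^sub>v p"
      have "U j a = 0" if "a < p" for a using arg_cong[OF z, of "\<lambda>v. v $ a"] that by simp
      then show False using one by (simp add: ip_def)
    qed
    then have "0 < quad_form A ?v" by (intro pos) simp_all
    also have "quad_form A ?v = (\<Sum>a<p. U j a * ip {..<p} (\<lambda>b. A $$ (a, b)) (U j))"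
      using A by (auto simp: quad_form_def scalar_prod_def ip_def atLeast0LessThan intro!: sum.cong)
    also have "\<dots> = (\<Sum>a<p. l j * (U j a * U j a))"
      by (intro sum.cong refl) (use j in \<open>simp add: eig\<close>)
    also have "\<dots> = l j * ip {..<p} (U j) (U j)" by (simp add: ip_def sum_distrib_left)
    finally show ?thesis unfolding one by simp
  qed
  then have "spectral_cov p A U l" using A U ent by unfold_locales auto
  then show ?thesis by blast
qed

lemma ratio_shift:
  assumes "filterlim N at_top sequentially"
  shows "(\<lambda>k. real (N k) / (real (N k) - 1)) \<longlonglongrightarrow> 1"
proof -
  have "filterlim (\<lambda>k. -1 + real (N k)) at_top sequentially"
    by (rule filterlim_tendsto_add_at_top[OF tendsto_const filterlim_compose[OF filterlim_real_sequentially assms]])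
  then have "(\<lambda>k. 1 + 1 / (-1 + real (N k))) \<longlonglongrightarrow> 1 + 0"
    by (intro tendsto_add tendsto_const tendsto_divide_0[OF tendsto_const] filterlim_at_top_imp_at_infinity)
  moreover have "\<forall>\<^sub>F k in sequentially. 1 + 1 / (-1 + real (N k)) = real (N k) / (real (N k) - 1)"
    using eventually_compose_filterlim[OF eventually_gt_at_top[of 1] assms]
    by eventually_elim (auto simp: field_simps)
  ultimately show ?thesis by (simp add: tendsto_cong)
qed

text \<open>
  The connection to the data: \<open>Sig\<close> has eigenvectors \<open>U\<close> and eigenvalues \<open>lam\<close>, and \<open>H\<close> rotates the sample index.
\<close>

locale normal_model = asym N p lam m c a1 a2 a3 d dI dS
  for N p :: "nat \<Rightarrow> nat" and lam m :: "nat \<Rightarrow> nat \<Rightarrow> real" and c a1 a2 a3 d dI dS :: real +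
  fixes M :: "nat \<Rightarrow> 'a measure" and X :: "nat \<Rightarrow> nat \<Rightarrow> 'a \<Rightarrow> nat \<Rightarrow> real" and mu mu0 :: "nat \<Rightarrow> real Matrix.vec"
    and Sig :: "nat \<Rightarrow> real Matrix.mat" and U H :: "nat \<Rightarrow> nat \<Rightarrow> nat \<Rightarrow> real"
  assumes sample: "\<And>k. normal_sample (M k) (N k) (p k) (mu k) (Sig k) (X k)"
    and frame: "\<And>k. 1 < N k \<Longrightarrow> sample_frame (p k) (Sig k) (U k) (lam k) (N k) (H k) (mu k) (mu0 k)"
    and mean0_dim: "\<And>k. mu0 k \<in> carrier_vec (p k)"
    and m_eq: "\<And>k. m k = sample_frame.m (p k) (U k) (lam k) (N k) (mu k) (mu0 k)"
begin

abbreviation "data k z \<equiv> sample_frame.x (p k) (U k) (lam k) (N k) (H k) (mu k) z"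

text \<open>
  Where \<open>S\<close> is invertible and no denominator vanishes, the statistics have their closed forms; elsewhere
  division by zero yields default values.
\<close>

definition regular where "regular k z \<longleftrightarrow> col_indep {1..<N k} (p k) z \<and> V k z \<noteq> 0 \<and> t1 k z \<noteq> 0"

lemma regular: "vanishing G (\<lambda>k. {z \<in> space (G k). \<not> regular k z})"
proof -
  have "vanishing G (\<lambda>k. {z \<in> space (G k). \<not> col_indep {1..<N k} (p k) z})"
    by (rule vanishing_AE) (use ev in \<open>eventually_elim, intro AE_grid_col_indep, simp\<close>)
  from vanishing_Un[OF this vanishing_Un[OF V_nonzero t1_nonzero]]
  show ?thesis by (rule vanishing_mono) (intro always_eventually allI, auto simp: regular_def)
qed

context
  fixes k z
  assumes k: "0 < p k \<and> p k < N k \<and> 1 < N k \<and> 0 < n k" and z: "regular k z"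
begin

interpretation sf: sample_frame "p k" "Sig k" "U k" "lam k" "N k" "H k" "mu k" "mu0 k"
  using frame k by simp

lemma nn: "sf.n = n k" by (simp add: sf.n_def n_def)
lemma gw: "sf.g z i l = w k z i l" by (simp add: sf.g_def wip_def)

lemma traces:
  "trace_mat (sample_cov (N k) (p k) (data k z)) = t1 k z"
  "trace_mat (sample_cov (N k) (p k) (data k z) ^\<^sub>m 2) = t2 k z"
  "trace_mat (sample_cov (N k) (p k) (data k z) ^\<^sub>m 3) = t3 k z"
  unfolding sf.trace_cov nn gw t1_def t2_def t3_def by (rule refl)+

lemma hats:
  "a1_hat (N k) (p k) (data k z) = h1 k z" "a2_hat (N k) (p k) (data k z) = h2 k z" "a3_hat (N k) (p k) (data k z) = h3 k z"
  unfolding a1_hat_def a2_hat_def a3_hat_def Let_def traces h1_def h2_def h3_def n_def by (rule refl)+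

lemma hats':
  "c_hat (N k) (p k) = ch k" "rho_hat (N k) (p k) (data k z) = rh k z" "sigma_hat (N k) (p k) (data k z) = sh k z"
  "x_hat (N k) (p k) \<alpha> (data k z) = xh \<alpha> k z"
proof -
  show c: "c_hat (N k) (p k) = ch k" by (simp add: c_hat_def n_def)
  show r: "rho_hat (N k) (p k) (data k z) = rh k z" unfolding rho_hat_def rh_def hats c ..
  show s: "sigma_hat (N k) (p k) (data k z) = sh k z" unfolding sigma_hat_def sh_def hats c r ..
  show "x_hat (N k) (p k) \<alpha> (data k z) = xh \<alpha> k z"
    unfolding x_hat_def xh_def Let_def hats c r s n_def ..
qed

lemma T2_eq: "sqrt (n k) * (hotelling_T2 (N k) (p k) (mu0 k) (data k z) / n k - pr k) = TA k z"
proof -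
  define W where "W = (\<Sum>j<p k. (shifted_row (m k) z j)\<^sup>2)"
  define I where "I = inv_form {1..<N k} (p k) (shifted_row (m k) z) z"
  define r where "r = sqrt (n k)"
  have r: "r > 0" "n k = r * r" using k by (auto simp: r_def)
  have T: "hotelling_T2 (N k) (p k) (mu0 k) (data k z) = n k * I"
    unfolding I_def m_eq nn[symmetric] by (rule sf.hotelling_x) (use z in \<open>simp add: regular_def\<close>)
  have V: "V k z = W / I" by (simp add: V_def hot_ratio_def ip_def W_def I_def power2_eq_square)
  have V0: "V k z \<noteq> 0" using z by (simp add: regular_def)
  then have "I \<noteq> 0" "W \<noteq> 0" unfolding V by auto
  then have I: "I = W / V k z" unfolding V by simp
  have "r * (n k * I / n k - pr k) = r * (W / V k z - pr k)" using r I by simp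
  also have "\<dots> = n k / V k z * ((W - pr k * V k z) / r)" unfolding r(2) using r(1) V0 by (simp add: field_simps)
  finally show ?thesis unfolding T TA_def A_def W_def r_def .
qed

lemma D_eq: "sqrt (n k) * (dempster_D (N k) (p k) (mu0 k) (data k z) - 1) = TD k z"
proof -
  define W where "W = (\<Sum>j<p k. lam k j * (shifted_row (m k) z j)\<^sup>2)"
  define r where "r = sqrt (n k)"
  define t where "t = t1 k z"
  have r: "r > 0" "n k = r * r" using k by (auto simp: r_def)
  have D: "dempster_D (N k) (p k) (mu0 k) (data k z) = W / t"
    unfolding sf.dempster_x traces W_def m_eq t_def ..
  have t: "t \<noteq> 0" using z by (simp add: regular_def t_def)
  have "(W - S 1 k) / r - (t - S 1 k) / r = (W - t) / r" by (simp add: diff_divide_distrib)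
  then have "n k / t * ((W - S 1 k) / r - (t - S 1 k) / r) = r * (W / t - 1)"
    unfolding r(2) using r(1) t by (simp add: field_simps)
  then show ?thesis unfolding D TD_def B_def W_def r_def t_def by simp
qed

lemma hotelling_rejects_iff:
  "hotelling_rejects (N k) (p k) (mu0 k) \<alpha> (data k z) \<longleftrightarrow> pr k * sqrt (n k) * (F_perc (p k) (N k - p k) \<alpha> - 1) \<le> TA k z"
proof -
  define T where "T = hotelling_T2 (N k) (p k) (mu0 k) (data k z)"
  define F where "F = F_perc (p k) (N k - p k) \<alpha>"
  have q: "0 < pr k" "0 < pr k * sqrt (n k)" using k by (auto simp: pr_def)
  have e: "(real (N k) - real (p k)) / ((real (N k) - 1) * real (p k)) * T = T / n k / pr k"
    by (simp add: pr_def n_def)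
  have "pr k * sqrt (n k) * (F - 1) \<le> TA k z \<longleftrightarrow> pr k * sqrt (n k) * (F - 1) \<le> pr k * sqrt (n k) * (T / n k / pr k - 1)"
  proof -
    have "pr k * (T / n k / pr k - 1) = T / n k - pr k" using q(1) by (simp add: right_diff_distrib)
    then have "pr k * sqrt (n k) * (T / n k / pr k - 1) = TA k z"
      unfolding T2_eq[symmetric] T_def[symmetric] by (metis mult.assoc mult.commute)
    then show ?thesis by simp
  qed
  also have "\<dots> \<longleftrightarrow> F - 1 \<le> T / n k / pr k - 1" using q(2) by (rule mult_le_cancel_left_pos)
  also have "\<dots> \<longleftrightarrow> F \<le> T / n k / pr k" by simp
  finally show ?thesis unfolding hotelling_rejects_def T_def[symmetric] F_def[symmetric] e by simp
qed

lemma dempster_rejects_iff: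
  "dempster_rejects (N k) (p k) (mu0 k) \<alpha> (data k z) \<longleftrightarrow> z_perc \<alpha> \<le> TD k z / sqrt (2 * h2 k z / (ch k * (h1 k z)\<^sup>2))"
  unfolding dempster_rejects_def hats hats' D_eq[symmetric] by (simp add: n_def)

lemma T_weighted_eq: "T_weighted (N k) (p k) (mu0 k) \<rho>' (data k z) = \<rho>' * TA k z + (1 - \<rho>') * TD k z"
  unfolding T_weighted_def Let_def T2_eq[symmetric] D_eq[symmetric] by (simp add: n_def pr_def mult.assoc)

lemma proposed_rejects_iff:
  "proposed_rejects (N k) (p k) (mu0 k) \<alpha> (data k z) \<longleftrightarrow> z_perc \<alpha> \<le> (rh k z * TA k z + (1 - rh k z) * TD k z) / sh k z"
  "proposed_adj_rejects (N k) (p k) (mu0 k) \<alpha> (data k z) \<longleftrightarrow> xh \<alpha> k z \<le> (rh k z * TA k z + (1 - rh k z) * TD k z) / sh k z"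
  unfolding proposed_rejects_def proposed_adj_rejects_def hats' T_weighted_eq by (rule refl)+

end

text \<open>
  Passes from a closed form of a rejection rule on regular arrays to the limit of its rejection
  probability under the normal model.
\<close>

lemma transfer:
  assumes rej: "rej \<in> {hotelling_rejects, dempster_rejects, proposed_rejects, proposed_adj_rejects}"
    and iff: "\<And>k z. 0 < p k \<and> p k < N k \<and> 1 < N k \<and> 0 < n k \<Longrightarrow> regular k z \<Longrightarrow>
       rej (N k) (p k) (mu0 k) \<alpha> (data k z) \<longleftrightarrow> P k z"
    and lim: "\<And>E. \<forall>\<^sub>F k in sequentially. E k \<in> sets (G k) \<Longrightarrow>
       vanishing G (\<lambda>k. {z \<in> space (G k). \<not> (z \<in> E k \<longleftrightarrow> P k z)}) \<Longrightarrow> (\<lambda>k. measure (G k) (E k)) \<longlonglongrightarrow> \<beta>"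
  shows "(\<lambda>k. rejection_prob (M k) (X k) (rej (N k) (p k) (mu0 k) \<alpha>)) \<longlonglongrightarrow> \<beta>"
proof -
  define E where "E k = {z \<in> space (G k). rej (N k) (p k) (mu0 k) \<alpha> (data k z)}" for k
  have eq: "E k \<in> sets (G k) \<and> rejection_prob (M k) (X k) (rej (N k) (p k) (mu0 k) \<alpha>) = measure (G k) (E k)" if N: "1 < N k" for k
  proof -
    interpret sf: sample_frame "p k" "Sig k" "U k" "lam k" "N k" "H k" "mu k" "mu0 k" using frame N by simp
    have local: "rej (N k) (p k) (mu0 k) \<alpha> x = rej (N k) (p k) (mu0 k) \<alpha> x'"
      if "\<And>i j. i < N k \<Longrightarrow> j < p k \<Longrightarrow> x i j = x' i j" for x x'
      using rej tests_local[of "N k" "p k" x x' "mu0 k" \<alpha>, OF that] by auto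
    have pred: "Measurable.pred (SS (N k) (p k)) (rej (N k) (p k) (mu0 k) \<alpha>)"
      using rej pred_tests[OF mean0_dim[of k], of "N k" \<alpha>] by auto
    have N0: "0 < N k" using N by simp
    note r = sf.rejection_prob_eq_gauss[OF sample N0 sf.mu sf.H local pred]
    show ?thesis using r by (simp add: E_def sf.x_def)
  qed
  have "(\<lambda>k. measure (G k) (E k)) \<longlonglongrightarrow> \<beta>"
  proof (rule lim)
    show "\<forall>\<^sub>F k in sequentially. E k \<in> sets (G k)" using ev by eventually_elim (simp add: eq)
    show "vanishing G (\<lambda>k. {z \<in> space (G k). \<not> (z \<in> E k \<longleftrightarrow> P k z)})"
    proof (rule vanishing_mono[OF regular])
      show "\<forall>\<^sub>F k in sequentially. {z \<in> space (G k). \<not> (z \<in> E k \<longleftrightarrow> P k z)} \<subseteq> {z \<in> space (G k). \<not> regular k z}"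
        using ev by eventually_elim (auto simp: E_def iff)
    qed
  qed
  moreover have "\<forall>\<^sub>F k in sequentially. measure (G k) (E k) = rejection_prob (M k) (X k) (rej (N k) (p k) (mu0 k) \<alpha>)"
    using ev by eventually_elim (simp add: eq)
  ultimately show ?thesis by (rule Lim_transform_eventually)
qed

abbreviation "gain_H \<equiv> d / ((1 - c) * s_hot)"
abbreviation "gain_D \<equiv> dI / (c * a1 * s_dem)"
abbreviation "K \<equiv> sqrt 2 * sqrt (1 + a1 * sqrt ((1 - c) / a2))"

lemma limiting_powers:
  assumes al: "0 < \<alpha>" "\<alpha> < 1"
  shows "(\<lambda>k. rejection_prob (M k) (X k) (hotelling_rejects (N k) (p k) (mu0 k) \<alpha>)) \<longlonglongrightarrow> 1 - Phi (z_perc \<alpha> - gain_H)"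
    and "(\<lambda>k. rejection_prob (M k) (X k) (dempster_rejects (N k) (p k) (mu0 k) \<alpha>)) \<longlonglongrightarrow> 1 - Phi (z_perc \<alpha> - gain_D)"
    and "rej \<in> {proposed_rejects, proposed_adj_rejects} \<Longrightarrow>
      (\<lambda>k. rejection_prob (M k) (X k) (rej (N k) (p k) (mu0 k) \<alpha>)) \<longlonglongrightarrow> 1 - Phi (z_perc \<alpha> - (gain_H + gain_D) / K)"
proof -
  show "(\<lambda>k. rejection_prob (M k) (X k) (hotelling_rejects (N k) (p k) (mu0 k) \<alpha>)) \<longlonglongrightarrow> 1 - Phi (z_perc \<alpha> - gain_H)"
    by (rule transfer[where rej = hotelling_rejects and \<alpha> = \<alpha>], simp, erule (1) hotelling_rejects_iff, erule (1) hotelling_power[OF al])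
  show "(\<lambda>k. rejection_prob (M k) (X k) (dempster_rejects (N k) (p k) (mu0 k) \<alpha>)) \<longlonglongrightarrow> 1 - Phi (z_perc \<alpha> - gain_D)"
    by (rule transfer[where rej = dempster_rejects and \<alpha> = \<alpha>], simp, erule (1) dempster_rejects_iff, erule (1) dempster_power)
  have "(\<lambda>k. rejection_prob (M k) (X k) (proposed_rejects (N k) (p k) (mu0 k) \<alpha>)) \<longlonglongrightarrow> 1 - Phi (z_perc \<alpha> - (gain_H + gain_D) / K)"
    by (rule transfer[where rej = proposed_rejects and \<alpha> = \<alpha>], simp, erule (1) proposed_rejects_iff(1), erule (1) proposed_power[OF tends_prob_constant])
  moreover have "(\<lambda>k. rejection_prob (M k) (X k) (proposed_adj_rejects (N k) (p k) (mu0 k) \<alpha>)) \<longlonglongrightarrow> 1 - Phi (z_perc \<alpha> - (gain_H + gain_D) / K)"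
    by (rule transfer[where rej = proposed_adj_rejects and \<alpha> = \<alpha>], simp, erule (1) proposed_rejects_iff(2), erule (1) proposed_power[OF tends_xh])
  ultimately show "(\<lambda>k. rejection_prob (M k) (X k) (rej (N k) (p k) (mu0 k) \<alpha>)) \<longlonglongrightarrow> 1 - Phi (z_perc \<alpha> - (gain_H + gain_D) / K)"
    if "rej \<in> {proposed_rejects, proposed_adj_rejects}" using that by auto
qed

lemma gain_ratio:
  assumes "0 < dI"
  shows "gain_H / gain_D = d / dI * sqrt (a2 * (1 - c))"
proof -
  define s where "s = s_hot"
  define t where "t = s_dem"
  define q where "q = sqrt (a2 * (1 - c))"
  have q: "c * a1 * t = (1 - c) * s * q" using \<rho>\<sigma>(6) by (simp add: s_def t_def q_def)
  have s: "s \<noteq> 0" unfolding s_def using s_hot(1) by (metis less_irrefl)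
  have "d / ((1 - c) * s) / (dI / (c * a1 * t)) = d * (c * a1 * t) / ((1 - c) * s * dI)" by (simp only: divide_divide_eq_left divide_divide_eq_right times_divide_eq_left)
  also have "\<dots> = d / dI * q" unfolding q using s nz(2) by simp
  finally show ?thesis by (simp add: s_def t_def q_def)
qed

text \<open>
  (C1) becomes a condition on the ratio of the gains after multiplication by \<open>\<surd>(a2 (1 - c))\<close>.
\<close>

lemma cond_C1_iff:
  assumes "0 < dI"
  shows "cond_C1 (d / dI) c a1 a2 \<longleftrightarrow> K - 1 \<le> gain_H / gain_D \<and> gain_H / gain_D \<le> inverse (K - 1)"
proof -
  have q: "0 < sqrt (a2 * (1 - c))" using c a_pos by simp
  show ?thesis unfolding cond_C1_def gain_ratio[OF assms] atLeastAtMost_iff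
    by (simp only: pos_divide_le_eq[OF q] pos_le_divide_eq[OF q])
qed

end

theorem proposition2p3:
  fixes M :: "nat \<Rightarrow> 'a measure"
    and N p :: "nat \<Rightarrow> nat"
    and \<mu> \<mu>0 :: "nat \<Rightarrow> real Matrix.vec"
    and \<Sigma> :: "nat \<Rightarrow> real Matrix.mat"
    and X :: "nat \<Rightarrow> nat \<Rightarrow> 'a \<Rightarrow> nat \<Rightarrow> real"
    and \<alpha> c d dI dS :: real
    and a :: "nat \<Rightarrow> real"
  assumes alpha: "0 < \<alpha>" "\<alpha> < 1"
    and mean_dim: "\<And>k. \<mu> k \<in> carrier_vec (p k)"
    and mean0_dim: "\<And>k. \<mu>0 k \<in> carrier_vec (p k)"
    and cov: "\<And>k. pos_def_mat (p k) (\<Sigma> k)"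
    and sample: "\<And>k. normal_sample (M k) (N k) (p k) (\<mu> k) (\<Sigma> k) (X k)"
    and A1: "filterlim N at_top sequentially" "filterlim p at_top sequentially"
      "(\<lambda>k. real (p k) / (real (N k) - 1)) \<longlonglongrightarrow> c" "0 < c" "c < 1"
    and A2: "\<And>i. i \<in> {1..6} \<Longrightarrow> (\<lambda>k. a_pop (p k) (\<Sigma> k) i) \<longlonglongrightarrow> a i"
      "\<And>i. i \<in> {1..6} \<Longrightarrow> 0 < a i"
    and A3: "(\<lambda>k. sqrt (real (N k) - 1) * Delta2 (\<mu> k) (\<mu>0 k) (\<Sigma> k)) \<longlonglongrightarrow> d" "0 < d"
      "(\<lambda>k. sqrt (real (N k) - 1) * DeltaI2 (\<mu> k) (\<mu>0 k)) \<longlonglongrightarrow> dI" "0 < dI"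
      "(\<lambda>k. sqrt (real (N k) - 1) * DeltaS2 (\<mu> k) (\<mu>0 k) (\<Sigma> k)) \<longlonglongrightarrow> dS" "0 < dS"
  shows "\<exists>\<beta>H \<beta>D.
    (\<lambda>k. rejection_prob (M k) (X k) (hotelling_rejects (N k) (p k) (\<mu>0 k) \<alpha>)) \<longlonglongrightarrow> \<beta>H \<and>
    (\<lambda>k. rejection_prob (M k) (X k) (dempster_rejects (N k) (p k) (\<mu>0 k) \<alpha>)) \<longlonglongrightarrow> \<beta>D \<and>
    (\<forall>rejects \<in> {proposed_rejects, proposed_adj_rejects}. \<exists>\<beta>P.
      (\<lambda>k. rejection_prob (M k) (X k) (rejects (N k) (p k) (\<mu>0 k) \<alpha>)) \<longlonglongrightarrow> \<beta>P \<and>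
      (cond_C1 (lim (\<lambda>k. Delta2 (\<mu> k) (\<mu>0 k) (\<Sigma> k) / DeltaI2 (\<mu> k) (\<mu>0 k))) c (a 1) (a 2) \<longrightarrow>
        \<beta>P \<ge> max \<beta>H \<beta>D) \<and>
      (\<not> cond_C1 (lim (\<lambda>k. Delta2 (\<mu> k) (\<mu>0 k) (\<Sigma> k) / DeltaI2 (\<mu> k) (\<mu>0 k))) c (a 1) (a 2) \<longrightarrow>
        min \<beta>H \<beta>D < \<beta>P \<and> \<beta>P < max \<beta>H \<beta>D))"
proof -
  obtain U lam where sc: "\<And>k. spectral_cov (p k) (\<Sigma> k) (U k) (lam k)"
    using exists_spectral_cov[OF cov] by metis
  have "\<forall>k. \<exists>H. 1 < N k \<longrightarrow> orthonormal_on {..<N k} {..<N k} H \<and> (\<forall>i<N k. H 0 i = 1 / sqrt (real (N k)))"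
    using exists_frame by blast
  from choice[OF this] obtain H where H: "\<And>k. 1 < N k \<Longrightarrow> orthonormal_on {..<N k} {..<N k} (H k)"
    "\<And>k i. 1 < N k \<Longrightarrow> i < N k \<Longrightarrow> H k 0 i = 1 / sqrt (real (N k))" by blast
  define m where "m k = sample_frame.m (p k) (U k) (lam k) (N k) (\<mu> k) (\<mu>0 k)" for k
  have frame: "sample_frame (p k) (\<Sigma> k) (U k) (lam k) (N k) (H k) (\<mu> k) (\<mu>0 k)" if "1 < N k" for k
    by (intro sample_frame.intro sample_frame_axioms.intro sc H mean_dim mean0_dim that)
  have N1: "\<forall>\<^sub>F k in sequentially. 1 < N k"
    using eventually_compose_filterlim[OF eventually_gt_at_top[of 1] A1(1)] by simp
  have shift: "(\<lambda>k. s k / sqrt (real (N k) - 1)) \<longlonglongrightarrow> l"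
    if D: "(\<lambda>k. sqrt (real (N k) - 1) * D k) \<longlonglongrightarrow> l" and s: "\<And>k. 1 < N k \<Longrightarrow> real (N k) * D k = s k"
    for s D :: "nat \<Rightarrow> real" and l
  proof -
    have "(\<lambda>k. real (N k) / (real (N k) - 1) * (sqrt (real (N k) - 1) * D k)) \<longlonglongrightarrow> 1 * l"
      by (intro tendsto_mult ratio_shift A1 D)
    moreover have "\<forall>\<^sub>F k in sequentially. real (N k) / (real (N k) - 1) * (sqrt (real (N k) - 1) * D k) = s k / sqrt (real (N k) - 1)"
      using N1
    proof eventually_elim
      case (elim k)
      define r where "r = sqrt (real (N k) - 1)"
      have r: "r \<noteq> 0" "real (N k) - 1 = r * r" using elim by (auto simp: r_def)
      show ?case unfolding s[OF elim, symmetric] r_def[symmetric] unfolding r(2) using r(1) by simp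
    qed
    ultimately show ?thesis by (simp add: tendsto_cong)
  qed
  interpret normal_model N p lam m c "a 1" "a 2" "a 3" d dI dS M X \<mu> \<mu>0 \<Sigma> U H
  proof (intro normal_model.intro asym.intro normal_model_axioms.intro)
    show "filterlim N at_top sequentially" "filterlim p at_top sequentially"
      "(\<lambda>k. real (p k) / (real (N k) - 1)) \<longlonglongrightarrow> c" "0 < c" "c < 1" by (rule A1)+
    show "0 < lam k j" if "j < p k" for k j using spectral_cov.lam[OF sc that] .
    show "(\<lambda>k. (\<Sum>j<p k. lam k j) / p k) \<longlonglongrightarrow> a 1" using A2(1)[of 1] unfolding spectral_cov.a_pop_Sig(1)[OF sc] by simp
    show "(\<lambda>k. (\<Sum>j<p k. (lam k j)^2) / p k) \<longlonglongrightarrow> a 2" using A2(1)[of 2] unfolding spectral_cov.a_pop_Sig(2)[OF sc] by simp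
    show "(\<lambda>k. (\<Sum>j<p k. (lam k j)^3) / p k) \<longlonglongrightarrow> a 3" using A2(1)[of 3] unfolding spectral_cov.a_pop_Sig(3)[OF sc] by simp
    show "0 < a 1" "0 < a 2" using A2(2) by simp_all
    show "(\<lambda>k. (\<Sum>j<p k. (m k j)\<^sup>2) / sqrt (real (N k) - 1)) \<longlonglongrightarrow> d"
      by (rule shift[OF A3(1)], unfold m_def) (rule sample_frame.Delta_sums(1)[OF frame])
    show "(\<lambda>k. (\<Sum>j<p k. lam k j * (m k j)\<^sup>2) / sqrt (real (N k) - 1)) \<longlonglongrightarrow> dI"
      by (rule shift[OF A3(3)], unfold m_def) (rule sample_frame.Delta_sums(2)[OF frame])
    show "(\<lambda>k. (\<Sum>j<p k. (lam k j)\<^sup>2 * (m k j)\<^sup>2) / sqrt (real (N k) - 1)) \<longlonglongrightarrow> dS"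
      by (rule shift[OF A3(5)], unfold m_def) (rule sample_frame.Delta_sums(3)[OF frame])
    show "normal_sample (M k) (N k) (p k) (\<mu> k) (\<Sigma> k) (X k)" "\<mu>0 k \<in> carrier_vec (p k)" for k
      by (rule sample mean0_dim)+
    show "sample_frame (p k) (\<Sigma> k) (U k) (lam k) (N k) (H k) (\<mu> k) (\<mu>0 k)" if "1 < N k" for k
      using that by (rule frame)
    show "m k = sample_frame.m (p k) (U k) (lam k) (N k) (\<mu> k) (\<mu>0 k)" for k by (rule m_def)
  qed
  have "(\<lambda>k. sqrt (real (N k) - 1) * Delta2 (\<mu> k) (\<mu>0 k) (\<Sigma> k) / (sqrt (real (N k) - 1) * DeltaI2 (\<mu> k) (\<mu>0 k))) \<longlonglongrightarrow> d / dI"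
    by (rule tendsto_divide[OF A3(1,3)]) (use A3(4) in simp)
  moreover have "\<forall>\<^sub>F k in sequentially. sqrt (real (N k) - 1) * Delta2 (\<mu> k) (\<mu>0 k) (\<Sigma> k) / (sqrt (real (N k) - 1) * DeltaI2 (\<mu> k) (\<mu>0 k))
      = Delta2 (\<mu> k) (\<mu>0 k) (\<Sigma> k) / DeltaI2 (\<mu> k) (\<mu>0 k)"
    using N1 by eventually_elim simp
  ultimately have "(\<lambda>k. Delta2 (\<mu> k) (\<mu>0 k) (\<Sigma> k) / DeltaI2 (\<mu> k) (\<mu>0 k)) \<longlonglongrightarrow> d / dI"
    by (rule Lim_transform_eventually)
  then have R: "lim (\<lambda>k. Delta2 (\<mu> k) (\<mu>0 k) (\<Sigma> k) / DeltaI2 (\<mu> k) (\<mu>0 k)) = d / dI" by (rule limI)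
  have gains: "0 < gain_H" "0 < gain_D"
    using A3(2,4) A1(4,5) A2(2)[of 1] A2(2)[of 2] by simp_all
  note cmp = power_comparison[OF gains K_bounds refl refl refl]
  show ?thesis unfolding R cond_C1_iff[OF A3(4)]
  proof (rule exI[of _ "1 - Phi (z_perc \<alpha> - gain_H)"], rule exI[of _ "1 - Phi (z_perc \<alpha> - gain_D)"], intro conjI ballI)
    fix rejects :: "nat \<Rightarrow> nat \<Rightarrow> real Matrix.vec \<Rightarrow> real \<Rightarrow> (nat \<Rightarrow> nat \<Rightarrow> real) \<Rightarrow> bool"
    assume "rejects \<in> {proposed_rejects, proposed_adj_rejects}"
    from limiting_powers(3)[OF alpha this]
    show "\<exists>\<beta>P. (\<lambda>k. rejection_prob (M k) (X k) (rejects (N k) (p k) (\<mu>0 k) \<alpha>)) \<longlonglongrightarrow> \<beta>P \<and>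
        (K - 1 \<le> gain_H / gain_D \<and> gain_H / gain_D \<le> inverse (K - 1) \<longrightarrow>
          max (1 - Phi (z_perc \<alpha> - gain_H)) (1 - Phi (z_perc \<alpha> - gain_D)) \<le> \<beta>P) \<and>
        (\<not> (K - 1 \<le> gain_H / gain_D \<and> gain_H / gain_D \<le> inverse (K - 1)) \<longrightarrow>
          min (1 - Phi (z_perc \<alpha> - gain_H)) (1 - Phi (z_perc \<alpha> - gain_D)) < \<beta>P \<and>
          \<beta>P < max (1 - Phi (z_perc \<alpha> - gain_H)) (1 - Phi (z_perc \<alpha> - gain_D)))"
      using cmp by blast
  qed (rule limiting_powers[OF alpha])+
qed


end
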